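(* Let $N\in\mathbb{N}$ (with $N\ge 1$) and $\alpha=(\alpha_1,\dots,\alpha_N)\in[-1/2,\infty)^N$, and set $\alpha_\star:=\alpha_1+\cdots+\alpha_N$. For $n\in\mathbb{N}$ let $X_1,\dots,X_n$ be independent random variables with values in $(0,\infty)^N$ and common distribution $\mu^\alpha$, and let $\mu_n=\frac{1}{n}\sum_{j=1}^n\delta_{X_j}$ be the associated empirical measure. Then there exist a constant $c>0$ and an integer $n_0$, depending only on $N$ and $\alpha$, such that for every $n\ge n_0$, $$\mathbb{E}\big[\mathrm{W}_2(\mu_n,\mu^\alpha)^2\big]\le c\cdot\begin{cases}\dfrac{\log n}{n^{1/(\alpha_\star+N)}}, & \text{if } \alpha_\star\in(1-N,\infty),\\[2mm] \dfrac{(\log n)^2}{n}, & \text{if } \alpha_\star=1-N,\\[2mm] \dfrac{(\log n)^{2(\alpha_\star+N)-1}}{n}, & \text{if } \alpha_\star\in(1/2-N,\,1-N),\\[2mm] \dfrac{\log\log n}{n}, & \text{if } \alpha_\star=1/2-N.\end{cases}$$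
   Context: For $\alpha=(\alpha_1,\dots,\alpha_N)\in(-1,\infty)^N$, $\mu^\alpha$ denotes the probability measure on $(0,\infty)^N$ given by $$\mu^\alpha(\mathrm{d}x)=\prod_{i=1}^N\frac{x_i^{\alpha_i}e^{-x_i}}{\Gamma(1+\alpha_i)}\,\mathrm{d}x,\qquad x=(x_1,\dots,x_N)\in(0,\infty)^N,$$ where $\Gamma$ is the Gamma function and $\mathrm{d}x$ is Lebesgue measure. The space $(0,\infty)^N$ is equipped with the metric $$\varrho_N(x,y)=\Big(\sum_{j=1}^N\varrho(x_j,y_j)^2\Big)^{1/2},\qquad \varrho(s,t)=2|\sqrt{s}-\sqrt{t}|\quad (s,t>0).$$ For Borel probability measures $\mu,\nu$ on $(0,\infty)^N$, the quadratic Kantorovich (Wasserstein) distance with respect to $\varrho_N$ is $$\mathrm{W}_2(\mu,\nu)=\Big(\inf_{\gamma\in\Pi(\mu,\nu)}\int_{(0,\infty)^N\times(0,\infty)^N}\varrho_N(x,y)^2\,\gamma(\mathrm{d}x,\mathrm{d}y)\Big)^{1/2}\in[0,\infty],$$ where $\Pi(\mu,\nu)$ is the set of Borel probability measures on $(0,\infty)^N\times(0,\infty)^N$ with marginals $\mu$ and $\nu$. $\delta_x$ denotes the Dirac measure at $x$, $\log$ is the natural logarithm, and $\mathbb{E}$ denotes expectation. *)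

theory Defs
  imports "HOL-Probability.Probability"
begin

definition pos_orthant :: "(real ^ 'N) set" where
  "pos_orthant = {x. \<forall>i. 0 < x $ i}"

definition orthant_borel :: "(real ^ 'N) measure" where
  "orthant_borel = restrict_space borel pos_orthant"

definition laguerre_measure :: "real ^ 'N \<Rightarrow> (real ^ 'N) measure" where
  "laguerre_measure \<alpha> = density (restrict_space lborel pos_orthant)
     (\<lambda>x. ennreal (\<Prod>i\<in>UNIV. x $ i powr \<alpha> $ i * exp (- (x $ i)) / Gamma (1 + \<alpha> $ i)))"

definition rho :: "real \<Rightarrow> real \<Rightarrow> real" where
  "rho s t = 2 * \<bar>sqrt s - sqrt t\<bar>"

definition rho_vec :: "real ^ 'N \<Rightarrow> real ^ 'N \<Rightarrow> real" where
  "rho_vec x y = sqrt (\<Sum>j\<in>UNIV. (rho (x $ j) (y $ j))\<^sup>2)"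

definition couplings :: "'a measure \<Rightarrow> 'b measure \<Rightarrow> ('a \<times> 'b) measure set" where
  "couplings \<mu> \<nu> = {\<gamma>. prob_space \<gamma> \<and> sets \<gamma> = sets (\<mu> \<Otimes>\<^sub>M \<nu>) \<and>
     distr \<gamma> \<mu> fst = \<mu> \<and> distr \<gamma> \<nu> snd = \<nu>}"

(* There is no square root on ennreal in the library; this one sends \<infinity> to \<infinity>. *)
definition ennreal_sqrt :: "ennreal \<Rightarrow> ennreal" where
  "ennreal_sqrt a = (if a = \<infinity> then \<infinity> else ennreal (sqrt (enn2real a)))"

lemma ennreal_sqrt_power2: "(ennreal_sqrt a)\<^sup>2 = a"
  by (cases a) (simp_all add: ennreal_sqrt_def ennreal_power)

definition W2 :: "(real ^ 'N) measure \<Rightarrow> (real ^ 'N) measure \<Rightarrow> ennreal" where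
  "W2 \<mu> \<nu> = ennreal_sqrt
     (INF \<gamma>\<in>couplings \<mu> \<nu>. \<integral>\<^sup>+ (x, y). ennreal ((rho_vec x y)\<^sup>2) \<partial>\<gamma>)"

definition empirical_measure :: "nat \<Rightarrow> (nat \<Rightarrow> real ^ 'N) \<Rightarrow> (real ^ 'N) measure" where
  "empirical_measure n x = distr (uniform_count_measure {1..n}) orthant_borel x"

(* The push-forward of the uniform distribution on the indices is the average of the
   Dirac measures at the sample points. *)
lemma emeasure_empirical_measure:
  fixes x :: "nat \<Rightarrow> real ^ 'N"
  assumes "n \<ge> 1" and "\<And>j. j \<in> {1..n} \<Longrightarrow> x j \<in> pos_orthant" and A: "A \<in> sets orthant_borel"
  shows "emeasure (empirical_measure n x) A =
    ennreal (1 / real n) * (\<Sum>j\<in>{1..n}. emeasure (return orthant_borel (x j)) A)"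
proof -
  have meas: "x \<in> measurable (uniform_count_measure {1..n}) orthant_borel"
    using assms(2)
    by (auto simp: uniform_count_measure_def orthant_borel_def space_restrict_space)
  have "emeasure (empirical_measure n x) A = ennreal (real (card (x -` A \<inter> {1..n})) / real n)"
    unfolding empirical_measure_def
    by (subst emeasure_distr[OF meas A], subst emeasure_uniform_count_measure)
       (auto simp: space_uniform_count_measure)
  also have "\<dots> = ennreal (1 / real n) * ennreal (real (card (x -` A \<inter> {1..n})))"
    by (simp flip: ennreal_mult)
  also have "ennreal (real (card (x -` A \<inter> {1..n}))) =
      (\<Sum>j\<in>{1..n}. emeasure (return orthant_borel (x j)) A)"
  proof -
    have "(\<Sum>j\<in>{1..n}. indicator A (x j) :: ennreal) = of_nat (card ({1..n} \<inter> x -` A))"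
      by (simp add: indicator_def sum.If_cases of_bool_def vimage_def)
    then show ?thesis
      using A by (simp add: Int_commute ennreal_of_nat_eq_real_of_nat)
  qed
  finally show ?thesis .
qed

(* The integrand is measurable on the sample space, so that this is the expectation in the
   usual sense, with values in [0, \<infinity>]. *)
definition expected_W2_sq ::
    "'w measure \<Rightarrow> (nat \<Rightarrow> 'w \<Rightarrow> real ^ 'N) \<Rightarrow> nat \<Rightarrow> real ^ 'N \<Rightarrow> ennreal" where
  "expected_W2_sq M X n \<alpha> =
     (\<integral>\<^sup>+ \<omega>. (W2 (empirical_measure n (\<lambda>j. X j \<omega>)) (laguerre_measure \<alpha>))\<^sup>2 \<partial>M)"

definition iid_sample ::
    "'w measure \<Rightarrow> (nat \<Rightarrow> 'w \<Rightarrow> real ^ 'N) \<Rightarrow> nat \<Rightarrow> (real ^ 'N) measure \<Rightarrow> bool" where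
  "iid_sample M X n \<mu> \<longleftrightarrow> prob_space M \<and>
     prob_space.indep_vars M (\<lambda>_. orthant_borel) X {1..n} \<and>
     (\<forall>j\<in>{1..n}. distr M orthant_borel (X j) = \<mu>)"

(* If all \<alpha>\<^sub>i \<ge> -1/2, then \<alpha>\<^sub>1 + ... + \<alpha>\<^sub>N \<ge> -N/2 \<ge> 1/2 - N, so that the last branch is never taken. *)
definition rate :: "real ^ 'N \<Rightarrow> nat \<Rightarrow> real" where
  "rate \<alpha> n = (let a = (\<Sum>i\<in>UNIV. \<alpha> $ i); N = real CARD('N) in
     if a > 1 - N then ln (real n) / real n powr (1 / (a + N))
     else if a = 1 - N then (ln (real n))\<^sup>2 / real n
     else if 1/2 - N < a \<and> a < 1 - N then ln (real n) powr (2 * (a + N) - 1) / real n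
     else if a = 1/2 - N then ln (ln (real n)) / real n
     else 0)"

end

theory Submission
  imports Defs "HOL-Real_Asymp.Real_Asymp"
begin

text \<open>
  Coordinatewise quantiles push the uniform law of the cube to the Gamma product measure. Because all
  \<open>\<alpha>\<^sub>i \<ge> - 1/2\<close>, the square root of a Gamma quantile is Lipschitz with respect to one map with Gaussian
  tails at both ends of (0,1),
  \<open>ref_quant u = sqrt (1 - ln (1 - u)) - sqrt (1 - ln u)\<close>, so that the cost no longer depends on \<open>\<alpha>\<close>.

  Each sample point is coded by labels: first, for every axis, its cell in a partition of (0,1) whose
  cells thin out towards both ends, and then K rounds of binary digits along all axes. Replacing the
  cut points, label after label and inside each group of sample points with equal labels, by the
  empirical ones couples the empirical measure exactly with the uniform law. Given the group, the number
  of points falling into a cell is binomial, so moving a cut with mass q beyond it costs each point of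
  a group of size s about \<open>E (q' - q)\<^sup>2 / q \<le> 1 / s\<close>, divided by the square of the local scale
  \<open>tail_root\<close>; the groups of a given depth thus contribute their number divided by n.

  With m of order ln n cells at either end, the coarse costs in dimension 1 are a harmonic sum of
  order ln m, hence of order ln ln n, divided by n. In higher dimension N, Gaussian spacing of the cells makes every cell of length of
  order 1 / sqrt m in the metric, and the choice of K balances the digit costs with the
  resolution \<open>1 / (m 4^K)\<close>: this gives \<open>(ln n)\<^sup>2 / n\<close> for N = 2 and \<open>ln n / n powr (2/N)\<close> for larger N.
  Since the sum of the \<open>\<alpha>\<^sub>i\<close> plus N is at least N/2, these rates imply all the branches of the theorem.
\<close>

section \<open>Cells of the unit interval and of the cube\<close>

text \<open>The rate \<open>ln ln n / n\<close> leaves no room for a spare logarithm. If the length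
  of the cells in the metric were ignored, each of the about \<open>2 * m\<close> coarse cells would
  cost order \<open>1 / n\<close>, in total \<open>ln n / n\<close>; dividing by
  \<open>tail_root\<close> squared turns the sum into a harmonic one. This is why transport is
  estimated through relative errors of tail masses, and why the singular but integrable
  \<open>end_weight\<close> is kept instead of a uniform bound. Targets depend on the labels alone,
  never on the residual positions. So expectations over labels are finite weighted sums, and the
  main estimate uses of the residual positions only that they lie in [0,1]. Over a group the targets
  are exactly uniform. Their first two moments are thus known, and the digit cost comes down to a
  covariance. A digit of axis j halves the loss inherited from the later operations, a digit of
  another axis doubles it. A round over d axes multiplies it by \<open>2 ^ d / 4\<close>: below 1,
  equal to 1 or above 1 for d = 1, d = 2 and d >= 3, which separates the three cases.\<close>

definition unif :: "real measure" where
  "unif = uniform_measure lborel {0<..<1}"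

lemma sets_unif [simp, measurable_cong]: "sets unif = sets borel"
  by (simp add: unif_def)

lemma space_unif [simp]: "space unif = UNIV"
  by (simp add: unif_def)

lemma prob_space_unif [simp]: "prob_space unif"
  unfolding unif_def by (rule prob_space_uniform_measure) auto

lemma nn_integral_unif:
  assumes "f \<in> borel_measurable borel"
  shows "(\<integral>\<^sup>+t. f t \<partial>unif) = (\<integral>\<^sup>+t. f t * indicator {0<..<1} t \<partial>lborel)"
  using assms unfolding unif_def by (subst nn_integral_uniform_measure) (auto simp: divide_ennreal_def)

lemma AE_unif: "AE t in unif. 0 < t \<and> t < 1"
  unfolding unif_def by (rule AE_uniform_measureI) auto

text \<open>Weak inequalities, because the empirical cut points of a group coincide whenever a cell
  catches no point of the group. Strictness for the true cut points is asked separately, in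
  \<open>tame\<close> and \<open>strict_specs\<close>.\<close>

definition cuts :: "(nat \<Rightarrow> real) \<Rightarrow> nat \<Rightarrow> bool" where
  "cuts B P \<longleftrightarrow> B 0 = 0 \<and> B P = 1 \<and> (\<forall>k<P. B k \<le> B (Suc k))"

definition cell :: "(nat \<Rightarrow> real) \<Rightarrow> nat \<Rightarrow> real \<Rightarrow> real" where
  "cell B k t = B k + (B (Suc k) - B k) * t"

lemma nn_integral_interval_affine:
  fixes f :: "real \<Rightarrow> ennreal"
  assumes f: "f \<in> borel_measurable borel" and "a \<le> b"
  shows "(\<integral>\<^sup>+t. f t * indicator {a<..<b} t \<partial>lborel) = ennreal (b - a) * (\<integral>\<^sup>+t. f (a + (b - a) * t) \<partial>unif)"
proof (cases "a = b")
  case False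
  with assms have ab: "a < b" by simp
  have "(\<integral>\<^sup>+t. f t * indicator {a<..<b} t \<partial>lborel)
      = ennreal \<bar>b - a\<bar> * (\<integral>\<^sup>+t. f (a + (b - a) * t) * indicator {a<..<b} (a + (b - a) * t) \<partial>lborel)"
    using ab f by (subst nn_integral_real_affine[where c = "b - a" and t = a]) auto
  also have "(\<lambda>t. indicator {a<..<b} (a + (b - a) * t) :: ennreal) = indicator {0<..<1}"
  proof
    fix t
    have "a + (b - a) * t < b \<longleftrightarrow> (b - a) * t < (b - a) * 1" by argo
    then have "a + (b - a) * t < b \<longleftrightarrow> t < 1" using ab by (simp only: mult_less_cancel_left_pos diff_gt_0_iff_gt)
    then show "indicator {a<..<b} (a + (b - a) * t) = (indicator {0<..<1} t :: ennreal)"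
      using ab by (auto simp: indicator_def zero_less_mult_iff)
  qed
  also have "(\<integral>\<^sup>+t. f (a + (b - a) * t) * indicator {0<..<1} t \<partial>lborel) = (\<integral>\<^sup>+t. f (a + (b - a) * t) \<partial>unif)"
    using f by (subst nn_integral_unif) auto
  finally show ?thesis using ab by simp
qed simp

text \<open>The law of total probability for the uniform law: choose cell k with probability equal
  to its length, then a uniform position in it. It serves both the true and the empirical cut
  points; an empty cell has weight 0.\<close>

lemma nn_integral_unif_cells:
  fixes f :: "real \<Rightarrow> ennreal"
  assumes f: "f \<in> borel_measurable borel" and "cuts B P"
  shows "(\<integral>\<^sup>+t. f t \<partial>unif) = (\<Sum>k<P. ennreal (B (Suc k) - B k) * (\<integral>\<^sup>+t. f (cell B k t) \<partial>unif))"
proof -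
  \<comment> \<open>With open intervals two neighbours miss only the null set \<open>{B m}\<close>.
    The invariant \<open>B 0 \<le> B m\<close> keeps the intervals nested in the induction.\<close>
  have *: "(\<integral>\<^sup>+t. f t * indicator {B 0<..<B m} t \<partial>lborel) =
     (\<Sum>k<m. ennreal (B (Suc k) - B k) * (\<integral>\<^sup>+t. f (cell B k t) \<partial>unif)) \<and> B 0 \<le> B m" if "m \<le> P" for m
    using that
  proof (induction m)
    case (Suc m)
    have le: "B 0 \<le> B m" "B m \<le> B (Suc m)" using Suc assms(2) by (auto simp: cuts_def)
    have "(\<integral>\<^sup>+t. f t * indicator {B 0<..<B (Suc m)} t \<partial>lborel)
        = (\<integral>\<^sup>+t. f t * indicator {B 0<..<B m} t + f t * indicator {B m<..<B (Suc m)} t \<partial>lborel)"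
      using AE_lborel_singleton[of "B m"]
      by (intro nn_integral_cong_AE) (auto elim!: eventually_mono simp: indicator_def dest: le_less_trans less_le_trans intro: order.strict_trans1[OF le(1)] order.strict_trans2[OF _ le(2)])
    also have "\<dots> = (\<integral>\<^sup>+t. f t * indicator {B 0<..<B m} t \<partial>lborel) + (\<integral>\<^sup>+t. f t * indicator {B m<..<B (Suc m)} t \<partial>lborel)"
      using f by (intro nn_integral_add) auto
    finally show ?case using Suc le nn_integral_interval_affine[OF f le(2)] by (simp add: cell_def)
  qed simp
  show ?thesis using *[of P] assms by (simp add: nn_integral_unif cuts_def)
qed

text \<open>Redrawing one coordinate independently does not change the law. In this form of Fubini
  the outer integral still runs over the full product, so it can be split further.\<close>

lemma nn_integral_PiM_component_update:
  assumes "finite I" "j \<in> I" and prob: "\<And>i. prob_space (M i)"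
    and f [measurable]: "f \<in> borel_measurable (Pi\<^sub>M I M)"
  shows "(\<integral>\<^sup>+v. f v \<partial>Pi\<^sub>M I M) = (\<integral>\<^sup>+v. (\<integral>\<^sup>+t. f (v(j := t)) \<partial>M j) \<partial>Pi\<^sub>M I M)"
proof -
  interpret product_prob_space M I using prob by (simp add: product_prob_spaceI)
  interpret product_sigma_finite M ..
  define J where "J = I - {j}"
  have J: "finite J" "j \<notin> J" "insert j J = I" using assms by (auto simp: J_def)
  have 1: "(\<integral>\<^sup>+v. h v \<partial>Pi\<^sub>M I M) = (\<integral>\<^sup>+v. (\<integral>\<^sup>+t. h (v(j := t)) \<partial>M j) \<partial>Pi\<^sub>M J M)"
    if "h \<in> borel_measurable (Pi\<^sub>M I M)" for h
    using product_nn_integral_insert[OF J(1,2), of h] that J(3) by simp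
  have [measurable]: "(\<lambda>x. (fst x)(j := snd x)) \<in> measurable (Pi\<^sub>M I M \<Otimes>\<^sub>M M j) (Pi\<^sub>M I M)"
    by (rule measurable_fun_upd[where J = I]) (use \<open>j \<in> I\<close> in auto)
  have "(\<lambda>v. \<integral>\<^sup>+t. f (v(j := t)) \<partial>M j) \<in> borel_measurable (Pi\<^sub>M I M)"
  proof -
    have "(\<lambda>x. f ((fst x)(j := snd x))) \<in> borel_measurable (Pi\<^sub>M I M \<Otimes>\<^sub>M M j)" by measurable
    then show ?thesis by (intro sigma_finite_measure.borel_measurable_nn_integral prob_space_imp_sigma_finite prob) (auto simp: case_prod_beta')
  qed
  from 1[OF this] have "(\<integral>\<^sup>+v. (\<integral>\<^sup>+t. f (v(j := t)) \<partial>M j) \<partial>Pi\<^sub>M I M) =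
     (\<integral>\<^sup>+v. (\<integral>\<^sup>+t. f (v(j := t)) \<partial>M j) \<partial>Pi\<^sub>M J M)"
    by (simp add: prob_space.emeasure_space_1[OF prob])
  then show ?thesis using 1[OF f] by simp
qed

text \<open>Stated for an arbitrary factor \<open>M j\<close> because it is applied on two levels:
  to one axis of the cube, where the factor is \<open>unif\<close>, and to one sample point, where
  the factor is the whole cube.\<close>

lemma nn_integral_PiM_split:
  fixes w :: "nat \<Rightarrow> ennreal"
  assumes "finite I" "j \<in> I" and prob: "\<And>i. prob_space (M i)"
    and T: "\<And>k. T k \<in> measurable (M j) (M j)"
    and split: "\<And>h. h \<in> borel_measurable (M j) \<Longrightarrow>
      (\<integral>\<^sup>+t. h t \<partial>M j) = (\<Sum>k<P. w k * (\<integral>\<^sup>+t. h (T k t) \<partial>M j))"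
    and f [measurable]: "f \<in> borel_measurable (Pi\<^sub>M I M)"
  shows "(\<integral>\<^sup>+v. f v \<partial>Pi\<^sub>M I M) = (\<Sum>k<P. w k * (\<integral>\<^sup>+v. f (v(j := T k (v j))) \<partial>Pi\<^sub>M I M))"
proof -
  note [measurable] = T
  have upd: "(\<lambda>x. (g x)(j := h x)) \<in> measurable N (Pi\<^sub>M I M)"
    if "g \<in> measurable N (Pi\<^sub>M I M)" "h \<in> measurable N (M j)" for g h and N :: "'z measure"
    by (rule measurable_fun_upd[where J = I]) (use \<open>j \<in> I\<close> that in auto)
  have comp: "(\<lambda>v. v j) \<in> measurable (Pi\<^sub>M I M) (M j)" using \<open>j \<in> I\<close> by measurable
  have fk [measurable]: "(\<lambda>v. f (v(j := T k (v j)))) \<in> borel_measurable (Pi\<^sub>M I M)" for k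
    by (intro measurable_compose[OF upd f] measurable_compose[OF comp T]) simp
  have ft: "(\<lambda>t. f (v(j := t))) \<in> borel_measurable (M j)" if "v \<in> space (Pi\<^sub>M I M)" for v
    by (rule measurable_compose[OF upd f]) (use that in auto)
  have int: "(\<lambda>v. \<integral>\<^sup>+t. f (v(j := T k t)) \<partial>M j) \<in> borel_measurable (Pi\<^sub>M I M)" for k
  proof -
    have "(\<lambda>x. f ((fst x)(j := T k (snd x)))) \<in> borel_measurable (Pi\<^sub>M I M \<Otimes>\<^sub>M M j)"
      by (rule measurable_compose[OF upd f]) auto
    then show ?thesis by (intro sigma_finite_measure.borel_measurable_nn_integral prob_space_imp_sigma_finite prob) (auto simp: case_prod_beta')
  qed
  have "(\<integral>\<^sup>+v. f v \<partial>Pi\<^sub>M I M) = (\<integral>\<^sup>+v. (\<integral>\<^sup>+t. f (v(j := t)) \<partial>M j) \<partial>Pi\<^sub>M I M)"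
    by (rule nn_integral_PiM_component_update) fact+
  also have "\<dots> = (\<integral>\<^sup>+v. (\<Sum>k<P. w k * (\<integral>\<^sup>+t. f (v(j := T k t)) \<partial>M j)) \<partial>Pi\<^sub>M I M)"
    by (intro nn_integral_cong split ft)
  also have "\<dots> = (\<Sum>k<P. w k * (\<integral>\<^sup>+v. (\<integral>\<^sup>+t. f (v(j := T k t)) \<partial>M j) \<partial>Pi\<^sub>M I M))"
    using int by (simp add: nn_integral_sum nn_integral_cmult)
  also have "(\<lambda>k. \<integral>\<^sup>+v. (\<integral>\<^sup>+t. f (v(j := T k t)) \<partial>M j) \<partial>Pi\<^sub>M I M) =
      (\<lambda>k. \<integral>\<^sup>+v. f (v(j := T k (v j))) \<partial>Pi\<^sub>M I M)"
    using nn_integral_PiM_component_update[OF assms(1,2) prob fk] by simp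
  finally show ?thesis .
qed

definition cube :: "('n::finite \<Rightarrow> real) measure" where
  "cube = Pi\<^sub>M UNIV (\<lambda>_. unif)"

lemma space_cube [simp]: "space cube = UNIV"
  by (simp add: cube_def space_PiM)

lemma prob_space_cube [simp]: "prob_space cube"
  unfolding cube_def by (rule prob_space_PiM) simp

lemma cell_measurable [measurable]: "cell B k \<in> borel_measurable borel"
  unfolding cell_def[abs_def] by measurable

lemma cube_component [measurable]: "(\<lambda>v. v j) \<in> borel_measurable (cube :: ('n::finite \<Rightarrow> real) measure)"
proof -
  have "(\<lambda>v. v j) \<in> measurable (cube :: ('n \<Rightarrow> real) measure) unif" unfolding cube_def by measurable
  then show ?thesis by (simp cong: measurable_cong_sets)
qed

lemma measurable_cubeI:
  "(\<And>j. (\<lambda>x. f x j) \<in> borel_measurable N) \<Longrightarrow> f \<in> measurable N (cube :: ('n::finite \<Rightarrow> real) measure)"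
  unfolding cube_def by (rule measurable_PiM_single') (auto cong: measurable_cong_sets)

lemma cube_update_cell [measurable]:
  "(\<lambda>v. v(j := cell B k (v j))) \<in> measurable cube (cube :: ('n::finite \<Rightarrow> real) measure)"
  by (rule measurable_cubeI) (auto simp: fun_upd_def)

lemma nn_integral_cube_cells:
  fixes f :: "('n::finite \<Rightarrow> real) \<Rightarrow> ennreal"
  assumes f: "f \<in> borel_measurable cube" and B: "cuts B P"
  shows "(\<integral>\<^sup>+v. f v \<partial>cube) =
    (\<Sum>k<P. ennreal (B (Suc k) - B k) * (\<integral>\<^sup>+v. f (v(j := cell B k (v j))) \<partial>cube))"
  unfolding cube_def
  by (rule nn_integral_PiM_split)
     (use f in \<open>auto simp: cube_def cong: measurable_cong_sets intro!: nn_integral_unif_cells[OF _ B]\<close>)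

lemma sum_PiE_insert:
  assumes "x \<notin> S"
  shows "(\<Sum>l\<in>PiE (insert x S) T. f l) = (\<Sum>y\<in>T x. \<Sum>l\<in>PiE S T. f (l(x := y)))"
proof -
  have "(\<Sum>l\<in>PiE (insert x S) T. f l) = (\<Sum>p\<in>T x \<times> PiE S T. f ((\<lambda>(y, g). g(x := y)) p))"
    unfolding PiE_insert_eq by (rule sum.reindex[OF inj_combinator[OF assms], unfolded comp_def])
  then show ?thesis by (simp add: sum.cartesian_product case_prod_beta')
qed

text \<open>The sample points are cut along axis j independently of each other, so a label vector
  has the product of the cell lengths as its weight. The set J of points already cut grows by
  induction.\<close>

lemma nn_integral_cubes_cells:
  fixes F :: "(nat \<Rightarrow> 'n::finite \<Rightarrow> real) \<Rightarrow> ennreal"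
  assumes "finite I" and B: "cuts B P" and "J \<subseteq> I"
    and F: "F \<in> borel_measurable (Pi\<^sub>M I (\<lambda>_. cube))"
  shows "(\<integral>\<^sup>+u. F u \<partial>Pi\<^sub>M I (\<lambda>_. cube)) =
    (\<Sum>l\<in>PiE J (\<lambda>_. {..<P}). ennreal (\<Prod>i\<in>J. B (Suc (l i)) - B (l i)) *
      (\<integral>\<^sup>+u. F (\<lambda>i. if i \<in> J then (u i)(j := cell B (l i) (u i j)) else u i) \<partial>Pi\<^sub>M I (\<lambda>_. cube)))"
proof -
  have "finite J" using assms finite_subset by blast
  then show ?thesis using \<open>J \<subseteq> I\<close>
  proof (induction J)
    case (insert a J)
    let ?T = "\<lambda>k v. v(j := cell B k (v j))"
    have m: "(\<lambda>u i. if i \<in> J then ?T (l i) (u i) else u i) \<in> measurable (Pi\<^sub>M I (\<lambda>_. cube)) (Pi\<^sub>M I (\<lambda>_. cube))" for l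
    proof (rule measurable_PiM_single')
      fix i assume "i \<in> I"
      then have "(\<lambda>u. u i) \<in> measurable (Pi\<^sub>M I (\<lambda>_. cube)) cube" by measurable
      then show "(\<lambda>u. if i \<in> J then ?T (l i) (u i) else u i) \<in> measurable (Pi\<^sub>M I (\<lambda>_. cube)) cube"
        by (cases "i \<in> J") (auto intro: measurable_compose[OF _ cube_update_cell])
    next
      show "(\<lambda>u i. if i \<in> J then ?T (l i) (u i) else u i) \<in> space (Pi\<^sub>M I (\<lambda>_. cube)) \<rightarrow> (\<Pi>\<^sub>E i\<in>I. space cube)"
        using insert.prems by (auto simp: space_PiM PiE_def extensional_def)
    qed
    have "(\<integral>\<^sup>+u. F u \<partial>Pi\<^sub>M I (\<lambda>_. cube)) =
       (\<Sum>l\<in>PiE J (\<lambda>_. {..<P}). ennreal (\<Prod>i\<in>J. B (Suc (l i)) - B (l i)) *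
        (\<Sum>k<P. ennreal (B (Suc k) - B k) * (\<integral>\<^sup>+u. F (\<lambda>i. if i \<in> J then ?T (l i) ((u(a := ?T k (u a))) i) else (u(a := ?T k (u a))) i) \<partial>Pi\<^sub>M I (\<lambda>_. cube))))"
      unfolding insert.IH[OF insert_subset[THEN iffD1, THEN conjunct2, OF insert.prems]]
      by (intro sum.cong refl arg_cong2[where f = "(*)"] nn_integral_PiM_split[where j = a])
         (use insert.prems assms in \<open>auto intro!: measurable_compose[OF m F] nn_integral_cube_cells cube_update_cell simp del: fun_upd_apply\<close>)
    also have "\<dots> = (\<Sum>l\<in>PiE J (\<lambda>_. {..<P}). \<Sum>k<P. ennreal (\<Prod>i\<in>insert a J. B (Suc ((l(a := k)) i)) - B ((l(a := k)) i)) *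
        (\<integral>\<^sup>+u. F (\<lambda>i. if i \<in> insert a J then ?T ((l(a := k)) i) (u i) else u i) \<partial>Pi\<^sub>M I (\<lambda>_. cube)))"
    proof (intro sum.cong refl, unfold sum_distrib_left, intro sum.cong refl)
      fix l k assume l: "l \<in> PiE J (\<lambda>_. {..<P})" and k: "k \<in> {..<P}"
      have "(\<Prod>i\<in>insert a J. B (Suc ((l(a := k)) i)) - B ((l(a := k)) i)) =
         (B (Suc k) - B k) * (\<Prod>i\<in>J. B (Suc (l i)) - B (l i))"
        using insert.hyps by (auto intro!: prod.cong)
      moreover have "(\<Prod>i\<in>J. B (Suc (l i)) - B (l i)) \<ge> 0" "B (Suc k) - B k \<ge> 0"
        using B l k by (auto simp: cuts_def intro!: prod_nonneg dest!: PiE_mem)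
      moreover have "(\<lambda>i. if i \<in> J then ?T (l i) ((u(a := ?T k (u a))) i) else (u(a := ?T k (u a))) i) =
         (\<lambda>i. if i \<in> insert a J then ?T ((l(a := k)) i) (u i) else u i)" for u :: "nat \<Rightarrow> 'n \<Rightarrow> real"
        using insert.hyps by auto
      ultimately show "ennreal (\<Prod>i\<in>J. B (Suc (l i)) - B (l i)) *
        (ennreal (B (Suc k) - B k) * (\<integral>\<^sup>+u. F (\<lambda>i. if i \<in> J then ?T (l i) ((u(a := ?T k (u a))) i) else (u(a := ?T k (u a))) i) \<partial>Pi\<^sub>M I (\<lambda>_. cube)))
       = ennreal (\<Prod>i\<in>insert a J. B (Suc ((l(a := k)) i)) - B ((l(a := k)) i)) *
        (\<integral>\<^sup>+u. F (\<lambda>i. if i \<in> insert a J then ?T ((l(a := k)) i) (u i) else u i) \<partial>Pi\<^sub>M I (\<lambda>_. cube))"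
        by (simp add: ennreal_mult ac_simps)
    qed
    also have "\<dots> = (\<Sum>l\<in>PiE (insert a J) (\<lambda>_. {..<P}). ennreal (\<Prod>i\<in>insert a J. B (Suc (l i)) - B (l i)) *
        (\<integral>\<^sup>+u. F (\<lambda>i. if i \<in> insert a J then ?T (l i) (u i) else u i) \<partial>Pi\<^sub>M I (\<lambda>_. cube)))"
      by (subst sum_PiE_insert[OF insert.hyps(2)]) (rule sum.swap)
    finally show ?case .
  qed simp
qed

section \<open>Labelled samples\<close>

text \<open>
  An operation \<open>(a, B, P)\<close> cuts axis a at \<open>B 0, \<dots>, B P\<close>, and the label \<open>l i\<close> is the cell of the i-th
  sample point. \<open>sample_pt\<close> reads the j-th coordinate of the sample off its labels and a residual
  position t. \<open>target_pt\<close> uses the empirical cut points of the group S instead and goes on inside the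
  subgroup with the same label; averaged over the group it is uniformly distributed, whatever
  the labels are (\<open>target_pt_marginal\<close>).
\<close>

fun sample_pt :: "('n \<times> (nat \<Rightarrow> real) \<times> nat) list \<Rightarrow> (nat \<Rightarrow> nat) list \<Rightarrow> 'n \<Rightarrow> nat \<Rightarrow> real \<Rightarrow> real" where
  "sample_pt ((a, B, P) # xs) (l # ls) j i t = (if a = j then cell B (l i) (sample_pt xs ls j i t) else sample_pt xs ls j i t)"
| "sample_pt _ _ j i t = t"

text \<open>The empirical distribution function of the labels of S at the cut points. For empty S
  the division by 0 makes it constantly 0, so the final value 1 required by \<open>cuts\<close>
  needs a nonempty group.\<close>

definition ecuts :: "(nat \<Rightarrow> nat) \<Rightarrow> nat set \<Rightarrow> nat \<Rightarrow> real" where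
  "ecuts l S k = real (card {i \<in> S. l i < k}) / real (card S)"

fun target_pt :: "('n \<times> (nat \<Rightarrow> real) \<times> nat) list \<Rightarrow> (nat \<Rightarrow> nat) list \<Rightarrow> nat set \<Rightarrow> 'n \<Rightarrow> nat \<Rightarrow> real \<Rightarrow> real" where
  "target_pt ((a, B, P) # xs) (l # ls) S j i t =
    (let s = target_pt xs ls {i' \<in> S. l i' = l i} j i t in if a = j then cell (ecuts l S) (l i) s else s)"
| "target_pt _ _ S j i t = t"

lemma ecuts_Suc:
  assumes "finite S"
  shows "ecuts l S (Suc k) = ecuts l S k + real (card {i \<in> S. l i = k}) / real (card S)"
proof -
  have "{i \<in> S. l i < Suc k} = {i \<in> S. l i < k} \<union> {i \<in> S. l i = k}" by auto
  then have "card {i \<in> S. l i < Suc k} = card {i \<in> S. l i < k} + card {i \<in> S. l i = k}"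
    using assms by (simp only:) (rule card_Un_disjoint, auto)
  then show ?thesis by (simp add: ecuts_def add_divide_distrib)
qed

lemma cuts_ecuts:
  assumes "finite S" "S \<noteq> {}" "\<And>i. i \<in> S \<Longrightarrow> l i < P"
  shows "cuts (ecuts l S) P"
proof -
  have "{i \<in> S. l i < P} = S" using assms by auto
  then have "ecuts l S P = 1" using assms by (simp add: ecuts_def)
  then show ?thesis using assms(1) by (auto simp: cuts_def ecuts_Suc) (simp add: ecuts_def)
qed

lemma sum_by_label:
  fixes f :: "nat \<Rightarrow> 'a::comm_monoid_add"
  assumes "finite S" "\<And>i. i \<in> S \<Longrightarrow> l i < (P::nat)"
  shows "(\<Sum>i\<in>S. f i) = (\<Sum>k<P. \<Sum>i\<in>{i \<in> S. l i = k}. f i)"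
proof -
  have "l ` S \<subseteq> {..<P}" using assms(2) by auto
  from sum.group[OF assms(1) _ this, of f] show ?thesis by simp
qed

text \<open>The points with label k make up exactly that fraction of S which is the length of the
  k-th empirical cell. Uniformity inside every subgroup therefore adds up to uniformity in the
  group, by splitting the cube along \<open>ecuts l S\<close>.\<close>

lemma target_pt_marginal:
  fixes f :: "('n::finite \<Rightarrow> real) \<Rightarrow> ennreal"
  assumes "list_all2 (\<lambda>(a, B, P) l. \<forall>i\<in>S. l i < P) xs ls" "finite S" "f \<in> borel_measurable cube"
  shows "(\<Sum>i\<in>S. \<integral>\<^sup>+v. f (\<lambda>j. target_pt xs ls S j i (v j)) \<partial>cube) = of_nat (card S) * (\<integral>\<^sup>+v. f v \<partial>cube)"
  using assms
proof (induction xs arbitrary: ls S f)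
  case (Cons x xs ls0)
  obtain a B P where x: "x = (a, B, P)" by (cases x)
  obtain l ls where ls: "ls0 = l # ls" and l: "\<And>i. i \<in> S \<Longrightarrow> l i < P"
    and valid: "list_all2 (\<lambda>(a, B, P) l. \<forall>i\<in>S. l i < P) xs ls"
    using Cons.prems(1) by (auto simp: x list_all2_Cons1)
  show ?case
  proof (cases "S = {}")
    case False
    define S' where "S' k = {i \<in> S. l i = k}" for k
    have fin: "finite (S' k)" for k using Cons.prems(2) by (simp add: S'_def)
    let ?T = "\<lambda>k v. v(a := cell (ecuts l S) k (v a))"
    have fT: "(\<lambda>v. f (?T k v)) \<in> borel_measurable cube" for k
      by (rule measurable_compose[OF cube_update_cell Cons.prems(3)])
    have "(\<Sum>i\<in>S. \<integral>\<^sup>+v. f (\<lambda>j. target_pt (x # xs) ls0 S j i (v j)) \<partial>cube) =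
      (\<Sum>k<P. \<Sum>i\<in>S' k. \<integral>\<^sup>+v. f (\<lambda>j. target_pt (x # xs) ls0 S j i (v j)) \<partial>cube)"
      unfolding S'_def using Cons.prems(2) l by (intro sum_by_label) auto
    also have "\<dots> = (\<Sum>k<P. \<Sum>i\<in>S' k. \<integral>\<^sup>+v. f (?T k (\<lambda>j. target_pt xs ls (S' k) j i (v j))) \<partial>cube)"
    proof (intro sum.cong refl nn_integral_cong arg_cong[where f = f] ext)
      fix k i v j assume "i \<in> S' k"
      then have "l i = k" by (simp add: S'_def)
      then show "target_pt (x # xs) ls0 S j i (v j) = (?T k (\<lambda>j. target_pt xs ls (S' k) j i (v j))) j"
        by (auto simp: x ls Let_def S'_def)
    qed
    also have "\<dots> = (\<Sum>k<P. of_nat (card (S' k)) * (\<integral>\<^sup>+v. f (?T k v) \<partial>cube))"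
    proof (intro sum.cong refl)
      fix k
      show "(\<Sum>i\<in>S' k. \<integral>\<^sup>+v. f (?T k (\<lambda>j. target_pt xs ls (S' k) j i (v j))) \<partial>cube) =
        of_nat (card (S' k)) * (\<integral>\<^sup>+v. f (?T k v) \<partial>cube)"
        by (rule Cons.IH[OF _ fin fT])
          (rule list_all2_mono[OF valid], auto simp: S'_def)
    qed
    also have "\<dots> = (\<Sum>k<P. of_nat (card S) * (ennreal (ecuts l S (Suc k) - ecuts l S k) * (\<integral>\<^sup>+v. f (?T k v) \<partial>cube)))"
    proof (intro sum.cong refl)
      fix k
      have "of_nat (card (S' k)) = of_nat (card S) * ennreal (ecuts l S (Suc k) - ecuts l S k)"
        using False Cons.prems(2)
        by (simp add: ecuts_Suc S'_def ennreal_of_nat_eq_real_of_nat flip: ennreal_mult)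
      then show "of_nat (card (S' k)) * (\<integral>\<^sup>+v. f (?T k v) \<partial>cube) =
        of_nat (card S) * (ennreal (ecuts l S (Suc k) - ecuts l S k) * (\<integral>\<^sup>+v. f (?T k v) \<partial>cube))"
        by (simp add: mult.assoc)
    qed
    also have "\<dots> = of_nat (card S) * (\<integral>\<^sup>+v. f v \<partial>cube)"
      by (subst nn_integral_cube_cells[OF Cons.prems(3) cuts_ecuts[OF Cons.prems(2) False l]])
        (auto simp: sum_distrib_left)
    finally show ?thesis .
  qed simp
qed simp

section \<open>Expectations over independent labels\<close>

text \<open>The expectation when the labels \<open>l i\<close> are independent and equal k with
  probability \<open>B (Suc k) - B k\<close>. A weighted sum over the finite label space raises no
  measurability questions. The real version allows subtraction; the twin \<open>navg\<close> takes
  integrands that are themselves integrals.\<close>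

definition avg :: "nat set \<Rightarrow> (nat \<Rightarrow> real) \<Rightarrow> nat \<Rightarrow> ((nat \<Rightarrow> nat) \<Rightarrow> real) \<Rightarrow> real" where
  "avg I B P F = (\<Sum>l\<in>PiE I (\<lambda>_. {..<P}). (\<Prod>i\<in>I. B (Suc (l i)) - B (l i)) * F l)"

definition navg :: "nat set \<Rightarrow> (nat \<Rightarrow> real) \<Rightarrow> nat \<Rightarrow> ((nat \<Rightarrow> nat) \<Rightarrow> ennreal) \<Rightarrow> ennreal" where
  "navg I B P F = (\<Sum>l\<in>PiE I (\<lambda>_. {..<P}). ennreal (\<Prod>i\<in>I. B (Suc (l i)) - B (l i)) * F l)"

fun expect :: "nat set \<Rightarrow> ('n \<times> (nat \<Rightarrow> real) \<times> nat) list \<Rightarrow> ((nat \<Rightarrow> nat) list \<Rightarrow> real) \<Rightarrow> real" where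
  "expect I [] F = F []"
| "expect I ((a, B, P) # xs) F = avg I B P (\<lambda>l. expect I xs (\<lambda>ls. F (l # ls)))"

fun nexpect :: "nat set \<Rightarrow> ('n \<times> (nat \<Rightarrow> real) \<times> nat) list \<Rightarrow> ((nat \<Rightarrow> nat) list \<Rightarrow> ennreal) \<Rightarrow> ennreal" where
  "nexpect I [] F = F []"
| "nexpect I ((a, B, P) # xs) F = navg I B P (\<lambda>l. nexpect I xs (\<lambda>ls. F (l # ls)))"

definition labels :: "nat set \<Rightarrow> ('n \<times> (nat \<Rightarrow> real) \<times> nat) list \<Rightarrow> (nat \<Rightarrow> nat) list \<Rightarrow> bool" where
  "labels I xs ls \<longleftrightarrow> list_all2 (\<lambda>(a, B, P) l. l \<in> PiE I (\<lambda>_. {..<P})) xs ls"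

lemma labels_simps [simp]:
  "labels I [] ls \<longleftrightarrow> ls = []"
  "labels I (x # xs) [] \<longleftrightarrow> False"
  "labels I ((a, B, P) # xs) (l # ls) \<longleftrightarrow> l \<in> PiE I (\<lambda>_. {..<P}) \<and> labels I xs ls"
  by (auto simp: labels_def)

definition specs :: "('n \<times> (nat \<Rightarrow> real) \<times> nat) list \<Rightarrow> bool" where
  "specs xs \<longleftrightarrow> (\<forall>(a, B, P)\<in>set xs. cuts B P)"

lemma specs_simps [simp]:
  "specs []" "specs ((a, B, P) # xs) \<longleftrightarrow> cuts B P \<and> specs xs"
  "specs (xs @ ys) \<longleftrightarrow> specs xs \<and> specs ys"
  by (simp_all add: specs_def ball_Un)

lemma avg_weight_nonneg:
  assumes "cuts B P" "l \<in> PiE I (\<lambda>_. {..<P})"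
  shows "0 \<le> (\<Prod>i\<in>I. B (Suc (l i)) - B (l i))"
  using assms by (auto simp: cuts_def intro!: prod_nonneg dest!: PiE_mem)

lemma avg_mono:
  assumes "cuts B P" "\<And>l. l \<in> PiE I (\<lambda>_. {..<P}) \<Longrightarrow> F l \<le> G l"
  shows "avg I B P F \<le> avg I B P G"
  unfolding avg_def using assms by (intro sum_mono mult_left_mono avg_weight_nonneg) auto

lemma navg_mono:
  assumes "\<And>l. l \<in> PiE I (\<lambda>_. {..<P}) \<Longrightarrow> F l \<le> G l"
  shows "navg I B P F \<le> navg I B P G"
  unfolding navg_def using assms by (intro sum_mono mult_left_mono) auto

lemma navg_ennreal:
  assumes "cuts B P" "\<And>l. l \<in> PiE I (\<lambda>_. {..<P}) \<Longrightarrow> 0 \<le> F l"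
  shows "navg I B P (\<lambda>l. ennreal (F l)) = ennreal (avg I B P F)"
proof -
  have "navg I B P (\<lambda>l. ennreal (F l)) =
     (\<Sum>l\<in>PiE I (\<lambda>_. {..<P}). ennreal ((\<Prod>i\<in>I. B (Suc (l i)) - B (l i)) * F l))"
    unfolding navg_def by (intro sum.cong refl ennreal_mult[symmetric] avg_weight_nonneg[OF assms(1)] assms(2))
  also have "\<dots> = ennreal (avg I B P F)"
    unfolding avg_def by (intro sum_ennreal mult_nonneg_nonneg avg_weight_nonneg[OF assms(1)] assms(2))
  finally show ?thesis .
qed

lemma avg_add: "avg I B P (\<lambda>l. F l + G l) = avg I B P F + avg I B P G"
  by (simp add: avg_def distrib_left sum.distrib)

lemma avg_cmult: "avg I B P (\<lambda>l. c * F l) = c * avg I B P F"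
  by (simp add: avg_def sum_distrib_left ac_simps)

lemma avg_diff: "avg I B P (\<lambda>l. F l - G l) = avg I B P F - avg I B P G"
  by (simp add: avg_def right_diff_distrib sum_subtractf)

lemma avg_sum: "avg I B P (\<lambda>l. \<Sum>x\<in>A. F x l) = (\<Sum>x\<in>A. avg I B P (F x))"
  by (simp add: avg_def sum_distrib_left) (rule sum.swap)

lemma avg_cong: "(\<And>l. l \<in> PiE I (\<lambda>_. {..<P}) \<Longrightarrow> F l = G l) \<Longrightarrow> avg I B P F = avg I B P G"
  by (simp add: avg_def cong: sum.cong)

text \<open>Independence of the labels, in the form of the distributive law for a product of
  sums.\<close>

lemma avg_prod:
  assumes "finite I"
  shows "avg I B P (\<lambda>l. \<Prod>i\<in>I. h i (l i)) = (\<Prod>i\<in>I. \<Sum>k<P. (B (Suc k) - B k) * h i k)"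
  using assms by (simp add: avg_def prod_sum_PiE prod.distrib)

lemma cuts_sum: "cuts B P \<Longrightarrow> (\<Sum>k<P. B (Suc k) - B k) = 1"
  by (simp add: cuts_def sum_lessThan_telescope)

lemma avg_const:
  assumes "finite I" "cuts B P"
  shows "avg I B P (\<lambda>_. c) = c"
proof -
  have "avg I B P (\<lambda>_. 1) = 1"
    using avg_prod[OF assms(1), of B P "\<lambda>_ _. 1"] cuts_sum[OF assms(2)] by simp
  then show ?thesis using avg_cmult[of I B P c "\<lambda>_. 1"] by simp
qed

lemma avg_single:
  assumes "finite I" "cuts B P" "i \<in> I"
  shows "avg I B P (\<lambda>l. f (l i)) = (\<Sum>k<P. (B (Suc k) - B k) * f k)"
proof -
  have "avg I B P (\<lambda>l. f (l i)) = avg I B P (\<lambda>l. \<Prod>x\<in>I. if x = i then f (l x) else 1)"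
    using assms by simp
  also have "\<dots> = (\<Prod>x\<in>I. if x = i then \<Sum>k<P. (B (Suc k) - B k) * f k else 1)"
    unfolding avg_prod[OF assms(1), of B P "\<lambda>x k. if x = i then f k else 1"] using cuts_sum[OF assms(2)]
    by (intro prod.cong refl) auto
  finally show ?thesis using assms by simp
qed

lemma avg_pair:
  assumes "finite I" "cuts B P" "i \<in> I" "i' \<in> I" "i \<noteq> i'"
  shows "avg I B P (\<lambda>l. f (l i) * g (l i')) =
    (\<Sum>k<P. (B (Suc k) - B k) * f k) * (\<Sum>k<P. (B (Suc k) - B k) * g k)"
proof -
  let ?F = "\<Sum>k<P. (B (Suc k) - B k) * f k" and ?G = "\<Sum>k<P. (B (Suc k) - B k) * g k"
  have "avg I B P (\<lambda>l. f (l i) * g (l i')) =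
     avg I B P (\<lambda>l. \<Prod>x\<in>I. (if x = i then f (l x) else 1) * (if x = i' then g (l x) else 1))"
    using assms by (simp add: prod.distrib)
  also have "\<dots> = (\<Prod>x\<in>I. (if x = i then ?F else 1) * (if x = i' then ?G else 1))"
    unfolding avg_prod[OF assms(1), of B P "\<lambda>x k. (if x = i then f k else 1) * (if x = i' then g k else 1)"]
    using cuts_sum[OF assms(2)] assms(5)
    by (intro prod.cong refl) auto
  finally show ?thesis using assms by (simp add: prod.distrib)
qed

text \<open>Variances of independent centred summands add: by \<open>avg_pair\<close> every mixed
  term is a product of two vanishing means.\<close>

lemma avg_sum_sq:
  assumes "finite I" "cuts B P" "S \<subseteq> I" and zero: "(\<Sum>k<P. (B (Suc k) - B k) * f k) = 0"
  shows "avg I B P (\<lambda>l. (\<Sum>i\<in>S. f (l i))\<^sup>2) = real (card S) * (\<Sum>k<P. (B (Suc k) - B k) * (f k)\<^sup>2)"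
proof -
  have "avg I B P (\<lambda>l. (\<Sum>i\<in>S. f (l i))\<^sup>2) = (\<Sum>i\<in>S. \<Sum>i'\<in>S. avg I B P (\<lambda>l. f (l i) * f (l i')))"
    by (simp add: power2_eq_square sum_product avg_sum)
  also have "\<dots> = (\<Sum>i\<in>S. \<Sum>i'\<in>S. if i' = i then (\<Sum>k<P. (B (Suc k) - B k) * (f k)\<^sup>2) else 0)"
  proof (intro sum.cong refl)
    fix i i' assume "i \<in> S" "i' \<in> S"
    then show "avg I B P (\<lambda>l. f (l i) * f (l i')) =
      (if i' = i then (\<Sum>k<P. (B (Suc k) - B k) * (f k)\<^sup>2) else 0)"
      using assms avg_pair[OF assms(1,2), of i i' f f] avg_single[OF assms(1,2), of i "\<lambda>x. f x * f x"]
      by (auto simp: power2_eq_square)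
  qed
  also have "\<dots> = (\<Sum>i\<in>S. (\<Sum>k<P. (B (Suc k) - B k) * (f k)\<^sup>2))"
    using finite_subset[OF assms(3,1)] by (simp cong: sum.cong)
  finally show ?thesis by simp
qed

lemma expect_cong:
  "(\<And>ls. labels I xs ls \<Longrightarrow> F ls = G ls) \<Longrightarrow> expect I xs F = expect I xs G"
proof (induction xs arbitrary: F G)
  case (Cons x xs)
  obtain a B P where x: "x = (a, B, P)" by (cases x)
  show ?case unfolding x expect.simps
    by (intro avg_cong Cons.IH Cons.prems) (simp_all add: x)
qed simp

lemma nexpect_mono:
  "(\<And>ls. labels I xs ls \<Longrightarrow> F ls \<le> G ls) \<Longrightarrow> nexpect I xs F \<le> nexpect I xs G"
proof (induction xs arbitrary: F G)
  case (Cons x xs)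
  obtain a B P where x: "x = (a, B, P)" by (cases x)
  show ?case unfolding x nexpect.simps
    by (intro navg_mono Cons.IH Cons.prems) (simp_all add: x)
qed simp

lemma expect_nonneg:
  "specs xs \<Longrightarrow> (\<And>ls. labels I xs ls \<Longrightarrow> 0 \<le> F ls) \<Longrightarrow> 0 \<le> expect I xs F"
proof (induction I xs F rule: expect.induct)
  case (2 I a B P xs F)
  then show ?case
    by (auto simp: avg_def intro!: sum_nonneg mult_nonneg_nonneg avg_weight_nonneg)
qed simp

lemma nexpect_ennreal:
  "specs xs \<Longrightarrow> (\<And>ls. labels I xs ls \<Longrightarrow> 0 \<le> F ls) \<Longrightarrow> nexpect I xs (\<lambda>ls. ennreal (F ls)) = ennreal (expect I xs F)"
proof (induction I xs F rule: expect.induct)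
  case (2 I a B P xs F)
  then have "navg I B P (\<lambda>l. nexpect I xs (\<lambda>ls. ennreal (F (l # ls)))) =
     navg I B P (\<lambda>l. ennreal (expect I xs (\<lambda>ls. F (l # ls))))"
    by (intro antisym navg_mono) auto
  also have "\<dots> = ennreal (avg I B P (\<lambda>l. expect I xs (\<lambda>ls. F (l # ls))))"
    using 2 by (intro navg_ennreal) (auto intro!: expect_nonneg)
  finally show ?case by simp
qed simp

lemma expect_add: "expect I xs (\<lambda>ls. F ls + G ls) = expect I xs F + expect I xs G"
  by (induction I xs F arbitrary: G rule: expect.induct) (auto simp: avg_add)

lemma expect_cmult: "expect I xs (\<lambda>ls. c * F ls) = c * expect I xs F"
  by (induction I xs F rule: expect.induct) (auto simp: avg_cmult)

lemma expect_diff: "expect I xs (\<lambda>ls. F ls - G ls) = expect I xs F - expect I xs G"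
  by (induction I xs F arbitrary: G rule: expect.induct) (auto simp: avg_diff)

lemma expect_sum: "expect I xs (\<lambda>ls. \<Sum>x\<in>A. F x ls) = (\<Sum>x\<in>A. expect I xs (F x))"
proof (induction xs arbitrary: F)
  case (Cons x xs)
  then show ?case by (cases x) (auto simp: avg_sum)
qed simp

lemma expect_const: "finite I \<Longrightarrow> specs xs \<Longrightarrow> expect I xs (\<lambda>_. c) = c"
  by (induction xs) (auto simp: avg_const)

lemma nexpect_add: "nexpect I xs (\<lambda>ls. F ls + G ls) = nexpect I xs F + nexpect I xs G"
proof (induction I xs F arbitrary: G rule: nexpect.induct)
  case (2 I a B P xs F)
  then show ?case by (simp add: navg_def distrib_left sum.distrib)
qed simp

lemma nexpect_cmult: "nexpect I xs (\<lambda>ls. c * F ls) = c * nexpect I xs F"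
proof (induction I xs F rule: nexpect.induct)
  case (2 I a B P xs F)
  then show ?case by (simp add: navg_def sum_distrib_left ac_simps)
qed simp

text \<open>Drawing the sample amounts to drawing all labels and then uniform residual positions,
  one operation at a time. Outside I the update returns \<open>u i\<close>, so that u remains
  extensional.\<close>

lemma nn_integral_cubes_nexpect:
  fixes F :: "(nat \<Rightarrow> 'n::finite \<Rightarrow> real) \<Rightarrow> ennreal"
  assumes "finite I" "specs xs" "F \<in> borel_measurable (Pi\<^sub>M I (\<lambda>_. cube))"
  shows "(\<integral>\<^sup>+u. F u \<partial>Pi\<^sub>M I (\<lambda>_. cube)) =
    nexpect I xs (\<lambda>ls. \<integral>\<^sup>+u. F (\<lambda>i. if i \<in> I then (\<lambda>j. sample_pt xs ls j i (u i j)) else u i) \<partial>Pi\<^sub>M I (\<lambda>_. cube))"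
  using assms(2,3)
proof (induction xs arbitrary: F)
  case Nil
  have "(\<lambda>i. if i \<in> I then (\<lambda>j. u i j) else u i) = u" for u :: "nat \<Rightarrow> 'n \<Rightarrow> real" by auto
  then show ?case by (simp cong: if_cong)
next
  case (Cons x xs)
  obtain a B P where x: "x = (a, B, P)" by (cases x)
  have B: "cuts B P" and xs: "specs xs" using Cons.prems(1) by (auto simp: x)
  define T where "T l u = (\<lambda>i. if i \<in> I then (u i)(a := cell B (l i) (u i a)) else u i)"
    for l and u :: "nat \<Rightarrow> 'n \<Rightarrow> real"
  have m: "T l \<in> measurable (Pi\<^sub>M I (\<lambda>_. cube)) (Pi\<^sub>M I (\<lambda>_. cube))" for l
    unfolding T_def
  proof (rule measurable_PiM_single')
    fix i assume "i \<in> I"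
    then have "(\<lambda>u. u i) \<in> measurable (Pi\<^sub>M I (\<lambda>_. cube)) cube" by measurable
    then show "(\<lambda>u. if i \<in> I then (u i)(a := cell B (l i) (u i a)) else u i) \<in> measurable (Pi\<^sub>M I (\<lambda>_. cube)) cube"
      using \<open>i \<in> I\<close> by (auto intro: measurable_compose[OF _ cube_update_cell])
  qed (auto simp: space_PiM PiE_def extensional_def)
  have "(\<integral>\<^sup>+u. F u \<partial>Pi\<^sub>M I (\<lambda>_. cube)) = navg I B P (\<lambda>l. \<integral>\<^sup>+u. F (T l u) \<partial>Pi\<^sub>M I (\<lambda>_. cube))"
    unfolding navg_def T_def by (rule nn_integral_cubes_cells[OF assms(1) B order.refl Cons.prems(2)])
  also have "\<dots> = navg I B P (\<lambda>l. nexpect I xs (\<lambda>ls. \<integral>\<^sup>+u. F (\<lambda>i. if i \<in> I then (\<lambda>j. sample_pt (x # xs) (l # ls) j i (u i j)) else u i) \<partial>Pi\<^sub>M I (\<lambda>_. cube)))"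
  proof (rule arg_cong[where f = "navg I B P"], rule ext)
    fix l
    have eq: "T l (\<lambda>i. if i \<in> I then (\<lambda>j. sample_pt xs ls j i (u i j)) else u i) =
       (\<lambda>i. if i \<in> I then (\<lambda>j. sample_pt (x # xs) (l # ls) j i (u i j)) else u i)" for ls and u :: "nat \<Rightarrow> 'n \<Rightarrow> real"
      by (rule ext) (simp add: T_def x fun_eq_iff)
    show "(\<integral>\<^sup>+u. F (T l u) \<partial>Pi\<^sub>M I (\<lambda>_. cube)) =
      nexpect I xs (\<lambda>ls. \<integral>\<^sup>+u. F (\<lambda>i. if i \<in> I then (\<lambda>j. sample_pt (x # xs) (l # ls) j i (u i j)) else u i) \<partial>Pi\<^sub>M I (\<lambda>_. cube))"
      unfolding Cons.IH[OF xs measurable_compose[OF m Cons.prems(2)]] eq ..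
  qed
  finally show ?case by (simp add: x)
qed

section \<open>The cost of the binary rounds\<close>

definition halves :: "nat \<Rightarrow> real" where
  "halves k = real k / 2"

lemma cuts_halves: "cuts halves 2"
  by (auto simp: cuts_def halves_def)

text \<open>
  \<open>center_var\<close> is the variance of the centre of the sample cell along axis j. The covariance with the centre
  of the target cell falls short of it by at most \<open>count_loss\<close> per group (\<open>expect_corr\<close>); an
  operation along another axis splits the group into P groups and multiplies the loss by P.
\<close>

fun center_var :: "'n \<Rightarrow> ('n \<times> (nat \<Rightarrow> real) \<times> nat) list \<Rightarrow> real" where
  "center_var j [] = 0"
| "center_var j ((a, B, P) # xs) = (if a = j then 1/16 + center_var j xs / 4 else center_var j xs)"

fun count_loss :: "'n \<Rightarrow> ('n \<times> (nat \<Rightarrow> real) \<times> nat) list \<Rightarrow> real" where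
  "count_loss j [] = 0"
| "count_loss j ((a, B, P) # xs) = (if a = j then 1/16 + count_loss j xs / 2 else real P * count_loss j xs)"

definition binary :: "'n \<Rightarrow> ('n \<times> (nat \<Rightarrow> real) \<times> nat) list \<Rightarrow> bool" where
  "binary j xs \<longleftrightarrow> (\<forall>(a, B, P)\<in>set xs. a = j \<longrightarrow> B = halves \<and> P = 2)"

lemma binary_simps [simp]:
  "binary j []"
  "binary j ((a, B, P) # xs) \<longleftrightarrow> (a = j \<longrightarrow> B = halves \<and> P = 2) \<and> binary j xs"
  "binary j (xs @ ys) \<longleftrightarrow> binary j xs \<and> binary j ys"
  by (simp_all add: binary_def ball_Un)

lemma center_var_nonneg: "0 \<le> center_var j xs"
  by (induction j xs rule: center_var.induct) auto

lemma count_loss_nonneg: "0 \<le> count_loss j xs"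
  by (induction j xs rule: count_loss.induct) auto

lemma sum_lessThan_2: "(\<Sum>k<2. f k) = f 0 + f (Suc 0)" for f :: "nat \<Rightarrow> 'a::comm_monoid_add"
  by (simp add: numeral_2_eq_2 lessThan_Suc add.commute)

lemma expect_sample_pt_mean:
  assumes "finite I" "i \<in> I"
  shows "specs xs \<Longrightarrow> binary j xs \<Longrightarrow> expect I xs (\<lambda>ls. sample_pt xs ls j i (1/2) - 1/2) = 0"
proof (induction xs)
  case (Cons x xs)
  obtain a B P where x: "x = (a, B, P)" by (cases x)
  have B: "cuts B P" and IH: "expect I xs (\<lambda>ls. sample_pt xs ls j i (1/2) - 1/2) = 0" and xs: "specs xs"
    using Cons by (auto simp: x)
  show ?case
  proof (cases "a = j")
    case True
    then have h: "B = halves" "P = 2" using Cons.prems by (auto simp: x)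
    have "expect I (x # xs) (\<lambda>ls. sample_pt (x # xs) ls j i (1/2) - 1/2) =
      avg I B P (\<lambda>l. expect I xs (\<lambda>ls. 1/2 * (sample_pt xs ls j i (1/2) - 1/2) + (real (l i) / 2 - 1/4)))"
      unfolding x expect.simps by (intro avg_cong expect_cong) (simp add: True h cell_def halves_def field_simps)
    also have "\<dots> = avg I B P (\<lambda>l. real (l i) / 2 - 1/4)"
      using IH by (simp only: expect_add expect_cmult expect_const[OF assms(1) xs] mult_zero_right add_0_left)
    also have "\<dots> = 0"
      using avg_single[OF assms(1) B assms(2), of "\<lambda>k. real k / 2 - 1/4"]
      by (simp add: h sum_lessThan_2 halves_def)
    finally show ?thesis .
  next
    case False
    then have "expect I (x # xs) (\<lambda>ls. sample_pt (x # xs) ls j i (1/2) - 1/2) = avg I B P (\<lambda>l. 0)"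
      unfolding x expect.simps by (intro avg_cong) (simp add: IH)
    then show ?thesis using avg_const[OF assms(1) B] by simp
  qed
qed simp

text \<open>A digit of axis j contributes variance 1/16. The centre given by the later labels is
  independent of it and enters scaled by 1/2, and the mixed term vanishes by
  \<open>expect_sample_pt_mean\<close>.\<close>

lemma expect_sample_pt_var:
  assumes "finite I" "i \<in> I"
  shows "specs xs \<Longrightarrow> binary j xs \<Longrightarrow> expect I xs (\<lambda>ls. (sample_pt xs ls j i (1/2) - 1/2)\<^sup>2) = center_var j xs"
proof (induction xs)
  case (Cons x xs)
  obtain a B P where x: "x = (a, B, P)" by (cases x)
  have B: "cuts B P" and IH: "expect I xs (\<lambda>ls. (sample_pt xs ls j i (1/2) - 1/2)\<^sup>2) = center_var j xs" and xs: "specs xs"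
    and mean: "expect I xs (\<lambda>ls. sample_pt xs ls j i (1/2) - 1/2) = 0"
    using Cons expect_sample_pt_mean[OF assms, of xs j] by (auto simp: x)
  show ?case
  proof (cases "a = j")
    case True
    then have h: "B = halves" "P = 2" using Cons.prems by (auto simp: x)
    have "expect I (x # xs) (\<lambda>ls. (sample_pt (x # xs) ls j i (1/2) - 1/2)\<^sup>2) =
      avg I B P (\<lambda>l. expect I xs (\<lambda>ls. 1/4 * (sample_pt xs ls j i (1/2) - 1/2)\<^sup>2 +
        (real (l i) / 2 - 1/4) * (sample_pt xs ls j i (1/2) - 1/2) + (real (l i) / 2 - 1/4)\<^sup>2))"
      unfolding x expect.simps
      by (intro avg_cong expect_cong) (simp add: True h cell_def halves_def field_simps power2_eq_square)
    also have "\<dots> = avg I B P (\<lambda>l. 1/4 * center_var j xs + (real (l i) / 2 - 1/4)\<^sup>2)"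
      using IH mean by (simp only: expect_add expect_cmult expect_const[OF assms(1) xs] mult_zero_right add_0_right)
    also have "\<dots> = 1/4 * center_var j xs + avg I B P (\<lambda>l. (real (l i) / 2 - 1/4)\<^sup>2)"
      by (simp only: avg_add avg_const[OF assms(1) B])
    also have "avg I B P (\<lambda>l. (real (l i) / 2 - 1/4)\<^sup>2) = 1/16"
      using avg_single[OF assms(1) B assms(2), of "\<lambda>k. (real k / 2 - 1/4)\<^sup>2"]
      by (simp add: h sum_lessThan_2 halves_def power2_eq_square)
    finally show ?thesis by (simp add: x True)
  next
    case False
    then have "expect I (x # xs) (\<lambda>ls. (sample_pt (x # xs) ls j i (1/2) - 1/2)\<^sup>2) = avg I B P (\<lambda>l. center_var j xs)"
      unfolding x expect.simps by (intro avg_cong) (simp add: IH)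
    then show ?thesis using avg_const[OF assms(1) B] False by (simp add: x)
  qed
qed simp

lemma ecuts_0 [simp]: "ecuts l S 0 = 0"
  by (simp add: ecuts_def)

text \<open>The targets of a group are jointly uniform and each is affine in t, so their values at t
  = 1/2 have mean 1/2. This holds for every choice of labels, not only in expectation. With c and d
  points in the two halves, the induction step is the identity
  \<open>c\<^sup>2 + 2 * c * d + d\<^sup>2 = (c + d)\<^sup>2\<close>.\<close>

lemma target_pt_center_sum:
  assumes "S \<subseteq> I" "finite I" "binary j xs" "labels I xs ls"
  shows "(\<Sum>i\<in>S. target_pt xs ls S j i (1/2)) = real (card S) / 2"
  using assms
proof (induction xs arbitrary: ls S)
  case (Cons x xs ls0)
  obtain a B P where x: "x = (a, B, P)" by (cases x)
  obtain l ls where ls: "ls0 = l # ls" and l: "l \<in> PiE I (\<lambda>_. {..<P})" and lls: "labels I xs ls"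
    using Cons.prems(4) by (cases ls0) (auto simp: x)
  have fin: "finite S" using Cons.prems finite_subset by blast
  have lP: "l i < P" if "i \<in> S" for i using l Cons.prems(1) that by (auto dest: PiE_mem)
  define S' where "S' k = {i \<in> S. l i = k}" for k
  have IH: "(\<Sum>i\<in>S' k. target_pt xs ls (S' k) j i (1/2)) = real (card (S' k)) / 2" for k
    using Cons.prems lls by (intro Cons.IH) (auto simp: S'_def x)
  have split: "(\<Sum>i\<in>S. f i) = (\<Sum>k<P. \<Sum>i\<in>S' k. f i)" for f :: "nat \<Rightarrow> real"
    unfolding S'_def by (rule sum_by_label[OF fin lP])
  show ?case
  proof (cases "a = j")
    case False
    have "(\<Sum>i\<in>S. target_pt (x # xs) ls0 S j i (1/2)) = (\<Sum>k<P. \<Sum>i\<in>S' k. target_pt xs ls (S' k) j i (1/2))"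
      unfolding split by (intro sum.cong refl) (auto simp: x ls False S'_def)
    also have "\<dots> = (\<Sum>k<P. \<Sum>i\<in>S' k. 1 / 2)" by (simp add: IH)
    also have "\<dots> = real (card S) / 2" unfolding split[symmetric] by simp
    finally show ?thesis .
  next
    case True
    show ?thesis
    proof (cases "S = {}")
      case False
      let ?e = "ecuts l S"
      have s0: "real (card S) > 0" using False fin by (simp add: card_gt_0_iff)
      have P: "P = 2" using Cons.prems(3) True by (simp add: x)
      have e: "?e (Suc k) = ?e k + real (card (S' k)) / real (card S)" for k
        by (simp add: ecuts_Suc[OF fin] S'_def)
      have s: "real (card S) = real (card (S' 0)) + real (card (S' (Suc 0)))"
        using split[of "\<lambda>_. 1"] by (simp add: P sum_lessThan_2)
      have "(\<Sum>i\<in>S. target_pt (x # xs) ls0 S j i (1/2)) =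
         (\<Sum>k<P. \<Sum>i\<in>S' k. ?e k + (?e (Suc k) - ?e k) * target_pt xs ls (S' k) j i (1/2))"
        unfolding split by (intro sum.cong refl) (auto simp: x ls True S'_def cell_def)
      also have "\<dots> = (\<Sum>k<P. real (card (S' k)) * ?e k + (?e (Suc k) - ?e k) * (real (card (S' k)) / 2))"
        by (simp add: sum.distrib IH flip: sum_distrib_left)
      also have "\<dots> = real (card S) / 2"
        using s0 unfolding P sum_lessThan_2 e by (simp add: field_simps) (simp add: s algebra_simps power2_eq_square)
      finally show ?thesis .
    qed simp
  qed
qed simp

lemma corr_expand:
  "(z / 2 + w) * (e + q * r) = (e / 2) * z + (q / 2) * (z * r) + w * (e + q * r)" for z w e q r :: real
  by (simp add: algebra_simps)

text \<open>Consider a digit of axis j, a group of size s, and let y be the number of points in the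
  right half minus s / 2. The label part of the covariance is
  \<open>s / 16 - y\<^sup>2 / (4 * s) + y / 4\<close>, where y has mean 0 and variance s / 4. The
  fluctuation of the counts thus loses exactly 1/16 whatever s is, which is the constant in
  \<open>count_loss\<close>. The losses of the two subgroups carry the total weight 1/2.\<close>

lemma expect_corr:
  assumes "finite I" "S \<subseteq> I" "specs xs" "binary j xs"
  shows "expect I xs (\<lambda>ls. \<Sum>i\<in>S. (sample_pt xs ls j i (1/2) - 1/2) * target_pt xs ls S j i (1/2)) \<ge>
    center_var j xs * real (card S) - count_loss j xs * of_bool (S \<noteq> {})"
  using assms(2-)
proof (induction xs arbitrary: S)
  case (Cons x xs)
  obtain a B P where x: "x = (a, B, P)" by (cases x)
  have B: "cuts B P" and xs: "specs xs" "binary j xs"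
    using Cons.prems by (auto simp: x)
  have fin: "finite S" using Cons.prems assms finite_subset by blast
  define S' where "S' l k = {i \<in> S. l i = k}" for l :: "nat \<Rightarrow> nat" and k
  let ?g = "\<lambda>ls T. \<Sum>i\<in>T. (sample_pt xs ls j i (1/2) - 1/2) * target_pt xs ls T j i (1/2)"
  have IH: "expect I xs (\<lambda>ls. ?g ls (S' l k)) \<ge> center_var j xs * real (card (S' l k)) - count_loss j xs * of_bool (S' l k \<noteq> {})" for l k
    using Cons.prems xs by (intro Cons.IH) (auto simp: S'_def)
  have split: "(\<Sum>i\<in>S. f i) = (\<Sum>k<P. \<Sum>i\<in>S' l k. f i)" if "l \<in> PiE I (\<lambda>_. {..<P})" for f :: "nat \<Rightarrow> real" and l
    unfolding S'_def using that Cons.prems(1) by (intro sum_by_label[OF fin]) (auto dest: PiE_mem)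
  show ?case
  proof (cases "S = {}")
    case True
    then show ?thesis by (simp add: expect_const[OF assms(1) Cons.prems(2)])
  next
    case False
    have s0: "real (card S) > 0" using False fin by (simp add: card_gt_0_iff)
    show ?thesis
    proof (cases "a = j")
      case False
      have "center_var j (x # xs) * real (card S) - count_loss j (x # xs) * of_bool (S \<noteq> {}) =
         avg I B P (\<lambda>l. center_var j xs * real (card S) - real P * count_loss j xs)"
        using \<open>S \<noteq> {}\<close> False by (simp add: x avg_const[OF assms(1) B])
      also have "\<dots> \<le> avg I B P (\<lambda>l. \<Sum>k<P. expect I xs (\<lambda>ls. ?g ls (S' l k)))"
      proof (rule avg_mono[OF B])
        fix l assume l: "l \<in> PiE I (\<lambda>_. {..<P})"
        have "center_var j xs * real (card S) - real P * count_loss j xs = (\<Sum>k<P. center_var j xs * real (card (S' l k)) - count_loss j xs)"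
          using split[OF l, of "\<lambda>_. 1"] by (simp add: sum_subtractf sum_distrib_left)
        also have "\<dots> \<le> (\<Sum>k<P. expect I xs (\<lambda>ls. ?g ls (S' l k)))"
        proof (rule sum_mono)
          fix k
          show "center_var j xs * real (card (S' l k)) - count_loss j xs \<le> expect I xs (\<lambda>ls. ?g ls (S' l k))"
            using IH[of l k] count_loss_nonneg[of j xs] by (auto simp: of_bool_def split: if_splits)
        qed
        finally show "center_var j xs * real (card S) - real P * count_loss j xs \<le> (\<Sum>k<P. expect I xs (\<lambda>ls. ?g ls (S' l k)))" .
      qed
      also have "\<dots> = avg I B P (\<lambda>l. expect I xs (\<lambda>ls. \<Sum>i\<in>S. (sample_pt (x # xs) (l # ls) j i (1/2) - 1/2) * target_pt (x # xs) (l # ls) S j i (1/2)))"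
        unfolding expect_sum[symmetric]
        by (intro avg_cong expect_cong, subst split, assumption, intro sum.cong refl)
          (auto simp: x False S'_def)
      finally show ?thesis by (simp add: x)
    next
      case True
      then have h: "B = halves" "P = 2" using Cons.prems by (auto simp: x)
      let ?s = "real (card S)"
      define X where "X l = (\<Sum>i\<in>S. real (l i) - 1/2)" for l :: "nat \<Rightarrow> nat"
      have aX: "avg I B P X = 0"
        unfolding X_def avg_sum
        by (intro sum.neutral ballI, subst avg_single[OF assms(1) B])
          (use Cons.prems in \<open>auto simp: h sum_lessThan_2 halves_def\<close>)
      have aX2: "avg I B P (\<lambda>l. (X l)\<^sup>2) = ?s / 4"
        unfolding X_def by (subst avg_sum_sq[OF assms(1) B])
          (use Cons.prems in \<open>auto simp: h sum_lessThan_2 halves_def power2_eq_square\<close>)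
      have "center_var j (x # xs) * ?s - count_loss j (x # xs) * of_bool (S \<noteq> {}) =
         avg I B P (\<lambda>l. (center_var j xs * ?s / 4 - count_loss j xs / 2 + ?s / 16) - (1 / (4 * ?s)) * (X l)\<^sup>2 + 1/4 * X l)"
        unfolding avg_add avg_diff avg_cmult avg_const[OF assms(1) B] aX aX2
        using \<open>S \<noteq> {}\<close> s0 by (simp add: x True field_simps)
      also have "\<dots> \<le> avg I B P (\<lambda>l. expect I xs (\<lambda>ls. \<Sum>i\<in>S. (sample_pt (x # xs) (l # ls) j i (1/2) - 1/2) * target_pt (x # xs) (l # ls) S j i (1/2)))"
      proof (rule avg_mono[OF B])
        fix l assume l: "l \<in> PiE I (\<lambda>_. {..<P})"
        let ?e = "ecuts l S"
        let ?c = "\<lambda>k. real (card (S' l k))"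
        have e: "?e (Suc k) = ?e k + ?c k / ?s" for k
          by (simp add: ecuts_Suc[OF fin] S'_def)
        have s: "?s = ?c 0 + ?c (Suc 0)"
          using split[OF l, of "\<lambda>_. 1"] by (simp add: h sum_lessThan_2)
        have Xl: "X l = ?c (Suc 0) - ?s / 2"
        proof -
          have "(\<Sum>i\<in>S. real (l i)) = (\<Sum>k<P. \<Sum>i\<in>S' l k. real k)"
            unfolding split[OF l] by (intro sum.cong refl) (auto simp: S'_def)
          then show ?thesis by (simp add: X_def sum_subtractf h sum_lessThan_2)
        qed
        have mean: "expect I xs (\<lambda>ls. \<Sum>i\<in>S' l k. sample_pt xs ls j i (1/2) - 1/2) = 0" for k
          unfolding expect_sum using Cons.prems
          by (intro sum.neutral ballI expect_sample_pt_mean[OF assms(1) _ xs]) (auto simp: S'_def)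
        have "expect I xs (\<lambda>ls. \<Sum>i\<in>S. (sample_pt (x # xs) (l # ls) j i (1/2) - 1/2) * target_pt (x # xs) (l # ls) S j i (1/2)) =
          expect I xs (\<lambda>ls. \<Sum>k<P. (?e k / 2) * (\<Sum>i\<in>S' l k. sample_pt xs ls j i (1/2) - 1/2) +
             (?c k / ?s / 2) * ?g ls (S' l k) + (real k / 2 - 1/4) * (?c k * ?e k + (?c k / ?s) * (?c k / 2)))"
        proof (rule expect_cong)
          fix ls assume lls: "labels I xs ls"
          have cs: "(\<Sum>i\<in>S' l k. target_pt xs ls (S' l k) j i (1/2)) = ?c k / 2" for k
            using Cons.prems xs lls by (intro target_pt_center_sum[OF _ assms(1)]) (auto simp: S'_def)
          have "(\<Sum>i\<in>S. (sample_pt (x # xs) (l # ls) j i (1/2) - 1/2) * target_pt (x # xs) (l # ls) S j i (1/2)) =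
            (\<Sum>k<P. \<Sum>i\<in>S' l k. (?e k / 2) * (sample_pt xs ls j i (1/2) - 1/2) +
             (?c k / ?s / 2) * ((sample_pt xs ls j i (1/2) - 1/2) * target_pt xs ls (S' l k) j i (1/2)) +
             (real k / 2 - 1/4) * (?e k + (?c k / ?s) * target_pt xs ls (S' l k) j i (1/2)))"
            unfolding split[OF l]
          proof (intro sum.cong refl)
            fix k i assume "i \<in> S' l k"
            then have li: "l i = k" "{i' \<in> S. l i' = l i} = S' l k" by (auto simp: S'_def)
            have "sample_pt (x # xs) (l # ls) j i (1/2) - 1/2 = (sample_pt xs ls j i (1/2) - 1/2) / 2 + (real k / 2 - 1/4)"
              by (simp add: x True h cell_def halves_def li field_simps)
            moreover have "target_pt (x # xs) (l # ls) S j i (1/2) = ?e k + (?c k / ?s) * target_pt xs ls (S' l k) j i (1/2)"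
              using li by (simp add: x True cell_def e Let_def)
            ultimately show "(sample_pt (x # xs) (l # ls) j i (1/2) - 1/2) * target_pt (x # xs) (l # ls) S j i (1/2) =
              (?e k / 2) * (sample_pt xs ls j i (1/2) - 1/2) +
              (?c k / ?s / 2) * ((sample_pt xs ls j i (1/2) - 1/2) * target_pt xs ls (S' l k) j i (1/2)) +
              (real k / 2 - 1/4) * (?e k + (?c k / ?s) * target_pt xs ls (S' l k) j i (1/2))"
              by (simp only: corr_expand)
          qed
          also have "\<dots> = (\<Sum>k<P. (?e k / 2) * (\<Sum>i\<in>S' l k. sample_pt xs ls j i (1/2) - 1/2) +
             (?c k / ?s / 2) * ?g ls (S' l k) + (real k / 2 - 1/4) * (?c k * ?e k + (?c k / ?s) * (?c k / 2)))"
            unfolding sum.distrib sum_distrib_left[symmetric] cs by simp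
          finally show "(\<Sum>i\<in>S. (sample_pt (x # xs) (l # ls) j i (1/2) - 1/2) * target_pt (x # xs) (l # ls) S j i (1/2)) = \<dots>" .
        qed
        also have "\<dots> = (\<Sum>k<P. (?c k / ?s / 2) * expect I xs (\<lambda>ls. ?g ls (S' l k)) +
           (real k / 2 - 1/4) * (?c k * ?e k + (?c k / ?s) * (?c k / 2)))"
          unfolding expect_sum[of I xs _ "{..<P}"] expect_add expect_cmult mean expect_const[OF assms(1) xs(1)] by simp
        also have "\<dots> \<ge> (\<Sum>k<P. (?c k / ?s / 2) * (center_var j xs * ?c k - count_loss j xs) +
           (real k / 2 - 1/4) * (?c k * ?e k + (?c k / ?s) * (?c k / 2)))"
        proof (intro sum_mono add_right_mono)
          fix k
          show "?c k / ?s / 2 * (center_var j xs * ?c k - count_loss j xs) \<le> ?c k / ?s / 2 * expect I xs (\<lambda>ls. ?g ls (S' l k))"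
          proof (cases "S' l k = {}")
            case False
            then show ?thesis using IH[of l k] s0 by (intro mult_left_mono) auto
          qed simp
        qed
        finally have 1: "(\<Sum>k<P. (?c k / ?s / 2) * (center_var j xs * ?c k - count_loss j xs) +
           (real k / 2 - 1/4) * (?c k * ?e k + (?c k / ?s) * (?c k / 2))) \<le>
           expect I xs (\<lambda>ls. \<Sum>i\<in>S. (sample_pt (x # xs) (l # ls) j i (1/2) - 1/2) * target_pt (x # xs) (l # ls) S j i (1/2))"
          by simp
        define y where "y = X l"
        have c: "?c 0 = ?s / 2 - y" "?c (Suc 0) = ?s / 2 + y" using s Xl by (auto simp: y_def)
        have "(\<Sum>k<P. (?c k / ?s / 2) * (center_var j xs * ?c k - count_loss j xs) +
           (real k / 2 - 1/4) * (?c k * ?e k + (?c k / ?s) * (?c k / 2))) =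
           center_var j xs * (?s / 4 + y\<^sup>2 / ?s) - count_loss j xs / 2 + ?s / 16 - y\<^sup>2 / (4 * ?s) + y / 4"
          using s0 unfolding h sum_lessThan_2 e c ecuts_0 by (simp add: field_simps power2_eq_square)
        \<comment> \<open>The term \<open>center_var j xs * y\<^sup>2 / ?s\<close> is nonnegative
          and is dropped.\<close>
        also have "\<dots> \<ge> (center_var j xs * ?s / 4 - count_loss j xs / 2 + ?s / 16) - (1 / (4 * ?s)) * y\<^sup>2 + 1/4 * y"
          using s0 center_var_nonneg[of j xs] by (simp add: distrib_left)
        finally show "(center_var j xs * ?s / 4 - count_loss j xs / 2 + ?s / 16) - (1 / (4 * ?s)) * (X l)\<^sup>2 + 1/4 * X l \<le>
           expect I xs (\<lambda>ls. \<Sum>i\<in>S. (sample_pt (x # xs) (l # ls) j i (1/2) - 1/2) * target_pt (x # xs) (l # ls) S j i (1/2))"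
          using 1 unfolding y_def by linarith
      qed
      finally show ?thesis by (simp add: x)
    qed
  qed
qed simp

section \<open>Mean squared distance between points and their targets\<close>

lemma nn_integral_cube_component:
  fixes j :: "'n::finite"
  assumes "f \<in> borel_measurable borel"
  shows "(\<integral>\<^sup>+v. f (v j) \<partial>cube) = (\<integral>\<^sup>+t. f t \<partial>unif)"
proof -
  have "distr cube unif (\<lambda>v :: 'n \<Rightarrow> real. v j) = unif"
    unfolding cube_def by (rule distr_PiM_component) auto
  moreover have "(\<integral>\<^sup>+t. f t \<partial>distr cube unif (\<lambda>v :: 'n \<Rightarrow> real. v j)) = (\<integral>\<^sup>+v. f (v j) \<partial>cube)"
    using assms by (intro nn_integral_distr) (auto cong: measurable_cong_sets)
  ultimately show ?thesis by simp
qed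

lemma nn_integral_unif_FTC:
  assumes "\<And>x. 0 \<le> x \<Longrightarrow> x \<le> 1 \<Longrightarrow> DERIV F x :> f x" "\<And>x. 0 \<le> x \<Longrightarrow> x \<le> 1 \<Longrightarrow> 0 \<le> f x"
    and [measurable]: "f \<in> borel_measurable borel"
  shows "(\<integral>\<^sup>+t. ennreal (f t) \<partial>unif) = ennreal (F 1 - F 0)"
proof -
  have "(\<integral>\<^sup>+t. ennreal (f t) \<partial>unif) = (\<integral>\<^sup>+t. ennreal (f t) * indicator {0<..<1} t \<partial>lborel)"
    by (intro nn_integral_unif) simp
  also have "\<dots> = (\<integral>\<^sup>+t. ennreal (f t) * indicator {0..1} t \<partial>lborel)"
    using AE_lborel_singleton[of 0] AE_lborel_singleton[of 1]
    by (intro nn_integral_cong_AE) (auto elim!: eventually_elim2 simp: indicator_def)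
  also have "\<dots> = ennreal (F 1 - F 0)"
    by (intro nn_integral_FTC_Icc) (use assms in \<open>auto intro: has_field_derivative_at_within\<close>)
  finally show ?thesis .
qed

lemma nn_integral_cube_affine_sq:
  "(\<integral>\<^sup>+v. ennreal ((p + q * v j)\<^sup>2) \<partial>cube) = ennreal (p\<^sup>2 + p * q + q\<^sup>2 / 3)" for j :: "'n::finite"
proof -
  have "(\<integral>\<^sup>+t. ennreal ((p + q * t)\<^sup>2) \<partial>unif) =
     ennreal ((\<lambda>t. p\<^sup>2 * t + p * q * t\<^sup>2 + q\<^sup>2 * t ^ 3 / 3) 1 - (\<lambda>t. p\<^sup>2 * t + p * q * t\<^sup>2 + q\<^sup>2 * t ^ 3 / 3) 0)"
  proof (rule nn_integral_unif_FTC)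
    show "DERIV (\<lambda>t. p\<^sup>2 * t + p * q * t\<^sup>2 + q\<^sup>2 * t ^ 3 / 3) x :> (p + q * x)\<^sup>2" for x
      by (auto intro!: derivative_eq_intros simp: power2_eq_square power3_eq_cube algebra_simps)
  qed auto
  then show ?thesis by (subst nn_integral_cube_component) auto
qed

lemma target_pt_affine: "\<exists>p q. \<forall>t. target_pt xs ls S j i t = p + q * t"
proof (induction xs arbitrary: ls S)
  case Nil
  have "\<forall>t. target_pt [] ls S j i t = 0 + 1 * t" by simp
  then show ?case by blast
next
  case (Cons x xs ls0)
  obtain a B P where x: "x = (a, B, P)" by (cases x)
  show ?case
  proof (cases ls0)
    case Nil
    have "\<forall>t. target_pt (x # xs) ls0 S j i t = 0 + 1 * t" by (simp add: Nil)
    then show ?thesis by blast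
  next
    case (Cons l ls)
    obtain p q where *: "\<And>t. target_pt xs ls {i' \<in> S. l i' = l i} j i t = p + q * t"
      using Cons.IH by blast
    show ?thesis
    proof (cases "a = j")
      case True
      show ?thesis
        by (rule exI[of _ "ecuts l S (l i) + (ecuts l S (Suc (l i)) - ecuts l S (l i)) * p"],
            rule exI[of _ "(ecuts l S (Suc (l i)) - ecuts l S (l i)) * q"])
           (simp add: x Cons True Let_def * cell_def algebra_simps)
    next
      case False
      then have "\<forall>t. target_pt (x # xs) ls0 S j i t = p + q * t" by (simp add: x Cons *)
      then show ?thesis by blast
    qed
  qed
qed

text \<open>The square is expanded around 1/2. By uniformity the targets of the group have total
  first moment \<open>card S / 2\<close> and second moment \<open>card S / 3\<close>, hence spread
  \<open>card S / 12\<close>. What depends on the coupling is only the correlation of z with the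
  target centres. The second claim lets the real expression pass through
  \<open>ennreal\<close>.\<close>

lemma target_pt_dev_sum:
  fixes j :: "'n::finite"
  assumes "finite I" "S \<subseteq> I" "binary j xs" "labels I xs ls"
  shows "(\<Sum>i\<in>S. \<integral>\<^sup>+v. ennreal ((z i - target_pt xs ls S j i (v j))\<^sup>2) \<partial>cube) =
    ennreal ((\<Sum>i\<in>S. (z i - 1/2)\<^sup>2) + (\<Sum>i\<in>S. z i - 1/2) - 2 * (\<Sum>i\<in>S. (z i - 1/2) * target_pt xs ls S j i (1/2)) +
      real (card S) / 12)" (is "_ = ennreal ?V")
    and "0 \<le> (\<Sum>i\<in>S. (z i - 1/2)\<^sup>2) + (\<Sum>i\<in>S. z i - 1/2) - 2 * (\<Sum>i\<in>S. (z i - 1/2) * target_pt xs ls S j i (1/2)) +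
      real (card S) / 12"
proof -
  have fin: "finite S" using assms finite_subset by blast
  have "\<forall>i. \<exists>p q. \<forall>t. target_pt xs ls S j i t = p + q * t" by (intro allI target_pt_affine)
  then obtain p q where pq: "\<And>i t. target_pt xs ls S j i t = p i + q i * t" by metis
  have nonneg: "0 \<le> a\<^sup>2 + a * b + b\<^sup>2 / 3" for a b :: real
  proof -
    have "a\<^sup>2 + a * b + b\<^sup>2 / 3 = (a + b / 2)\<^sup>2 + b\<^sup>2 / 12" by (simp add: power2_eq_square algebra_simps)
    then show ?thesis by simp
  qed
  have valid: "list_all2 (\<lambda>(a, B, P) l. \<forall>i\<in>S. l i < P) xs ls"
    using assms(4) unfolding labels_def
    by (rule list_all2_mono) (use assms(2) in \<open>auto dest!: PiE_mem\<close>)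
  have "(\<Sum>i\<in>S. \<integral>\<^sup>+v. ennreal ((target_pt xs ls S j i (v j))\<^sup>2) \<partial>cube) = of_nat (card S) * (\<integral>\<^sup>+v. ennreal ((v j)\<^sup>2) \<partial>(cube :: ('n \<Rightarrow> real) measure))"
    using target_pt_marginal[OF valid fin, of "\<lambda>v. ennreal ((v j)\<^sup>2)"] by simp
  also have "(\<integral>\<^sup>+v. ennreal ((v j)\<^sup>2) \<partial>(cube :: ('n \<Rightarrow> real) measure)) = ennreal (1/3)"
    using nn_integral_cube_affine_sq[of 0 1 j] by simp
  finally have "ennreal (\<Sum>i\<in>S. (p i)\<^sup>2 + p i * q i + (q i)\<^sup>2 / 3) = ennreal (real (card S) * (1/3))"
    unfolding pq nn_integral_cube_affine_sq
    by (subst (asm) sum_ennreal) (auto simp: nonneg ennreal_of_nat_eq_real_of_nat simp flip: ennreal_mult)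
  then have sq: "(\<Sum>i\<in>S. (p i)\<^sup>2 + p i * q i + (q i)\<^sup>2 / 3) = real (card S) / 3"
    by (subst (asm) ennreal_inj) (auto intro!: sum_nonneg nonneg)
  have ctr: "(\<Sum>i\<in>S. p i + q i / 2) = real (card S) / 2"
    using target_pt_center_sum[OF assms(2,1,3,4)] unfolding pq by simp
  have *: "(\<integral>\<^sup>+v. ennreal ((z i - (p i + q i * v j))\<^sup>2) \<partial>(cube :: ('n \<Rightarrow> real) measure)) =
     ennreal ((z i - p i)\<^sup>2 + (z i - p i) * (- q i) + (- q i)\<^sup>2 / 3)" for i
    using nn_integral_cube_affine_sq[of "z i - p i" "- q i" j] by (simp add: diff_diff_eq)
  let ?D = "\<Sum>i\<in>S. (z i - p i)\<^sup>2 + (z i - p i) * (- q i) + (- q i)\<^sup>2 / 3"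
  have 1: "(\<Sum>i\<in>S. \<integral>\<^sup>+v. ennreal ((z i - target_pt xs ls S j i (v j))\<^sup>2) \<partial>cube) = ennreal ?D"
    unfolding pq * by (rule sum_ennreal) (rule nonneg)
  define A C where "A i = (p i)\<^sup>2 + p i * q i + (q i)\<^sup>2 / 3" and "C i = p i + q i / 2" for i
  have "?D = (\<Sum>i\<in>S. (z i - 1/2)\<^sup>2 + (z i - 1/2) - 2 * ((z i - 1/2) * C i) + A i - C i + 1/4)"
    by (intro sum.cong refl) (simp add: A_def C_def power2_eq_square algebra_simps)
  also have "\<dots> = (\<Sum>i\<in>S. (z i - 1/2)\<^sup>2) + (\<Sum>i\<in>S. z i - 1/2) - 2 * (\<Sum>i\<in>S. (z i - 1/2) * C i) +
      (\<Sum>i\<in>S. A i) - (\<Sum>i\<in>S. C i) + real (card S) / 4"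
    by (simp add: sum.distrib sum_subtractf flip: sum_distrib_left)
  also have "\<dots> = ?V" using sq ctr by (simp add: A_def C_def pq)
  finally have D: "?D = ?V" .
  show "(\<Sum>i\<in>S. \<integral>\<^sup>+v. ennreal ((z i - target_pt xs ls S j i (v j))\<^sup>2) \<partial>cube) = ennreal ?V"
    using 1 unfolding D .
  have "0 \<le> ?D" by (rule sum_nonneg) (rule nonneg)
  then show "0 \<le> ?V" unfolding D .
qed

text \<open>The variance of the sample centre enters once and its covariance with the target twice,
  with a minus sign. What remains is \<open>1/12 - center_var\<close>, the variance of a uniform
  position inside the final cell, plus twice the covariance loss.\<close>

lemma nexpect_fine:
  fixes j :: "'n::finite"
  assumes "finite I" "S \<subseteq> I" "specs xs" "binary j xs"
  shows "nexpect I xs (\<lambda>ls. \<Sum>i\<in>S. \<integral>\<^sup>+v. ennreal ((sample_pt xs ls j i (1/2) - target_pt xs ls S j i (v j))\<^sup>2) \<partial>cube) \<le>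
    ennreal (real (card S) * (1/12 - center_var j xs) + 2 * count_loss j xs * of_bool (S \<noteq> {}))"
proof -
  let ?z = "\<lambda>ls i. sample_pt xs ls j i (1/2) - 1/2"
  let ?V = "\<lambda>ls. (\<Sum>i\<in>S. (?z ls i)\<^sup>2) + (\<Sum>i\<in>S. ?z ls i) - 2 * (\<Sum>i\<in>S. ?z ls i * target_pt xs ls S j i (1/2)) +
      real (card S) / 12"
  have fin: "finite S" using assms finite_subset by blast
  have "nexpect I xs (\<lambda>ls. \<Sum>i\<in>S. \<integral>\<^sup>+v. ennreal ((sample_pt xs ls j i (1/2) - target_pt xs ls S j i (v j))\<^sup>2) \<partial>cube) =
     nexpect I xs (\<lambda>ls. ennreal (?V ls))"
    by (intro antisym nexpect_mono) (simp_all add: target_pt_dev_sum[OF assms(1,2,4)])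
  also have "\<dots> = ennreal (expect I xs ?V)"
    by (intro nexpect_ennreal assms(3) target_pt_dev_sum(2)[OF assms(1,2,4)])
  also have "expect I xs ?V = expect I xs (\<lambda>ls. \<Sum>i\<in>S. (?z ls i)\<^sup>2) + expect I xs (\<lambda>ls. \<Sum>i\<in>S. ?z ls i) -
      2 * expect I xs (\<lambda>ls. \<Sum>i\<in>S. ?z ls i * target_pt xs ls S j i (1/2)) + real (card S) / 12"
    by (simp only: expect_add expect_diff expect_cmult expect_const[OF assms(1,3)])
  also have "expect I xs (\<lambda>ls. \<Sum>i\<in>S. (?z ls i)\<^sup>2) = real (card S) * center_var j xs"
    unfolding expect_sum using assms(2) by (simp add: expect_sample_pt_var[OF assms(1) _ assms(3,4)] subset_iff)
  also have "expect I xs (\<lambda>ls. \<Sum>i\<in>S. ?z ls i) = 0"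
    unfolding expect_sum using assms(2) expect_sample_pt_mean[OF assms(1) _ assms(3,4)] by (intro sum.neutral) auto
  also have "real (card S) * center_var j xs + 0 - 2 * expect I xs (\<lambda>ls. \<Sum>i\<in>S. ?z ls i * target_pt xs ls S j i (1/2)) + real (card S) / 12
     \<le> real (card S) * (1/12 - center_var j xs) + 2 * count_loss j xs * of_bool (S \<noteq> {})"
    using expect_corr[OF assms] by (simp add: algebra_simps)
  finally show ?thesis by (simp add: ennreal_leI)
qed

section \<open>The reference quantile\<close>

text \<open>Up to constants, the distance from the centre at which a Gaussian tail has mass w. The
  summand 1 keeps it at least 1 on (0,1], so that it can be divided by.\<close>

definition tail_root :: "real \<Rightarrow> real" where
  "tail_root w = sqrt (1 - ln w)"

definition ref_quant :: "real \<Rightarrow> real" where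
  "ref_quant u = tail_root (1 - u) - tail_root u"

text \<open>The price of squared logarithms near the ends of a cell, as a function of the relative
  position z. Its integral over the unit interval is 4.\<close>

definition end_weight :: "real \<Rightarrow> real" where
  "end_weight z = 1 / sqrt z + 1 / sqrt (1 - z)"

text \<open>With t the square of x this reads \<open>2 * ln x \<le> x - 1 / x\<close>, and the
  difference of the two sides has derivative \<open>(1 - 1 / x)\<^sup>2\<close>. Values below 1
  follow by inversion.\<close>

lemma abs_ln_le: "0 < t \<Longrightarrow> \<bar>ln t\<bar> \<le> \<bar>t - 1\<bar> / sqrt t" for t :: real
proof -
  assume t: "0 < t"
  have *: "ln s \<le> (s - 1) / sqrt s" if "1 \<le> s" for s :: real
  proof -
    define h where "h = (\<lambda>x::real. x - 1 / x - 2 * ln x)"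
    have "h 1 \<le> h (sqrt s)"
    proof (rule DERIV_nonneg_imp_nondecreasing[where f = h])
      fix x assume x: "1 \<le> x" "x \<le> sqrt s"
      have "DERIV h x :> 1 + 1 / x\<^sup>2 - 2 / x"
        unfolding h_def using x by (auto intro!: derivative_eq_intros simp: power2_eq_square)
      moreover have "1 + 1 / x\<^sup>2 - 2 / x = (1 - 1 / x)\<^sup>2" using x by (simp add: power2_eq_square field_simps)
      ultimately show "\<exists>y. DERIV h x :> y \<and> y \<ge> 0" by auto
    qed (use that in auto)
    then have "2 * ln (sqrt s) \<le> sqrt s - 1 / sqrt s" by (simp add: h_def)
    moreover have "2 * ln (sqrt s) = ln s" using that by (simp add: ln_sqrt)
    moreover have "sqrt s - 1 / sqrt s = (s - 1) / sqrt s" using that by (simp add: field_simps)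
    ultimately show ?thesis by simp
  qed
  show ?thesis
  proof (cases "1 \<le> t")
    case False
    have "1 \<le> 1 / t" using False t by simp
    from *[OF this] have "- ln t \<le> (1 / t - 1) / sqrt (1 / t)" using t by (simp add: ln_div)
    also have "\<dots> = (1 - t) / sqrt t"
      using t by (simp add: real_sqrt_divide field_simps)
    finally show ?thesis using False t by simp
  qed (use * in auto)
qed

lemma ln_sq_le:
  assumes "0 < t"
  shows "(ln t)\<^sup>2 \<le> 4 * (sqrt t - 1)\<^sup>2 / sqrt t"
proof -
  have "\<bar>ln t\<bar> = 2 * \<bar>ln (sqrt t)\<bar>" using assms by (simp add: ln_sqrt)
  also have "\<dots> \<le> 2 * (\<bar>sqrt t - 1\<bar> / sqrt (sqrt t))"
    using abs_ln_le[of "sqrt t"] assms by simp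
  finally have "\<bar>ln t\<bar>\<^sup>2 \<le> (2 * (\<bar>sqrt t - 1\<bar> / sqrt (sqrt t)))\<^sup>2" by (intro power_mono) auto
  then show ?thesis using assms by (simp add: power_mult_distrib power_divide)
qed

text \<open>Here x is the ratio of an empirical to a true tail mass and t the ratio of the
  corresponding points in these tails. The hypothesis \<open>lam * x \<le> t\<close> limits how far
  t can drop below x and costs \<open>1 / sqrt lam\<close>. For x up to 4 the estimate of
  \<open>(ln t)\<^sup>2\<close> near 1 suffices; for larger x one of the squares on the right
  dominates.\<close>

lemma x_ln_sq_le:
  assumes "0 < x" "0 < t" "0 < lam" "lam \<le> 1" "lam * x \<le> t"
  shows "x * (ln t)\<^sup>2 \<le> 16 * ((t - 1)\<^sup>2 + (x - 1)\<^sup>2) / sqrt lam"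
proof -
  define s where "s = sqrt t"
  define y where "y = sqrt x"
  define m where "m = sqrt lam"
  have pos: "0 < s" "0 < y" "0 < m" "m \<le> 1" using assms by (auto simp: s_def y_def m_def)
  have sq: "t = s\<^sup>2" "x = y\<^sup>2" "lam = m\<^sup>2" using assms by (auto simp: s_def y_def m_def)
  have ms: "m * y \<le> s" using assms(5) pos unfolding sq
    by (simp add: power_mult_distrib[symmetric] power_mono_iff)
  have ln: "(ln t)\<^sup>2 \<le> 4 * (s - 1)\<^sup>2 / s" using ln_sq_le[OF assms(2)] by (simp add: s_def)
  have t1: "(t - 1)\<^sup>2 = (s - 1)\<^sup>2 * (s + 1)\<^sup>2" unfolding sq by (simp add: power2_eq_square algebra_simps)
  show ?thesis
  proof (cases "y \<le> 2")
    case True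
    have "x * (ln t)\<^sup>2 \<le> y\<^sup>2 * (4 * (s - 1)\<^sup>2 / s)" unfolding sq(2) using ln by (intro mult_left_mono) auto
    also have "\<dots> \<le> y\<^sup>2 * (4 * (t - 1)\<^sup>2 / (m * y))"
    proof (rule mult_left_mono[OF frac_le])
      have "1 \<le> (s + 1)\<^sup>2" using pos by simp
      then show "4 * (s - 1)\<^sup>2 \<le> 4 * (t - 1)\<^sup>2" unfolding t1 by (simp add: mult_le_cancel_left1)
    qed (use ms pos in auto)
    also have "\<dots> = 4 * y * (t - 1)\<^sup>2 / m" using pos by (simp add: power2_eq_square field_simps)
    also have "\<dots> \<le> 16 * ((t - 1)\<^sup>2 + (x - 1)\<^sup>2) / m"
    proof (intro divide_right_mono)
      have "4 * y * (t - 1)\<^sup>2 \<le> 16 * (t - 1)\<^sup>2" using True by (intro mult_right_mono) auto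
      then show "4 * y * (t - 1)\<^sup>2 \<le> 16 * ((t - 1)\<^sup>2 + (x - 1)\<^sup>2)" by (simp add: add_increasing2)
    qed (use pos in auto)
    finally show ?thesis by (simp add: m_def)
  next
    case False
    have big: "z ^ 3 \<le> 2 * (z\<^sup>2 - 1)\<^sup>2" if "2 \<le> z" for z :: real
    proof -
      have "z ^ 3 \<le> z ^ 4 / 2" using that by (simp add: power3_eq_cube power4_eq_xxxx)
      moreover have "4 * z\<^sup>2 \<le> z\<^sup>2 * z\<^sup>2" using that by (intro mult_right_mono power_mono[of 2 z 2, simplified]) auto
      moreover have "2 * (z\<^sup>2 - 1)\<^sup>2 = 2 * z ^ 4 - 4 * z\<^sup>2 + 2" by (simp add: power2_eq_square power4_eq_xxxx algebra_simps)
      moreover have "0 \<le> z ^ 3" using that by simp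
      moreover have "z\<^sup>2 * z\<^sup>2 = z ^ 4" by (simp add: power2_eq_square power4_eq_xxxx)
      ultimately show ?thesis by linarith
    qed
    have s1: "(s - 1)\<^sup>2 / s \<le> s + 1 / s"
      using pos by (simp add: power2_eq_square field_simps)
    show ?thesis
    proof (cases "y \<le> s")
      case True
      have "x * (ln t)\<^sup>2 \<le> s\<^sup>2 * (4 * (s + 1 / s))"
        unfolding sq(2) using ln s1 True pos by (intro mult_mono power_mono) auto
      also have "\<dots> = 4 * (s ^ 3 + s)" using pos by (simp add: power2_eq_square power3_eq_cube field_simps)
      also have "\<dots> \<le> 8 * s ^ 3"
        using True False power_increasing[of 1 3 s] by simp
      also have "\<dots> \<le> 16 * (t - 1)\<^sup>2" unfolding sq using big[of s] True False by simp
      also have "\<dots> \<le> 16 * ((t - 1)\<^sup>2 + (x - 1)\<^sup>2)" by simp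
      also have "\<dots> \<le> 16 * ((t - 1)\<^sup>2 + (x - 1)\<^sup>2) / m"
        using pos by (simp add: le_divide_eq mult_left_le)
      finally show ?thesis by (simp add: m_def)
    next
      case ys: False
      have "s + 1 / s \<le> y + 1 / (m * y)" using ys ms pos by (intro add_mono frac_le) auto
      also have "\<dots> \<le> 2 * y / m"
      proof -
        have "y \<le> y / m" using pos by (simp add: le_divide_eq mult_left_le)
        moreover have "1 / (m * y) \<le> y / m"
        proof -
          have "1 / y \<le> y" using False by (simp add: divide_le_eq) (smt (verit) mult_le_cancel_left1)
          then have "(1 / y) / m \<le> y / m" using pos by (intro divide_right_mono) auto
          then show ?thesis by (simp add: mult.commute)
        qed
        ultimately show ?thesis by (simp add: add_divide_distrib[symmetric])
      qed
      finally have "x * (ln t)\<^sup>2 \<le> y\<^sup>2 * (4 * (2 * y / m))"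
        unfolding sq(2) using ln s1 by (intro mult_left_mono) auto
      also have "\<dots> = 8 * y ^ 3 / m" by (simp add: power2_eq_square power3_eq_cube)
      also have "\<dots> \<le> 16 * (x - 1)\<^sup>2 / m"
        unfolding sq(2) using big[of y] False pos by (intro divide_right_mono) auto
      also have "\<dots> \<le> 16 * ((t - 1)\<^sup>2 + (x - 1)\<^sup>2) / m" using pos by (intro divide_right_mono) auto
      finally show ?thesis by (simp add: m_def)
    qed
  qed
qed

lemma tail_root_ge_1: "0 < w \<Longrightarrow> w \<le> 1 \<Longrightarrow> 1 \<le> tail_root w"
  by (simp add: tail_root_def)

lemma tail_root_antimono: "0 < w \<Longrightarrow> w \<le> q \<Longrightarrow> tail_root q \<le> tail_root w"
  by (simp add: tail_root_def)

text \<open>Difference of squares: the squares of the two roots differ by a difference of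
  logarithms, and the sum of the roots is at least \<open>tail_root q\<close>. The point v may lie
  anywhere in (0,1], as an empirical position can.\<close>

lemma tail_root_diff_le:
  assumes "0 < w" "w \<le> q" "q \<le> 1" "0 < v" "v \<le> 1"
  shows "\<bar>tail_root w - tail_root v\<bar> \<le> \<bar>ln w - ln v\<bar> / tail_root q"
proof -
  have g: "1 \<le> tail_root w" "1 \<le> tail_root v" "1 \<le> tail_root q" "tail_root q \<le> tail_root w"
    using assms by (auto intro!: tail_root_ge_1 tail_root_antimono)
  have "(tail_root w - tail_root v) * (tail_root w + tail_root v) = ln v - ln w"
  proof -
    have "ln w \<le> 0" "ln v \<le> 0" using assms by auto
    then show ?thesis by (simp add: tail_root_def algebra_simps)
  qed
  then have "\<bar>tail_root w - tail_root v\<bar> * (tail_root w + tail_root v) = \<bar>ln w - ln v\<bar>"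
    using g by (metis abs_minus_commute abs_mult abs_of_nonneg add_nonneg_nonneg zero_le_one order_trans)
  moreover have "\<bar>tail_root w - tail_root v\<bar> * tail_root q \<le> \<bar>tail_root w - tail_root v\<bar> * (tail_root w + tail_root v)"
    using g by (intro mult_left_mono) auto
  ultimately show ?thesis using g by (simp add: le_divide_eq)
qed

lemma tail_root_lipschitz:
  assumes "0 < r" "r \<le> w" "w \<le> q" "q \<le> 1" "r \<le> v" "v \<le> q"
  shows "\<bar>tail_root w - tail_root v\<bar> \<le> \<bar>w - v\<bar> / (r * tail_root q)"
proof -
  have ln: "\<bar>ln w - ln v\<bar> \<le> \<bar>w - v\<bar> / r"
  proof -
    have *: "ln x - ln y \<le> (x - y) / r" if "r \<le> y" "y \<le> x" for x y
    proof -
      have "ln x - ln y = ln (x / y)" using that assms(1) by (simp add: ln_div)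
      also have "\<dots> \<le> x / y - 1" using that assms(1) by (intro ln_le_minus_one) auto
      also have "\<dots> = (x - y) / y" using that assms(1) by (simp add: field_simps)
      also have "\<dots> \<le> (x - y) / r" using that assms(1) by (intro divide_left_mono) auto
      finally show ?thesis .
    qed
    show ?thesis
      using *[of v w] *[of w v] assms by (cases "v \<le> w") (auto simp: abs_if)
  qed
  have "\<bar>tail_root w - tail_root v\<bar> \<le> \<bar>ln w - ln v\<bar> / tail_root q" using assms by (intro tail_root_diff_le) auto
  also have "\<dots> \<le> \<bar>w - v\<bar> / r / tail_root q"
    using tail_root_ge_1[of q] assms ln by (intro divide_right_mono) auto
  finally show ?thesis by (simp add: divide_simps)
qed

text \<open>Within an end cell of tail mass q the oscillation is controlled by the relative position
  alone, uniformly in how far out the cell lies.\<close>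

lemma tail_root_tail:
  assumes "0 < q" "q \<le> 1" "0 < lam" "lam \<le> 1"
  shows "(tail_root (q * lam) - tail_root q)\<^sup>2 \<le> 16 / sqrt lam"
proof -
  have "\<bar>tail_root (q * lam) - tail_root q\<bar> \<le> \<bar>ln (q * lam) - ln q\<bar> / tail_root q"
    using assms by (intro tail_root_diff_le) (auto simp: mult_le_one mult_left_le)
  also have "\<dots> \<le> \<bar>ln (q * lam) - ln q\<bar> / 1" using tail_root_ge_1[of q] assms by (intro divide_left_mono) auto
  also have "\<bar>ln (q * lam) - ln q\<bar> = \<bar>ln lam\<bar>" using assms by (simp add: ln_mult)
  finally have "\<bar>tail_root (q * lam) - tail_root q\<bar>\<^sup>2 \<le> \<bar>ln lam\<bar>\<^sup>2" by (intro power_mono) auto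
  also have "\<dots> \<le> 4 * (sqrt lam - 1)\<^sup>2 / sqrt lam" using ln_sq_le[OF assms(3)] by simp
  also have "\<dots> \<le> 16 / sqrt lam"
  proof (intro divide_right_mono)
    have "(sqrt lam - 1)\<^sup>2 \<le> 1" using assms by (simp add: abs_square_le_1 abs_le_iff)
    then show "4 * (sqrt lam - 1)\<^sup>2 \<le> 16" by simp
  qed (use assms in auto)
  finally show ?thesis by simp
qed

text \<open>The true cell, seen from its tail, runs from r to q, the empirical one from r' to q',
  and lam is a relative position. Errors are measured relative to tail masses. In a bounded cell q
  and r are comparable through c. In an end cell r = 0 forces r' = 0, so the ratios t and x agree,
  and the quotient by r has the value 0.\<close>

lemma tail_root_transport:
  assumes "0 \<le> r" "r < q" "q \<le> 1" "r = 0 \<or> q \<le> c * r" "1 \<le> c"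
    and "0 \<le> r'" "r' < q'" "q' \<le> 1" "r = 0 \<Longrightarrow> r' = 0" and lam: "0 < lam" "lam < 1"
  shows "(q' - r') * (tail_root (r + (q - r) * lam) - tail_root (r' + (q' - r') * lam))\<^sup>2 \<le>
    48 * c\<^sup>2 * ((q' - q)\<^sup>2 / q + (r' - r)\<^sup>2 / r) / (tail_root q)\<^sup>2 / sqrt lam"
proof -
  define w where "w = r + (q - r) * lam"
  define w' where "w' = r' + (q' - r') * lam"
  define x where "x = q' / q"
  define t where "t = w' / w"
  define E where "E = (q' - q)\<^sup>2 / q + (r' - r)\<^sup>2 / r"
  have q: "0 < q" "0 < q'" using assms by auto
  have lamq: "lam * q \<le> w" "lam * q' \<le> w'"
    using assms by (auto simp: w_def w'_def algebra_simps mult_right_le_one_le mult_left_le_one_le)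
  have w: "0 < w" "w \<le> q" "0 < w'" "w' \<le> q'"
  proof -
    show "0 < w" "0 < w'" using lamq q lam by (auto intro: less_le_trans[OF mult_pos_pos])
    have "(q - r) * lam \<le> (q - r) * 1" "(q' - r') * lam \<le> (q' - r') * 1"
      using assms by (auto intro!: mult_left_mono)
    then show "w \<le> q" "w' \<le> q'" by (auto simp: w_def w'_def)
  qed
  have E1: "q * (x - 1)\<^sup>2 \<le> E"
  proof -
    have "q * (x - 1)\<^sup>2 = (q' - q)\<^sup>2 / q" using q by (simp add: x_def power2_eq_square field_simps)
    then show ?thesis using assms by (simp add: E_def)
  qed
  have E2: "q * (t - 1)\<^sup>2 \<le> 2 * c\<^sup>2 * E"
  proof (cases "r = 0")
    case True
    then have "t = x" using assms lam by (simp add: t_def w_def w'_def x_def)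
    moreover have "1 * E \<le> 2 * c\<^sup>2 * E"
      using assms(5) E1 q by (intro mult_right_mono) (auto simp: power2_eq_square intro: order_trans[OF _ E1] mult_ge1_I)
    ultimately show ?thesis using E1 by simp
  next
    case False
    then have r: "0 < r" "q \<le> c * r" using assms by auto
    have wr: "q \<le> c * w" using r assms(1,2,5) lam unfolding w_def
      by (smt (verit) mult_nonneg_nonneg mult_left_mono)
    have "\<bar>t - 1\<bar> = \<bar>w' - w\<bar> / w" using w by (simp add: t_def field_simps)
    also have "w' - w = (1 - lam) * (r' - r) + lam * (q' - q)" by (simp add: w_def w'_def algebra_simps)
    also have "\<bar>(1 - lam) * (r' - r) + lam * (q' - q)\<bar> \<le> \<bar>r' - r\<bar> + \<bar>q' - q\<bar>"
      using lam by (intro order_trans[OF abs_triangle_ineq] add_mono) (auto simp: abs_mult intro!: mult_left_le_one_le)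
    also have "(\<bar>r' - r\<bar> + \<bar>q' - q\<bar>) / w \<le> (\<bar>r' - r\<bar> + \<bar>q' - q\<bar>) / (q / c)"
      using wr q assms(5) w by (intro divide_left_mono) (auto simp: field_simps)
    finally have "\<bar>t - 1\<bar>\<^sup>2 \<le> (c / q * (\<bar>r' - r\<bar> + \<bar>q' - q\<bar>))\<^sup>2"
      using w by (intro power_mono) (auto simp: divide_right_mono field_simps)
    also have "\<dots> = c\<^sup>2 / q\<^sup>2 * (\<bar>r' - r\<bar> + \<bar>q' - q\<bar>)\<^sup>2" by (simp add: power_mult_distrib power_divide)
    also have "\<dots> \<le> c\<^sup>2 / q\<^sup>2 * (2 * ((r' - r)\<^sup>2 + (q' - q)\<^sup>2))"
      using sum_squares_bound[of "\<bar>r' - r\<bar>" "\<bar>q' - q\<bar>"] by (intro mult_left_mono) (auto simp: power2_sum)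
    finally have "q * (t - 1)\<^sup>2 \<le> q * (c\<^sup>2 / q\<^sup>2 * (2 * ((r' - r)\<^sup>2 + (q' - q)\<^sup>2)))"
      using q by (intro mult_left_mono) auto
    also have "\<dots> = 2 * c\<^sup>2 * ((q' - q)\<^sup>2 / q + (r' - r)\<^sup>2 / q)" using q by (simp add: power2_eq_square field_simps)
    also have "\<dots> \<le> 2 * c\<^sup>2 * E"
      unfolding E_def using r assms by (intro mult_left_mono add_mono divide_left_mono) auto
    finally show ?thesis .
  qed
  have "0 \<le> E" using E1 q by (smt (verit) mult_nonneg_nonneg zero_le_power2)
  have t: "0 < t" "lam * x \<le> t"
  proof -
    show "0 < t" using w by (simp add: t_def)
    have "lam * q' / q \<le> w' / w" using lamq w q lam by (intro frac_le) auto
    then show "lam * x \<le> t" by (simp add: t_def x_def)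
  qed
  have x: "0 < x" using q by (simp add: x_def)
  have "(tail_root w - tail_root w')\<^sup>2 \<le> (\<bar>ln w - ln w'\<bar> / tail_root q)\<^sup>2"
    using power_mono[OF tail_root_diff_le[of w q w'] abs_ge_zero, of 2] w assms by simp
  also have "ln w - ln w' = - ln t" using w by (simp add: t_def ln_div)
  finally have g: "(tail_root w - tail_root w')\<^sup>2 \<le> (ln t)\<^sup>2 / (tail_root q)\<^sup>2" by (simp add: power_divide)
  \<comment> \<open>The empirical cell has mass at most \<open>q' = q * x\<close>, which supplies
    the factor x of \<open>x_ln_sq_le\<close>.\<close>
  have "(q' - r') * (tail_root w - tail_root w')\<^sup>2 \<le> (q * x) * ((ln t)\<^sup>2 / (tail_root q)\<^sup>2)"
    using g assms q by (intro mult_mono) (auto simp: x_def)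
  also have "\<dots> = q * (x * (ln t)\<^sup>2) / (tail_root q)\<^sup>2" by simp
  also have "\<dots> \<le> q * (16 * ((t - 1)\<^sup>2 + (x - 1)\<^sup>2) / sqrt lam) / (tail_root q)\<^sup>2"
    using x_ln_sq_le[of x t lam] x t lam q by (intro divide_right_mono mult_left_mono) auto
  also have "\<dots> = 16 * (q * (t - 1)\<^sup>2 + q * (x - 1)\<^sup>2) / (tail_root q)\<^sup>2 / sqrt lam"
    by (simp add: field_simps)
  also have "\<dots> \<le> 16 * (3 * c\<^sup>2 * E) / (tail_root q)\<^sup>2 / sqrt lam"
  proof (intro divide_right_mono mult_left_mono)
    have "1 * E \<le> c\<^sup>2 * E" using assms(5) \<open>0 \<le> E\<close> by (intro mult_right_mono) auto
    then show "q * (t - 1)\<^sup>2 + q * (x - 1)\<^sup>2 \<le> 3 * c\<^sup>2 * E" using E1 E2 by simp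
  qed (use lam in auto)
  finally show ?thesis by (simp add: w_def w'_def E_def)
qed

lemma end_weight_ge: "0 < z \<Longrightarrow> z < 1 \<Longrightarrow> 1 \<le> end_weight z"
proof -
  assume z: "0 < z" "z < 1"
  have "1 \<le> 1 / sqrt z" using z by simp
  moreover have "0 \<le> 1 / sqrt (1 - z)" using z by simp
  ultimately show ?thesis unfolding end_weight_def by linarith
qed

lemma nn_integral_unif_reflect:
  assumes [measurable]: "f \<in> borel_measurable borel"
  shows "(\<integral>\<^sup>+t. f (1 - t) \<partial>unif) = (\<integral>\<^sup>+t. f t \<partial>unif)"
proof -
  have "(\<integral>\<^sup>+t. f t \<partial>unif) = (\<integral>\<^sup>+t. f t * indicator {0<..<1} t \<partial>lborel)"
    by (rule nn_integral_unif) simp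
  also have "\<dots> = (\<integral>\<^sup>+t. f (1 - t) * indicator {0<..<1} (1 - t) \<partial>lborel)"
    by (subst nn_integral_real_affine[where c = "-1" and t = 1]) auto
  also have "(\<lambda>t::real. indicator {0<..<1} (1 - t) :: ennreal) = indicator {0<..<1}"
    by (auto simp: indicator_def)
  also have "(\<integral>\<^sup>+t. f (1 - t) * indicator {0<..<1} t \<partial>lborel) = (\<integral>\<^sup>+t. f (1 - t) \<partial>unif)"
    by (rule nn_integral_unif[symmetric]) simp
  finally show ?thesis ..
qed

lemma nn_integral_end_weight: "(\<integral>\<^sup>+t. ennreal (end_weight t) \<partial>unif) = 4"
proof -
  have "((\<lambda>x. x powr (-1/2)) has_integral (1 powr (-1/2 + 1) / (-1/2 + 1))) {0..1::real}"
    by (rule has_integral_powr_from_0) auto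
  then have "(\<integral>\<^sup>+x. ennreal (x powr (-1/2)) * indicator {0..1} x \<partial>lborel) = ennreal 2"
    using nn_integral_has_integral_lebesgue'[of "{0..1}" "\<lambda>x::real. x powr (-1/2)" 2] by simp
  also have "(\<integral>\<^sup>+x. ennreal (x powr (-1/2)) * indicator {0..1} x \<partial>lborel) =
     (\<integral>\<^sup>+x. ennreal (1 / sqrt x) * indicator {0<..<1} x \<partial>lborel)"
    using AE_lborel_singleton[of 0] AE_lborel_singleton[of 1]
    by (intro nn_integral_cong_AE)
      (auto elim!: eventually_elim2 simp: indicator_def powr_minus powr_half_sqrt inverse_eq_divide)
  finally have 1: "(\<integral>\<^sup>+t. ennreal (1 / sqrt t) \<partial>unif) = 2"
    by (subst nn_integral_unif) auto
  have "(\<integral>\<^sup>+t. ennreal (end_weight t) \<partial>unif) = (\<integral>\<^sup>+t. ennreal (1 / sqrt t) + ennreal (1 / sqrt (1 - t)) \<partial>unif)"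
    by (rule nn_integral_cong_AE) (use AE_unif in eventually_elim, simp add: end_weight_def)
  also have "\<dots> = (\<integral>\<^sup>+t. ennreal (1 / sqrt t) \<partial>unif) + (\<integral>\<^sup>+t. ennreal (1 / sqrt (1 - t)) \<partial>unif)"
    by (intro nn_integral_add) (auto cong: measurable_cong_sets)
  also have "(\<integral>\<^sup>+t. ennreal (1 / sqrt (1 - t)) \<partial>unif) = (\<integral>\<^sup>+t. ennreal (1 / sqrt t) \<partial>unif)"
    by (rule nn_integral_unif_reflect) simp
  finally show ?thesis using 1 by simp
qed

section \<open>The cost of the coarse cells\<close>

text \<open>Across a cell the mass to its right drops at most by the factor c, except in the last
  cell, and the mass to its left grows at most by this factor, except in the first. The relative
  errors at the two ends of a bounded cell are thereby comparable. The exceptional cells are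
  distinct since \<open>2 \<le> P\<close>.\<close>

definition tame :: "real \<Rightarrow> (nat \<Rightarrow> real) \<Rightarrow> nat \<Rightarrow> bool" where
  "tame c B P \<longleftrightarrow> 1 \<le> c \<and> 2 \<le> P \<and> B 0 = 0 \<and> B P = 1 \<and> (\<forall>k<P. B k < B (Suc k)) \<and>
    (\<forall>k. Suc k < P \<longrightarrow> 1 - B k \<le> c * (1 - B (Suc k))) \<and>
    (\<forall>k. 0 < k \<and> k < P \<longrightarrow> B (Suc k) \<le> c * B k)"

definition clip :: "(nat \<Rightarrow> real) \<Rightarrow> nat \<Rightarrow> real \<Rightarrow> real" where
  "clip B P x = max (B 1) (min (B (P - 1)) x)"

text \<open>
  \<open>lipsq\<close> bounds the square of the length of the k-th cell in the metric of \<open>ref_quant\<close>, and \<open>count_cost\<close>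
  the cost of moving its two end points to the empirical ones. On the first and the last cell
  \<open>ref_quant\<close> is unbounded; there the sample is clipped, at the price of \<open>tail_cost\<close>.
\<close>

definition lipsq :: "(nat \<Rightarrow> real) \<Rightarrow> nat \<Rightarrow> nat \<Rightarrow> real" where
  "lipsq B P k = (if 0 < k \<and> Suc k < P then
     ((B (Suc k) - B k) / ((1 - B (Suc k)) * tail_root (1 - B k)) + (B (Suc k) - B k) / (B k * tail_root (B (Suc k))))\<^sup>2 else 0)"

definition tail_cost :: "real \<Rightarrow> nat \<Rightarrow> nat \<Rightarrow> real" where
  "tail_cost c P k = (if k = 0 \<or> Suc k = P then 2 * c\<^sup>2 + 32 else 0)"

definition count_cost :: "(nat \<Rightarrow> real) \<Rightarrow> nat \<Rightarrow> nat \<Rightarrow> real" where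
  "count_cost B P k = (B k + (if Suc k < P then B (Suc k) else 0)) / (tail_root (1 - B k))\<^sup>2 +
     (1 - B (Suc k) + (if 0 < k then 1 - B k else 0)) / (tail_root (B (Suc k)))\<^sup>2"

lemma tame_cuts: "tame c B P \<Longrightarrow> cuts B P"
  by (auto simp: tame_def cuts_def intro: less_imp_le)

lemma cuts_mono:
  assumes "cuts B P" "k \<le> m" "m \<le> P"
  shows "B k \<le> B m"
  using assms(2,3)
proof (induction m rule: dec_induct)
  case (step m)
  then show ?case using assms(1) by (auto simp: cuts_def intro: order_trans)
qed simp

lemma cuts_bounds: "cuts B P \<Longrightarrow> k \<le> P \<Longrightarrow> 0 \<le> B k \<and> B k \<le> 1"
  using cuts_mono[of B P 0 k] cuts_mono[of B P k P] by (simp add: cuts_def)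

lemma tame_mono_strict:
  assumes "tame c B P" "k < m" "m \<le> P"
  shows "B k < B m"
proof -
  have "B k < B (Suc k)" using assms by (simp add: tame_def)
  also have "\<dots> \<le> B m" using assms by (intro cuts_mono[OF tame_cuts]) auto
  finally show ?thesis .
qed

lemma tame_pos:
  assumes "tame c B P" "k \<le> P"
  shows "0 < k \<Longrightarrow> 0 < B k" "k < P \<Longrightarrow> B k < 1"
  using tame_mono_strict[OF assms(1), of 0 k] tame_mono_strict[OF assms(1), of k P] assms
  by (auto simp: tame_def)

lemma sum_sq_le: "(x - y)\<^sup>2 \<le> 2 * (x - z)\<^sup>2 + 2 * (z - y)\<^sup>2" for x y z :: real
proof -
  have "0 \<le> ((x - z) - (z - y))\<^sup>2" by simp
  then show ?thesis by (simp add: power2_eq_square algebra_simps)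
qed

lemma diff_sq_le: "(x - y)\<^sup>2 \<le> 2 * x\<^sup>2 + 2 * y\<^sup>2" for x y :: real
  using sum_sq_le[of x y 0] by simp

lemma end_weight_ge_parts: "0 < z \<Longrightarrow> z < 1 \<Longrightarrow> 1 / sqrt z \<le> end_weight z \<and> 1 / sqrt (1 - z) \<le> end_weight z"
  by (auto simp: end_weight_def)

lemma cell_between:
  assumes "B k \<le> B (Suc k)" "0 \<le> z" "z \<le> 1"
  shows "B k \<le> cell B k z" "cell B k z \<le> B (Suc k)"
proof -
  have "(B (Suc k) - B k) * z \<le> (B (Suc k) - B k) * 1" using assms by (intro mult_left_mono) auto
  then show "cell B k z \<le> B (Suc k)" by (simp add: cell_def)
  show "B k \<le> cell B k z" using assms by (simp add: cell_def)
qed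

lemma cell_less:
  assumes "B k < B (Suc k)" "0 < z" "z < 1"
  shows "B k < cell B k z" "cell B k z < B (Suc k)"
proof -
  have "(B (Suc k) - B k) * z < (B (Suc k) - B k) * 1" using assms by (intro mult_strict_left_mono) auto
  then show "cell B k z < B (Suc k)" by (simp add: cell_def)
  show "B k < cell B k z" using assms by (simp add: cell_def)
qed

text \<open>One application of \<open>tail_root_transport\<close> to each summand of
  \<open>ref_quant\<close>: directly for the left tail, and after the reflection of u and z at 1/2
  for the right tail.\<close>

lemma ref_quant_transport:
  assumes B: "tame c B P" and A: "cuts A P" and k: "k < P" "A k < A (Suc k)" and z: "0 < z" "z < 1"
  shows "(A (Suc k) - A k) * (ref_quant (cell B k z) - ref_quant (cell A k z))\<^sup>2 \<le>
    96 * c\<^sup>2 * (((A k - B k)\<^sup>2 / (1 - B k) + (A (Suc k) - B (Suc k))\<^sup>2 / (1 - B (Suc k))) / (tail_root (1 - B k))\<^sup>2 +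
      ((A (Suc k) - B (Suc k))\<^sup>2 / B (Suc k) + (A k - B k)\<^sup>2 / B k) / (tail_root (B (Suc k)))\<^sup>2) * end_weight z"
proof -
  let ?a = "B k" and ?b = "B (Suc k)" and ?a' = "A k" and ?b' = "A (Suc k)"
  have bnd: "0 \<le> ?a" "?b \<le> 1" "?a < ?b" "0 \<le> ?a'" "?b' \<le> 1"
    using cuts_bounds[OF tame_cuts[OF B]] cuts_bounds[OF A] B k by (auto simp: tame_def)
  have c: "1 \<le> c" using B by (simp add: tame_def)
  let ?R = "((?a' - ?a)\<^sup>2 / (1 - ?a) + (?b' - ?b)\<^sup>2 / (1 - ?b)) / (tail_root (1 - ?a))\<^sup>2"
  let ?L = "((?b' - ?b)\<^sup>2 / ?b + (?a' - ?a)\<^sup>2 / ?a) / (tail_root ?b)\<^sup>2"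
  have RL: "0 \<le> ?R" "0 \<le> ?L" using bnd by auto
  have R: "(?b' - ?a') * (tail_root (1 - cell B k z) - tail_root (1 - cell A k z))\<^sup>2 \<le> 48 * c\<^sup>2 * ?R * end_weight z"
  proof -
    have last: "Suc k = P" if "1 - ?b = 0"
      using that tame_pos(2)[OF B, of "Suc k"] k by (cases "Suc k = P") auto
    have "((1 - ?a') - (1 - ?b')) * (tail_root ((1 - ?b) + ((1 - ?a) - (1 - ?b)) * (1 - z)) - tail_root ((1 - ?b') + ((1 - ?a') - (1 - ?b')) * (1 - z)))\<^sup>2 \<le>
      48 * c\<^sup>2 * (((1 - ?a') - (1 - ?a))\<^sup>2 / (1 - ?a) + ((1 - ?b') - (1 - ?b))\<^sup>2 / (1 - ?b)) / (tail_root (1 - ?a))\<^sup>2 / sqrt (1 - z)"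
    proof (rule tail_root_transport)
      show "1 - ?b = 0 \<or> 1 - ?a \<le> c * (1 - ?b)"
        using B k by (cases "Suc k = P") (auto simp: tame_def)
      show "1 - ?b' = 0" if "1 - ?b = 0" using last[OF that] A by (simp add: cuts_def)
    qed (use bnd k z c in auto)
    also have "((1 - ?a') - (1 - ?a))\<^sup>2 = (?a' - ?a)\<^sup>2"
      by (simp add: power2_eq_square algebra_simps)
    also have "((1 - ?b') - (1 - ?b))\<^sup>2 = (?b' - ?b)\<^sup>2"
      by (simp add: power2_eq_square algebra_simps)
    also have "(1 - ?b) + ((1 - ?a) - (1 - ?b)) * (1 - z) = 1 - cell B k z"
      by (simp add: cell_def algebra_simps)
    also have "(1 - ?b') + ((1 - ?a') - (1 - ?b')) * (1 - z) = 1 - cell A k z"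
      by (simp add: cell_def algebra_simps)
    also have "48 * c\<^sup>2 * ((?a' - ?a)\<^sup>2 / (1 - ?a) + (?b' - ?b)\<^sup>2 / (1 - ?b)) / (tail_root (1 - ?a))\<^sup>2 / sqrt (1 - z) =
       48 * c\<^sup>2 * ?R * (1 / sqrt (1 - z))" by simp
    also have "\<dots> \<le> 48 * c\<^sup>2 * ?R * end_weight z"
      using RL end_weight_ge_parts[OF z] by (intro mult_left_mono mult_nonneg_nonneg) auto
    finally show ?thesis by simp
  qed
  have L: "(?b' - ?a') * (tail_root (cell B k z) - tail_root (cell A k z))\<^sup>2 \<le> 48 * c\<^sup>2 * ?L * end_weight z"
  proof -
    have first: "k = 0" if "?a = 0" using that tame_pos(1)[OF B, of k] k by (cases "k = 0") auto
    have "(?b' - ?a') * (tail_root (?a + (?b - ?a) * z) - tail_root (?a' + (?b' - ?a') * z))\<^sup>2 \<le>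
      48 * c\<^sup>2 * ((?b' - ?b)\<^sup>2 / ?b + (?a' - ?a)\<^sup>2 / ?a) / (tail_root ?b)\<^sup>2 / sqrt z"
    proof (rule tail_root_transport)
      show "?a = 0 \<or> ?b \<le> c * ?a"
        using B k by (cases "k = 0") (auto simp: tame_def)
      show "?a' = 0" if "?a = 0" using first[OF that] A by (simp add: cuts_def)
    qed (use bnd k z c in auto)
    also have "48 * c\<^sup>2 * ((?b' - ?b)\<^sup>2 / ?b + (?a' - ?a)\<^sup>2 / ?a) / (tail_root ?b)\<^sup>2 / sqrt z =
       48 * c\<^sup>2 * ?L * (1 / sqrt z)" by simp
    also have "\<dots> \<le> 48 * c\<^sup>2 * ?L * end_weight z"
      using RL end_weight_ge_parts[OF z] by (intro mult_left_mono mult_nonneg_nonneg) auto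
    finally show ?thesis by (simp add: cell_def)
  qed
  have "(?b' - ?a') * (ref_quant (cell B k z) - ref_quant (cell A k z))\<^sup>2 \<le>
     (?b' - ?a') * (2 * (tail_root (1 - cell B k z) - tail_root (1 - cell A k z))\<^sup>2 + 2 * (tail_root (cell B k z) - tail_root (cell A k z))\<^sup>2)"
  proof (intro mult_left_mono)
    have "ref_quant (cell B k z) - ref_quant (cell A k z) =
      (tail_root (1 - cell B k z) - tail_root (1 - cell A k z)) - (tail_root (cell B k z) - tail_root (cell A k z))"
      by (simp add: ref_quant_def)
    then show "(ref_quant (cell B k z) - ref_quant (cell A k z))\<^sup>2 \<le>
      2 * (tail_root (1 - cell B k z) - tail_root (1 - cell A k z))\<^sup>2 + 2 * (tail_root (cell B k z) - tail_root (cell A k z))\<^sup>2"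
      using diff_sq_le by metis
  qed (use k in auto)
  also have "\<dots> \<le> 2 * (48 * c\<^sup>2 * ?R * end_weight z) + 2 * (48 * c\<^sup>2 * ?L * end_weight z)"
    using R L by (simp add: distrib_left)
  also have "\<dots> = 96 * c\<^sup>2 * (?R + ?L) * end_weight z" by (simp only: distrib_left distrib_right)
  finally show ?thesis .
qed

text \<open>In an inner cell this is the Lipschitz bound of both summands. In an end cell clipping
  sends every point to the inner boundary. There one summand of \<open>ref_quant\<close> varies by
  at most c, by tameness, and the other is handled by \<open>tail_root_tail\<close>; twice
  \<open>c\<^sup>2 + 16\<close> is the constant in \<open>tail_cost\<close>.\<close>

lemma ref_quant_local:
  assumes B: "tame c B P" and k: "k < P" and z: "0 \<le> z" "z \<le> 1" and y: "0 < y" "y < 1"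
  shows "(ref_quant (clip B P (cell B k z)) - ref_quant (cell B k y))\<^sup>2 \<le> lipsq B P k * (z - y)\<^sup>2 + tail_cost c P k * end_weight y"
proof -
  let ?a = "B k" and ?b = "B (Suc k)"
  have c: "1 \<le> c" and P: "2 \<le> P" using B by (auto simp: tame_def)
  have ab: "?a < ?b" "0 \<le> ?a" "?b \<le> 1" using B k cuts_bounds[OF tame_cuts[OF B]] by (auto simp: tame_def)
  have mono: "B i \<le> B m" if "i \<le> m" "m \<le> P" for i m using cuts_mono[OF tame_cuts[OF B] that] .
  have cz: "?a \<le> cell B k z" "cell B k z \<le> ?b" using cell_between[of B k z] ab z by auto
  have cy: "?a < cell B k y" "cell B k y < ?b" using cell_less[of B k y] ab y by auto
  have G: "(ref_quant u - ref_quant v)\<^sup>2 \<le> 2 * (tail_root (1 - u) - tail_root (1 - v))\<^sup>2 + 2 * (tail_root u - tail_root v)\<^sup>2" for u v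
  proof -
    have "ref_quant u - ref_quant v = (tail_root (1 - u) - tail_root (1 - v)) - (tail_root u - tail_root v)" by (simp add: ref_quant_def)
    then show ?thesis using diff_sq_le by metis
  qed
  have end_weight: "1 \<le> end_weight y" by (rule end_weight_ge[OF y])
  consider "0 < k" "Suc k < P" | "k = 0" | "Suc k = P" "k \<noteq> 0" using k by linarith
  then show ?thesis
  proof cases
    case 1
    have "B 1 \<le> ?a" "?b \<le> B (P - 1)" using 1 by (auto intro!: mono)
    then have clip: "clip B P (cell B k z) = cell B k z" using cz by (auto simp: clip_def)
    have a: "0 < ?a" "?b < 1" using tame_pos[OF B] 1 by auto
    define d where "d = \<bar>cell B k z - cell B k y\<bar>"
    have d: "d = (?b - ?a) * \<bar>z - y\<bar>"
    proof -
      have "cell B k z - cell B k y = (?b - ?a) * (z - y)" by (simp add: cell_def algebra_simps)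
      then show ?thesis using ab by (simp add: d_def abs_mult)
    qed
    have 1: "\<bar>tail_root (1 - cell B k z) - tail_root (1 - cell B k y)\<bar> \<le> d / ((1 - ?b) * tail_root (1 - ?a))"
      using tail_root_lipschitz[of "1 - ?b" "1 - cell B k z" "1 - ?a" "1 - cell B k y"] a ab cz cy
      by (simp add: d_def abs_minus_commute)
    have 2: "\<bar>tail_root (cell B k z) - tail_root (cell B k y)\<bar> \<le> d / (?a * tail_root ?b)"
      using tail_root_lipschitz[of ?a "cell B k z" ?b "cell B k y"] a ab cz cy by (simp add: d_def)
    have "\<bar>ref_quant (cell B k z) - ref_quant (cell B k y)\<bar> \<le>
       \<bar>tail_root (1 - cell B k z) - tail_root (1 - cell B k y)\<bar> + \<bar>tail_root (cell B k z) - tail_root (cell B k y)\<bar>"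
      unfolding ref_quant_def by linarith
    also have "\<dots> \<le> d / ((1 - ?b) * tail_root (1 - ?a)) + d / (?a * tail_root ?b)" using 1 2 by linarith
    also have "\<dots> = ((?b - ?a) / ((1 - ?b) * tail_root (1 - ?a)) + (?b - ?a) / (?a * tail_root ?b)) * \<bar>z - y\<bar>"
      unfolding d by (simp add: distrib_right)
    finally have "\<bar>ref_quant (cell B k z) - ref_quant (cell B k y)\<bar>\<^sup>2 \<le>
      (((?b - ?a) / ((1 - ?b) * tail_root (1 - ?a)) + (?b - ?a) / (?a * tail_root ?b)) * \<bar>z - y\<bar>)\<^sup>2"
      by (intro power_mono) auto
    also have "\<dots> = lipsq B P k * (z - y)\<^sup>2"
      using \<open>0 < k\<close> \<open>Suc k < P\<close> by (simp add: lipsq_def power_mult_distrib)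
    finally show ?thesis using \<open>0 < k\<close> \<open>Suc k < P\<close> by (simp add: clip tail_cost_def)
  next
    case 2
    have "?b \<le> B (P - 1)" using 2 P by (intro mono) auto
    then have clip: "clip B P (cell B k z) = ?b" using cz ab 2 by (auto simp: clip_def)
    have b: "0 < ?b" "?b < 1" using tame_pos[OF B, of "Suc k"] 2 P by auto
    have cb: "1 \<le> c * (1 - ?b)" using B P 2 by (auto simp: tame_def dest!: spec[of _ 0])
    have cyb: "cell B k y = ?b * y" using B 2 by (simp add: cell_def tame_def)
    have "\<bar>tail_root (1 - ?b) - tail_root (1 - ?b * y)\<bar> \<le> \<bar>(1 - ?b) - (1 - ?b * y)\<bar> / ((1 - ?b) * tail_root 1)"
      using b y by (intro tail_root_lipschitz) (auto simp: mult_left_le)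
    also have "\<dots> \<le> 1 / (1 - ?b)"
    proof -
      have "\<bar>(1 - ?b) - (1 - ?b * y)\<bar> = ?b * (1 - y)" using b y by (simp add: algebra_simps mult_left_le)
      also have "\<dots> \<le> 1" using b y by (intro mult_le_one) auto
      finally show ?thesis using b by (simp add: tail_root_def divide_right_mono)
    qed
    also have "\<dots> \<le> c" using cb b by (simp add: divide_le_eq)
    finally have "\<bar>tail_root (1 - ?b) - tail_root (1 - ?b * y)\<bar>\<^sup>2 \<le> c\<^sup>2" by (intro power_mono) auto
    then have 1: "(tail_root (1 - ?b) - tail_root (1 - ?b * y))\<^sup>2 \<le> c\<^sup>2 * end_weight y"
      using end_weight by (simp add: order_trans[OF _ mult_left_mono[of 1 "end_weight y" "c\<^sup>2"]])
    have "(tail_root (?b * y) - tail_root ?b)\<^sup>2 \<le> 16 / sqrt y" using b y by (intro tail_root_tail) auto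
    also have "\<dots> \<le> 16 * end_weight y" using end_weight_ge_parts[OF y] by simp
    finally have 2: "(tail_root ?b - tail_root (?b * y))\<^sup>2 \<le> 16 * end_weight y" by (simp add: power2_commute)
    have "(ref_quant ?b - ref_quant (?b * y))\<^sup>2 \<le> (2 * c\<^sup>2 + 32) * end_weight y"
      using G[of ?b "?b * y"] 1 2 by (simp add: distrib_right)
    then show ?thesis unfolding clip cyb using \<open>k = 0\<close> P by (simp add: tail_cost_def lipsq_def)
  next
    case 3
    have b1: "?b = 1" using 3 B by (simp add: tame_def)
    have Pk: "P - 1 = k" using 3 by auto
    have "B 1 \<le> ?a" using 3 by (intro mono) auto
    then have clip: "clip B P (cell B k z) = ?a" using cz Pk by (auto simp: clip_def)
    have a: "0 < ?a" "?a < 1" using tame_pos[OF B, of k] 3 k by auto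
    have ca: "1 \<le> c * ?a" using B 3 k b1 by (auto simp: tame_def)
    have cya: "1 - cell B k y = (1 - ?a) * (1 - y)" by (simp add: cell_def b1 algebra_simps)
    have "\<bar>tail_root ?a - tail_root (cell B k y)\<bar> \<le> \<bar>?a - cell B k y\<bar> / (?a * tail_root 1)"
      using a cy b1 by (intro tail_root_lipschitz) auto
    also have "\<dots> \<le> 1 / ?a" using a cy b1 by (simp add: tail_root_def divide_right_mono)
    also have "\<dots> \<le> c" using ca a by (simp add: divide_le_eq)
    finally have "\<bar>tail_root ?a - tail_root (cell B k y)\<bar>\<^sup>2 \<le> c\<^sup>2" by (intro power_mono) auto
    then have 1: "(tail_root ?a - tail_root (cell B k y))\<^sup>2 \<le> c\<^sup>2 * end_weight y"
      using end_weight by (simp add: order_trans[OF _ mult_left_mono[of 1 "end_weight y" "c\<^sup>2"]])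
    have "(tail_root ((1 - ?a) * (1 - y)) - tail_root (1 - ?a))\<^sup>2 \<le> 16 / sqrt (1 - y)"
      using a y by (intro tail_root_tail) auto
    also have "\<dots> \<le> 16 * end_weight y" using end_weight_ge_parts[OF y] by simp
    finally have 2: "(tail_root (1 - ?a) - tail_root (1 - cell B k y))\<^sup>2 \<le> 16 * end_weight y" by (simp add: cya power2_commute)
    have "(ref_quant ?a - ref_quant (cell B k y))\<^sup>2 \<le> (2 * c\<^sup>2 + 32) * end_weight y"
      using G[of ?a "cell B k y"] 1 2 by (simp add: distrib_right)
    then show ?thesis using 3 by (simp add: clip tail_cost_def lipsq_def)
  qed
qed

section \<open>Positions of sample points and targets, and moments of the counts\<close>

lemma sample_pt_in_01:
  assumes "specs xs" "labels I xs ls" "i \<in> I" "0 \<le> t" "t \<le> 1"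
  shows "0 \<le> sample_pt xs ls j i t \<and> sample_pt xs ls j i t \<le> 1"
  using assms(1,2)
proof (induction xs arbitrary: ls)
  case (Cons x xs ls0)
  obtain a B P where x: "x = (a, B, P)" by (cases x)
  obtain l ls where ls: "ls0 = l # ls" using Cons.prems by (cases ls0) (auto simp: x)
  have IH: "0 \<le> sample_pt xs ls j i t \<and> sample_pt xs ls j i t \<le> 1" using Cons by (auto simp: x ls)
  have B: "cuts B P" and l: "l i < P" using Cons.prems assms(3) by (auto simp: x ls)
  have "B (l i) \<le> B (Suc (l i))" using B l by (auto simp: cuts_def)
  then have "B (l i) \<le> cell B (l i) (sample_pt xs ls j i t)" "cell B (l i) (sample_pt xs ls j i t) \<le> B (Suc (l i))"
    using IH by (auto intro: cell_between)
  then show ?case using IH cuts_bounds[OF B, of "l i"] cuts_bounds[OF B, of "Suc (l i)"] l by (auto simp: x ls)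
qed (use assms in simp)

text \<open>Strict, because i itself belongs to the group, so that its empirical cell has positive
  length at every level.\<close>

lemma target_pt_in_01:
  assumes "finite I" "labels I xs ls" "S \<subseteq> I" "i \<in> S" "0 < t" "t < 1"
  shows "0 < target_pt xs ls S j i t \<and> target_pt xs ls S j i t < 1"
  using assms(2-4)
proof (induction xs arbitrary: ls S)
  case (Cons x xs ls0)
  obtain a B P where x: "x = (a, B, P)" by (cases x)
  obtain l ls where ls: "ls0 = l # ls" using Cons.prems by (cases ls0) (auto simp: x)
  let ?S = "{i' \<in> S. l i' = l i}"
  have IH: "0 < target_pt xs ls ?S j i t \<and> target_pt xs ls ?S j i t < 1"
    using Cons.prems by (intro Cons.IH) (auto simp: x ls)
  have fin: "finite S" using Cons.prems assms(1) finite_subset by blast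
  have l: "l i' < P" if "i' \<in> S" for i' using Cons.prems that by (auto simp: x ls)
  have e: "cuts (ecuts l S) P" using Cons.prems by (intro cuts_ecuts fin l) auto
  have "ecuts l S (l i) < ecuts l S (Suc (l i))"
    using Cons.prems fin by (auto simp: ecuts_Suc card_gt_0_iff intro!: divide_pos_pos)
  then have "ecuts l S (l i) < cell (ecuts l S) (l i) (target_pt xs ls ?S j i t)"
    "cell (ecuts l S) (l i) (target_pt xs ls ?S j i t) < ecuts l S (Suc (l i))"
    using IH by (auto intro: cell_less)
  then show ?case using IH cuts_bounds[OF e, of "l i"] cuts_bounds[OF e, of "Suc (l i)"] l[OF Cons.prems(3)]
    by (auto simp: x ls Let_def)
qed (use assms in simp)

text \<open>By the binary recursion the right-hand side is the squared half-width of the final cell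
  along axis j.\<close>

lemma sample_pt_near_center:
  assumes "binary j xs" "0 \<le> t" "t \<le> 1" "length ls = length xs"
  shows "(sample_pt xs ls j i t - sample_pt xs ls j i (1/2))\<^sup>2 \<le> 3 * (1/12 - center_var j xs)"
  using assms(1,4)
proof (induction xs arbitrary: ls)
  case Nil
  have "\<bar>t - 1/2\<bar> \<le> 1/2" using assms(2,3) by linarith
  then have "\<bar>t - 1/2\<bar>\<^sup>2 \<le> (1/2)\<^sup>2" by (intro power_mono) auto
  then show ?case by (simp add: power2_eq_square)
next
  case (Cons x xs ls0)
  obtain a B P where x: "x = (a, B, P)" by (cases x)
  obtain l ls where ls: "ls0 = l # ls" using Cons.prems by (cases ls0) auto
  have IH: "(sample_pt xs ls j i t - sample_pt xs ls j i (1/2))\<^sup>2 \<le> 3 * (1/12 - center_var j xs)"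
    using Cons by (auto simp: x ls)
  show ?case
  proof (cases "a = j")
    case True
    then have "sample_pt (x # xs) ls0 j i t - sample_pt (x # xs) ls0 j i (1/2) = (sample_pt xs ls j i t - sample_pt xs ls j i (1/2)) / 2"
      using Cons.prems by (simp add: x ls cell_def halves_def field_simps)
    then have "(sample_pt (x # xs) ls0 j i t - sample_pt (x # xs) ls0 j i (1/2))\<^sup>2 = (sample_pt xs ls j i t - sample_pt xs ls j i (1/2))\<^sup>2 / 4"
      by (simp only:) (simp add: power_divide)
    then show ?thesis using IH True by (simp add: x del: sample_pt.simps)
  qed (use IH in \<open>simp add: x ls\<close>)
qed

lemma binary_center_var: "center_var j xs \<le> 1/12"
  by (induction j xs rule: center_var.induct) auto

lemma nn_integral_target_pt_component:
  fixes j :: "'n::finite"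
  assumes "finite I" "S \<subseteq> I" "labels I xs ls" "f \<in> borel_measurable borel"
  shows "(\<Sum>i\<in>S. \<integral>\<^sup>+v. f (target_pt xs ls S j i (v j)) \<partial>cube) = of_nat (card S) * (\<integral>\<^sup>+t. f t \<partial>unif)"
proof -
  have "list_all2 (\<lambda>(a, B, P) l. \<forall>i\<in>S. l i < P) xs ls"
    using assms(3) unfolding labels_def
    by (rule list_all2_mono) (use assms(2) in \<open>auto dest!: PiE_mem\<close>)
  from target_pt_marginal[OF this, of "\<lambda>v. f (v j)"] show ?thesis
    using assms finite_subset by (auto simp: nn_integral_cube_component)
qed

lemma target_pt_measurable [measurable]: "(\<lambda>t. target_pt xs ls S j i t) \<in> borel_measurable borel"
proof -
  obtain p q where "\<And>t. target_pt xs ls S j i t = p + q * t" using target_pt_affine[of xs ls S j i] by blast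
  then show ?thesis by simp
qed

lemma AE_cube: "AE v in (cube :: ('n::finite \<Rightarrow> real) measure). \<forall>j. 0 < v j \<and> v j < 1"
proof -
  have "AE v in (cube :: ('n \<Rightarrow> real) measure). 0 < v j \<and> v j < 1" for j
    unfolding cube_def by (rule AE_PiM_component[where P = "\<lambda>t. 0 < t \<and> t < 1" and M = "\<lambda>_. unif"]) (simp_all only: UNIV_I AE_unif prob_space_unif)
  then show ?thesis by (simp add: AE_all_countable)
qed

lemma avg_card:
  assumes "finite I" "cuts B P" "S \<subseteq> I" "k < P"
  shows "avg I B P (\<lambda>l. real (card {i \<in> S. l i = k})) = real (card S) * (B (Suc k) - B k)"
proof -
  have fin: "finite S" using assms finite_subset by blast
  have "real (card {i \<in> S. l i = k}) = (\<Sum>i\<in>S. of_bool (l i = k))" for l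
    using fin by (simp add: sum.If_cases of_bool_def Int_def)
  then have "avg I B P (\<lambda>l. real (card {i \<in> S. l i = k})) = (\<Sum>i\<in>S. avg I B P (\<lambda>l. of_bool (l i = k)))"
    by (simp add: avg_sum)
  also have "\<dots> = (\<Sum>i\<in>S. B (Suc k) - B k)"
  proof (intro sum.cong refl)
    fix i assume "i \<in> S"
    then show "avg I B P (\<lambda>l. of_bool (l i = k)) = B (Suc k) - B k"
      using assms avg_single[OF assms(1,2), of i "\<lambda>m. of_bool (m = k)"]
      by (auto simp: of_bool_def if_distrib cong: if_cong)
  qed
  finally show ?thesis by simp
qed

text \<open>The variance of a binomial proportion with success probability
  \<open>B k\<close>.\<close>

lemma avg_ecuts_sq:
  assumes "finite I" "cuts B P" "S \<subseteq> I" "S \<noteq> {}" "k \<le> P"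
  shows "avg I B P (\<lambda>l. (ecuts l S k - B k)\<^sup>2) = B k * (1 - B k) / real (card S)"
proof -
  have fin: "finite S" using assms finite_subset by blast
  have s: "0 < real (card S)" using fin assms by (simp add: card_gt_0_iff)
  let ?f = "\<lambda>m. of_bool (m < k) - B k"
  have sum_k: "(\<Sum>m<P. (B (Suc m) - B m) * of_bool (m < k)) = B k"
  proof -
    have "(\<Sum>m<P. (B (Suc m) - B m) * of_bool (m < k)) = (\<Sum>m\<in>{..<P} \<inter> {m. m < k}. B (Suc m) - B m)"
      by (simp add: sum.inter_restrict of_bool_def if_distrib cong: if_cong)
    also have "{..<P} \<inter> {m. m < k} = {..<k}" using assms by auto
    finally show ?thesis using assms(2) by (simp add: sum_lessThan_telescope cuts_def)
  qed
  have sum1: "(\<Sum>m<P. (B (Suc m) - B m)) = 1" by (rule cuts_sum) fact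
  have zero: "(\<Sum>m<P. (B (Suc m) - B m) * ?f m) = 0"
    using sum_k sum1 by (simp add: right_diff_distrib sum_subtractf flip: sum_distrib_right)
  have sq: "(\<Sum>m<P. (B (Suc m) - B m) * (?f m)\<^sup>2) = B k * (1 - B k)"
  proof -
    have "(\<Sum>m<P. (B (Suc m) - B m) * (?f m)\<^sup>2) =
      (\<Sum>m<P. (1 - 2 * B k) * ((B (Suc m) - B m) * of_bool (m < k)) + (B k)\<^sup>2 * (B (Suc m) - B m))"
      by (intro sum.cong refl) (simp add: of_bool_def power2_eq_square algebra_simps)
    also have "\<dots> = (1 - 2 * B k) * B k + (B k)\<^sup>2"
      unfolding sum.distrib sum_distrib_left[symmetric] sum_k sum1 by simp
    finally show ?thesis by (simp add: power2_eq_square algebra_simps)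
  qed
  have "ecuts l S k - B k = (1 / real (card S)) * (\<Sum>i\<in>S. ?f (l i))" for l
  proof -
    have "real (card {i \<in> S. l i < k}) = (\<Sum>i\<in>S. of_bool (l i < k))"
      using fin by (simp add: sum.If_cases of_bool_def Int_def)
    then show ?thesis using s by (simp add: ecuts_def sum_subtractf field_simps)
  qed
  then have "avg I B P (\<lambda>l. (ecuts l S k - B k)\<^sup>2) =
     (1 / real (card S))\<^sup>2 * avg I B P (\<lambda>l. (\<Sum>i\<in>S. ?f (l i))\<^sup>2)"
    by (simp only: power_mult_distrib avg_cmult)
  also have "\<dots> = B k * (1 - B k) / real (card S)"
    unfolding avg_sum_sq[OF assms(1-3) zero] sq using s by (simp add: power2_eq_square)
  finally show ?thesis .
qed

lemma nexpect_sum: "nexpect I xs (\<lambda>ls. \<Sum>x\<in>A. F x ls) = (\<Sum>x\<in>A. nexpect I xs (F x))"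
proof (induction A rule: infinite_finite_induct)
  case (insert a A)
  then show ?case by (simp add: nexpect_add)
next
  case (infinite A)
  then show ?case using nexpect_cmult[of I xs 0 "\<lambda>_. 0"] by simp
next
  case empty
  then show ?case using nexpect_cmult[of I xs 0 "\<lambda>_. 0"] by simp
qed

lemma nexpect_const: "finite I \<Longrightarrow> specs xs \<Longrightarrow> 0 \<le> c \<Longrightarrow> nexpect I xs (\<lambda>_. ennreal c) = ennreal c"
  by (simp add: nexpect_ennreal expect_const)

text \<open>The error is split at an intermediate point y of the true cell k, placed at the relative
  position that the target has in its empirical cell: \<open>ref_quant_local\<close> compares the
  clipped sample with it, and \<open>ref_quant_transport\<close> moves the ends of the cell to the
  empirical cuts. Over a subgroup the position is uniform, so \<open>end_weight\<close> integrates
  to 4. Transport is bounded with the weight \<open>n l k / s\<close>; summing over the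
  \<open>n l k\<close> points gives s times an error of mean order 1 / s, a cost per group that does
  not depend on its size.\<close>

lemma coarse_bound:
  fixes j :: "'n::finite"
  assumes I: "finite I" "S \<subseteq> I" and B: "tame c B P" and ys: "specs ys" "binary j ys"
    and t: "\<And>i. i \<in> S \<Longrightarrow> 0 \<le> t i \<and> t i \<le> 1"
  shows "nexpect I ((j, B, P) # ys) (\<lambda>ls. \<Sum>i\<in>S. \<integral>\<^sup>+v. ennreal ((ref_quant (clip B P (sample_pt ((j, B, P) # ys) ls j i (t i))) -
      ref_quant (target_pt ((j, B, P) # ys) ls S j i (v j)))\<^sup>2) \<partial>cube) \<le>
    ennreal (real (card S) * (\<Sum>k<P. (B (Suc k) - B k) * (16 * lipsq B P k * (1/12 - center_var j ys) + 8 * tail_cost c P k)) +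
      (8 * count_loss j ys * (\<Sum>k<P. lipsq B P k) + 768 * c\<^sup>2 * (\<Sum>k<P. count_cost B P k)) * of_bool (S \<noteq> {}))"
proof (cases "S = {}")
  case True
  then show ?thesis using nexpect_cmult[of I "(j, B, P) # ys" 0 "\<lambda>_. 0"] by simp
next
  case False
  have fin: "finite S" using I finite_subset by blast
  define s where "s = real (card S)"
  have s: "0 < s" using fin False by (simp add: s_def card_gt_0_iff)
  have cB: "cuts B P" by (rule tame_cuts[OF B])
  define S' where "S' l k = {i \<in> S. l i = k}" for l :: "nat \<Rightarrow> nat" and k
  define n where "n l k = real (card (S' l k))" for l k
  define \<delta> where "\<delta> = 1/12 - center_var j ys"
  have \<delta>: "0 \<le> \<delta>" using binary_center_var[of j ys] by (simp add: \<delta>_def)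
  define w where "w k = lipsq B P k" for k
  have w: "0 \<le> w k" for k by (simp add: w_def lipsq_def)
  define T where "T k = tail_cost c P k" for k
  have T: "0 \<le> T k" for k by (simp add: T_def tail_cost_def)
  \<comment> \<open>The constant is twice the 96 of \<open>ref_quant_transport\<close>, since a
    square is split by \<open>sum_sq_le\<close>. The integral 4 of \<open>end_weight\<close> later
    turns it into 768.\<close>
  define bet where "bet l k = 192 * c\<^sup>2 *
     (((ecuts l S k - B k)\<^sup>2 / (1 - B k) + (ecuts l S (Suc k) - B (Suc k))\<^sup>2 / (1 - B (Suc k))) / (tail_root (1 - B k))\<^sup>2 +
      ((ecuts l S (Suc k) - B (Suc k))\<^sup>2 / B (Suc k) + (ecuts l S k - B k)\<^sup>2 / B k) / (tail_root (B (Suc k)))\<^sup>2)" for l k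
  have bet: "0 \<le> bet l k" if "k < P" for l k
    unfolding bet_def using cuts_bounds[OF cB, of k] cuts_bounds[OF cB, of "Suc k"] that
    by (intro mult_nonneg_nonneg add_nonneg_nonneg divide_nonneg_nonneg) auto
  define R where "R l k = n l k * (16 * w k * \<delta> + 8 * T k) + 8 * count_loss j ys * w k + 4 * s * bet l k" for l k
  have R: "0 \<le> R l k" if "k < P" for l k
    unfolding R_def n_def using w T \<delta> s bet[OF that] count_loss_nonneg[of j ys] by (intro add_nonneg_nonneg mult_nonneg_nonneg) auto
  let ?D = "\<lambda>ls i v. ennreal ((ref_quant (clip B P (sample_pt ((j, B, P) # ys) ls j i (t i))) - ref_quant (target_pt ((j, B, P) # ys) ls S j i (v j)))\<^sup>2)"
  have point: "?D (l # ls) i v \<le> ennreal (4 * w k) * ennreal ((sample_pt ys ls j i (1/2) - target_pt ys ls (S' l k) j i (v j))\<^sup>2) +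
      (ennreal (12 * w k * \<delta>) + ennreal (2 * T k + s / n l k * bet l k) * ennreal (end_weight (target_pt ys ls (S' l k) j i (v j))))"
    if l: "l \<in> PiE I (\<lambda>_. {..<P})" and ls: "labels I ys ls" and i: "i \<in> S' l k" and k: "k < P"
      and v: "0 < v j" "v j < 1" for l ls i k and v :: "'n \<Rightarrow> real"
  proof -
    define z where "z = sample_pt ys ls j i (t i)"
    define zb where "zb = sample_pt ys ls j i (1/2)"
    define y where "y = target_pt ys ls (S' l k) j i (v j)"
    have iS: "i \<in> S" "l i = k" using i by (auto simp: S'_def)
    have z: "0 \<le> z" "z \<le> 1" unfolding z_def using sample_pt_in_01[OF ys(1) ls, of i "t i" j] t[OF iS(1)] iS(1) I(2) by auto
    have y: "0 < y" "y < 1" unfolding y_def using target_pt_in_01[OF I(1) ls _ i v, of j] I(2) by (auto simp: S'_def)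
    have zz: "(z - zb)\<^sup>2 \<le> 3 * \<delta>" unfolding z_def zb_def \<delta>_def using ls t[OF iS(1)]
      by (intro sample_pt_near_center ys(2)) (auto simp: labels_def dest: list_all2_lengthD)
    have cA: "cuts (ecuts l S) P" using l I(2) False by (intro cuts_ecuts fin) (auto dest: PiE_mem)
    have npos: "0 < n l k" using i fin by (auto simp: n_def card_gt_0_iff S'_def)
    have gap: "ecuts l S (Suc k) - ecuts l S k = n l k / s" by (simp add: ecuts_Suc[OF fin] n_def s_def S'_def)
    have tr: "2 * (ref_quant (cell B k y) - ref_quant (cell (ecuts l S) k y))\<^sup>2 \<le> s / n l k * bet l k * end_weight y"
    proof -
      have "n l k / s * (ref_quant (cell B k y) - ref_quant (cell (ecuts l S) k y))\<^sup>2 \<le> bet l k / 2 * end_weight y"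
      proof -
        have "0 < n l k / s" using npos s by simp
        then have "ecuts l S k < ecuts l S (Suc k)" using gap by linarith
        from ref_quant_transport[OF B cA k this y] show ?thesis unfolding gap bet_def by simp
      qed
      then have "(s / n l k) * (n l k / s * (ref_quant (cell B k y) - ref_quant (cell (ecuts l S) k y))\<^sup>2) \<le> (s / n l k) * (bet l k / 2 * end_weight y)"
        using npos s by (intro mult_left_mono) auto
      moreover have "(s / n l k) * (n l k / s * (ref_quant (cell B k y) - ref_quant (cell (ecuts l S) k y))\<^sup>2) =
        (ref_quant (cell B k y) - ref_quant (cell (ecuts l S) k y))\<^sup>2" using npos s by simp
      moreover have "(s / n l k) * (bet l k / 2 * end_weight y) = (s / n l k * bet l k * end_weight y) / 2" by simp
      moreover have "2 * x \<le> y" if "a \<le> b" "a = x" "b = y / 2" for a b x y :: real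
        using that by linarith
      ultimately show ?thesis by blast
    qed
    have "(ref_quant (clip B P (cell B k z)) - ref_quant (cell (ecuts l S) k y))\<^sup>2 \<le>
       2 * (w k * (z - y)\<^sup>2 + T k * end_weight y) + s / n l k * bet l k * end_weight y"
      unfolding w_def T_def
      by (rule order_trans[OF sum_sq_le[where z = "ref_quant (cell B k y)"] add_mono[OF mult_left_mono[OF ref_quant_local[OF B k z y]] tr]]) simp
    also have "\<dots> \<le> 2 * (w k * (6 * \<delta> + 2 * (zb - y)\<^sup>2) + T k * end_weight y) + s / n l k * bet l k * end_weight y"
      using sum_sq_le[of z y zb] zz w[of k] by (intro add_right_mono mult_left_mono) auto
    also have "\<dots> = 4 * w k * (zb - y)\<^sup>2 + (12 * w k * \<delta> + (2 * T k + s / n l k * bet l k) * end_weight y)"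
      by (simp add: algebra_simps)
    finally have "(ref_quant (clip B P (cell B k z)) - ref_quant (cell (ecuts l S) k y))\<^sup>2 \<le> \<dots>" .
    moreover have "(ref_quant (clip B P (sample_pt ((j, B, P) # ys) (l # ls) j i (t i))) - ref_quant (target_pt ((j, B, P) # ys) (l # ls) S j i (v j))) =
       ref_quant (clip B P (cell B k z)) - ref_quant (cell (ecuts l S) k y)"
      by (simp add: iS z_def y_def S'_def Let_def)
    moreover have "0 \<le> 4 * w k" "0 \<le> 12 * w k * \<delta>" "0 \<le> 2 * T k + s / n l k * bet l k" "0 \<le> end_weight y"
      using w[of k] \<delta> T[of k] s npos bet[OF k, of l] y by (auto simp: end_weight_def)
    ultimately show ?thesis unfolding zb_def[symmetric] y_def[symmetric]
      by (simp only: ennreal_mult'[symmetric] ennreal_plus[symmetric] mult_nonneg_nonneg zero_le_power2 add_nonneg_nonneg) (rule ennreal_leI, simp)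
  qed
  have block: "(\<Sum>i\<in>S' l k. \<integral>\<^sup>+v. ?D (l # ls) i v \<partial>cube) \<le>
     ennreal (4 * w k) * (\<Sum>i\<in>S' l k. \<integral>\<^sup>+v. ennreal ((sample_pt ys ls j i (1/2) - target_pt ys ls (S' l k) j i (v j))\<^sup>2) \<partial>cube) +
     ennreal (12 * w k * \<delta> * n l k + 4 * (2 * T k * n l k + s * bet l k))"
    if l: "l \<in> PiE I (\<lambda>_. {..<P})" and ls: "labels I ys ls" and k: "k < P" for l ls k
  proof (cases "S' l k = {}")
    case False
    have finS': "finite (S' l k)" "S' l k \<subseteq> I" using fin I(2) by (auto simp: S'_def)
    have npos: "0 < n l k" using False finS' by (auto simp: n_def card_gt_0_iff)
    have "(\<Sum>i\<in>S' l k. \<integral>\<^sup>+v. ?D (l # ls) i v \<partial>cube) \<le> (\<Sum>i\<in>S' l k. \<integral>\<^sup>+v.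
       ennreal (4 * w k) * ennreal ((sample_pt ys ls j i (1/2) - target_pt ys ls (S' l k) j i (v j))\<^sup>2) +
      (ennreal (12 * w k * \<delta>) + ennreal (2 * T k + s / n l k * bet l k) * ennreal (end_weight (target_pt ys ls (S' l k) j i (v j)))) \<partial>cube)"
      by (intro sum_mono nn_integral_mono_AE, rule eventually_mono[OF AE_cube]) (rule point[OF l ls _ k], auto)
    also have "\<dots> = ennreal (4 * w k) * (\<Sum>i\<in>S' l k. \<integral>\<^sup>+v. ennreal ((sample_pt ys ls j i (1/2) - target_pt ys ls (S' l k) j i (v j))\<^sup>2) \<partial>cube) +
      (of_nat (card (S' l k)) * ennreal (12 * w k * \<delta>) + ennreal (2 * T k + s / n l k * bet l k) *
        (\<Sum>i\<in>S' l k. \<integral>\<^sup>+v. ennreal (end_weight (target_pt ys ls (S' l k) j i (v j))) \<partial>cube))"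
    proof -
      have [measurable]: "end_weight \<in> borel_measurable borel" unfolding end_weight_def[abs_def] by measurable
      have [simp]: "emeasure cube (space (cube :: ('n \<Rightarrow> real) measure)) = 1" by (rule prob_space.emeasure_space_1) simp
      show ?thesis
        by (simp add: nn_integral_add nn_integral_cmult sum.distrib sum_distrib_left del: space_cube)
    qed
    also have "(\<Sum>i\<in>S' l k. \<integral>\<^sup>+v. ennreal (end_weight (target_pt ys ls (S' l k) j i (v j))) \<partial>(cube :: ('n \<Rightarrow> real) measure)) = of_nat (card (S' l k)) * 4"
    proof -
      have "(\<lambda>y. ennreal (end_weight y)) \<in> borel_measurable borel" by (simp add: end_weight_def)
      from nn_integral_target_pt_component[OF I(1) finS'(2) ls this] show ?thesis by (simp add: nn_integral_end_weight)
    qed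
    also have "of_nat (card (S' l k)) * ennreal (12 * w k * \<delta>) + ennreal (2 * T k + s / n l k * bet l k) * (of_nat (card (S' l k)) * 4) =
       ennreal (n l k * (12 * w k * \<delta>) + (2 * T k + s / n l k * bet l k) * (n l k * 4))"
    proof -
      have "of_nat (card (S' l k)) = ennreal (n l k)" by (simp add: n_def ennreal_of_nat_eq_real_of_nat)
      moreover have "4 = ennreal 4" by simp
      ultimately show ?thesis
        using w[of k] \<delta> T[of k] s npos bet[OF k, of l]
        by (simp only: ennreal_mult'[symmetric] ennreal_mult[symmetric] ennreal_plus[symmetric] mult_nonneg_nonneg add_nonneg_nonneg divide_nonneg_nonneg less_imp_le zero_le_numeral)
    qed
    also have "n l k * (12 * w k * \<delta>) + (2 * T k + s / n l k * bet l k) * (n l k * 4) =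
       12 * w k * \<delta> * n l k + 4 * (2 * T k * n l k + s * bet l k)"
      using npos by (simp add: field_simps)
    finally show ?thesis .
  qed simp
  have "nexpect I ((j, B, P) # ys) (\<lambda>ls. \<Sum>i\<in>S. \<integral>\<^sup>+v. ?D ls i v \<partial>cube) \<le> navg I B P (\<lambda>l. ennreal (\<Sum>k<P. R l k))"
    unfolding nexpect.simps
  proof (rule navg_mono)
    fix l assume l: "l \<in> PiE I (\<lambda>_. {..<P})"
    have lP: "l i < P" if "i \<in> S" for i using l I(2) that by (auto dest: PiE_mem)
    have "nexpect I ys (\<lambda>ls. \<Sum>i\<in>S. \<integral>\<^sup>+v. ?D (l # ls) i v \<partial>cube) \<le>
       nexpect I ys (\<lambda>ls. \<Sum>k<P. ennreal (4 * w k) * (\<Sum>i\<in>S' l k. \<integral>\<^sup>+v. ennreal ((sample_pt ys ls j i (1/2) - target_pt ys ls (S' l k) j i (v j))\<^sup>2) \<partial>cube) +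
         ennreal (12 * w k * \<delta> * n l k + 4 * (2 * T k * n l k + s * bet l k)))"
    proof (rule nexpect_mono)
      fix ls assume ls: "labels I ys ls"
      have "(\<Sum>i\<in>S. \<integral>\<^sup>+v. ?D (l # ls) i v \<partial>cube) = (\<Sum>k<P. \<Sum>i\<in>S' l k. \<integral>\<^sup>+v. ?D (l # ls) i v \<partial>cube)"
        unfolding S'_def by (rule sum_by_label[OF fin lP])
      also have "\<dots> \<le> (\<Sum>k<P. ennreal (4 * w k) * (\<Sum>i\<in>S' l k. \<integral>\<^sup>+v. ennreal ((sample_pt ys ls j i (1/2) - target_pt ys ls (S' l k) j i (v j))\<^sup>2) \<partial>cube) +
         ennreal (12 * w k * \<delta> * n l k + 4 * (2 * T k * n l k + s * bet l k)))"
        by (intro sum_mono block l ls) auto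
      finally show "(\<Sum>i\<in>S. \<integral>\<^sup>+v. ?D (l # ls) i v \<partial>cube) \<le> \<dots>" .
    qed
    also have "\<dots> \<le> (\<Sum>k<P. ennreal (R l k))"
      unfolding nexpect_sum
    proof (rule sum_mono)
      fix k assume "k \<in> {..<P}"
      then have k: "k < P" by simp
      have sub: "S' l k \<subseteq> I" using I(2) by (auto simp: S'_def)
      let ?K = "12 * w k * \<delta> * n l k + 4 * (2 * T k * n l k + s * bet l k)"
      have K: "0 \<le> ?K" using w[of k] \<delta> T[of k] s bet[OF k, of l]
        by (intro add_nonneg_nonneg mult_nonneg_nonneg) (auto simp: n_def)
      have "nexpect I ys (\<lambda>ls. ennreal (4 * w k) * (\<Sum>i\<in>S' l k. \<integral>\<^sup>+v. ennreal ((sample_pt ys ls j i (1/2) - target_pt ys ls (S' l k) j i (v j))\<^sup>2) \<partial>cube) + ennreal ?K) =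
        ennreal (4 * w k) * nexpect I ys (\<lambda>ls. \<Sum>i\<in>S' l k. \<integral>\<^sup>+v. ennreal ((sample_pt ys ls j i (1/2) - target_pt ys ls (S' l k) j i (v j))\<^sup>2) \<partial>cube) + ennreal ?K"
        unfolding nexpect_add nexpect_cmult nexpect_const[OF I(1) ys(1) K] ..
      also have "\<dots> \<le> ennreal (4 * w k) * ennreal (n l k * \<delta> + 2 * count_loss j ys * of_bool (S' l k \<noteq> {})) + ennreal ?K"
        using nexpect_fine[OF I(1) sub ys] unfolding n_def \<delta>_def by (intro add_right_mono mult_left_mono) auto
      also have "\<dots> \<le> ennreal (4 * w k) * ennreal (n l k * \<delta> + 2 * count_loss j ys) + ennreal ?K"
        using count_loss_nonneg[of j ys] by (intro add_right_mono mult_left_mono ennreal_leI) auto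
      also have "\<dots> = ennreal (4 * w k * (n l k * \<delta> + 2 * count_loss j ys) + ?K)"
      proof -
        have "0 \<le> 4 * w k" "0 \<le> n l k * \<delta> + 2 * count_loss j ys" using w[of k] \<delta> count_loss_nonneg[of j ys] by (auto simp: n_def)
        then show ?thesis using K by (simp add: ennreal_mult ennreal_plus)
      qed
      also have "4 * w k * (n l k * \<delta> + 2 * count_loss j ys) + ?K = R l k" by (simp add: R_def algebra_simps)
      finally show "nexpect I ys (\<lambda>ls. ennreal (4 * w k) * (\<Sum>i\<in>S' l k. \<integral>\<^sup>+v. ennreal ((sample_pt ys ls j i (1/2) - target_pt ys ls (S' l k) j i (v j))\<^sup>2) \<partial>cube) + ennreal ?K)
        \<le> ennreal (R l k)" .
    qed
    also have "\<dots> = ennreal (\<Sum>k<P. R l k)" using R by (intro sum_ennreal) auto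
    finally show "nexpect I ys (\<lambda>ls. \<Sum>i\<in>S. \<integral>\<^sup>+v. ?D (l # ls) i v \<partial>cube) \<le> ennreal (\<Sum>k<P. R l k)" .
  qed
  also have "\<dots> = ennreal (avg I B P (\<lambda>l. \<Sum>k<P. R l k))"
    using R by (intro navg_ennreal cB sum_nonneg) auto
  also have "avg I B P (\<lambda>l. \<Sum>k<P. R l k) =
     (\<Sum>k<P. s * ((B (Suc k) - B k) * (16 * w k * \<delta> + 8 * T k)) + 8 * count_loss j ys * w k + 768 * c\<^sup>2 * count_cost B P k)"
    unfolding avg_sum
  proof (intro sum.cong refl)
    fix k assume "k \<in> {..<P}"
    then have k: "k < P" by simp
    have n: "avg I B P (\<lambda>l. n l k) = s * (B (Suc k) - B k)"
      unfolding n_def s_def S'_def by (rule avg_card[OF I(1) cB I(2) k])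
    let ?E = "\<lambda>m l. (ecuts l S m - B m)\<^sup>2"
    let ?g1 = "(tail_root (1 - B k))\<^sup>2" and ?g2 = "(tail_root (B (Suc k)))\<^sup>2"
    have E: "avg I B P (?E m) = B m * (1 - B m) / s" if "m \<le> P" for m
      unfolding s_def by (rule avg_ecuts_sq[OF I(1) cB I(2) False that])
    have "avg I B P (\<lambda>l. bet l k) = avg I B P (\<lambda>l. (192 * c\<^sup>2 / (1 - B k) / ?g1) * ?E k l +
       (192 * c\<^sup>2 / (1 - B (Suc k)) / ?g1) * ?E (Suc k) l + (192 * c\<^sup>2 / B (Suc k) / ?g2) * ?E (Suc k) l +
       (192 * c\<^sup>2 / B k / ?g2) * ?E k l)"
      by (intro avg_cong) (simp add: bet_def distrib_left add_divide_distrib)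
    also have "\<dots> = (192 * c\<^sup>2 / (1 - B k) / ?g1) * (B k * (1 - B k) / s) +
       (192 * c\<^sup>2 / (1 - B (Suc k)) / ?g1) * (B (Suc k) * (1 - B (Suc k)) / s) +
       (192 * c\<^sup>2 / B (Suc k) / ?g2) * (B (Suc k) * (1 - B (Suc k)) / s) +
       (192 * c\<^sup>2 / B k / ?g2) * (B k * (1 - B k) / s)"
      unfolding avg_add avg_cmult using k by (simp add: E)
    \<comment> \<open>The variance \<open>B k * (1 - B k) / s\<close> cancels against the tail mass
      in the denominator. At k = 0 or \<open>Suc k = P\<close> that mass can be 0 and the quotient
      is then 0, which is the origin of the two conditionals in \<open>count_cost\<close>.\<close>
    also have "\<dots> = 192 * c\<^sup>2 / s * count_cost B P k"
    proof -
      have cancel1: "(C / d / g) * (b * d / s) = C / s * (b / g)" if "d \<noteq> 0" for C d g b :: real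
        using that by (simp add: mult.commute)
      have cancel2: "(C / b / g) * (b * d / s) = C / s * (d / g)" if "b \<noteq> 0" for C d g b :: real
        using that by (simp add: mult.commute)
      have 1: "(192 * c\<^sup>2 / (1 - B k) / ?g1) * (B k * (1 - B k) / s) = 192 * c\<^sup>2 / s * (B k / ?g1)"
        using tame_pos(2)[OF B, of k] k by (intro cancel1) simp
      have 2: "(192 * c\<^sup>2 / (1 - B (Suc k)) / ?g1) * (B (Suc k) * (1 - B (Suc k)) / s) =
        192 * c\<^sup>2 / s * ((if Suc k < P then B (Suc k) else 0) / ?g1)"
      proof (cases "Suc k < P")
        case True
        then show ?thesis using tame_pos(2)[OF B, of "Suc k"] by (simp only: if_True) (intro cancel1, simp)
      next
        case False
        then have "Suc k = P" using k by simp
        then show ?thesis using B by (simp add: tame_def)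
      qed
      have 3: "(192 * c\<^sup>2 / B (Suc k) / ?g2) * (B (Suc k) * (1 - B (Suc k)) / s) = 192 * c\<^sup>2 / s * ((1 - B (Suc k)) / ?g2)"
        using tame_pos(1)[OF B, of "Suc k"] k by (intro cancel2) simp
      have 4: "(192 * c\<^sup>2 / B k / ?g2) * (B k * (1 - B k) / s) = 192 * c\<^sup>2 / s * ((if 0 < k then 1 - B k else 0) / ?g2)"
      proof (cases "0 < k")
        case True
        then show ?thesis using tame_pos(1)[OF B, of k] k by (simp only: if_True) (intro cancel2, simp)
      next
        case False
        then show ?thesis using B by (simp add: tame_def)
      qed
      show ?thesis unfolding 1 2 3 4 count_cost_def by (simp only: distrib_left add_divide_distrib)
    qed
    finally have b: "avg I B P (\<lambda>l. bet l k) = 192 * c\<^sup>2 / s * count_cost B P k" .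
    have "avg I B P (\<lambda>l. R l k) = avg I B P (\<lambda>l. (16 * w k * \<delta> + 8 * T k) * n l k + 8 * count_loss j ys * w k + (4 * s) * bet l k)"
      by (intro avg_cong) (simp add: R_def)
    also have "\<dots> = (16 * w k * \<delta> + 8 * T k) * (s * (B (Suc k) - B k)) + 8 * count_loss j ys * w k + (4 * s) * (192 * c\<^sup>2 / s * count_cost B P k)"
      unfolding avg_add avg_cmult avg_const[OF I(1) cB] n b ..
    finally show "avg I B P (\<lambda>l. R l k) = s * ((B (Suc k) - B k) * (16 * w k * \<delta> + 8 * T k)) + 8 * count_loss j ys * w k + 768 * c\<^sup>2 * count_cost B P k"
      using s by simp
  qed
  also have "\<dots> = s * (\<Sum>k<P. (B (Suc k) - B k) * (16 * w k * \<delta> + 8 * T k)) + (8 * count_loss j ys * (\<Sum>k<P. w k) + 768 * c\<^sup>2 * (\<Sum>k<P. count_cost B P k))"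
    by (simp add: sum.distrib sum_distrib_left)
  finally show ?thesis using False by (simp add: s_def w_def T_def \<delta>_def)
qed

section \<open>Combining the operations of all axes\<close>

text \<open>An operation along another axis leaves coordinate j alone and splits S into at most P
  groups. The part of the bound proportional to the group sizes adds up unchanged, the part paid per
  group is paid up to P times.\<close>

lemma nexpect_skip:
  fixes h :: "nat \<Rightarrow> real \<Rightarrow> real \<Rightarrow> ennreal" and j :: "'n::finite"
  assumes I: "finite I" and "a \<noteq> j" and B: "cuts B P" and A: "0 \<le> A" "0 \<le> C"
    and IH: "\<And>S. S \<subseteq> I \<Longrightarrow> nexpect I xs (\<lambda>ls. \<Sum>i\<in>S. \<integral>\<^sup>+v. h i (sample_pt xs ls j i (t i)) (target_pt xs ls S j i (v j)) \<partial>cube) \<le>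
      ennreal (real (card S) * A + C * of_bool (S \<noteq> {}))"
    and S: "S \<subseteq> I"
  shows "nexpect I ((a, B, P) # xs) (\<lambda>ls. \<Sum>i\<in>S. \<integral>\<^sup>+v. h i (sample_pt ((a, B, P) # xs) ls j i (t i)) (target_pt ((a, B, P) # xs) ls S j i (v j)) \<partial>cube) \<le>
      ennreal (real (card S) * A + real P * C * of_bool (S \<noteq> {}))"
proof (cases "S = {}")
  case True
  then show ?thesis using nexpect_cmult[of I "(a, B, P) # xs" 0 "\<lambda>_. 0"] by simp
next
  case False
  have fin: "finite S" using I S finite_subset by blast
  define S' where "S' l k = {i \<in> S. l i = k}" for l :: "nat \<Rightarrow> nat" and k
  have "nexpect I ((a, B, P) # xs) (\<lambda>ls. \<Sum>i\<in>S. \<integral>\<^sup>+v. h i (sample_pt ((a, B, P) # xs) ls j i (t i)) (target_pt ((a, B, P) # xs) ls S j i (v j)) \<partial>cube) \<le>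
    navg I B P (\<lambda>l. ennreal (real (card S) * A + real P * C))"
    unfolding nexpect.simps
  proof (rule navg_mono)
    fix l assume l: "l \<in> PiE I (\<lambda>_. {..<P})"
    have lP: "l i < P" if "i \<in> S" for i using l S that by (auto dest: PiE_mem)
    have sub: "S' l k \<subseteq> I" for k using S by (auto simp: S'_def)
    have "nexpect I xs (\<lambda>ls. \<Sum>i\<in>S. \<integral>\<^sup>+v. h i (sample_pt ((a, B, P) # xs) (l # ls) j i (t i)) (target_pt ((a, B, P) # xs) (l # ls) S j i (v j)) \<partial>cube) =
      nexpect I xs (\<lambda>ls. \<Sum>k<P. \<Sum>i\<in>S' l k. \<integral>\<^sup>+v. h i (sample_pt xs ls j i (t i)) (target_pt xs ls (S' l k) j i (v j)) \<partial>cube)"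
    proof (rule arg_cong[where f = "nexpect I xs"], rule ext)
      fix ls
      have "(\<Sum>i\<in>S. \<integral>\<^sup>+v. h i (sample_pt ((a, B, P) # xs) (l # ls) j i (t i)) (target_pt ((a, B, P) # xs) (l # ls) S j i (v j)) \<partial>cube) =
        (\<Sum>k<P. \<Sum>i\<in>S' l k. \<integral>\<^sup>+v. h i (sample_pt ((a, B, P) # xs) (l # ls) j i (t i)) (target_pt ((a, B, P) # xs) (l # ls) S j i (v j)) \<partial>cube)"
        unfolding S'_def by (rule sum_by_label[OF fin lP])
      also have "\<dots> = (\<Sum>k<P. \<Sum>i\<in>S' l k. \<integral>\<^sup>+v. h i (sample_pt xs ls j i (t i)) (target_pt xs ls (S' l k) j i (v j)) \<partial>cube)"
        using assms(2) by (intro sum.cong refl) (auto simp: S'_def Let_def)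
      finally show "(\<Sum>i\<in>S. \<integral>\<^sup>+v. h i (sample_pt ((a, B, P) # xs) (l # ls) j i (t i)) (target_pt ((a, B, P) # xs) (l # ls) S j i (v j)) \<partial>cube) = \<dots>" .
    qed
    also have "\<dots> \<le> (\<Sum>k<P. ennreal (real (card (S' l k)) * A + C))"
      unfolding nexpect_sum[of I xs _ "{..<P}"]
    proof (rule sum_mono)
      fix k
      have "ennreal (real (card (S' l k)) * A + C * of_bool (S' l k \<noteq> {})) \<le> ennreal (real (card (S' l k)) * A + C)"
        using A by (intro ennreal_leI) auto
      from order_trans[OF IH[OF sub] this]
      show "nexpect I xs (\<lambda>ls. \<Sum>i\<in>S' l k. \<integral>\<^sup>+v. h i (sample_pt xs ls j i (t i)) (target_pt xs ls (S' l k) j i (v j)) \<partial>cube) \<le>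
        ennreal (real (card (S' l k)) * A + C)" .
    qed
    also have "\<dots> = ennreal (\<Sum>k<P. real (card (S' l k)) * A + C)"
      using A by (intro sum_ennreal) auto
    also have "(\<Sum>k<P. real (card (S' l k)) * A + C) = real (card S) * A + real P * C"
      using sum_by_label[OF fin lP, where f = "\<lambda>_. 1::real"]
      by (simp add: sum.distrib S'_def flip: sum_distrib_right)
    finally show "nexpect I xs (\<lambda>ls. \<Sum>i\<in>S. \<integral>\<^sup>+v. h i (sample_pt ((a, B, P) # xs) (l # ls) j i (t i)) (target_pt ((a, B, P) # xs) (l # ls) S j i (v j)) \<partial>cube) \<le>
      ennreal (real (card S) * A + real P * C)" .
  qed
  also have "\<dots> = ennreal (real (card S) * A + real P * C)"
    using A by (subst navg_ennreal[OF B]) (simp_all add: avg_const[OF I B])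
  finally show ?thesis using False by simp
qed

definition coarse_ops :: "(nat \<Rightarrow> real) \<Rightarrow> nat \<Rightarrow> 'n list \<Rightarrow> ('n \<times> (nat \<Rightarrow> real) \<times> nat) list" where
  "coarse_ops B P ax = map (\<lambda>a. (a, B, P)) ax"

definition fine_ops :: "nat \<Rightarrow> 'n list \<Rightarrow> ('n \<times> (nat \<Rightarrow> real) \<times> nat) list" where
  "fine_ops K ax = concat (replicate K (map (\<lambda>a. (a, halves, 2)) ax))"

lemma fine_Suc: "fine_ops (Suc K) ax = coarse_ops halves 2 ax @ fine_ops K ax"
  by (simp add: fine_ops_def coarse_ops_def)

lemma specs_coarse: "cuts B P \<Longrightarrow> specs (coarse_ops B P ax)"
  by (induction ax) (auto simp: coarse_ops_def)

lemma specs_fine: "specs (fine_ops K ax)"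
proof (induction K)
  case (Suc K)
  then show ?case by (simp add: fine_Suc specs_coarse[OF cuts_halves])
qed (simp add: fine_ops_def)

lemma binary_coarse_notin: "j \<notin> set ax \<Longrightarrow> binary j (coarse_ops B P ax)"
  by (induction ax) (auto simp: coarse_ops_def)

lemma binary_fine: "binary j (fine_ops K ax)"
proof (induction K)
  case (Suc K)
  have "binary j (coarse_ops halves 2 ax)" by (induction ax) (auto simp: coarse_ops_def)
  then show ?case using Suc by (simp add: fine_Suc)
qed (simp add: fine_ops_def)

lemma center_var_coarse_notin: "j \<notin> set ax \<Longrightarrow> center_var j (coarse_ops B P ax @ ys) = center_var j ys"
  by (induction ax) (auto simp: coarse_ops_def)

lemma count_loss_coarse_notin: "j \<notin> set ax \<Longrightarrow> count_loss j (coarse_ops B P ax @ ys) = real P ^ length ax * count_loss j ys"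
  by (induction ax) (auto simp: coarse_ops_def)

lemma coarse_split: "coarse_ops B P (xs @ a # ys) @ zs = coarse_ops B P xs @ (a, B, P) # (coarse_ops B P ys @ zs)"
  by (simp add: coarse_ops_def)

lemma center_var_fine:
  assumes "distinct ax" "j \<in> set ax"
  shows "1/12 - center_var j (fine_ops K ax) = 1 / (12 * 4 ^ K)"
proof (induction K)
  case (Suc K)
  obtain pre post where ax: "ax = pre @ j # post" using assms(2) by (auto simp: in_set_conv_decomp)
  have "j \<notin> set pre" "j \<notin> set post" using assms(1) ax by auto
  then have "center_var j (fine_ops (Suc K) ax) = 1/16 + center_var j (fine_ops K ax) / 4"
    unfolding fine_Suc unfolding ax coarse_split by (simp add: center_var_coarse_notin)
  then have "1/12 - center_var j (fine_ops (Suc K) ax) = (1/12 - center_var j (fine_ops K ax)) / 4" by simp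
  then show ?case unfolding Suc by simp
qed (simp add: fine_ops_def)

text \<open>In one round the digits of the other axes double the number of groups and the digit of j
  halves the loss of what follows, whence the ratio. The fresh loss is
  \<open>2 ^ length pre / 16\<close>, at most \<open>2 ^ length ax / 32\<close> because j itself is
  not in \<open>pre\<close>.\<close>

lemma count_loss_fine:
  assumes "distinct ax" "j \<in> set ax"
  shows "count_loss j (fine_ops K ax) \<le> 2 ^ length ax / 32 * (\<Sum>k<K. (2 ^ length ax / 4) ^ k)"
proof (induction K)
  case (Suc K)
  obtain pre post where ax: "ax = pre @ j # post" using assms(2) by (auto simp: in_set_conv_decomp)
  have notin: "j \<notin> set pre" "j \<notin> set post" using assms(1) ax by auto
  let ?q = "2 ^ length ax / 4 :: real"
  have q: "?q = 2 ^ length pre * 2 ^ length post / 2" by (simp add: ax power_add)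
  have "count_loss j (fine_ops (Suc K) ax) = 2 ^ length pre * (1/16 + 2 ^ length post * count_loss j (fine_ops K ax) / 2)"
    unfolding fine_Suc unfolding ax coarse_split using notin by (simp add: count_loss_coarse_notin)
  also have "\<dots> = 2 ^ length pre / 16 + ?q * count_loss j (fine_ops K ax)" unfolding q by (simp add: field_simps)
  also have "\<dots> \<le> 2 ^ length ax / 32 + ?q * (2 ^ length ax / 32 * (\<Sum>k<K. ?q ^ k))"
    using Suc by (intro add_mono mult_left_mono) (simp_all add: ax power_add)
  also have "\<dots> = 2 ^ length ax / 32 * (\<Sum>k<Suc K. ?q ^ k)"
    by (subst sum.lessThan_Suc_shift) (simp add: sum_distrib_left algebra_simps)
  finally show ?case .
qed (simp add: fine_ops_def)

lemma nexpect_skip_coarse: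
  fixes h :: "nat \<Rightarrow> real \<Rightarrow> real \<Rightarrow> ennreal" and j :: "'n::finite"
  assumes I: "finite I" and B: "cuts B P" and A: "0 \<le> A" "0 \<le> C"
    and xs: "\<And>S. S \<subseteq> I \<Longrightarrow> nexpect I xs (\<lambda>ls. \<Sum>i\<in>S. \<integral>\<^sup>+v. h i (sample_pt xs ls j i (t i)) (target_pt xs ls S j i (v j)) \<partial>cube) \<le>
      ennreal (real (card S) * A + C * of_bool (S \<noteq> {}))"
    and ax: "j \<notin> set ax" and S: "S \<subseteq> I"
  shows "nexpect I (coarse_ops B P ax @ xs) (\<lambda>ls. \<Sum>i\<in>S. \<integral>\<^sup>+v. h i (sample_pt (coarse_ops B P ax @ xs) ls j i (t i)) (target_pt (coarse_ops B P ax @ xs) ls S j i (v j)) \<partial>cube) \<le>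
      ennreal (real (card S) * A + real P ^ length ax * C * of_bool (S \<noteq> {}))"
  using ax S
proof (induction ax arbitrary: S)
  case Nil
  then show ?case using xs by (simp add: coarse_ops_def)
next
  case (Cons a ax)
  have eq: "coarse_ops B P (a # ax) @ xs = (a, B, P) # (coarse_ops B P ax @ xs)" by (simp add: coarse_ops_def)
  have "nexpect I (coarse_ops B P (a # ax) @ xs) (\<lambda>ls. \<Sum>i\<in>S. \<integral>\<^sup>+v. h i (sample_pt (coarse_ops B P (a # ax) @ xs) ls j i (t i)) (target_pt (coarse_ops B P (a # ax) @ xs) ls S j i (v j)) \<partial>cube) \<le>
      ennreal (real (card S) * A + real P * (real P ^ length ax * C) * of_bool (S \<noteq> {}))"
    unfolding eq
  proof (rule nexpect_skip)
    show "nexpect I (coarse_ops B P ax @ xs) (\<lambda>ls. \<Sum>i\<in>S'. \<integral>\<^sup>+v. h i (sample_pt (coarse_ops B P ax @ xs) ls j i (t i)) (target_pt (coarse_ops B P ax @ xs) ls S' j i (v j)) \<partial>cube) \<le>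
      ennreal (real (card S') * A + (real P ^ length ax * C) * of_bool (S' \<noteq> {}))" if "S' \<subseteq> I" for S'
      using Cons.IH[OF _ that] Cons.prems by simp
  qed (use Cons.prems I B A in auto)
  then show ?case by (simp add: mult.assoc)
qed

lemma lipsq_nonneg: "0 \<le> lipsq B P k"
  by (simp add: lipsq_def)

lemma tail_cost_nonneg: "0 \<le> tail_cost c P k"
  by (simp add: tail_cost_def)

lemma count_cost_nonneg: "cuts B P \<Longrightarrow> k < P \<Longrightarrow> 0 \<le> count_cost B P k"
  unfolding count_cost_def using cuts_bounds[of B P k] cuts_bounds[of B P "Suc k"]
  by (intro add_nonneg_nonneg divide_nonneg_nonneg) auto

text \<open>The coarse axes before j multiply the whole cost per group by P, those after j only its
  \<open>count_loss\<close>; both are bounded by the power with exponent one less than the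
  dimension. The positions t are arbitrary, so that they can be integrated out afterwards.\<close>

lemma coordinate_bound:
  fixes j :: "'n::finite" and K :: nat
  assumes I: "finite I" and B: "tame c B P" and ax: "distinct ax" "set ax = (UNIV :: 'n set)"
    and t: "\<And>i. i \<in> I \<Longrightarrow> 0 \<le> t i \<and> t i \<le> 1"
  defines "xs \<equiv> coarse_ops B P ax @ fine_ops K ax"
  shows "nexpect I xs (\<lambda>ls. \<Sum>i\<in>I. \<integral>\<^sup>+v. ennreal ((ref_quant (clip B P (sample_pt xs ls j i (t i))) - ref_quant (target_pt xs ls I j i (v j)))\<^sup>2) \<partial>cube) \<le>
    ennreal (real (card I) * (\<Sum>k<P. (B (Suc k) - B k) * (2 * lipsq B P k / 4 ^ K + 8 * tail_cost c P k)) +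
      real P ^ (CARD('n) - 1) * (2 ^ CARD('n) * (\<Sum>k<K. (2 ^ CARD('n) / 4) ^ k) * (\<Sum>k<P. lipsq B P k) +
        768 * c\<^sup>2 * (\<Sum>k<P. count_cost B P k)))"
proof -
  have N: "length ax = CARD('n)" using ax distinct_card by metis
  obtain pre post where split: "ax = pre @ j # post" using ax(2) by (metis UNIV_I in_set_conv_decomp)
  have notin: "j \<notin> set pre" "j \<notin> set post" using ax(1) split by auto
  define ys where "ys = coarse_ops B P post @ fine_ops K ax"
  have cB: "cuts B P" by (rule tame_cuts[OF B])
  have P: "1 \<le> real P" using B by (simp add: tame_def)
  have ys: "specs ys" "binary j ys"
    using notin by (simp_all add: ys_def specs_coarse[OF cB] specs_fine binary_fine binary_coarse_notin)
  have xs: "xs = coarse_ops B P pre @ (j, B, P) # ys"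
    unfolding xs_def ys_def by (subst split) (rule coarse_split)
  have lips: "0 \<le> (\<Sum>k<P. lipsq B P k)" by (intro sum_nonneg lipsq_nonneg)
  have hcs: "0 \<le> (\<Sum>k<P. count_cost B P k)" using count_cost_nonneg[OF cB] by (intro sum_nonneg) auto
  have center_var: "1/12 - center_var j ys = 1 / (12 * 4 ^ K)"
    using center_var_fine[OF ax(1), of j K] ax(2) notin by (simp add: ys_def center_var_coarse_notin)
  let ?A = "\<Sum>k<P. (B (Suc k) - B k) * (16 * lipsq B P k * (1/12 - center_var j ys) + 8 * tail_cost c P k)"
  let ?A' = "\<Sum>k<P. (B (Suc k) - B k) * (2 * lipsq B P k / 4 ^ K + 8 * tail_cost c P k)"
  let ?C = "8 * count_loss j ys * (\<Sum>k<P. lipsq B P k) + 768 * c\<^sup>2 * (\<Sum>k<P. count_cost B P k)"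
  let ?s = "\<Sum>k<K. (2 ^ CARD('n) / 4) ^ k :: real"
  let ?C' = "2 ^ CARD('n) * ?s * (\<Sum>k<P. lipsq B P k) + 768 * c\<^sup>2 * (\<Sum>k<P. count_cost B P k)"
  have Bk: "0 \<le> B (Suc k) - B k" if "k < P" for k using cB that by (simp add: cuts_def)
  have A: "0 \<le> ?A"
    unfolding center_var using Bk by (intro sum_nonneg mult_nonneg_nonneg add_nonneg_nonneg lipsq_nonneg tail_cost_nonneg) auto
  have C: "0 \<le> ?C" using lips hcs count_loss_nonneg[of j ys] by simp
  have "nexpect I xs (\<lambda>ls. \<Sum>i\<in>I. \<integral>\<^sup>+v. ennreal ((ref_quant (clip B P (sample_pt xs ls j i (t i))) - ref_quant (target_pt xs ls I j i (v j)))\<^sup>2) \<partial>cube) \<le>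
    ennreal (real (card I) * ?A + real P ^ length pre * ?C * of_bool (I \<noteq> {}))"
    unfolding xs
  proof (rule nexpect_skip_coarse[where h = "\<lambda>i x y. ennreal ((ref_quant (clip B P x) - ref_quant y)\<^sup>2)"])
    fix S assume S: "S \<subseteq> I"
    show "nexpect I ((j, B, P) # ys) (\<lambda>ls. \<Sum>i\<in>S. \<integral>\<^sup>+v. ennreal ((ref_quant (clip B P (sample_pt ((j, B, P) # ys) ls j i (t i))) -
        ref_quant (target_pt ((j, B, P) # ys) ls S j i (v j)))\<^sup>2) \<partial>cube) \<le> ennreal (real (card S) * ?A + ?C * of_bool (S \<noteq> {}))"
      by (rule coarse_bound[OF I S B ys]) (use t S in auto)
  qed (use I cB A C notin in auto)
  also have "\<dots> \<le> ennreal (real (card I) * ?A' + real P ^ (CARD('n) - 1) * ?C')"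
  proof (intro ennreal_leI add_mono mult_left_mono)
    show "?A \<le> ?A'"
    proof (intro sum_mono mult_left_mono add_right_mono)
      fix k
      have "16 * lipsq B P k * (1 / (12 * 4 ^ K)) \<le> 2 * lipsq B P k / 4 ^ K"
        using lipsq_nonneg[of B P k] by (simp add: field_simps)
      then show "16 * lipsq B P k * (1/12 - center_var j ys) \<le> 2 * lipsq B P k / 4 ^ K" unfolding center_var .
    qed (use Bk in auto)
    have Nl: "CARD('n) - 1 = length pre + length post" using N split by simp
    have count_loss: "8 * count_loss j ys \<le> real P ^ length post * (2 ^ CARD('n) * ?s)"
    proof -
      have s: "0 \<le> ?s" by (intro sum_nonneg) auto
      have "count_loss j ys = real P ^ length post * count_loss j (fine_ops K ax)"
        using notin by (simp add: ys_def count_loss_coarse_notin)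
      moreover have "8 * count_loss j (fine_ops K ax) \<le> 2 ^ CARD('n) * ?s"
      proof -
        have "32 * count_loss j (fine_ops K ax) \<le> 2 ^ CARD('n) * ?s"
          using count_loss_fine[OF ax(1), of j K] ax(2) unfolding N by simp
        then show ?thesis using count_loss_nonneg[of j "fine_ops K ax"] by linarith
      qed
      then have "real P ^ length post * (8 * count_loss j (fine_ops K ax)) \<le> real P ^ length post * (2 ^ CARD('n) * ?s)"
        by (intro mult_left_mono) auto
      ultimately show ?thesis by simp
    qed
    have "?C \<le> real P ^ length post * (2 ^ CARD('n) * ?s) * (\<Sum>k<P. lipsq B P k) + real P ^ length post * (768 * c\<^sup>2 * (\<Sum>k<P. count_cost B P k))"
    proof (intro add_mono mult_right_mono count_loss lips)
      have "1 \<le> real P ^ length post" using P by simp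
      then show "768 * c\<^sup>2 * (\<Sum>k<P. count_cost B P k) \<le> real P ^ length post * (768 * c\<^sup>2 * (\<Sum>k<P. count_cost B P k))"
        using mult_right_mono[of 1 "real P ^ length post" "768 * c\<^sup>2 * (\<Sum>k<P. count_cost B P k)"] hcs by simp
    qed
    also have "\<dots> = real P ^ length post * ?C'" by (simp add: algebra_simps)
    finally have "real P ^ length pre * ?C \<le> real P ^ length pre * (real P ^ length post * ?C')"
      by (intro mult_left_mono) auto
    moreover have "real P ^ length pre * ?C * of_bool (I \<noteq> {}) \<le> real P ^ length pre * ?C" using C P by (auto simp: of_bool_def)
    ultimately show "real P ^ length pre * ?C * of_bool (I \<noteq> {}) \<le> real P ^ (CARD('n) - 1) * ?C'"
      unfolding Nl power_add by (simp add: mult.assoc)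
  qed auto
  finally show ?thesis .
qed

section \<open>The distance from an empirical measure\<close>

lemma space_orthant_borel [simp]: "space orthant_borel = pos_orthant"
  by (simp add: orthant_borel_def space_restrict_space)

lemma sets_laguerre [simp]: "sets (laguerre_measure \<alpha>) = sets orthant_borel"
  by (simp add: laguerre_measure_def orthant_borel_def cong: sets_restrict_space_cong)

lemma sets_empirical [simp]: "sets (empirical_measure n x) = sets orthant_borel"
  by (simp add: empirical_measure_def)

lemma space_empirical [simp]: "space (empirical_measure n x) = pos_orthant"
  by (simp add: empirical_measure_def)

lemma borel_orthant: fixes f :: "real ^ 'N \<Rightarrow> 'b::topological_space" shows "f \<in> borel_measurable borel \<Longrightarrow> f \<in> borel_measurable orthant_borel"
  unfolding orthant_borel_def by (rule measurable_restrict_space1)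

lemma singleton_orthant: "a \<in> pos_orthant \<Longrightarrow> {a} \<in> sets orthant_borel"
  unfolding orthant_borel_def by (subst sets_restrict_space) force

lemma continuous_on_rho_vec [continuous_intros]:
  assumes "continuous_on S f" "continuous_on S g"
  shows "continuous_on S (\<lambda>x. rho_vec (f x) (g x))"
  unfolding rho_vec_def rho_def by (intro continuous_intros assms)

text \<open>After taking square roots of the coordinates, \<open>rho_vec\<close> is twice the
  Euclidean distance.\<close>

lemma rho_vec_triangle: "rho_vec x z \<le> rho_vec x y + rho_vec y z"
proof -
  have eq: "rho_vec x y = 2 * norm ((\<chi> j. sqrt (x $ j)) - (\<chi> j. sqrt (y $ j)))" for x y :: "real ^ 'a"
  proof -
    have "rho_vec x y = sqrt (4 * (\<Sum>j\<in>UNIV. (sqrt (x $ j) - sqrt (y $ j))\<^sup>2))"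
      by (simp add: rho_vec_def rho_def power_mult_distrib sum_distrib_left)
    then show ?thesis by (simp add: norm_vec_def L2_set_def real_sqrt_mult)
  qed
  show ?thesis
    unfolding eq using norm_triangle_ineq[of "(\<chi> j. sqrt (x $ j)) - (\<chi> j. sqrt (y $ j))" "(\<chi> j. sqrt (y $ j)) - (\<chi> j. sqrt (z $ j))"]
    by simp
qed

lemma rho_vec_nonneg [simp]: "0 \<le> rho_vec x y"
  by (simp add: rho_vec_def sum_nonneg)

lemma rho_vec_refl [simp]: "rho_vec x x = 0"
  by (simp add: rho_vec_def rho_def)

lemma W2_sq: "(W2 \<mu> \<nu>)\<^sup>2 = (INF \<gamma>\<in>couplings \<mu> \<nu>. \<integral>\<^sup>+ (x, y). ennreal ((rho_vec x y)\<^sup>2) \<partial>\<gamma>)"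
  unfolding W2_def by (rule ennreal_sqrt_power2)

section \<open>Index couplings and measurability of the distance\<close>

text \<open>Couplings with the uniform law on the indices form the same set for all samples; the
  sample occurs in the integrand alone. This makes the dependence of the distance on the sample
  accessible to continuity arguments, and its measurability is what the change to another
  probability space requires.\<close>

definition index_cost :: "(nat \<Rightarrow> real ^ 'N) \<Rightarrow> (nat \<times> (real ^ 'N)) measure \<Rightarrow> ennreal" where
  "index_cost x \<eta> = (\<integral>\<^sup>+ (i, y). ennreal ((rho_vec (x i) y)\<^sup>2) \<partial>\<eta>)"

lemma sets_uniform_count_pair:
  "sets (uniform_count_measure A \<Otimes>\<^sub>M \<nu>) = sets (count_space A \<Otimes>\<^sub>M \<nu>)"
  by (rule sets_pair_measure_cong) (simp_all add: sets_uniform_count_measure_count_space)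

lemma measurable_rho_vec_snd:
  fixes x :: "nat \<Rightarrow> real ^ 'N"
  assumes "sets \<nu> = sets orthant_borel"
  shows "(\<lambda>(i, y). ennreal ((rho_vec (x i) y)\<^sup>2)) \<in> borel_measurable (uniform_count_measure {1..n} \<Otimes>\<^sub>M \<nu>)"
proof -
  have "(\<lambda>y. ennreal ((rho_vec (x i) y)\<^sup>2)) \<in> borel_measurable \<nu>" for i
  proof -
    have "(\<lambda>y. rho_vec (x i) y) \<in> borel_measurable borel"
      by (intro borel_measurable_continuous_onI continuous_intros)
    then have "(\<lambda>y. ennreal ((rho_vec (x i) y)\<^sup>2)) \<in> borel_measurable borel" by simp
    then have "(\<lambda>y. ennreal ((rho_vec (x i) y)\<^sup>2)) \<in> borel_measurable orthant_borel" by (rule borel_orthant)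
    then show ?thesis using assms by (simp cong: measurable_cong_sets)
  qed
  then have "(\<lambda>(i, y). ennreal ((rho_vec (x i) y)\<^sup>2)) \<in> borel_measurable (count_space {1..n} \<Otimes>\<^sub>M \<nu>)"
    by (intro measurable_pair_measure_countable1) (auto simp: case_prod_beta intro: countable_finite)
  then show ?thesis
    using measurable_cong_sets[OF sets_uniform_count_pair refl] by blast
qed

text \<open>Replacing the index i by the point \<open>x i\<close> pushes an index coupling forward
  to a coupling with the empirical measure, at the same cost.\<close>

lemma W2_sq_le_index_cost:
  fixes x :: "nat \<Rightarrow> real ^ 'N"
  assumes x: "\<And>i. i \<in> {1..n} \<Longrightarrow> x i \<in> pos_orthant"
    and \<nu>: "sets \<nu> = sets orthant_borel" and \<eta>: "\<eta> \<in> couplings (uniform_count_measure {1..n}) \<nu>"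
  shows "(W2 (empirical_measure n x) \<nu>)\<^sup>2 \<le> index_cost x \<eta>"
proof -
  let ?u = "uniform_count_measure {1..n}" and ?e = "empirical_measure n x"
  have \<eta>s: "prob_space \<eta>" "sets \<eta> = sets (?u \<Otimes>\<^sub>M \<nu>)" "distr \<eta> ?u fst = ?u" "distr \<eta> \<nu> snd = \<nu>"
    using \<eta> by (auto simp: couplings_def)
  have xm [measurable]: "x \<in> measurable ?u ?e"
    using x by (auto simp: uniform_count_measure_def cong: measurable_cong_sets)
  have m: "(\<lambda>(i, y). (x i, y)) \<in> measurable (?u \<Otimes>\<^sub>M \<nu>) (?e \<Otimes>\<^sub>M \<nu>)"
    using xm by measurable
  have m\<eta>: "(\<lambda>(i, y). (x i, y)) \<in> measurable \<eta> (?e \<Otimes>\<^sub>M \<nu>)"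
    using m \<eta>s(2) by (simp cong: measurable_cong_sets)
  have f\<eta>: "fst \<in> measurable \<eta> ?u" "snd \<in> measurable \<eta> \<nu>"
    using \<eta>s(2) by (simp_all cong: measurable_cong_sets)
  define \<gamma> where "\<gamma> = distr \<eta> (?e \<Otimes>\<^sub>M \<nu>) (\<lambda>(i, y). (x i, y))"
  have "\<gamma> \<in> couplings ?e \<nu>"
    unfolding couplings_def
  proof (intro CollectI conjI)
    show "prob_space \<gamma>" unfolding \<gamma>_def using \<eta>s(1) m\<eta> by (rule prob_space.prob_space_distr)
    show "sets \<gamma> = sets (?e \<Otimes>\<^sub>M \<nu>)" by (simp add: \<gamma>_def)
    have "distr \<gamma> ?e fst = distr \<eta> ?e (\<lambda>p. x (fst p))"
      unfolding \<gamma>_def using m\<eta> by (subst distr_distr) (auto simp: comp_def case_prod_beta)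
    also have "\<dots> = distr (distr \<eta> ?u fst) ?e x"
      using f\<eta> xm by (subst distr_distr) (auto simp: comp_def)
    also have "\<dots> = ?e"
      unfolding \<eta>s(3) unfolding empirical_measure_def by (rule distr_cong) auto
    finally show "distr \<gamma> ?e fst = ?e" .
    have "distr \<gamma> \<nu> snd = distr \<eta> \<nu> snd"
      unfolding \<gamma>_def using m\<eta> by (subst distr_distr) (auto simp: comp_def case_prod_beta)
    then show "distr \<gamma> \<nu> snd = \<nu>" using \<eta>s(4) by simp
  qed
  then have "(W2 ?e \<nu>)\<^sup>2 \<le> (\<integral>\<^sup>+ (x, y). ennreal ((rho_vec x y)\<^sup>2) \<partial>\<gamma>)"
    unfolding W2_sq by (rule INF_lower)
  also have "\<dots> = index_cost x \<eta>"
  proof -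
    have "(\<lambda>p. rho_vec (fst p) (snd p)) \<in> borel_measurable (borel :: ((real ^ 'N) \<times> (real ^ 'N)) measure)"
      by (intro borel_measurable_continuous_onI continuous_intros)
    then have 1: "(\<lambda>p. rho_vec (fst p) (snd p)) \<in> borel_measurable ((borel :: (real ^ 'N) measure) \<Otimes>\<^sub>M borel)"
      by (simp add: borel_prod)
    have 2: "(\<lambda>p. (fst p, snd p)) \<in> measurable (orthant_borel \<Otimes>\<^sub>M orthant_borel) ((borel :: (real ^ 'N) measure) \<Otimes>\<^sub>M borel)"
      by (intro measurable_Pair measurable_compose[OF measurable_fst] measurable_compose[OF measurable_snd] borel_orthant) auto
    have "(\<lambda>p. rho_vec (fst p) (snd p)) \<in> borel_measurable (orthant_borel \<Otimes>\<^sub>M (orthant_borel :: (real ^ 'N) measure))"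
      using measurable_compose[OF 2 1] by simp
    then have "(\<lambda>p. ennreal ((rho_vec (fst p) (snd p))\<^sup>2)) \<in> borel_measurable (orthant_borel \<Otimes>\<^sub>M (orthant_borel :: (real ^ 'N) measure))"
      by simp
    moreover have "sets (?e \<Otimes>\<^sub>M \<nu>) = sets (orthant_borel \<Otimes>\<^sub>M (orthant_borel :: (real ^ 'N) measure))"
      using \<nu> by (intro sets_pair_measure_cong) auto
    ultimately have "(\<lambda>p. ennreal ((rho_vec (fst p) (snd p))\<^sup>2)) \<in> borel_measurable (?e \<Otimes>\<^sub>M \<nu>)"
      using measurable_cong_sets by blast
    then have "(\<lambda>p. ennreal ((rho_vec (fst p) (snd p))\<^sup>2)) \<in> borel_measurable (distr \<eta> (?e \<Otimes>\<^sub>M \<nu>) (\<lambda>(i, y). (x i, y)))"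
      by simp
    from nn_integral_distr[OF m\<eta> this] show ?thesis
      unfolding \<gamma>_def index_cost_def by (simp add: case_prod_beta')
  qed
  finally show ?thesis .
qed

text \<open>Conversely, a coupling with the empirical measure is lifted to the index set by splitting the
  mass of a multiple atom evenly among the indices that sit there.\<close>

lemma index_coupling_exists:
  fixes x :: "nat \<Rightarrow> real ^ 'N"
  assumes n: "1 \<le> n" and x: "\<And>i. i \<in> {1..n} \<Longrightarrow> x i \<in> pos_orthant"
    and \<nu>: "sets \<nu> = sets orthant_borel" "prob_space \<nu>" and \<gamma>: "\<gamma> \<in> couplings (empirical_measure n x) \<nu>"
  shows "\<exists>\<eta>\<in>couplings (uniform_count_measure {1..n}) \<nu>.
    index_cost x \<eta> = (\<integral>\<^sup>+ (x, y). ennreal ((rho_vec x y)\<^sup>2) \<partial>\<gamma>)"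
proof -
  let ?u = "uniform_count_measure {1..n}" and ?e = "empirical_measure n x" and ?I = "{1..n}"
  have \<gamma>s: "prob_space \<gamma>" "sets \<gamma> = sets (?e \<Otimes>\<^sub>M \<nu>)" "distr \<gamma> ?e fst = ?e" "distr \<gamma> \<nu> snd = \<nu>"
    using \<gamma> by (auto simp: couplings_def)
  interpret \<gamma>: prob_space \<gamma> by (rule \<gamma>s(1))
  define k where "k i = card {i' \<in> ?I. x i' = x i}" for i
  have k: "0 < k i" if "i \<in> ?I" for i using that unfolding k_def by (subst card_gt_0_iff) auto
  define wt where "wt i a = ennreal (1 / real (k i)) * indicator {x i} a" for i a
  define f where "f = (\<lambda>(i, p :: (real ^ 'N) \<times> (real ^ 'N)). wt i (fst p))"
  define \<kappa> where "\<kappa> = density (count_space ?I \<Otimes>\<^sub>M \<gamma>) f"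
  define \<eta> where "\<eta> = distr \<kappa> (?u \<Otimes>\<^sub>M \<nu>) (\<lambda>(i, p). (i, snd p))"
  have fm: "fst \<in> measurable \<gamma> orthant_borel" "snd \<in> measurable \<gamma> \<nu>"
    using \<gamma>s(2) by (simp_all cong: measurable_cong_sets sets_pair_measure_cong)
  have wtm: "(\<lambda>p. wt i (fst p)) \<in> borel_measurable \<gamma>" if "i \<in> ?I" for i
  proof -
    have "wt i \<in> borel_measurable orthant_borel"
      unfolding wt_def using singleton_orthant[OF x[OF that]] by (intro borel_measurable_times_ennreal borel_measurable_indicator) auto
    then show ?thesis by (rule measurable_compose[OF fm(1)])
  qed
  have pairm: "h \<in> borel_measurable (count_space ?I \<Otimes>\<^sub>M \<gamma>)" if "\<And>i. i \<in> ?I \<Longrightarrow> (\<lambda>p. h (i, p)) \<in> borel_measurable \<gamma>" for h :: "_ \<Rightarrow> ennreal"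
    using that by (intro measurable_pair_measure_countable1) (auto intro: countable_finite)
  have fmeas: "f \<in> borel_measurable (count_space ?I \<Otimes>\<^sub>M \<gamma>)" by (rule pairm) (simp add: f_def wtm)
  have us: "sets (?u \<Otimes>\<^sub>M \<nu>) = sets (count_space ?I \<Otimes>\<^sub>M \<nu>)"
    by (rule sets_uniform_count_pair)
  have pm0: "(\<lambda>(i, p). (i, snd p)) \<in> measurable (count_space ?I \<Otimes>\<^sub>M \<gamma>) (count_space ?I \<Otimes>\<^sub>M \<nu>)"
    unfolding case_prod_beta'
    by (intro measurable_Pair measurable_fst measurable_compose[OF measurable_snd fm(2)])
  have sample_pt: "(\<lambda>(i, p). (i, snd p)) \<in> measurable \<kappa> (?u \<Otimes>\<^sub>M \<nu>)"
  proof -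
    have "sets \<kappa> = sets (count_space ?I \<Otimes>\<^sub>M \<gamma>)" by (simp only: \<kappa>_def sets_density)
    from measurable_cong_sets[OF this us] show ?thesis using pm0 by blast
  qed
  have key: "(\<integral>\<^sup>+ q. h q \<partial>\<eta>) = (\<integral>\<^sup>+ p. (\<Sum>i\<in>?I. wt i (fst p) * h (i, snd p)) \<partial>\<gamma>)"
    if h: "h \<in> borel_measurable (?u \<Otimes>\<^sub>M \<nu>)" for h
  proof -
    have hi: "(\<lambda>p. h (i, snd p)) \<in> borel_measurable \<gamma>" if "i \<in> ?I" for i
    proof -
      have "(\<lambda>p. (i, snd p)) \<in> measurable \<gamma> (?u \<Otimes>\<^sub>M \<nu>)"
        using fm(2) that by (intro measurable_Pair) (auto simp: space_uniform_count_measure)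
      then show ?thesis by (rule measurable_compose[OF _ h])
    qed
    have "(\<integral>\<^sup>+ q. h q \<partial>\<eta>) = (\<integral>\<^sup>+ r. h (fst r, snd (snd r)) \<partial>\<kappa>)"
      unfolding \<eta>_def using h by (subst nn_integral_distr[OF sample_pt]) (auto simp: case_prod_beta')
    also have "\<dots> = (\<integral>\<^sup>+ r. f r * h (fst r, snd (snd r)) \<partial>(count_space ?I \<Otimes>\<^sub>M \<gamma>))"
      unfolding \<kappa>_def by (rule nn_integral_density[OF fmeas]) (rule pairm, simp add: hi)
    also have "\<dots> = (\<integral>\<^sup>+ i. (\<integral>\<^sup>+ p. wt i (fst p) * h (i, snd p) \<partial>\<gamma>) \<partial>count_space ?I)"
    proof -
      have "(\<lambda>r. f r * h (fst r, snd (snd r))) \<in> borel_measurable (count_space ?I \<Otimes>\<^sub>M \<gamma>)"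
        by (rule pairm, simp only: f_def case_prod_conv fst_conv snd_conv) (intro borel_measurable_times_ennreal wtm hi)
      from \<gamma>.nn_integral_fst[OF this] show ?thesis by (simp add: f_def)
    qed
    also have "\<dots> = (\<Sum>i\<in>?I. \<integral>\<^sup>+ p. wt i (fst p) * h (i, snd p) \<partial>\<gamma>)"
      by (rule nn_integral_count_space_finite) simp
    also have "\<dots> = (\<integral>\<^sup>+ p. (\<Sum>i\<in>?I. wt i (fst p) * h (i, snd p)) \<partial>\<gamma>)"
      by (intro nn_integral_sum[symmetric] borel_measurable_times_ennreal wtm hi)
    finally show ?thesis .
  qed
  have emp: "emeasure \<gamma> {p \<in> space \<gamma>. fst p = x i} = ennreal (real (k i) / real n)" if "i \<in> ?I" for i
  proof -
    have "emeasure ?e {x i} = emeasure (distr \<gamma> ?e fst) {x i}" using \<gamma>s(3) by simp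
    also have "\<dots> = emeasure \<gamma> {p \<in> space \<gamma>. fst p = x i}"
      using fm(1) singleton_orthant[OF x[OF that]]
      by (subst emeasure_distr) (auto cong: measurable_cong_sets intro!: arg_cong[where f = "emeasure \<gamma>"])
    finally have "emeasure \<gamma> {p \<in> space \<gamma>. fst p = x i} = emeasure ?e {x i}" ..
    also have "\<dots> = ennreal (1 / real n) * (\<Sum>j\<in>?I. emeasure (return orthant_borel (x j)) {x i})"
      by (rule emeasure_empirical_measure[OF n x singleton_orthant[OF x[OF that]]])
    also have "(\<Sum>j\<in>?I. emeasure (return orthant_borel (x j)) {x i}) = (\<Sum>j\<in>?I. of_bool (x j = x i))"
      using singleton_orthant[OF x[OF that]] by (intro sum.cong refl) (auto simp: indicator_def)
    also have "\<dots> = of_nat (k i)" by (simp add: k_def sum.If_cases of_bool_def Int_def)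
    finally show ?thesis by (simp add: ennreal_of_nat_eq_real_of_nat flip: ennreal_mult)
  qed
  have one: "(\<Sum>i\<in>?I. wt i a) = 1" if "a \<in> x ` ?I" for a
  proof -
    obtain i0 where i0: "i0 \<in> ?I" "a = x i0" using \<open>a \<in> x ` ?I\<close> by blast
    have "(\<Sum>i\<in>?I. wt i a) = (\<Sum>i\<in>?I. if x i = x i0 then ennreal (1 / real (k i0)) else 0)"
      by (intro sum.cong refl) (auto simp: wt_def i0 indicator_def k_def)
    also have "\<dots> = of_nat (k i0) * ennreal (1 / real (k i0))"
      by (simp add: sum.If_cases Int_def k_def)
    also have "\<dots> = 1" using k[OF i0(1)] by (simp add: ennreal_of_nat_eq_real_of_nat flip: ennreal_mult)
    finally show ?thesis .
  qed
  \<comment> \<open>The weights sum to 1 only over sample points, and the coupling lives on the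
    whole product; its first marginal shows that almost every first coordinate is a sample
    point.\<close>
  have atoms: "AE p in \<gamma>. fst p \<in> x ` ?I"
  proof -
    have xI: "x ` ?I \<in> sets orthant_borel"
    proof -
      have "x ` ?I = (\<Union>i\<in>?I. {x i})" by auto
      then show ?thesis using x singleton_orthant by (metis (no_types, lifting) finite_atLeastAtMost sets.finite_UN)
    qed
    have "AE a in ?e. a \<in> x ` ?I"
    proof -
      have xm: "x \<in> measurable ?u orthant_borel"
        using x by (auto simp: uniform_count_measure_def cong: measurable_cong_sets)
      have "{a \<in> space orthant_borel. a \<in> x ` ?I} = x ` ?I" using x by auto
      then have "{a \<in> space orthant_borel. a \<in> x ` ?I} \<in> sets orthant_borel" using xI by (simp only:)
      moreover have "AE i in ?u. x i \<in> x ` ?I" by (rule AE_I2) (simp add: space_uniform_count_measure)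
      ultimately show ?thesis
        unfolding empirical_measure_def using AE_distr_iff[OF xm, of "\<lambda>a. a \<in> x ` ?I"] by blast
    qed
    then have AE: "AE a in distr \<gamma> ?e fst. a \<in> x ` ?I" unfolding \<gamma>s(3) .
    have fst: "fst \<in> measurable \<gamma> ?e" using fm(1) measurable_cong_sets[OF refl sets_empirical] by blast
    have "{a \<in> space ?e. a \<in> x ` ?I} = x ` ?I" using x by auto
    then have "{a \<in> space ?e. a \<in> x ` ?I} \<in> sets ?e" using xI by (simp only: sets_empirical)
    then show ?thesis using AE AE_distr_iff[OF fst, of "\<lambda>a. a \<in> x ` ?I"] by blast
  qed
  have "\<eta> \<in> couplings ?u \<nu>"
    unfolding couplings_def
  proof (intro CollectI conjI)
    show s\<eta>: "sets \<eta> = sets (?u \<Otimes>\<^sub>M \<nu>)" by (simp add: \<eta>_def)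
    have m\<eta>: "fst \<in> measurable \<eta> ?u" "snd \<in> measurable \<eta> \<nu>"
      using s\<eta> by (simp_all cong: measurable_cong_sets)
    show snd: "distr \<eta> \<nu> snd = \<nu>"
    proof (rule measure_eqI)
      fix B assume "B \<in> sets (distr \<eta> \<nu> snd)"
      then have B: "B \<in> sets \<nu>" by simp
      have "emeasure (distr \<eta> \<nu> snd) B = (\<integral>\<^sup>+ y. indicator B y \<partial>distr \<eta> \<nu> snd)" using B by simp
      also have "\<dots> = (\<integral>\<^sup>+ q. indicator B (snd q) \<partial>\<eta>)" using B m\<eta> by (subst nn_integral_distr) auto
      also have "\<dots> = (\<integral>\<^sup>+ p. (\<Sum>i\<in>?I. wt i (fst p) * indicator B (snd p)) \<partial>\<gamma>)"
        using B by (subst key) auto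
      also have "\<dots> = (\<integral>\<^sup>+ p. indicator B (snd p) \<partial>\<gamma>)"
        by (rule nn_integral_cong_AE) (use atoms in eventually_elim, simp only: one sum_distrib_right[symmetric] mult_1)
      also have "\<dots> = (\<integral>\<^sup>+ y. indicator B y \<partial>distr \<gamma> \<nu> snd)" using B fm by (subst nn_integral_distr) auto
      also have "\<dots> = emeasure \<nu> B" using B \<gamma>s(4) by simp
      finally show "emeasure (distr \<eta> \<nu> snd) B = emeasure \<nu> B" .
    qed simp
    show "prob_space \<eta>"
      using prob_space_distrD[OF m\<eta>(2)] snd \<nu>(2) by simp
    show "distr \<eta> ?u fst = ?u"
    proof (rule measure_eqI)
      fix A assume "A \<in> sets (distr \<eta> ?u fst)"
      then have A: "A \<in> sets ?u" by simp
      then have A: "A \<in> sets ?u" "A \<subseteq> ?I"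
        using sets.sets_into_space[OF A] by (simp_all only: space_uniform_count_measure)
      have "emeasure (distr \<eta> ?u fst) A = (\<integral>\<^sup>+ y. indicator A y \<partial>distr \<eta> ?u fst)" using A by simp
      also have "\<dots> = (\<integral>\<^sup>+ q. indicator A (fst q) \<partial>\<eta>)" using A m\<eta> by (subst nn_integral_distr) auto
      also have "\<dots> = (\<integral>\<^sup>+ p. (\<Sum>i\<in>?I. wt i (fst p) * indicator A i) \<partial>\<gamma>)"
        using A by (subst key) auto
      also have "\<dots> = (\<Sum>i\<in>?I. \<integral>\<^sup>+ p. wt i (fst p) * indicator A i \<partial>\<gamma>)"
        by (intro nn_integral_sum borel_measurable_times_ennreal wtm borel_measurable_const)
      also have "\<dots> = (\<Sum>i\<in>?I. ennreal (1 / real n) * indicator A i)"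
      proof (intro sum.cong refl)
        fix i assume i: "i \<in> ?I"
        have "(\<integral>\<^sup>+ p. wt i (fst p) * indicator A i \<partial>\<gamma>) = (\<integral>\<^sup>+ p. wt i (fst p) \<partial>\<gamma>) * indicator A i"
          by (rule nn_integral_multc) (rule wtm[OF i])
        also have "(\<integral>\<^sup>+ p. wt i (fst p) \<partial>\<gamma>) = (\<integral>\<^sup>+ p. ennreal (1 / real (k i)) * indicator {p \<in> space \<gamma>. fst p = x i} p \<partial>\<gamma>)"
          by (intro nn_integral_cong) (auto simp: wt_def indicator_def)
        also have "\<dots> = ennreal (1 / real (k i)) * ennreal (real (k i) / real n)"
        proof -
          have "{p \<in> space \<gamma>. fst p = x i} = fst -` {x i} \<inter> space \<gamma>" by auto
          then have "{p \<in> space \<gamma>. fst p = x i} \<in> sets \<gamma>"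
            using measurable_sets[OF fm(1) singleton_orthant[OF x[OF i]]] by simp
          then show ?thesis by (simp add: nn_integral_cmult_indicator emp[OF i])
        qed
        also have "\<dots> = ennreal (1 / real n)" using k[OF i] by (simp flip: ennreal_mult)
        finally show "(\<integral>\<^sup>+ p. wt i (fst p) * indicator A i \<partial>\<gamma>) = ennreal (1 / real n) * indicator A i" .
      qed
      also have "\<dots> = emeasure ?u A"
      proof -
        have "(\<Sum>i\<in>?I. indicator A i :: ennreal) = (\<Sum>i\<in>?I. if i \<in> A then 1 else 0)"
          by (intro sum.cong refl) (simp only: indicator_def of_bool_def)
        also have "\<dots> = (\<Sum>i\<in>?I \<inter> A. 1)" by (rule sum.inter_restrict[symmetric]) simp
        also have "?I \<inter> A = A" using A(2) by blast
        finally have "(\<Sum>i\<in>?I. indicator A i :: ennreal) = ennreal (real (card A))"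
          by (simp add: ennreal_of_nat_eq_real_of_nat)
        then have "(\<Sum>i\<in>?I. ennreal (1 / real n) * indicator A i) = ennreal (1 / real n * real (card A))"
          by (simp only: sum_distrib_left[symmetric]) (simp flip: ennreal_mult)
        also have "\<dots> = emeasure ?u A"
          using n A(2) by (subst emeasure_uniform_count_measure) auto
        finally show ?thesis .
      qed
      finally show "emeasure (distr \<eta> ?u fst) A = emeasure ?u A" .
    qed simp
  qed
  moreover have "index_cost x \<eta> = (\<integral>\<^sup>+ (x, y). ennreal ((rho_vec x y)\<^sup>2) \<partial>\<gamma>)"
  proof -
    have "index_cost x \<eta> = (\<integral>\<^sup>+ p. (\<Sum>i\<in>?I. wt i (fst p) * ennreal ((rho_vec (x i) (snd p))\<^sup>2)) \<partial>\<gamma>)"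
      unfolding index_cost_def using key[OF measurable_rho_vec_snd[OF \<nu>(1), of x]] by simp
    also have "\<dots> = (\<integral>\<^sup>+ p. ennreal ((rho_vec (fst p) (snd p))\<^sup>2) \<partial>\<gamma>)"
    proof (rule nn_integral_cong_AE, use atoms in eventually_elim)
      fix p :: "(real ^ 'N) \<times> (real ^ 'N)" assume p: "fst p \<in> x ` ?I"
      have "(\<Sum>i\<in>?I. wt i (fst p) * ennreal ((rho_vec (x i) (snd p))\<^sup>2)) = (\<Sum>i\<in>?I. wt i (fst p) * ennreal ((rho_vec (fst p) (snd p))\<^sup>2))"
        by (intro sum.cong refl) (auto simp: wt_def indicator_def)
      then show "(\<Sum>i\<in>?I. wt i (fst p) * ennreal ((rho_vec (x i) (snd p))\<^sup>2)) = ennreal ((rho_vec (fst p) (snd p))\<^sup>2)"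
        by (simp only: one[OF p] sum_distrib_right[symmetric] mult_1)
    qed
    finally show ?thesis by (simp add: case_prod_beta')
  qed
  ultimately show ?thesis by blast
qed

lemma W2_sq_eq_index_cost:
  assumes "1 \<le> n" "\<And>i. i \<in> {1..n} \<Longrightarrow> x i \<in> pos_orthant" "sets \<nu> = sets orthant_borel" "prob_space \<nu>"
  shows "(W2 (empirical_measure n x) \<nu>)\<^sup>2 = (INF \<eta>\<in>couplings (uniform_count_measure {1..n}) \<nu>. index_cost x \<eta>)"
proof (rule antisym)
  show "(W2 (empirical_measure n x) \<nu>)\<^sup>2 \<le> (INF \<eta>\<in>couplings (uniform_count_measure {1..n}) \<nu>. index_cost x \<eta>)"
    using assms by (intro INF_greatest W2_sq_le_index_cost)
  show "(INF \<eta>\<in>couplings (uniform_count_measure {1..n}) \<nu>. index_cost x \<eta>) \<le> (W2 (empirical_measure n x) \<nu>)\<^sup>2"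
    unfolding W2_sq
  proof (rule INF_greatest)
    fix \<gamma> assume "\<gamma> \<in> couplings (empirical_measure n x) \<nu>"
    from index_coupling_exists[OF assms this]
    show "(INF \<eta>\<in>couplings (uniform_count_measure {1..n}) \<nu>. index_cost x \<eta>) \<le> (\<integral>\<^sup>+ (x, y). ennreal ((rho_vec x y)\<^sup>2) \<partial>\<gamma>)"
      by (metis INF_lower)
  qed
qed

text \<open>The triangle inequality followed by Young's inequality. Thanks to the factor
  \<open>1 + e\<close> on the cost, the additive error depends on the two samples and not on the
  coupling.\<close>

lemma index_cost_perturb:
  fixes x x' :: "nat \<Rightarrow> real ^ 'N"
  assumes \<eta>: "\<eta> \<in> couplings (uniform_count_measure {1..n}) \<nu>" and \<nu>: "sets \<nu> = sets orthant_borel" and "0 < e"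
  shows "index_cost x' \<eta> \<le> ennreal (1 + e) * index_cost x \<eta> +
    ennreal ((1 + 1 / e) * (\<Sum>i\<in>{1..n}. (rho_vec (x' i) (x i))\<^sup>2))"
proof -
  let ?u = "uniform_count_measure {1..n}"
  let ?d = "(1 + 1 / e) * (\<Sum>i\<in>{1..n}. (rho_vec (x' i) (x i))\<^sup>2)"
  have \<eta>s: "prob_space \<eta>" "sets \<eta> = sets (?u \<Otimes>\<^sub>M \<nu>)" using \<eta> by (auto simp: couplings_def)
  have space: "fst q \<in> {1..n}" if "q \<in> space \<eta>" for q
    using that sets_eq_imp_space_eq[OF \<eta>s(2)] by (auto simp: space_pair_measure space_uniform_count_measure)
  have point: "(rho_vec (x' i) y)\<^sup>2 \<le> (1 + e) * (rho_vec (x i) y)\<^sup>2 + ?d" if "i \<in> {1..n}" for i y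
  proof -
    let ?a = "rho_vec (x' i) (x i)" and ?b = "rho_vec (x i) y"
    have "(rho_vec (x' i) y)\<^sup>2 \<le> (?a + ?b)\<^sup>2" by (intro power_mono rho_vec_triangle) simp
    also have "\<dots> \<le> (1 + e) * ?b\<^sup>2 + (1 + 1 / e) * ?a\<^sup>2"
    proof -
      have "(e * ?b - ?a)\<^sup>2 / e = e * ?b\<^sup>2 + ?a\<^sup>2 / e - 2 * ?a * ?b"
        using \<open>0 < e\<close> by (simp add: power2_eq_square field_simps)
      moreover have "0 \<le> (e * ?b - ?a)\<^sup>2 / e" using \<open>0 < e\<close> by simp
      ultimately have "2 * ?a * ?b \<le> e * ?b\<^sup>2 + ?a\<^sup>2 / e" by linarith
      then show ?thesis by (simp add: power2_sum algebra_simps)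
    qed
    also have "(1 + 1 / e) * ?a\<^sup>2 \<le> ?d"
      using \<open>0 < e\<close> that by (intro mult_left_mono member_le_sum) auto
    finally show ?thesis by simp
  qed
  have d0: "0 \<le> ?d" using \<open>0 < e\<close> by (intro mult_nonneg_nonneg sum_nonneg) auto
  have m: "(\<lambda>q. ennreal ((rho_vec (x (fst q)) (snd q))\<^sup>2)) \<in> borel_measurable \<eta>"
    using measurable_rho_vec_snd[OF \<nu>, of x n] measurable_cong_sets[OF \<eta>s(2) refl] by (auto simp: case_prod_beta')
  have "index_cost x' \<eta> \<le> (\<integral>\<^sup>+ q. ennreal (1 + e) * ennreal ((rho_vec (x (fst q)) (snd q))\<^sup>2) + ennreal ?d \<partial>\<eta>)"
    unfolding index_cost_def
  proof (rule nn_integral_mono)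
    fix q assume "q \<in> space \<eta>"
    then have "ennreal ((rho_vec (x' (fst q)) (snd q))\<^sup>2) \<le> ennreal ((1 + e) * (rho_vec (x (fst q)) (snd q))\<^sup>2 + ?d)"
      by (intro ennreal_leI point space)
    also have "\<dots> = ennreal (1 + e) * ennreal ((rho_vec (x (fst q)) (snd q))\<^sup>2) + ennreal ?d"
      using \<open>0 < e\<close> d0 by (subst ennreal_plus) (auto simp: ennreal_mult)
    finally show "(case q of (i, y) \<Rightarrow> ennreal ((rho_vec (x' i) y)\<^sup>2)) \<le> \<dots>" by (simp add: case_prod_beta')
  qed
  also have "\<dots> = ennreal (1 + e) * (\<integral>\<^sup>+ q. ennreal ((rho_vec (x (fst q)) (snd q))\<^sup>2) \<partial>\<eta>) + ennreal ?d"
    using m prob_space.emeasure_space_1[OF \<eta>s(1)] by (simp add: nn_integral_add nn_integral_cmult)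
  finally show ?thesis unfolding index_cost_def by (simp add: case_prod_beta')
qed

text \<open>For a fixed coupling the cost is upper semicontinuous in the sample, and an infimum of upper
  semicontinuous functions is again upper semicontinuous, hence Borel.\<close>

lemma borel_measurable_INF_index_cost:
  fixes \<nu> :: "(real ^ 'N) measure"
  assumes \<nu>: "sets \<nu> = sets orthant_borel"
  shows "(\<lambda>x. INF \<eta>\<in>couplings (uniform_count_measure {1..n}) \<nu>. index_cost x \<eta>) \<in> borel_measurable borel"
proof (rule borel_measurableI_less)
  fix a :: ennreal
  let ?C = "couplings (uniform_count_measure {1..n}) \<nu>"
  have "{x \<in> space borel. (INF \<eta>\<in>?C. index_cost x \<eta>) < a} = (\<Union>\<eta>\<in>?C. {x. index_cost x \<eta> < a})"
    by (auto simp: INF_less_iff)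
  moreover have "open (\<Union>\<eta>\<in>?C. {x. index_cost x \<eta> < a})"
  proof (intro open_UN ballI)
    fix \<eta> assume \<eta>: "\<eta> \<in> ?C"
    show "open {x. index_cost x \<eta> < a}"
  proof (subst open_subopen, intro ballI)
    fix x assume "x \<in> {x. index_cost x \<eta> < a}"
    then have less: "index_cost x \<eta> < a" by simp
    then obtain c where c: "index_cost x \<eta> = ennreal c" "0 \<le> c"
      by (cases "index_cost x \<eta>") auto
    obtain b where b: "ennreal c < ennreal b" "ennreal b < a" "c < b"
    proof -
      obtain b' where "ennreal c < b'" "b' < a" using less c dense by metis
      then show ?thesis using that by (cases b') (auto simp: ennreal_less_iff c)
    qed
    \<comment> \<open>Chosen so that \<open>e * c \<le> (b - c) / 2\<close>; the summand 1 in the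
      denominator covers c = 0.\<close>
    define e where "e = (b - c) / (2 * (c + 1))"
    have e: "0 < e" "(1 + e) * c < b"
    proof -
      show "0 < e" using b c by (simp add: e_def)
      have "e * c \<le> (b - c) / 2" using b c by (simp add: e_def field_simps)
      then show "(1 + e) * c < b" using b(3) by (simp add: algebra_simps)
    qed
    let ?f = "\<lambda>x'. (1 + e) * c + (1 + 1 / e) * (\<Sum>i\<in>{1..n}. (rho_vec (x' i) (x i))\<^sup>2)"
    have "continuous_on UNIV ?f"
      by (intro continuous_intros continuous_on_product_coordinates)
    then have "open {x'. ?f x' < b}"
      using open_Collect_less[of ?f "\<lambda>_. b"] by simp
    moreover have "x \<in> {x'. ?f x' < b}" using e by simp
    moreover have "{x'. ?f x' < b} \<subseteq> {x'. index_cost x' \<eta> < a}"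
    proof
      fix x' assume "x' \<in> {x'. ?f x' < b}"
      then have "?f x' < b" by simp
      have "index_cost x' \<eta> \<le> ennreal (1 + e) * index_cost x \<eta> + ennreal ((1 + 1 / e) * (\<Sum>i\<in>{1..n}. (rho_vec (x' i) (x i))\<^sup>2))"
        by (rule index_cost_perturb[OF \<eta> \<nu> e(1)])
      also have "\<dots> = ennreal (?f x')"
        using e c by (simp add: ennreal_mult sum_nonneg)
      also have "\<dots> \<le> ennreal b" using \<open>?f x' < b\<close> by (intro ennreal_leI) simp
      finally show "x' \<in> {x'. index_cost x' \<eta> < a}" using b(2) by auto
    qed
    ultimately show "\<exists>T. open T \<and> x \<in> T \<and> T \<subseteq> {x. index_cost x \<eta> < a}" by blast
  qed
  qed
  ultimately show "{x \<in> space borel. (INF \<eta>\<in>?C. index_cost x \<eta>) < a} \<in> sets borel" by (simp only: borel_open)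
qed

text \<open>A sample is extended by 0 to a full sequence, since on a countable product the Borel
  sets are generated by the coordinates. The index cost reads only the entries from 1 to n.\<close>

lemma measurable_W2_sq_empirical:
  fixes \<nu> :: "(real ^ 'N) measure"
  assumes n: "1 \<le> n" and \<nu>: "sets \<nu> = sets orthant_borel" "prob_space \<nu>"
  shows "(\<lambda>x. (W2 (empirical_measure n x) \<nu>)\<^sup>2) \<in> borel_measurable (Pi\<^sub>M {1..n} (\<lambda>_. orthant_borel))"
proof -
  let ?f = "\<lambda>x. INF \<eta>\<in>couplings (uniform_count_measure {1..n}) \<nu>. index_cost x \<eta>"
  let ?e = "\<lambda>x i. if i \<in> {1..n} then x i else (0 :: real ^ 'N)"
  have "?e \<in> measurable (Pi\<^sub>M {1..n} (\<lambda>_. orthant_borel)) (Pi\<^sub>M UNIV (\<lambda>_. borel))"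
  proof (rule measurable_PiM_single')
    fix i
    show "(\<lambda>x. ?e x i) \<in> measurable (Pi\<^sub>M {1..n} (\<lambda>_. orthant_borel)) (borel :: (real ^ 'N) measure)"
    proof (cases "i \<in> {1..n}")
      case True
      then have "(\<lambda>x. x i) \<in> measurable (Pi\<^sub>M {1..n} (\<lambda>_. orthant_borel)) (orthant_borel :: (real ^ 'N) measure)"
        by (rule measurable_component_singleton)
      moreover have "(\<lambda>x. x) \<in> measurable orthant_borel (borel :: (real ^ 'N) measure)" by (rule borel_orthant) simp
      ultimately have "(\<lambda>x. x i) \<in> measurable (Pi\<^sub>M {1..n} (\<lambda>_. orthant_borel)) (borel :: (real ^ 'N) measure)"
        by (rule measurable_compose)
      then show ?thesis using True by simp
    next
      case False
      then have "(\<lambda>x. ?e x i) = (\<lambda>_. 0)" by auto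
      then show ?thesis by (simp only:) simp
    qed
  qed (auto simp: space_PiM)
  then have "?e \<in> measurable (Pi\<^sub>M {1..n} (\<lambda>_. orthant_borel)) borel"
    using measurable_cong_sets[OF refl sets_PiM_equal_borel] by blast
  from measurable_compose[OF this borel_measurable_INF_index_cost[OF \<nu>(1), of n]]
  have "(\<lambda>x. ?f (?e x)) \<in> borel_measurable (Pi\<^sub>M {1..n} (\<lambda>_. orthant_borel))" .
  moreover have "?f (?e x) = (W2 (empirical_measure n x) \<nu>)\<^sup>2" if "x \<in> space (Pi\<^sub>M {1..n} (\<lambda>_. orthant_borel))" for x
  proof -
    have "index_cost (?e x) \<eta> = index_cost x \<eta>" if "\<eta> \<in> couplings (uniform_count_measure {1..n}) \<nu>" for \<eta>
    proof -
      have "sets \<eta> = sets (uniform_count_measure {1..n} \<Otimes>\<^sub>M \<nu>)" using that by (simp add: couplings_def)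
      from sets_eq_imp_space_eq[OF this] show ?thesis
        unfolding index_cost_def
        by (intro nn_integral_cong) (auto simp: space_pair_measure space_uniform_count_measure)
    qed
    then have "?f (?e x) = ?f x" by (intro INF_cong refl)
    also have "\<dots> = (W2 (empirical_measure n x) \<nu>)\<^sup>2"
      by (rule W2_sq_eq_index_cost[symmetric, OF n _ \<nu>]) (use that in \<open>auto simp: space_PiM\<close>)
    finally show ?thesis .
  qed
  ultimately show ?thesis by (subst measurable_cong[where g = "\<lambda>x. ?f (?e x)"]) auto
qed

lemma empirical_measure_cong:
  "(\<And>i. i \<in> {1..n} \<Longrightarrow> x i = y i) \<Longrightarrow> empirical_measure n x = empirical_measure n y"
  unfolding empirical_measure_def by (intro distr_cong) (auto simp: space_uniform_count_measure)

text \<open>Both sides integrate the same measurable function of the sample against its joint law,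
  which independence identifies with the product law.\<close>

lemma expected_W2_sq_iid:
  fixes \<alpha> :: "real ^ 'N" and M :: "'w measure"
  assumes n: "1 \<le> n" and prob: "prob_space (laguerre_measure \<alpha>)" and iid: "iid_sample M X n (laguerre_measure \<alpha>)"
  shows "expected_W2_sq M X n \<alpha> = expected_W2_sq (Pi\<^sub>M {1..n} (\<lambda>_. laguerre_measure \<alpha>)) (\<lambda>j x. x j) n \<alpha>"
proof -
  let ?\<mu> = "laguerre_measure \<alpha>"
  interpret M: prob_space M using iid by (simp add: iid_sample_def)
  have ind: "M.indep_vars (\<lambda>_. orthant_borel) X {1..n}" using iid by (simp add: iid_sample_def)
  then have rv: "X i \<in> measurable M orthant_borel" if "i \<in> {1..n}" for i
    using that by (auto simp: M.indep_vars_def)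
  have "distr M (Pi\<^sub>M {1..n} (\<lambda>_. orthant_borel)) (\<lambda>\<omega>. \<lambda>i\<in>{1..n}. X i \<omega>) =
     Pi\<^sub>M {1..n} (\<lambda>i. distr M orthant_borel (X i))"
    using ind n by (subst (asm) M.indep_vars_iff_distr_eq_PiM') (auto intro: rv)
  also have "\<dots> = Pi\<^sub>M {1..n} (\<lambda>_. ?\<mu>)"
    using iid by (intro PiM_cong) (auto simp: iid_sample_def)
  finally have eq: "distr M (Pi\<^sub>M {1..n} (\<lambda>_. orthant_borel)) (\<lambda>\<omega>. \<lambda>i\<in>{1..n}. X i \<omega>) = Pi\<^sub>M {1..n} (\<lambda>_. ?\<mu>)" .
  have X: "(\<lambda>\<omega>. \<lambda>i\<in>{1..n}. X i \<omega>) \<in> measurable M (Pi\<^sub>M {1..n} (\<lambda>_. orthant_borel))"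
    by (intro measurable_restrict rv)
  have "(\<lambda>x. (W2 (empirical_measure n x) ?\<mu>)\<^sup>2) \<in>
    borel_measurable (distr M (Pi\<^sub>M {1..n} (\<lambda>_. orthant_borel)) (\<lambda>\<omega>. \<lambda>i\<in>{1..n}. X i \<omega>))"
    using measurable_W2_sq_empirical[OF n sets_laguerre prob] by simp
  from nn_integral_distr[OF X this] have "(\<integral>\<^sup>+ x. (W2 (empirical_measure n x) ?\<mu>)\<^sup>2 \<partial>Pi\<^sub>M {1..n} (\<lambda>_. ?\<mu>)) =
     (\<integral>\<^sup>+ \<omega>. (W2 (empirical_measure n (\<lambda>i\<in>{1..n}. X i \<omega>)) ?\<mu>)\<^sup>2 \<partial>M)"
    unfolding eq .
  also have "(\<lambda>\<omega>. empirical_measure n (\<lambda>i\<in>{1..n}. X i \<omega>)) = (\<lambda>\<omega>. empirical_measure n (\<lambda>j. X j \<omega>))"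
    by (intro ext empirical_measure_cong) auto
  finally show ?thesis unfolding expected_W2_sq_def by simp
qed

section \<open>Gamma quantiles\<close>

lemma mult_tail_root_le_1:
  assumes "0 < w" "w \<le> 1"
  shows "w * tail_root w \<le> 1"
proof -
  have "- ln w \<le> 1 / w - 1" using ln_le_minus_one[of "1 / w"] assms by (simp add: ln_div)
  then have "tail_root w \<le> sqrt (1 / w)" unfolding tail_root_def by (intro real_sqrt_le_mono) simp
  then have "w * tail_root w \<le> w * sqrt (1 / w)" using assms by (intro mult_left_mono) auto
  also have "\<dots> = sqrt w" using assms by (simp add: real_sqrt_divide real_div_sqrt)
  also have "\<dots> \<le> 1" using assms by simp
  finally show ?thesis .
qed

lemma DERIV_tail_root:
  assumes "0 < w" "w \<le> 1"
  shows "DERIV tail_root w :> - 1 / (2 * w * tail_root w)"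
proof -
  have "0 < 1 - ln w" using ln_le_minus_one[of w] assms by linarith
  then show ?thesis
    unfolding tail_root_def[abs_def] using assms
    by (auto intro!: derivative_eq_intros simp: divide_simps)
qed

text \<open>The distribution function is given by its derivative and its two limits alone, which
  reduces the tail estimates to calculus in one variable.\<close>

locale gamma_cdf =
  fixes F :: "real \<Rightarrow> real" and \<alpha> Z :: real
  assumes Z: "0 < Z" and \<alpha>: "- 1 / 2 \<le> \<alpha>"
    and F': "\<And>x. 0 < x \<Longrightarrow> DERIV F x :> x powr \<alpha> * exp (- x) / Z"
    and F0: "(F \<longlongrightarrow> 0) (at_right 0)" and F1: "(F \<longlongrightarrow> 1) at_top"
begin

definition \<phi> :: "real \<Rightarrow> real" where
  "\<phi> x = x powr \<alpha> * exp (- x) / Z"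

lemma \<phi>_pos: "0 < x \<Longrightarrow> 0 < \<phi> x"
  using Z by (simp add: \<phi>_def)

lemma DERIV_F: "0 < x \<Longrightarrow> DERIV F x :> \<phi> x"
  using F' by (simp add: \<phi>_def)

lemma DERIV_\<phi>: "0 < x \<Longrightarrow> DERIV \<phi> x :> \<phi> x * (\<alpha> / x - 1)"
  unfolding \<phi>_def[abs_def] using Z
  by (auto intro!: derivative_eq_intros simp: powr_diff field_simps)

lemma F_strict_mono:
  assumes "0 < x" "x < y"
  shows "F x < F y"
proof (rule DERIV_pos_imp_increasing[OF assms(2)])
  fix z assume "x \<le> z" "z \<le> y"
  then have "0 < z" using assms by simp
  then show "\<exists>d. DERIV F z :> d \<and> 0 < d" using DERIV_F \<phi>_pos by blast
qed

lemma F_bounds: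
  assumes "0 < x"
  shows "0 < F x" "F x < 1"
proof -
  have "0 \<le> F (x / 2)"
  proof (rule tendsto_upperbound[OF F0])
    have "0 < x / 2" using assms by simp
    from eventually_at_right_real[OF this] show "\<forall>\<^sub>F y in at_right 0. F y \<le> F (x / 2)"
      by eventually_elim (rule less_imp_le[OF F_strict_mono], auto)
  qed simp
  also have "F (x / 2) < F x" using assms by (intro F_strict_mono) auto
  finally show "0 < F x" .
  have "F x < F (x + 1)" using assms by (intro F_strict_mono) auto
  also have "F (x + 1) \<le> 1"
  proof (rule tendsto_lowerbound[OF F1])
    show "\<forall>\<^sub>F y in at_top. F (x + 1) \<le> F y"
      using eventually_gt_at_top[of "x + 1"]
      by eventually_elim (rule less_imp_le[OF F_strict_mono], use assms in auto)
  qed simp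
  finally show "F x < 1" .
qed

text \<open>A comparison principle: to compare F with an explicit function it is enough to compare
  derivatives and to control the difference from below near 0. \<open>nonneg_right\<close> does the
  same at infinity.\<close>

lemma nonneg_left:
  fixes D e :: "real \<Rightarrow> real"
  assumes x: "0 < x" and D: "\<And>y. 0 < y \<Longrightarrow> y \<le> x \<Longrightarrow> \<exists>d\<ge>0. DERIV D y :> d"
    and low: "\<And>y. 0 < y \<Longrightarrow> y \<le> x \<Longrightarrow> - e y \<le> D y" and e: "(e \<longlongrightarrow> 0) (at_right 0)"
  shows "0 \<le> D x"
proof -
  have "- 0 \<le> D x"
  proof (rule tendsto_upperbound[OF tendsto_minus[OF e]])
    show "\<forall>\<^sub>F y in at_right 0. - e y \<le> D x"
      using eventually_at_right_real[OF x]
    proof eventually_elim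
      case (elim y)
      then have "- e y \<le> D y" using low by simp
      also have "D y \<le> D x"
      proof (rule DERIV_nonneg_imp_nondecreasing[where f = D])
        show "\<exists>d. DERIV D z :> d \<and> d \<ge> 0" if "y \<le> z" "z \<le> x" for z
          using D[of z] elim that by auto
      qed (use elim in auto)
      finally show ?case .
    qed
  qed simp
  then show ?thesis by simp
qed

lemma nonneg_right:
  fixes D e :: "real \<Rightarrow> real"
  assumes D: "\<And>y. x \<le> y \<Longrightarrow> \<exists>d\<le>0. DERIV D y :> d"
    and low: "\<And>y. x \<le> y \<Longrightarrow> - e y \<le> D y" and e: "(e \<longlongrightarrow> 0) at_top"
  shows "0 \<le> D x"
proof -
  have "- 0 \<le> D x"
  proof (rule tendsto_upperbound[OF tendsto_minus[OF e]])
    show "\<forall>\<^sub>F y in at_top. - e y \<le> D x"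
      using eventually_ge_at_top[of x]
    proof eventually_elim
      case (elim y)
      then have "- e y \<le> D y" using low by simp
      also have "D y \<le> D x"
        using elim by (intro DERIV_nonpos_imp_nonincreasing[where f = D]) (use D in force)+
      finally show ?case .
    qed
  qed simp
  then show ?thesis by simp
qed

text \<open>The difference has the derivative
  \<open>\<phi> y * (4 * (1 + \<alpha> - y) - 1)\<close>. For \<alpha> at least -1/2 and y at most
  1/4 the bracket is nonnegative; this fixes the factor 4 together with the range up to 1/4.\<close>

lemma F_le:
  assumes "0 < x" "x \<le> 1/4"
  shows "F x \<le> 4 * x * \<phi> x"
proof -
  have "0 \<le> (\<lambda>x. 4 * x * \<phi> x - F x) x"
  proof (rule nonneg_left[where D = "\<lambda>x. 4 * x * \<phi> x - F x" and e = F, OF assms(1) _ _ F0])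
    fix y assume y: "0 < y" "y \<le> x"
    have "DERIV (\<lambda>x. 4 * x * \<phi> x - F x) y :> \<phi> y * (4 * (1 + \<alpha> - y) - 1)"
      using y by (auto intro!: derivative_eq_intros DERIV_F DERIV_\<phi> simp: field_simps)
    moreover have "0 \<le> \<phi> y * (4 * (1 + \<alpha> - y) - 1)"
      using y assms \<alpha> \<phi>_pos[of y] by (intro mult_nonneg_nonneg) auto
    ultimately show "\<exists>d\<ge>0. DERIV (\<lambda>x. 4 * x * \<phi> x - F x) y :> d" by blast
    show "- F y \<le> 4 * y * \<phi> y - F y" using y \<phi>_pos[of y] by simp
  qed
  then show ?thesis by simp
qed

lemma F_ge:
  assumes "0 < x" "x \<le> 1/4"
  shows "exp (-1) / (Z * (1 + \<alpha>)) * x powr (\<alpha> + 1) \<le> F x"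
proof -
  let ?c = "exp (-1) / (Z * (1 + \<alpha>))"
  have c: "0 < ?c" using Z \<alpha> by simp
  have "0 \<le> (\<lambda>x. F x - ?c * x powr (\<alpha> + 1)) x"
  proof (rule nonneg_left[where D = "\<lambda>x. F x - ?c * x powr (\<alpha> + 1)" and e = "\<lambda>x. ?c * x powr (\<alpha> + 1)", OF assms(1)])
    fix y assume y: "0 < y" "y \<le> x"
    have "DERIV (\<lambda>x. F x - ?c * x powr (\<alpha> + 1)) y :> \<phi> y - ?c * ((\<alpha> + 1) * y powr \<alpha>)"
      using y Z \<alpha> by (auto intro!: derivative_eq_intros DERIV_F)
    moreover have "0 \<le> \<phi> y - ?c * ((\<alpha> + 1) * y powr \<alpha>)"
    proof -
      have "?c * ((\<alpha> + 1) * y powr \<alpha>) = y powr \<alpha> * exp (-1) / Z" proof -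
        have "1 + \<alpha> \<noteq> 0" "Z \<noteq> 0" using \<alpha> Z by auto
        then show ?thesis by (simp add: add.commute[of \<alpha> 1])
      qed
      also have "\<dots> \<le> \<phi> y"
        unfolding \<phi>_def using y assms Z by (intro divide_right_mono mult_left_mono) auto
      finally show ?thesis by simp
    qed
    ultimately show "\<exists>d\<ge>0. DERIV (\<lambda>x. F x - ?c * x powr (\<alpha> + 1)) y :> d" by blast
    show "- (?c * y powr (\<alpha> + 1)) \<le> F y - ?c * y powr (\<alpha> + 1)" using F_bounds[of y] y by simp
  next
    have "((\<lambda>x::real. x powr (\<alpha> + 1)) \<longlongrightarrow> 0) (at_right 0)"
      using \<alpha> by (intro tendsto_eq_intros tendsto_ident_at refl) (auto simp: eventually_at_right_less intro: eventually_mono[OF eventually_at_right_less])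
    then show "((\<lambda>x. ?c * x powr (\<alpha> + 1)) \<longlongrightarrow> 0) (at_right 0)" by (rule tendsto_mult_right_zero)
  qed
  then show ?thesis by simp
qed

lemma F_compl_le:
  assumes "2 * \<bar>\<alpha>\<bar> + 1 \<le> x"
  shows "1 - F x \<le> 2 * \<phi> x"
proof -
  have "0 \<le> (\<lambda>x. 2 * \<phi> x - (1 - F x)) x"
  proof (rule nonneg_right[where D = "\<lambda>x. 2 * \<phi> x - (1 - F x)" and e = "\<lambda>x. 1 - F x"])
    fix y assume y: "x \<le> y"
    then have y0: "0 < y" "2 * \<bar>\<alpha>\<bar> \<le> y" using assms by auto
    have "DERIV (\<lambda>x. 2 * \<phi> x - (1 - F x)) y :> \<phi> y * (2 * (\<alpha> / y) - 1)"
      using y0 by (auto intro!: derivative_eq_intros DERIV_F DERIV_\<phi> simp: field_simps)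
    moreover have "\<phi> y * (2 * (\<alpha> / y) - 1) \<le> 0"
      using y0 \<phi>_pos[of y] by (intro mult_nonneg_nonpos) (auto simp: field_simps)
    ultimately show "\<exists>d\<le>0. DERIV (\<lambda>x. 2 * \<phi> x - (1 - F x)) y :> d" by blast
    show "- (1 - F y) \<le> 2 * \<phi> y - (1 - F y)" using y0 \<phi>_pos[of y] by simp
  next
    show "((\<lambda>x. 1 - F x) \<longlongrightarrow> 0) at_top" using tendsto_diff[OF tendsto_const F1, of 1] by simp
  qed
  then show ?thesis by simp
qed

text \<open>The doubled rate in the exponent absorbs the power of x even for negative \<alpha>.
  Later just the order of the logarithm counts, so nothing is lost.\<close>

lemma F_compl_ge:
  assumes "1 \<le> x"
  shows "exp (- 2 * x) / (2 * Z) \<le> 1 - F x"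
proof -
  have "0 \<le> (\<lambda>x. (1 - F x) - exp (- 2 * x) / (2 * Z)) x"
  proof (rule nonneg_right[where D = "\<lambda>x. (1 - F x) - exp (- 2 * x) / (2 * Z)" and e = "\<lambda>x. exp (- 2 * x) / (2 * Z)"])
    fix y assume y: "x \<le> y"
    then have y0: "1 \<le> y" "0 < y" using assms by auto
    have "DERIV (\<lambda>x. (1 - F x) - exp (- 2 * x) / (2 * Z)) y :> exp (- 2 * y) / Z - \<phi> y"
      using y0 Z by (auto intro!: derivative_eq_intros DERIV_F simp: field_simps)
    moreover have "exp (- 2 * y) / Z \<le> \<phi> y"
    proof -
      have "y \<le> exp y" using exp_ge_add_one_self[of y] by linarith
      then have "exp (- y) \<le> y powr (-1)" using y0 by (simp add: powr_minus exp_minus field_simps)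
      also have "\<dots> \<le> y powr \<alpha>" using y0 \<alpha> by (intro powr_mono) auto
      finally have "exp (- y) * exp (- y) \<le> y powr \<alpha> * exp (- y)" by (intro mult_right_mono) auto
      then show ?thesis using Z by (simp add: \<phi>_def divide_right_mono flip: exp_add)
    qed
    ultimately show "\<exists>d\<le>0. DERIV (\<lambda>x. (1 - F x) - exp (- 2 * x) / (2 * Z)) y :> d"
      by (intro exI[of _ "exp (- 2 * y) / Z - \<phi> y"]) auto
    show "- (exp (- 2 * y) / (2 * Z)) \<le> (1 - F y) - exp (- 2 * y) / (2 * Z)" using F_bounds[of y] y0 by simp
  next
    show "((\<lambda>x. exp (- 2 * x) / (2 * Z)) \<longlongrightarrow> 0) at_top"
      using Z by real_asymp
  qed
  then show ?thesis by simp
qed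

definition \<psi>' :: "real \<Rightarrow> real" where
  "\<psi>' x = \<phi> x / (2 * (1 - F x) * tail_root (1 - F x)) + \<phi> x / (2 * F x * tail_root (F x))"

lemma DERIV_\<psi>:
  assumes "0 < x"
  shows "DERIV (\<lambda>x. ref_quant (F x)) x :> \<psi>' x"
proof -
  have 1: "DERIV (\<lambda>x. tail_root (F x)) x :> - 1 / (2 * F x * tail_root (F x)) * \<phi> x"
    using F_bounds[OF assms] by (intro DERIV_chain2[OF DERIV_tail_root DERIV_F] assms) auto
  have "DERIV (\<lambda>x. 1 - F x) x :> 0 - \<phi> x"
    by (intro DERIV_diff DERIV_const DERIV_F assms)
  then have 2: "DERIV (\<lambda>x. tail_root (1 - F x)) x :> - 1 / (2 * (1 - F x) * tail_root (1 - F x)) * (0 - \<phi> x)"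
    using F_bounds[OF assms] by (intro DERIV_chain2[OF DERIV_tail_root]) auto
  have "\<psi>' x = - 1 / (2 * (1 - F x) * tail_root (1 - F x)) * (0 - \<phi> x) - - 1 / (2 * F x * tail_root (F x)) * \<phi> x"
    by (simp add: \<psi>'_def)
  then show ?thesis
    unfolding ref_quant_def using DERIV_diff[OF 2 1] by metis
qed

lemma \<psi>'_ge_parts:
  assumes "0 < x"
  shows "\<phi> x / (2 * (1 - F x) * tail_root (1 - F x)) \<le> \<psi>' x" "\<phi> x / (2 * F x * tail_root (F x)) \<le> \<psi>' x"
  using F_bounds[OF assms] \<phi>_pos[OF assms] tail_root_ge_1[of "F x"] tail_root_ge_1[of "1 - F x"]
  by (auto simp: \<psi>'_def)

lemma tail_root_le:
  assumes "0 < w" "exp (1 - b) \<le> w"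
  shows "tail_root w \<le> sqrt b"
proof -
  have "1 - b \<le> ln w" using assms by (simp add: ln_ge_iff)
  then show ?thesis unfolding tail_root_def by (intro real_sqrt_le_mono) simp
qed

text \<open>\<open>F_ge\<close> gives the generous bound \<open>sqrt (A / x)\<close> for a quantity
  that grows only logarithmically, and \<open>F_le\<close> bounds F x by a multiple of
  \<open>x * \<phi> x\<close>. The denominator of the second part of \<open>\<psi>'\<close> is thus
  at most of order \<open>sqrt x * \<phi> x\<close>.\<close>

lemma \<psi>'_left: "\<exists>c>0. \<forall>x. 0 < x \<and> x \<le> 1/4 \<longrightarrow> c / sqrt x \<le> \<psi>' x"
proof -
  define K where "K = exp (-1) / (Z * (1 + \<alpha>))"
  have K: "0 < K" using Z \<alpha> by (simp add: K_def)
  \<comment> \<open>The summands pay for the constant 1, for \<open>ln K\<close>, and for the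
    logarithm of \<open>x powr (\<alpha> + 1)\<close>, the last one through
    \<open>- ln x \<le> 1 / x\<close>.\<close>
  define A where "A = 1 + \<bar>ln K\<bar> + (\<alpha> + 1)"
  have A: "0 < A" using \<alpha> by (simp add: A_def)
  have "1 / (8 * sqrt A) / sqrt x \<le> \<psi>' x" if x: "0 < x" "x \<le> 1/4" for x
  proof -
    have "exp (1 - A / x) \<le> F x"
    proof -
      have "1 + \<bar>ln K\<bar> \<le> (1 + \<bar>ln K\<bar>) / x" using x by (simp add: le_divide_eq mult_left_le)
      moreover have "- ln x \<le> 1 / x - 1" using ln_le_minus_one[of "1 / x"] x by (simp add: ln_div)
      then have "(\<alpha> + 1) * (- ln x) \<le> (\<alpha> + 1) * (1 / x)" using \<alpha> by (intro mult_left_mono) auto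
      ultimately have "1 - A / x \<le> ln K + (\<alpha> + 1) * ln x"
        by (simp add: A_def add_divide_distrib)
      then have "exp (1 - A / x) \<le> exp (ln K + (\<alpha> + 1) * ln x)" by simp
      also have "\<dots> = K * x powr (\<alpha> + 1)" using K x by (simp add: exp_add powr_def)
      also have "\<dots> \<le> F x" unfolding K_def by (rule F_ge[OF x])
      finally show ?thesis .
    qed
    then have g: "tail_root (F x) \<le> sqrt (A / x)" using F_bounds[OF x(1)] by (intro tail_root_le) auto
    have "2 * F x * tail_root (F x) \<le> 2 * (4 * x * \<phi> x) * sqrt (A / x)"
      using F_le[OF x] g F_bounds[OF x(1)] tail_root_ge_1[of "F x"] x \<phi>_pos[OF x(1)] by (intro mult_mono) auto
    also have "\<dots> = 8 * sqrt A * sqrt x * \<phi> x" using x by (simp add: real_sqrt_divide real_div_sqrt field_simps)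
    finally have le: "2 * F x * tail_root (F x) \<le> 8 * sqrt A * sqrt x * \<phi> x" .
    have "1 / (8 * sqrt A) / sqrt x = \<phi> x / (8 * sqrt A * sqrt x * \<phi> x)"
      using \<phi>_pos[OF x(1)] by simp
    also have "\<dots> \<le> \<phi> x / (2 * F x * tail_root (F x))"
      using le \<phi>_pos[OF x(1)] F_bounds[OF x(1)] tail_root_ge_1[of "F x"] A x by (intro divide_left_mono mult_pos_pos) auto
    also have "\<dots> \<le> \<psi>' x" by (rule \<psi>'_ge_parts[OF x(1)])
    finally show ?thesis .
  qed
  moreover have "0 < 1 / (8 * sqrt A)" using A by simp
  ultimately show ?thesis by blast
qed

text \<open>In the right tail \<open>1 - F x\<close> is at most \<open>2 * \<phi> x\<close> and at
  least exponentially small of order x in the exponent, so \<open>tail_root (1 - F x)\<close> is at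
  most of order \<open>sqrt x\<close>.\<close>

lemma \<psi>'_right: "\<exists>c>0. \<forall>x. 2 * \<bar>\<alpha>\<bar> + 1 \<le> x \<longrightarrow> c / sqrt x \<le> \<psi>' x"
proof -
  define A where "A = 3 + \<bar>ln (2 * Z)\<bar>"
  have A: "0 < A" by (simp add: A_def)
  have "1 / (4 * sqrt A) / sqrt x \<le> \<psi>' x" if x: "2 * \<bar>\<alpha>\<bar> + 1 \<le> x" for x
  proof -
    have x1: "1 \<le> x" "0 < x" using x by auto
    have "exp (1 - A * x) \<le> 1 - F x"
    proof -
      have "(1 + \<bar>ln (2 * Z)\<bar>) * 1 \<le> (1 + \<bar>ln (2 * Z)\<bar>) * x" using x1 by (intro mult_left_mono) auto
      then have "1 - A * x \<le> - 2 * x - ln (2 * Z)" by (simp add: A_def algebra_simps)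
      then have "exp (1 - A * x) \<le> exp (- 2 * x - ln (2 * Z))" by simp
      also have "\<dots> = exp (- 2 * x) / (2 * Z)" using Z by (simp add: exp_diff)
      also have "\<dots> \<le> 1 - F x" by (rule F_compl_ge[OF x1(1)])
      finally show ?thesis .
    qed
    then have g: "tail_root (1 - F x) \<le> sqrt (A * x)" using F_bounds[OF x1(2)] by (intro tail_root_le) auto
    have "2 * (1 - F x) * tail_root (1 - F x) \<le> 2 * (2 * \<phi> x) * sqrt (A * x)"
      using F_compl_le[OF x] g F_bounds[OF x1(2)] tail_root_ge_1[of "1 - F x"] \<phi>_pos[OF x1(2)] by (intro mult_mono) auto
    also have "\<dots> = 4 * sqrt A * sqrt x * \<phi> x" by (simp add: real_sqrt_mult)
    finally have le: "2 * (1 - F x) * tail_root (1 - F x) \<le> 4 * sqrt A * sqrt x * \<phi> x" .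
    have "1 / (4 * sqrt A) / sqrt x = \<phi> x / (4 * sqrt A * sqrt x * \<phi> x)"
      using \<phi>_pos[OF x1(2)] by simp
    also have "\<dots> \<le> \<phi> x / (2 * (1 - F x) * tail_root (1 - F x))"
      using le \<phi>_pos[OF x1(2)] F_bounds[OF x1(2)] tail_root_ge_1[of "1 - F x"] A x1 by (intro divide_left_mono mult_pos_pos) auto
    also have "\<dots> \<le> \<psi>' x" by (rule \<psi>'_ge_parts[OF x1(2)])
    finally show ?thesis .
  qed
  moreover have "0 < 1 / (4 * sqrt A)" using A by simp
  ultimately show ?thesis by blast
qed

lemma \<psi>'_middle: "\<exists>c>0. \<forall>x\<in>{1/4..M}. c / sqrt x \<le> \<psi>' x"
proof (cases "1/4 \<le> M")
  case True
  have "continuous_on {1/4..M} (\<lambda>x. sqrt x * \<phi> x / 2)"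
    unfolding \<phi>_def using Z by (intro continuous_intros) auto
  then obtain x0 where x0: "x0 \<in> {1/4..M}" "\<And>x. x \<in> {1/4..M} \<Longrightarrow> sqrt x0 * \<phi> x0 / 2 \<le> sqrt x * \<phi> x / 2"
    using continuous_attains_inf[of "{1/4..M}" "\<lambda>x. sqrt x * \<phi> x / 2"] True by auto
  define c where "c = sqrt x0 * \<phi> x0 / 2"
  have "0 < c" using x0 \<phi>_pos[of x0] by (simp add: c_def)
  moreover have "c / sqrt x \<le> \<psi>' x" if x: "x \<in> {1/4..M}" for x
  proof -
    have xp: "0 < x" using x by simp
    have "c / sqrt x \<le> (sqrt x * \<phi> x / 2) / sqrt x"
      using x0(2)[OF x] xp unfolding c_def by (intro divide_right_mono) auto
    also have "\<dots> = \<phi> x / 2" using xp by simp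
    also have "\<dots> \<le> \<phi> x / (2 * F x * tail_root (F x))"
      using mult_tail_root_le_1[of "F x"] F_bounds[OF xp] tail_root_ge_1[of "F x"] \<phi>_pos[OF xp]
      by (intro divide_left_mono mult_pos_pos) auto
    also have "\<dots> \<le> \<psi>' x" by (rule \<psi>'_ge_parts[OF xp])
    finally show ?thesis .
  qed
  ultimately show ?thesis by blast
qed (auto intro: exI[of _ 1])

text \<open>On three ranges covering the half-line \<open>\<psi>'\<close> dominates a multiple of
  the derivative of the square root, so subtracting that multiple of \<open>sqrt\<close> leaves an
  increasing function. Read through the quantile function, this is its Lipschitz bound.\<close>

lemma ref_quant_F_expands: "\<exists>c>0. \<forall>x y. 0 < x \<and> x \<le> y \<longrightarrow> c * (sqrt y - sqrt x) \<le> ref_quant (F y) - ref_quant (F x)"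
proof -
  obtain c1 where c1: "0 < c1" "\<And>x. 0 < x \<Longrightarrow> x \<le> 1/4 \<Longrightarrow> c1 / sqrt x \<le> \<psi>' x" using \<psi>'_left by blast
  obtain c2 where c2: "0 < c2" "\<And>x. x \<in> {1/4..2 * \<bar>\<alpha>\<bar> + 1} \<Longrightarrow> c2 / sqrt x \<le> \<psi>' x" using \<psi>'_middle by blast
  obtain c3 where c3: "0 < c3" "\<And>x. 2 * \<bar>\<alpha>\<bar> + 1 \<le> x \<Longrightarrow> c3 / sqrt x \<le> \<psi>' x" using \<psi>'_right by blast
  define c where "c = min c1 (min c2 c3)"
  have c: "0 < c" "c \<le> c1" "c \<le> c2" "c \<le> c3" using c1 c2 c3 by (auto simp: c_def)
  have low: "c / sqrt x \<le> \<psi>' x" if x: "0 < x" for x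
  proof -
    consider "x \<le> 1/4" | "x \<in> {1/4..2 * \<bar>\<alpha>\<bar> + 1}" | "2 * \<bar>\<alpha>\<bar> + 1 \<le> x" by fastforce
    then show ?thesis
    proof cases
      case 1
      have "c / sqrt x \<le> c1 / sqrt x" using c x by (intro divide_right_mono) auto
      then show ?thesis using c1(2)[OF x 1] by simp
    next
      case 2
      have "c / sqrt x \<le> c2 / sqrt x" using c x by (intro divide_right_mono) auto
      then show ?thesis using c2(2)[OF 2] by simp
    next
      case 3
      have "c / sqrt x \<le> c3 / sqrt x" using c x by (intro divide_right_mono) auto
      then show ?thesis using c3(2)[OF 3] by simp
    qed
  qed
  have "2 * c * (sqrt y - sqrt x) \<le> ref_quant (F y) - ref_quant (F x)" if xy: "0 < x" "x \<le> y" for x y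
  proof -
    let ?D = "\<lambda>x. ref_quant (F x) - 2 * c * sqrt x"
    have "?D x \<le> ?D y"
    proof (rule DERIV_nonneg_imp_nondecreasing[where f = ?D, OF xy(2)])
      fix z assume z: "x \<le> z" "z \<le> y"
      then have z0: "0 < z" using xy by simp
      have "DERIV ?D z :> \<psi>' z - 2 * c * (inverse (sqrt z) / 2)"
        by (intro DERIV_diff DERIV_\<psi>[OF z0] DERIV_cmult DERIV_real_sqrt[OF z0])
      moreover have "0 \<le> \<psi>' z - 2 * c * (inverse (sqrt z) / 2)" using low[OF z0] by (simp add: field_simps)
      ultimately show "\<exists>d. DERIV ?D z :> d \<and> d \<ge> 0" by blast
    qed
    then show ?thesis by (simp add: algebra_simps)
  qed
  moreover have "0 < 2 * c" using c by simp
  ultimately show ?thesis by blast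
qed

end

section \<open>Gamma distributions and their quantile functions\<close>

definition gamma_dens :: "real \<Rightarrow> real \<Rightarrow> real" where
  "gamma_dens \<alpha> x = (if 0 < x then x powr \<alpha> * exp (- x) / Gamma (1 + \<alpha>) else 0)"

definition gamma_meas :: "real \<Rightarrow> real measure" where
  "gamma_meas \<alpha> = density lborel (\<lambda>x. ennreal (gamma_dens \<alpha> x))"

lemma gamma_dens_measurable [measurable]: "gamma_dens \<alpha> \<in> borel_measurable borel"
  unfolding gamma_dens_def[abs_def] by measurable

lemma gamma_dens_nonneg: "- 1 < \<alpha> \<Longrightarrow> 0 \<le> gamma_dens \<alpha> x"
  by (simp add: gamma_dens_def)

lemma sets_gamma_meas [simp, measurable_cong]: "sets (gamma_meas \<alpha>) = sets borel"
  by (simp add: gamma_meas_def)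

lemma prob_space_gamma_meas:
  assumes "- 1 < \<alpha>"
  shows "prob_space (gamma_meas \<alpha>)"
proof
  have "((\<lambda>t. t powr \<alpha> / exp t) has_integral Gamma (1 + \<alpha>)) {0..}"
    using Gamma_integral_real[of "1 + \<alpha>"] assms by simp
  then have "((\<lambda>t. (t powr \<alpha> / exp t) / Gamma (1 + \<alpha>)) has_integral Gamma (1 + \<alpha>) / Gamma (1 + \<alpha>)) {0..}"
    by (rule has_integral_divide)
  moreover have G: "0 < Gamma (1 + \<alpha>)" using assms by (intro Gamma_real_pos) simp
  ultimately have "((\<lambda>t. (t powr \<alpha> / exp t) / Gamma (1 + \<alpha>)) has_integral 1) {0..}" by simp
  from nn_integral_has_integral_lebesgue'[OF _ this] G
  have "(\<integral>\<^sup>+t. ennreal ((t powr \<alpha> / exp t) / Gamma (1 + \<alpha>)) * indicator {0..} t \<partial>lborel) = 1" by simp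
  moreover have "(\<integral>\<^sup>+t. ennreal (gamma_dens \<alpha> t) \<partial>lborel) =
    (\<integral>\<^sup>+t. ennreal ((t powr \<alpha> / exp t) / Gamma (1 + \<alpha>)) * indicator {0..} t \<partial>lborel)"
    using AE_lborel_singleton[of 0]
    by (intro nn_integral_cong_AE) (auto elim!: eventually_mono simp: gamma_dens_def indicator_def exp_minus field_simps)
  ultimately show "emeasure (gamma_meas \<alpha>) (space (gamma_meas \<alpha>)) = 1"
    by (simp add: gamma_meas_def emeasure_density)
qed

lemma real_distribution_gamma_meas: "- 1 < \<alpha> \<Longrightarrow> real_distribution (gamma_meas \<alpha>)"
  by (simp add: real_distribution_def real_distribution_axioms_def prob_space_gamma_meas)

lemma cdf_gamma_meas_nonpos:
  assumes "x \<le> 0"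
  shows "cdf (gamma_meas \<alpha>) x = 0"
proof -
  have "emeasure (gamma_meas \<alpha>) {..x} = (\<integral>\<^sup>+t. ennreal (gamma_dens \<alpha> t) * indicator {..x} t \<partial>lborel)"
    by (simp add: gamma_meas_def emeasure_density)
  also have "\<dots> = (\<integral>\<^sup>+t. 0 \<partial>(lborel :: real measure))"
    using assms by (intro nn_integral_cong) (auto simp: gamma_dens_def indicator_def)
  finally show ?thesis by (simp add: cdf_def measure_def)
qed

lemma gamma_cdf_gamma_meas:
  assumes \<alpha>: "- 1 / 2 \<le> \<alpha>"
  shows "gamma_cdf (cdf (gamma_meas \<alpha>)) \<alpha> (Gamma (1 + \<alpha>))"
proof
  interpret M: real_distribution "gamma_meas \<alpha>" by (rule real_distribution_gamma_meas) (use \<alpha> in simp)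
  show "- 1 / 2 \<le> \<alpha>" by fact
  show G: "0 < Gamma (1 + \<alpha>)" using \<alpha> by (intro Gamma_real_pos) simp
  show "(cdf (gamma_meas \<alpha>) \<longlongrightarrow> 1) at_top" by (rule M.cdf_lim_at_top_prob)
  have "continuous (at_right 0) (cdf (gamma_meas \<alpha>))" by (rule M.cdf_is_right_cont)
  then show "(cdf (gamma_meas \<alpha>) \<longlongrightarrow> 0) (at_right 0)" by (simp add: continuous_within cdf_gamma_meas_nonpos)
  fix x :: real assume x: "0 < x"
  let ?f = "\<lambda>x. x powr \<alpha> * exp (- x) / Gamma (1 + \<alpha>)"
  \<comment> \<open>The interval from x / 2 to 2 * x stays away from 0, where the density is
    unbounded for negative \<alpha>.\<close>
  define a where "a = x / 2"
  define b where "b = 2 * x"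
  have ab: "0 < a" "a < x" "x < b" using x by (auto simp: a_def b_def)
  have cont: "continuous_on {a..b} ?f" using ab G by (intro continuous_intros) auto
  have step: "cdf (gamma_meas \<alpha>) y = cdf (gamma_meas \<alpha>) a + integral {a..y} ?f" if y: "y \<in> {a<..<b}" for y
  proof -
    have "continuous_on {a..y} ?f" by (rule continuous_on_subset[OF cont]) (use y in auto)
    then have "(?f has_integral integral {a..y} ?f) {a..y}"
      by (intro integrable_integral integrable_continuous_interval)
    from nn_integral_has_integral_lebesgue'[OF _ this] G
    have "(\<integral>\<^sup>+t. ennreal (?f t) * indicator {a..y} t \<partial>lborel) = ennreal (integral {a..y} ?f)"
      by auto
    also have "(\<integral>\<^sup>+t. ennreal (?f t) * indicator {a..y} t \<partial>lborel) =
      (\<integral>\<^sup>+t. ennreal (gamma_dens \<alpha> t) * indicator {a<..y} t \<partial>lborel)"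
      using AE_lborel_singleton[of a] ab
      by (intro nn_integral_cong_AE) (auto elim!: eventually_mono simp: gamma_dens_def indicator_def)
    also have "\<dots> = emeasure (gamma_meas \<alpha>) {a<..y}" by (simp add: gamma_meas_def emeasure_density)
    finally have e: "emeasure (gamma_meas \<alpha>) {a<..y} = ennreal (integral {a..y} ?f)" .
    have "0 \<le> integral {a..y} ?f"
      using G \<open>continuous_on {a..y} ?f\<close>
      by (intro Henstock_Kurzweil_Integration.integral_nonneg integrable_continuous_interval) auto
    then have "measure (gamma_meas \<alpha>) {a<..y} = integral {a..y} ?f"
      by (simp only: measure_def e enn2real_ennreal)
    then show ?thesis using M.cdf_diff_eq[of a y] y by simp
  qed
  have "((\<lambda>y. integral {a..y} ?f) has_real_derivative ?f x) (at x within {a..b})"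
    by (rule integral_has_real_derivative[OF cont]) (use ab in auto)
  then have "((\<lambda>y. integral {a..y} ?f) has_real_derivative ?f x) (at x within {a<..<b})"
    by (rule DERIV_subset) auto
  then have "((\<lambda>y. integral {a..y} ?f) has_real_derivative ?f x) (at x)"
    using ab by (simp add: at_within_open[of x "{a<..<b}"])
  from DERIV_add[OF DERIV_const[of "cdf (gamma_meas \<alpha>) a"] this]
  have "((\<lambda>y. cdf (gamma_meas \<alpha>) a + integral {a..y} ?f) has_real_derivative ?f x) (at x)"
    by (simp only: add_0)
  then show "DERIV (cdf (gamma_meas \<alpha>)) x :> ?f x"
  proof (rule DERIV_cong_ev[THEN iffD1, rotated -1])
    show "\<forall>\<^sub>F y in nhds x. cdf (gamma_meas \<alpha>) a + integral {a..y} ?f = cdf (gamma_meas \<alpha>) y"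
      using eventually_nhds_in_open[of "{a<..<b}" x] ab by (auto elim!: eventually_mono simp: step)
  qed auto
qed

text \<open>Off the open unit interval, a null set for \<open>unif\<close>, the value 1 keeps the
  quantile positive, so that image points always lie in the orthant.\<close>

definition gquant :: "real \<Rightarrow> real \<Rightarrow> real" where
  "gquant \<alpha> u = (if 0 < u \<and> u < 1 then SOME x. 0 < x \<and> cdf (gamma_meas \<alpha>) x = u else 1)"

context
  fixes \<alpha> :: real
  assumes \<alpha>: "- 1 / 2 \<le> \<alpha>"
begin

interpretation gamma_cdf "cdf (gamma_meas \<alpha>)" \<alpha> "Gamma (1 + \<alpha>)"
  by (rule gamma_cdf_gamma_meas[OF \<alpha>])

lemma gquant_inverse:
  assumes "0 < u" "u < 1"
  shows "0 < gquant \<alpha> u \<and> cdf (gamma_meas \<alpha>) (gquant \<alpha> u) = u"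
proof -
  have "\<exists>x>0. cdf (gamma_meas \<alpha>) x = u"
  proof -
    have "\<forall>\<^sub>F x in at_right 0. 0 < x \<and> cdf (gamma_meas \<alpha>) x < u"
      using order_tendstoD(2)[OF F0 assms(1)] eventually_at_right_less[of 0] by eventually_elim auto
    then have "\<exists>a. 0 < a \<and> cdf (gamma_meas \<alpha>) a < u" by (rule eventually_happens'[OF trivial_limit_at_right_real])
    then obtain a where a: "0 < a" "cdf (gamma_meas \<alpha>) a < u" by blast
    have "\<forall>\<^sub>F x in at_top. a < x \<and> u < cdf (gamma_meas \<alpha>) x"
      using order_tendstoD(1)[OF F1 assms(2)] eventually_gt_at_top[of a] by eventually_elim auto
    then have "\<exists>b. a < b \<and> u < cdf (gamma_meas \<alpha>) b" by (rule eventually_happens'[OF trivial_limit_at_top_linorder])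
    then obtain b where b: "a < b" "u < cdf (gamma_meas \<alpha>) b" by blast
    have "continuous_on {a..b} (cdf (gamma_meas \<alpha>))"
    proof (intro continuous_at_imp_continuous_on ballI)
      fix x assume "x \<in> {a..b}"
      then have "0 < x" using a by simp
      then show "isCont (cdf (gamma_meas \<alpha>)) x" by (rule DERIV_isCont[OF DERIV_F])
    qed
    then obtain x where "a \<le> x" "x \<le> b" "cdf (gamma_meas \<alpha>) x = u"
      using IVT'[of "cdf (gamma_meas \<alpha>)" a u b] a b by auto
    then show ?thesis using a by (intro exI[of _ x]) auto
  qed
  from someI_ex[OF this] show ?thesis using assms by (simp add: gquant_def)
qed

lemma gquant_pos: "0 < gquant \<alpha> u"
  using gquant_inverse[of u] by (cases "0 < u \<and> u < 1") (auto simp: gquant_def)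

lemma gquant_le_iff:
  assumes "0 < u" "u < 1" "0 < x"
  shows "gquant \<alpha> u \<le> x \<longleftrightarrow> u \<le> cdf (gamma_meas \<alpha>) x"
proof -
  have q: "0 < gquant \<alpha> u" "cdf (gamma_meas \<alpha>) (gquant \<alpha> u) = u" using gquant_inverse[OF assms(1,2)] by auto
  show ?thesis
    using F_strict_mono[of "gquant \<alpha> u" x] F_strict_mono[of x "gquant \<alpha> u"] q assms(3)
    by (cases "gquant \<alpha> u" x rule: linorder_cases) auto
qed

lemma gquant_measurable: "gquant \<alpha> \<in> borel_measurable borel"
proof (rule borel_measurableI_le)
  fix x
  have "{u \<in> space borel. gquant \<alpha> u \<le> x} =
    (if 0 < x then ({0<..<1} \<inter> {..cdf (gamma_meas \<alpha>) x}) \<union> (if 1 \<le> x then - {0<..<1} else {}) else {})"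
  proof (cases "0 < x")
    case True
    have iff: "gquant \<alpha> u \<le> x \<longleftrightarrow> (0 < u \<and> u < 1 \<and> u \<le> cdf (gamma_meas \<alpha>) x) \<or> (1 \<le> x \<and> \<not> (0 < u \<and> u < 1))" for u
      using gquant_le_iff[of u x] True by (cases "0 < u \<and> u < 1") (auto simp: gquant_def)
    show ?thesis unfolding iff using True by (cases "1 \<le> x") auto
  next
    case False
    then have "\<not> gquant \<alpha> u \<le> x" for u using gquant_pos[of u] by linarith
    then show ?thesis using False by simp
  qed
  then show "{u \<in> space borel. gquant \<alpha> u \<le> x} \<in> sets borel" by simp
qed

lemma distr_gquant: "distr unif borel (gquant \<alpha>) = gamma_meas \<alpha>"
proof (rule cdf_unique)
  show "real_distribution (gamma_meas \<alpha>)" by (rule real_distribution_gamma_meas) (use \<alpha> in simp)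
  have m: "gquant \<alpha> \<in> measurable unif borel" using gquant_measurable by (simp cong: measurable_cong_sets)
  show "real_distribution (distr unif borel (gquant \<alpha>))"
    using prob_space.prob_space_distr[OF prob_space_unif m] by (simp add: real_distribution_def real_distribution_axioms_def)
  show "cdf (distr unif borel (gquant \<alpha>)) = cdf (gamma_meas \<alpha>)"
  proof
    fix x
    have eq: "cdf (distr unif borel (gquant \<alpha>)) x = measure unif {u. gquant \<alpha> u \<le> x}"
      using m by (simp add: cdf_def measure_distr vimage_def)
    show "cdf (distr unif borel (gquant \<alpha>)) x = cdf (gamma_meas \<alpha>) x"
    proof (cases "0 < x")
      case True
      have b: "0 < cdf (gamma_meas \<alpha>) x" "cdf (gamma_meas \<alpha>) x < 1" using F_bounds[OF True] by auto
      have "{u. gquant \<alpha> u \<le> x} \<in> sets borel"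
        using gquant_measurable by simp
      then have "emeasure unif {u. gquant \<alpha> u \<le> x} = emeasure lborel ({0<..<1} \<inter> {u. gquant \<alpha> u \<le> x})"
        unfolding unif_def by (subst emeasure_uniform_measure) (auto simp: divide_ennreal_def)
      also have "{0<..<1} \<inter> {u. gquant \<alpha> u \<le> x} = {0<..cdf (gamma_meas \<alpha>) x}"
        using gquant_le_iff[OF _ _ True] b by (auto intro: order.strict_trans1)
      finally show ?thesis unfolding eq using b by (simp add: measure_def)
    next
      case False
      then have "\<not> gquant \<alpha> u \<le> x" for u using gquant_pos[of u] by linarith
      then have "{u. gquant \<alpha> u \<le> x} = {}" by simp
      then show ?thesis unfolding eq using False by (simp add: cdf_gamma_meas_nonpos)
    qed
  qed
qed

lemma gquant_lipschitz: "\<exists>C>0. \<forall>u v. 0 < u \<and> u < 1 \<and> 0 < v \<and> v < 1 \<longrightarrow>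
  \<bar>sqrt (gquant \<alpha> u) - sqrt (gquant \<alpha> v)\<bar> \<le> C * \<bar>ref_quant u - ref_quant v\<bar>"
proof -
  obtain c where c: "0 < c" "\<And>x y. 0 < x \<Longrightarrow> x \<le> y \<Longrightarrow>
      c * (sqrt y - sqrt x) \<le> ref_quant (cdf (gamma_meas \<alpha>) y) - ref_quant (cdf (gamma_meas \<alpha>) x)"
    using ref_quant_F_expands by blast
  have "\<bar>sqrt (gquant \<alpha> u) - sqrt (gquant \<alpha> v)\<bar> \<le> 1 / c * \<bar>ref_quant u - ref_quant v\<bar>"
    if uv: "0 < u" "u < 1" "0 < v" "v < 1" for u v
  proof -
    have *: "c * \<bar>sqrt (gquant \<alpha> u) - sqrt (gquant \<alpha> v)\<bar> \<le> \<bar>ref_quant u - ref_quant v\<bar>"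
      if uv: "0 < u" "u < 1" "0 < v" "v < 1" and le: "gquant \<alpha> v \<le> gquant \<alpha> u" for u v
      using c(2)[of "gquant \<alpha> v" "gquant \<alpha> u"] gquant_inverse[of u] gquant_inverse[of v] uv le by simp
    have "c * \<bar>sqrt (gquant \<alpha> u) - sqrt (gquant \<alpha> v)\<bar> \<le> \<bar>ref_quant u - ref_quant v\<bar>"
      using *[of u v] *[of v u] uv by (cases "gquant \<alpha> v \<le> gquant \<alpha> u") (auto simp: abs_minus_commute)
    then show ?thesis using c(1) by (simp add: field_simps)
  qed
  moreover have "0 < 1 / c" using c by simp
  ultimately show ?thesis by blast
qed

end

section \<open>From the cube to the orthant\<close>

lemma borel_measurable_vec_lambdaI:
  assumes "\<And>j. (\<lambda>x. f x j) \<in> borel_measurable M"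
  shows "(\<lambda>x. \<chi> j. f x j :: real ^ 'N) \<in> borel_measurable M"
proof (rule borel_measurable_euclidean_space[THEN iffD2], intro ballI)
  fix b :: "real ^ 'N" assume "b \<in> Basis"
  then obtain j where "b = axis j 1" by (auto simp: Basis_vec_def)
  then show "(\<lambda>x. (\<chi> j. f x j) \<bullet> b) \<in> borel_measurable M" using assms by (simp add: inner_axis)
qed

lemma measurable_PiM_lborel_component [measurable]:
  "(\<lambda>v. v j) \<in> borel_measurable (Pi\<^sub>M UNIV (\<lambda>_. lborel))"
  using measurable_component_singleton[of j UNIV "\<lambda>_. lborel"] by simp

text \<open>The bridge between densities on vectors and product measures on functions, obtained by
  comparing the volumes of boxes.\<close>

lemma lborel_vec:
  "(lborel :: (real ^ 'N) measure) = distr (Pi\<^sub>M UNIV (\<lambda>_::'N. lborel)) borel (\<lambda>v. \<chi> j. v j)"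
proof (rule lborel_eqI)
  interpret product_sigma_finite "\<lambda>_::'N. lborel :: real measure" ..
  have m: "(\<lambda>v. \<chi> j. v j) \<in> measurable (Pi\<^sub>M UNIV (\<lambda>_::'N. lborel)) (borel :: (real ^ 'N) measure)"
    by (rule borel_measurable_vec_lambdaI) measurable
  fix l u :: "real ^ 'N" assume le: "\<And>b. b \<in> Basis \<Longrightarrow> l \<bullet> b \<le> u \<bullet> b"
  have lu: "l $ j \<le> u $ j" for j using le[of "axis j 1"] by (simp add: cart_eq_inner_axis)
  have "(\<lambda>v. \<chi> j. v j) -` box l u \<inter> space (Pi\<^sub>M UNIV (\<lambda>_::'N. lborel)) = PiE UNIV (\<lambda>j. {l $ j<..<u $ j})"
    by (auto simp: space_PiM mem_box_cart PiE_def Pi_def)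
  then have "emeasure (distr (Pi\<^sub>M UNIV (\<lambda>_::'N. lborel)) borel (\<lambda>v. \<chi> j. v j)) (box l u) =
    emeasure (Pi\<^sub>M UNIV (\<lambda>_::'N. lborel)) (PiE UNIV (\<lambda>j. {l $ j<..<u $ j}))"
    using m by (subst emeasure_distr) auto
  also have "\<dots> = (\<Prod>j\<in>UNIV. ennreal (u $ j - l $ j))"
    using lu by (subst emeasure_PiM) auto
  also have "\<dots> = ennreal (\<Prod>j\<in>UNIV. u $ j - l $ j)" using lu by (intro prod_ennreal) auto
  also have "(\<Prod>j\<in>UNIV. u $ j - l $ j) = (\<Prod>b\<in>Basis. (u - l) \<bullet> b)"
  proof -
    have Basis: "(Basis :: (real ^ 'N) set) = (\<lambda>j. axis j 1) ` UNIV" by (auto simp: Basis_vec_def)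
    have "inj (\<lambda>j. axis j 1 :: real ^ 'N)" by (auto simp: inj_def axis_eq_axis)
    then show ?thesis unfolding Basis by (subst prod.reindex) (auto simp: inner_axis)
  qed
  finally show "emeasure (distr (Pi\<^sub>M UNIV (\<lambda>_::'N. lborel)) borel (\<lambda>v. \<chi> j. v j)) (box l u) = (\<Prod>b\<in>Basis. (u - l) \<bullet> b)" .
qed simp

definition quant :: "real ^ 'N \<Rightarrow> ('N \<Rightarrow> real) \<Rightarrow> real ^ 'N" where
  "quant \<alpha> v = (\<chi> j. gquant (\<alpha> $ j) (v j))"

context
  fixes \<alpha> :: "real ^ 'N"
  assumes \<alpha>: "\<And>j. - 1 / 2 \<le> \<alpha> $ j"
begin

lemma \<alpha>_gt: "- 1 < \<alpha> $ j"
  using \<alpha>[of j] by simp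

lemma PiM_gamma_meas_density:
  "density (Pi\<^sub>M UNIV (\<lambda>_::'N. lborel)) (\<lambda>v. ennreal (\<Prod>j\<in>UNIV. gamma_dens (\<alpha> $ j) (v j))) = Pi\<^sub>M UNIV (\<lambda>j. gamma_meas (\<alpha> $ j))"
proof -
  interpret L: product_sigma_finite "\<lambda>_::'N. lborel :: real measure" ..
  interpret G: product_prob_space "\<lambda>j. gamma_meas (\<alpha> $ j)"
    using prob_space_gamma_meas[OF \<alpha>_gt] by (simp add: product_prob_spaceI)
  show ?thesis
  proof (rule G.PiM_eqI)
    have "sets (Pi\<^sub>M UNIV (\<lambda>_::'N. lborel)) = sets (Pi\<^sub>M UNIV (\<lambda>j. gamma_meas (\<alpha> $ j)))"
      by (rule sets_PiM_cong) auto
    then show "sets (density (Pi\<^sub>M UNIV (\<lambda>_::'N. lborel)) (\<lambda>v. ennreal (\<Prod>j\<in>UNIV. gamma_dens (\<alpha> $ j) (v j)))) = sets (Pi\<^sub>M UNIV (\<lambda>j. gamma_meas (\<alpha> $ j)))"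
      by simp
    fix A :: "'N \<Rightarrow> real set" assume "\<And>i. i \<in> UNIV \<Longrightarrow> A i \<in> sets (gamma_meas (\<alpha> $ i))"
    then have A [measurable]: "A i \<in> sets borel" for i by simp
    have "emeasure (density (Pi\<^sub>M UNIV (\<lambda>_::'N. lborel)) (\<lambda>v. ennreal (\<Prod>j\<in>UNIV. gamma_dens (\<alpha> $ j) (v j)))) (PiE UNIV A) =
      (\<integral>\<^sup>+v. ennreal (\<Prod>j\<in>UNIV. gamma_dens (\<alpha> $ j) (v j)) * indicator (PiE UNIV A) v \<partial>Pi\<^sub>M UNIV (\<lambda>_::'N. lborel))"
      by (subst emeasure_density) (auto intro!: sets_PiM_I_finite)
    also have "\<dots> = (\<integral>\<^sup>+v. (\<Prod>j\<in>UNIV. ennreal (gamma_dens (\<alpha> $ j) (v j)) * indicator (A j) (v j)) \<partial>Pi\<^sub>M UNIV (\<lambda>_::'N. lborel))"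
    proof (intro nn_integral_cong)
      fix v :: "'N \<Rightarrow> real"
      have "indicator (PiE UNIV A) v = (\<Prod>j\<in>UNIV. indicator (A j) (v j) :: ennreal)"
        by (auto simp: indicator_def PiE_def Pi_def prod_zero_iff)
      then show "ennreal (\<Prod>j\<in>UNIV. gamma_dens (\<alpha> $ j) (v j)) * indicator (PiE UNIV A) v =
        (\<Prod>j\<in>UNIV. ennreal (gamma_dens (\<alpha> $ j) (v j)) * indicator (A j) (v j))"
        by (simp add: prod.distrib prod_ennreal gamma_dens_nonneg[OF \<alpha>_gt])
    qed
    also have "\<dots> = (\<Prod>j\<in>UNIV. \<integral>\<^sup>+x. ennreal (gamma_dens (\<alpha> $ j) x) * indicator (A j) x \<partial>lborel)"
      by (rule L.product_nn_integral_prod) auto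
    also have "\<dots> = (\<Prod>j\<in>UNIV. emeasure (gamma_meas (\<alpha> $ j)) (A j))"
      by (simp add: gamma_meas_def emeasure_density)
    finally show "emeasure (density (Pi\<^sub>M UNIV (\<lambda>_::'N. lborel)) (\<lambda>v. ennreal (\<Prod>j\<in>UNIV. gamma_dens (\<alpha> $ j) (v j)))) (PiE UNIV A) =
      (\<Prod>j\<in>UNIV. emeasure (gamma_meas (\<alpha> $ j)) (A j))" .
  qed simp
qed

lemma PiM_gamma_meas_quant:
  "distr cube (Pi\<^sub>M UNIV (\<lambda>_::'N. borel)) (\<lambda>v j. gquant (\<alpha> $ j) (v j)) = Pi\<^sub>M UNIV (\<lambda>j. gamma_meas (\<alpha> $ j))"
proof -
  interpret U: product_prob_space "\<lambda>_::'N. unif" by (simp add: product_prob_spaceI)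
  interpret G: product_prob_space "\<lambda>j. gamma_meas (\<alpha> $ j)"
    using prob_space_gamma_meas[OF \<alpha>_gt] by (simp add: product_prob_spaceI)
  have q: "(\<lambda>v. gquant (\<alpha> $ j) (v j)) \<in> borel_measurable (cube :: ('N \<Rightarrow> real) measure)" for j
    by (rule measurable_compose[OF cube_component gquant_measurable[OF \<alpha>]])
  have m: "(\<lambda>v j. gquant (\<alpha> $ j) (v j)) \<in> measurable cube (Pi\<^sub>M UNIV (\<lambda>_::'N. borel))"
    by (rule measurable_PiM_single') (auto simp: q)
  show ?thesis
  proof (rule G.PiM_eqI)
    show "sets (distr cube (Pi\<^sub>M UNIV (\<lambda>_::'N. borel)) (\<lambda>v j. gquant (\<alpha> $ j) (v j))) = sets (Pi\<^sub>M UNIV (\<lambda>j. gamma_meas (\<alpha> $ j)))"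
      by (simp, rule sets_PiM_cong) auto
    fix A :: "'N \<Rightarrow> real set" assume "\<And>i. i \<in> UNIV \<Longrightarrow> A i \<in> sets (gamma_meas (\<alpha> $ i))"
    then have A: "A i \<in> sets borel" for i by simp
    have "emeasure (distr cube (Pi\<^sub>M UNIV (\<lambda>_::'N. borel)) (\<lambda>v j. gquant (\<alpha> $ j) (v j))) (PiE UNIV A) =
      emeasure cube ((\<lambda>v j. gquant (\<alpha> $ j) (v j)) -` PiE UNIV A \<inter> space cube)"
      using A by (intro emeasure_distr m sets_PiM_I_finite) auto
    also have "(\<lambda>v j. gquant (\<alpha> $ j) (v j)) -` PiE UNIV A \<inter> space cube = PiE UNIV (\<lambda>j. gquant (\<alpha> $ j) -` A j)"
      by (auto simp: PiE_def Pi_def)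
    also have "emeasure cube \<dots> = (\<Prod>j\<in>UNIV. emeasure unif (gquant (\<alpha> $ j) -` A j))"
      unfolding cube_def
      by (rule U.emeasure_PiM) (use measurable_sets[OF gquant_measurable[OF \<alpha>] A] in \<open>auto\<close>)
    also have "\<dots> = (\<Prod>j\<in>UNIV. emeasure (gamma_meas (\<alpha> $ j)) (A j))"
    proof (intro prod.cong refl)
      fix j
      have "gquant (\<alpha> $ j) \<in> measurable unif borel"
        using gquant_measurable[OF \<alpha>] measurable_cong_sets[OF sets_unif refl] by blast
      then show "emeasure unif (gquant (\<alpha> $ j) -` A j) = emeasure (gamma_meas (\<alpha> $ j)) (A j)"
        unfolding distr_gquant[OF \<alpha>, symmetric] using A by (subst emeasure_distr) auto
    qed
    finally show "emeasure (distr cube (Pi\<^sub>M UNIV (\<lambda>_::'N. borel)) (\<lambda>v j. gquant (\<alpha> $ j) (v j))) (PiE UNIV A) =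
      (\<Prod>j\<in>UNIV. emeasure (gamma_meas (\<alpha> $ j)) (A j))" .
  qed simp
qed

lemma quant_pos: "quant \<alpha> v \<in> pos_orthant"
  using gquant_pos[OF \<alpha>] by (simp add: pos_orthant_def quant_def)

lemma quant_measurable_borel: "quant \<alpha> \<in> borel_measurable cube"
  unfolding quant_def[abs_def]
  by (intro borel_measurable_vec_lambdaI measurable_compose[OF cube_component gquant_measurable[OF \<alpha>]])

lemma quant_measurable [measurable]: "quant \<alpha> \<in> measurable cube orthant_borel"
  unfolding orthant_borel_def by (rule measurable_restrict_space2) (auto simp: quant_pos quant_measurable_borel)

text \<open>Both sides are read off the product of the one-dimensional Gamma laws, once as a product
  density and once as the image of the cube under the coordinate quantiles.\<close>

lemma distr_quant: "distr cube orthant_borel (quant \<alpha>) = laguerre_measure \<alpha>"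
proof (rule measure_eqI)
  fix A assume "A \<in> sets (distr cube orthant_borel (quant \<alpha>))"
  then have A: "A \<in> sets orthant_borel" by simp
  let ?v = "\<lambda>v. \<chi> j. v j :: real ^ 'N"
  let ?L = "Pi\<^sub>M UNIV (\<lambda>_::'N. lborel :: real measure)"
  let ?d = "\<lambda>x :: real ^ 'N. \<Prod>i\<in>UNIV. gamma_dens (\<alpha> $ i) (x $ i)"
  have pos: "pos_orthant \<in> sets (borel :: (real ^ 'N) measure)"
  proof -
    have "pos_orthant = (\<Inter>i. {x :: real ^ 'N. 0 < x $ i})" by (auto simp: pos_orthant_def)
    moreover have "open (\<Inter>i. {x :: real ^ 'N. 0 < x $ i})"
      by (intro open_INT ballI open_Collect_less continuous_intros) auto
    ultimately show ?thesis by simp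
  qed
  have A': "A \<in> sets borel" "A \<subseteq> pos_orthant"
    using A pos unfolding orthant_borel_def by (auto simp: sets_restrict_space)
  have mv: "?v \<in> measurable ?L borel" by (rule borel_measurable_vec_lambdaI) measurable
  have mv': "?v \<in> measurable (Pi\<^sub>M UNIV (\<lambda>j. gamma_meas (\<alpha> $ j))) borel" by (rule borel_measurable_vec_lambdaI) measurable
  have md: "(\<lambda>x. ennreal (?d x)) \<in> borel_measurable borel" by measurable
  have "emeasure (laguerre_measure \<alpha>) A = (\<integral>\<^sup>+x. ennreal (\<Prod>i\<in>UNIV. x $ i powr \<alpha> $ i * exp (- (x $ i)) / Gamma (1 + \<alpha> $ i)) * indicator A x
      \<partial>restrict_space lborel pos_orthant)"
    unfolding laguerre_measure_def using A
    by (intro emeasure_density) (auto simp: orthant_borel_def cong: sets_restrict_space_cong intro!: measurable_restrict_space1)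
  also have "\<dots> = (\<integral>\<^sup>+x. ennreal (\<Prod>i\<in>UNIV. x $ i powr \<alpha> $ i * exp (- (x $ i)) / Gamma (1 + \<alpha> $ i)) * indicator A x * indicator pos_orthant x \<partial>lborel)"
    using pos by (intro nn_integral_restrict_space) auto
  also have "\<dots> = (\<integral>\<^sup>+x. ennreal (?d x) * indicator A x \<partial>lborel)"
    using A'(2) by (intro nn_integral_cong) (auto simp: indicator_def gamma_dens_def pos_orthant_def intro!: arg_cong[where f = ennreal] prod.cong)
  also have "\<dots> = (\<integral>\<^sup>+v. ennreal (?d (?v v)) * indicator A (?v v) \<partial>?L)"
    unfolding lborel_vec using mv md A'(1) by (subst nn_integral_distr) auto
  also have "\<dots> = (\<integral>\<^sup>+v. indicator A (?v v) \<partial>density ?L (\<lambda>v. ennreal (\<Prod>j\<in>UNIV. gamma_dens (\<alpha> $ j) (v j))))"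
    using measurable_sets[OF mv A'(1)] by (subst nn_integral_density) (auto intro!: measurable_compose[OF mv] borel_measurable_indicator A'(1))
  also have "\<dots> = (\<integral>\<^sup>+v. indicator A (?v v) \<partial>distr cube (Pi\<^sub>M UNIV (\<lambda>_::'N. borel)) (\<lambda>v j. gquant (\<alpha> $ j) (v j)))"
    unfolding PiM_gamma_meas_density PiM_gamma_meas_quant ..
  also have "\<dots> = (\<integral>\<^sup>+v. indicator A (quant \<alpha> v) \<partial>cube)"
  proof (subst nn_integral_distr)
    show "(\<lambda>v j. gquant (\<alpha> $ j) (v j)) \<in> measurable cube (Pi\<^sub>M UNIV (\<lambda>_::'N. borel))"
      by (rule measurable_PiM_single') (auto intro: measurable_compose[OF cube_component gquant_measurable[OF \<alpha>]])
    have "?v \<in> measurable (Pi\<^sub>M UNIV (\<lambda>_::'N. borel)) borel" by (rule borel_measurable_vec_lambdaI) measurable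
    from measurable_compose[OF this borel_measurable_indicator[OF A'(1)]]
    show "(\<lambda>v. indicator A (?v v) :: ennreal) \<in> borel_measurable (distr cube (Pi\<^sub>M UNIV (\<lambda>_::'N. borel)) (\<lambda>v j. gquant (\<alpha> $ j) (v j)))"
      by simp
  qed (simp add: quant_def)
  also have "\<dots> = (\<integral>\<^sup>+x. indicator A x \<partial>distr cube orthant_borel (quant \<alpha>))"
    using A by (intro nn_integral_distr[symmetric] quant_measurable) auto
  also have "\<dots> = emeasure (distr cube orthant_borel (quant \<alpha>)) A" using A by simp
  finally show "emeasure (distr cube orthant_borel (quant \<alpha>)) A = emeasure (laguerre_measure \<alpha>) A" ..
qed simp

lemma prob_space_laguerre: "prob_space (laguerre_measure \<alpha>)"
  unfolding distr_quant[symmetric] by (rule prob_space.prob_space_distr[OF prob_space_cube quant_measurable])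

lemma quant_lipschitz: "\<exists>C>0. \<forall>u v. (\<forall>j. 0 < u j \<and> u j < 1 \<and> 0 < v j \<and> v j < 1) \<longrightarrow>
  (rho_vec (quant \<alpha> u) (quant \<alpha> v))\<^sup>2 \<le> C * (\<Sum>j\<in>UNIV. (ref_quant (u j) - ref_quant (v j))\<^sup>2)"
proof -
  have "\<forall>j. \<exists>C>0. \<forall>u v. 0 < u \<and> u < 1 \<and> 0 < v \<and> v < 1 \<longrightarrow>
    \<bar>sqrt (gquant (\<alpha> $ j) u) - sqrt (gquant (\<alpha> $ j) v)\<bar> \<le> C * \<bar>ref_quant u - ref_quant v\<bar>"
    using gquant_lipschitz[OF \<alpha>] by blast
  then obtain C where C: "\<And>j. 0 < C j" "\<And>j u v. 0 < u \<Longrightarrow> u < 1 \<Longrightarrow> 0 < v \<Longrightarrow> v < 1 \<Longrightarrow>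
    \<bar>sqrt (gquant (\<alpha> $ j) u) - sqrt (gquant (\<alpha> $ j) v)\<bar> \<le> C j * \<bar>ref_quant u - ref_quant v\<bar>"
    by metis
  define D where "D = (\<Sum>j\<in>UNIV. 4 * (C j)\<^sup>2)"
  have D: "4 * (C j)\<^sup>2 \<le> D" for j unfolding D_def by (rule member_le_sum) auto
  have "0 < D" using D C(1) by (meson less_le_trans mult_pos_pos zero_less_numeral zero_less_power)
  moreover have "(rho_vec (quant \<alpha> u) (quant \<alpha> v))\<^sup>2 \<le> D * (\<Sum>j\<in>UNIV. (ref_quant (u j) - ref_quant (v j))\<^sup>2)"
    if uv: "\<forall>j. 0 < u j \<and> u j < 1 \<and> 0 < v j \<and> v j < 1" for u v
  proof -
    have "(rho_vec (quant \<alpha> u) (quant \<alpha> v))\<^sup>2 = (\<Sum>j\<in>UNIV. 4 * \<bar>sqrt (gquant (\<alpha> $ j) (u j)) - sqrt (gquant (\<alpha> $ j) (v j))\<bar>\<^sup>2)"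
      by (simp add: rho_vec_def sum_nonneg rho_def quant_def power_mult_distrib)
    also have "\<dots> \<le> (\<Sum>j\<in>UNIV. D * (ref_quant (u j) - ref_quant (v j))\<^sup>2)"
    proof (rule sum_mono)
      fix j
      have "\<bar>sqrt (gquant (\<alpha> $ j) (u j)) - sqrt (gquant (\<alpha> $ j) (v j))\<bar>\<^sup>2 \<le> (C j * \<bar>ref_quant (u j) - ref_quant (v j)\<bar>)\<^sup>2"
        using uv by (intro power_mono C(2)) auto
      then have "4 * \<bar>sqrt (gquant (\<alpha> $ j) (u j)) - sqrt (gquant (\<alpha> $ j) (v j))\<bar>\<^sup>2 \<le> 4 * (C j)\<^sup>2 * (ref_quant (u j) - ref_quant (v j))\<^sup>2"
        by (simp add: power_mult_distrib)
      also have "\<dots> \<le> D * (ref_quant (u j) - ref_quant (v j))\<^sup>2" using D by (intro mult_right_mono) auto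
      finally show "4 * \<bar>sqrt (gquant (\<alpha> $ j) (u j)) - sqrt (gquant (\<alpha> $ j) (v j))\<bar>\<^sup>2 \<le> D * (ref_quant (u j) - ref_quant (v j))\<^sup>2" .
    qed
    also have "\<dots> = D * (\<Sum>j\<in>UNIV. (ref_quant (u j) - ref_quant (v j))\<^sup>2)" by (rule sum_distrib_left[symmetric])
    finally show ?thesis .
  qed
  ultimately show ?thesis by blast
qed

end

section \<open>The expected cost\<close>

lemma measurable_cube_coords:
  assumes "\<And>j. g j \<in> borel_measurable borel"
  shows "(\<lambda>v j. g j (v j)) \<in> measurable cube (cube :: ('n::finite \<Rightarrow> real) measure)"
  by (rule measurable_cubeI) (rule measurable_compose[OF cube_component assms])

lemma target_pt_coords_measurable:
  "(\<lambda>v j. target_pt xs ls S j i (v j)) \<in> measurable cube (cube :: ('n::finite \<Rightarrow> real) measure)"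
  by (rule measurable_cube_coords) (rule target_pt_measurable)

text \<open>The coupling draws an index and a point of the cube, and keeps the index together with
  the quantile of its target. By \<open>target_pt_marginal\<close> its second marginal is correct
  for each fixed list of labels; the sample itself enters the cost alone.\<close>

lemma coupling_cost_bound:
  fixes \<alpha> :: "real ^ 'N"
  assumes \<alpha>: "\<And>j. - 1 / 2 \<le> \<alpha> $ j" and n: "1 \<le> n" and ls: "labels {1..n} xs ls"
    and x: "\<And>i. i \<in> {1..n} \<Longrightarrow> x i \<in> pos_orthant"
  shows "(W2 (empirical_measure n x) (laguerre_measure \<alpha>))\<^sup>2 \<le>
    ennreal (1 / real n) * (\<Sum>i\<in>{1..n}. \<integral>\<^sup>+v. ennreal ((rho_vec (x i) (quant \<alpha> (\<lambda>j. target_pt xs ls {1..n} j i (v j))))\<^sup>2) \<partial>cube)"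
proof -
  let ?I = "{1..n}" and ?u = "uniform_count_measure {1..n}" and ?\<mu> = "laguerre_measure \<alpha>"
  let ?r = "\<lambda>i v j. target_pt xs ls ?I j i (v j)"
  define T where "T = (\<lambda>(i, v). (i, quant \<alpha> (?r i v)))"
  define \<eta> where "\<eta> = distr (?u \<Otimes>\<^sub>M cube) (?u \<Otimes>\<^sub>M ?\<mu>) T"
  have rq: "(\<lambda>v. quant \<alpha> (?r i v)) \<in> measurable cube ?\<mu>" for i
    using measurable_compose[OF target_pt_coords_measurable quant_measurable[OF \<alpha>]]
      measurable_cong_sets[OF refl sets_laguerre[of \<alpha>]] by blast
  have Tm0: "T \<in> measurable (count_space ?I \<Otimes>\<^sub>M cube) (?u \<Otimes>\<^sub>M ?\<mu>)"
    unfolding T_def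
  proof (rule measurable_pair_measure_countable1)
    fix i assume i: "i \<in> ?I"
    have "(\<lambda>v. (i, quant \<alpha> (?r i v))) \<in> measurable cube (?u \<Otimes>\<^sub>M ?\<mu>)"
      using i by (intro measurable_Pair rq measurable_const) (simp only: space_uniform_count_measure)
    then show "(\<lambda>v. case (i, v) of (i, v) \<Rightarrow> (i, quant \<alpha> (?r i v))) \<in> measurable cube (?u \<Otimes>\<^sub>M ?\<mu>)" by simp
  qed (auto intro: countable_finite)
  then have Tm: "T \<in> measurable (?u \<Otimes>\<^sub>M cube) (?u \<Otimes>\<^sub>M ?\<mu>)"
    using measurable_cong_sets[OF sets_uniform_count_pair refl] by blast
  interpret C: prob_space "cube :: ('N \<Rightarrow> real) measure" by simp
  have key: "(\<integral>\<^sup>+q. h q \<partial>\<eta>) = ennreal (1 / real n) * (\<Sum>i\<in>?I. \<integral>\<^sup>+v. h (i, quant \<alpha> (?r i v)) \<partial>cube)"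
    if h: "h \<in> borel_measurable (?u \<Otimes>\<^sub>M ?\<mu>)" for h
  proof -
    have "h \<in> borel_measurable (distr (?u \<Otimes>\<^sub>M cube) (?u \<Otimes>\<^sub>M ?\<mu>) T)" using h by simp
    then have "(\<integral>\<^sup>+q. h q \<partial>\<eta>) = (\<integral>\<^sup>+p. h (T p) \<partial>(?u \<Otimes>\<^sub>M cube))"
      unfolding \<eta>_def by (rule nn_integral_distr[OF Tm])
    also have "\<dots> = (\<integral>\<^sup>+i. (\<integral>\<^sup>+v. h (T (i, v)) \<partial>cube) \<partial>?u)"
      by (rule C.nn_integral_fst[symmetric]) (rule measurable_compose[OF Tm h])
    also have "\<dots> = (\<Sum>i\<in>?I. ennreal (1 / real n) * (\<integral>\<^sup>+v. h (T (i, v)) \<partial>cube))"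
      unfolding uniform_count_measure_def by (subst nn_integral_point_measure_finite) (auto simp: n mult.commute)
    finally show ?thesis by (simp add: T_def sum_distrib_left)
  qed
  have s\<eta>: "sets \<eta> = sets (?u \<Otimes>\<^sub>M ?\<mu>)" by (simp add: \<eta>_def)
  have m\<eta>: "fst \<in> measurable \<eta> ?u" "snd \<in> measurable \<eta> ?\<mu>"
    using measurable_cong_sets[OF s\<eta> refl] measurable_fst measurable_snd by blast+
  have snd: "distr \<eta> ?\<mu> snd = ?\<mu>"
  proof (rule measure_eqI)
    fix A assume "A \<in> sets (distr \<eta> ?\<mu> snd)"
    then have A: "A \<in> sets ?\<mu>" by simp
    have hA: "(\<lambda>q. indicator A (snd q) :: ennreal) \<in> borel_measurable (?u \<Otimes>\<^sub>M ?\<mu>)"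
      by (rule measurable_compose[OF measurable_snd borel_measurable_indicator[OF A]])
    have "emeasure (distr \<eta> ?\<mu> snd) A = (\<integral>\<^sup>+y. indicator A y \<partial>distr \<eta> ?\<mu> snd)" using A by simp
    also have "\<dots> = (\<integral>\<^sup>+q. indicator A (snd q) \<partial>\<eta>)" by (rule nn_integral_distr[OF m\<eta>(2) borel_measurable_indicator]) (use A in simp)
    also have "\<dots> = ennreal (1 / real n) * (\<Sum>i\<in>?I. \<integral>\<^sup>+v. indicator A (quant \<alpha> (?r i v)) \<partial>cube)"
      using key[OF hA] by simp
    also have "(\<Sum>i\<in>?I. \<integral>\<^sup>+v. indicator A (quant \<alpha> (?r i v)) \<partial>cube) = of_nat (card ?I) * (\<integral>\<^sup>+v. indicator A (quant \<alpha> v) \<partial>cube)"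
    proof (rule target_pt_marginal)
      show "list_all2 (\<lambda>(a, B, P) l. \<forall>i\<in>?I. l i < P) xs ls"
        using ls unfolding labels_def by (rule list_all2_mono) (auto dest!: PiE_mem)
      show "(\<lambda>v. indicator A (quant \<alpha> v) :: ennreal) \<in> borel_measurable cube"
        using A by (intro measurable_compose[OF quant_measurable[OF \<alpha>]] borel_measurable_indicator) simp
    qed simp
    also have "(\<integral>\<^sup>+v. indicator A (quant \<alpha> v) \<partial>cube) = (\<integral>\<^sup>+y. indicator A y \<partial>distr cube orthant_borel (quant \<alpha>))"
      using A by (intro nn_integral_distr[symmetric] quant_measurable[OF \<alpha>]) auto
    also have "\<dots> = emeasure ?\<mu> A" using A by (simp add: distr_quant[OF \<alpha>])
    also have "ennreal (1 / real n) * (of_nat (card ?I) * emeasure ?\<mu> A) = (ennreal (1 / real n) * ennreal (real n)) * emeasure ?\<mu> A"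
      by (simp add: mult.assoc ennreal_of_nat_eq_real_of_nat)
    also have "ennreal (1 / real n) * ennreal (real n) = 1" using n by (simp flip: ennreal_mult)
    finally show "emeasure (distr \<eta> ?\<mu> snd) A = emeasure ?\<mu> A" by simp
  qed simp
  have "\<eta> \<in> couplings ?u ?\<mu>"
    unfolding couplings_def
  proof (intro CollectI conjI)
    show "sets \<eta> = sets (?u \<Otimes>\<^sub>M ?\<mu>)" "distr \<eta> ?\<mu> snd = ?\<mu>" by fact+
    show "prob_space \<eta>" using prob_space_distrD[OF m\<eta>(2)] snd prob_space_laguerre[OF \<alpha>] by simp
    show "distr \<eta> ?u fst = ?u"
    proof (rule measure_eqI)
      fix A assume "A \<in> sets (distr \<eta> ?u fst)"
      then have A: "A \<in> sets ?u" by simp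
      then have AI: "A \<subseteq> ?I" using sets.sets_into_space[OF A] by (simp only: space_uniform_count_measure)
      have hA: "(\<lambda>q. indicator A (fst q) :: ennreal) \<in> borel_measurable (?u \<Otimes>\<^sub>M ?\<mu>)"
        by (rule measurable_compose[OF measurable_fst borel_measurable_indicator[OF A]])
      have "emeasure (distr \<eta> ?u fst) A = (\<integral>\<^sup>+y. indicator A y \<partial>distr \<eta> ?u fst)" using A by simp
      also have "\<dots> = (\<integral>\<^sup>+q. indicator A (fst q) \<partial>\<eta>)" by (rule nn_integral_distr[OF m\<eta>(1) borel_measurable_indicator]) (use A in simp)
      also have "\<dots> = ennreal (1 / real n) * (\<Sum>i\<in>?I. indicator A i)"
      proof -
        have "(\<integral>\<^sup>+v. indicator A (fst (i, quant \<alpha> (?r i v))) \<partial>cube) = (indicator A i :: ennreal)" for i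
          using C.emeasure_space_1 by simp
        then show ?thesis by (simp only: key[OF hA])
      qed
      also have "(\<Sum>i\<in>?I. indicator A i :: ennreal) = (\<Sum>i\<in>?I \<inter> A. 1)"
        by (subst sum.inter_restrict) (simp_all add: indicator_def of_bool_def)
      also have "?I \<inter> A = A" using AI by blast
      also have "ennreal (1 / real n) * (\<Sum>i\<in>A. 1) = emeasure ?u A"
        using AI n by (subst emeasure_uniform_count_measure) (auto simp: ennreal_of_nat_eq_real_of_nat simp flip: ennreal_mult)
      finally show "emeasure (distr \<eta> ?u fst) A = emeasure ?u A" .
    qed simp
  qed
  then have "(W2 (empirical_measure n x) ?\<mu>)\<^sup>2 \<le> index_cost x \<eta>"
    by (intro W2_sq_le_index_cost x sets_laguerre)
  also have "\<dots> = ennreal (1 / real n) * (\<Sum>i\<in>?I. \<integral>\<^sup>+v. ennreal ((rho_vec (x i) (quant \<alpha> (?r i v)))\<^sup>2) \<partial>cube)"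
    unfolding index_cost_def using key[OF measurable_rho_vec_snd[OF sets_laguerre]] by simp
  finally show ?thesis .
qed

text \<open>Cells of positive length, so that the sample rebuilt from labels stays in the open cube,
  where \<open>quant_lipschitz\<close> applies.\<close>

definition strict_specs :: "('n \<times> (nat \<Rightarrow> real) \<times> nat) list \<Rightarrow> bool" where
  "strict_specs xs \<longleftrightarrow> (\<forall>(a, B, P)\<in>set xs. cuts B P \<and> (\<forall>k<P. B k < B (Suc k)))"

lemma strict_specs_specs: "strict_specs xs \<Longrightarrow> specs xs"
  by (auto simp: strict_specs_def specs_def)

lemma sample_pt_in_open:
  assumes "strict_specs xs" "labels I xs ls" "i \<in> I" "0 < t" "t < 1"
  shows "0 < sample_pt xs ls j i t \<and> sample_pt xs ls j i t < 1"
  using assms(1,2)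
proof (induction xs arbitrary: ls)
  case (Cons x xs ls0)
  obtain a B P where x: "x = (a, B, P)" by (cases x)
  obtain l ls where ls: "ls0 = l # ls" using Cons.prems by (cases ls0) (auto simp: x)
  have IH: "0 < sample_pt xs ls j i t \<and> sample_pt xs ls j i t < 1" using Cons by (auto simp: x ls strict_specs_def)
  have B: "cuts B P" "\<forall>k<P. B k < B (Suc k)" and l: "l i < P" using Cons.prems assms(3) by (auto simp: x ls strict_specs_def)
  then have "B (l i) < cell B (l i) (sample_pt xs ls j i t)" "cell B (l i) (sample_pt xs ls j i t) < B (Suc (l i))"
    using IH by (auto intro: cell_less)
  then show ?case using IH cuts_bounds[OF B(1), of "l i"] cuts_bounds[OF B(1), of "Suc (l i)"] l by (auto simp: x ls)
qed (use assms in simp)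

lemma sample_pt_measurable [measurable]: "sample_pt xs ls j i \<in> borel_measurable borel"
proof (induction xs arbitrary: ls)
  case (Cons x xs ls0)
  obtain a B P where x: "x = (a, B, P)" by (cases x)
  show ?case
  proof (cases ls0)
    case (Cons l ls)
    have [measurable]: "sample_pt xs ls j i \<in> borel_measurable borel" by (rule Cons.IH)
    show ?thesis unfolding x Cons by (cases "a = j") (simp_all add: measurable_compose[OF _ cell_measurable])
  next
    case Nil
    have "sample_pt ((a, B, P) # xs) [] j i = (\<lambda>t. t)" by (rule ext) simp
    then show ?thesis by (simp add: x Nil)
  qed
next
  case Nil
  have "sample_pt [] ls j i = (\<lambda>t. t)" by (rule ext) simp
  then show ?case by simp
qed

lemma nexpect_nn_integral:
  assumes "\<And>ls. H ls \<in> borel_measurable M"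
  shows "nexpect I xs (\<lambda>ls. \<integral>\<^sup>+u. H ls u \<partial>M) = (\<integral>\<^sup>+u. nexpect I xs (\<lambda>ls. H ls u) \<partial>M) \<and>
    (\<lambda>u. nexpect I xs (\<lambda>ls. H ls u)) \<in> borel_measurable M"
  using assms
proof (induction xs arbitrary: H)
  case (Cons x xs)
  obtain a B P where x: "x = (a, B, P)" by (cases x)
  have IH: "nexpect I xs (\<lambda>ls. \<integral>\<^sup>+u. H (l # ls) u \<partial>M) = (\<integral>\<^sup>+u. nexpect I xs (\<lambda>ls. H (l # ls) u) \<partial>M)"
    and [measurable]: "(\<lambda>u. nexpect I xs (\<lambda>ls. H (l # ls) u)) \<in> borel_measurable M" for l
    using Cons by auto
  show ?case
    unfolding x nexpect.simps navg_def IH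
    by (simp add: nn_integral_sum nn_integral_cmult)
qed simp

lemma ref_quant_measurable [measurable]: "ref_quant \<in> borel_measurable borel"
  unfolding ref_quant_def[abs_def] tail_root_def[abs_def] by measurable

lemma clip_measurable [measurable]: "clip B P \<in> borel_measurable borel"
  unfolding clip_def[abs_def] by measurable

text \<open>Clipping changes the two end cells only; there \<open>ref_quant_local\<close> is used
  with equal positions z and y.\<close>

lemma tail_integral:
  assumes B: "tame c B P"
  shows "(\<integral>\<^sup>+u. ennreal ((ref_quant u - ref_quant (clip B P u))\<^sup>2) \<partial>unif) \<le> ennreal (\<Sum>k<P. (B (Suc k) - B k) * (4 * tail_cost c P k))"
proof -
  have cB: "cuts B P" by (rule tame_cuts[OF B])
  have d: "0 \<le> B (Suc k) - B k" if "k < P" for k using cB that by (simp add: cuts_def)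
  have [measurable]: "end_weight \<in> borel_measurable borel" unfolding end_weight_def[abs_def] by measurable
  have "(\<integral>\<^sup>+u. ennreal ((ref_quant u - ref_quant (clip B P u))\<^sup>2) \<partial>unif) =
     (\<Sum>k<P. ennreal (B (Suc k) - B k) * (\<integral>\<^sup>+t. ennreal ((ref_quant (cell B k t) - ref_quant (clip B P (cell B k t)))\<^sup>2) \<partial>unif))"
    by (rule nn_integral_unif_cells[OF _ cB]) measurable
  also have "\<dots> \<le> (\<Sum>k<P. ennreal (B (Suc k) - B k) * ennreal (4 * tail_cost c P k))"
  proof (intro sum_mono mult_left_mono)
    fix k assume "k \<in> {..<P}"
    then have k: "k < P" by simp
    have "(\<integral>\<^sup>+t. ennreal ((ref_quant (cell B k t) - ref_quant (clip B P (cell B k t)))\<^sup>2) \<partial>unif) \<le> (\<integral>\<^sup>+t. ennreal (tail_cost c P k) * ennreal (end_weight t) \<partial>unif)"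
    proof (rule nn_integral_mono_AE, use AE_unif in eventually_elim)
      case (elim t)
      then have "(ref_quant (clip B P (cell B k t)) - ref_quant (cell B k t))\<^sup>2 \<le> tail_cost c P k * end_weight t"
        using ref_quant_local[OF B k, of t t] by simp
      moreover have "0 \<le> end_weight t" using elim by (simp add: end_weight_def)
      ultimately show ?case
        using tail_cost_nonneg[of c P k] by (simp add: power2_commute ennreal_leI flip: ennreal_mult)
    qed
    also have "\<dots> = ennreal (tail_cost c P k) * 4"
      by (subst nn_integral_cmult) (simp_all add: nn_integral_end_weight cong: measurable_cong_sets)
    also have "\<dots> = ennreal (4 * tail_cost c P k)"
      using tail_cost_nonneg[of c P k] by (simp add: ennreal_mult mult.commute)
    finally show "(\<integral>\<^sup>+t. ennreal ((ref_quant (cell B k t) - ref_quant (clip B P (cell B k t)))\<^sup>2) \<partial>unif) \<le> ennreal (4 * tail_cost c P k)" .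
  qed simp
  also have "\<dots> = (\<Sum>k<P. ennreal ((B (Suc k) - B k) * (4 * tail_cost c P k)))"
    using d tail_cost_nonneg by (intro sum.cong refl) (simp add: ennreal_mult)
  also have "\<dots> = ennreal (\<Sum>k<P. (B (Suc k) - B k) * (4 * tail_cost c P k))"
    using d tail_cost_nonneg by (intro sum_ennreal mult_nonneg_nonneg) auto
  finally show ?thesis .
qed

lemma strict_specs_ops:
  assumes "tame c B P"
  shows "strict_specs (coarse_ops B P ax @ fine_ops K ax)"
proof -
  have 1: "strict_specs (coarse_ops D Q ax)" if "cuts D Q" "\<forall>k<Q. D k < D (Suc k)" for D Q
    using that by (auto simp: strict_specs_def coarse_ops_def)
  have 2: "strict_specs (xs @ ys) \<longleftrightarrow> strict_specs xs \<and> strict_specs ys" for xs ys :: "('a \<times> (nat \<Rightarrow> real) \<times> nat) list"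
    by (simp add: strict_specs_def ball_Un)
  have "\<forall>k<2. halves k < halves (Suc k)" by (simp add: halves_def)
  then have "strict_specs (fine_ops K ax)"
    by (induction K) (simp_all add: fine_Suc 2 1[OF cuts_halves], simp add: fine_ops_def strict_specs_def)
  then show ?thesis using 1[OF tame_cuts[OF assms]] assms by (simp add: 2 tame_def)
qed

lemma AE_cubes:
  assumes "finite I"
  shows "AE u in Pi\<^sub>M I (\<lambda>_. cube). \<forall>i\<in>I. \<forall>j::'n::finite. 0 < u i j \<and> u i j < 1"
  by (intro AE_finite_allI assms AE_PiM_component[where P = "\<lambda>v. \<forall>j. 0 < v j \<and> v j < 1"] AE_cube prob_space_cube)

lemma expected_W2_sq_cube:
  fixes \<alpha> :: "real ^ 'N"
  assumes \<alpha>: "\<And>j. - 1 / 2 \<le> \<alpha> $ j" and n: "1 \<le> n"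
  shows "expected_W2_sq (Pi\<^sub>M {1..n} (\<lambda>_. laguerre_measure \<alpha>)) (\<lambda>j x. x j) n \<alpha> =
    (\<integral>\<^sup>+u. (W2 (empirical_measure n (\<lambda>i. quant \<alpha> (u i))) (laguerre_measure \<alpha>))\<^sup>2 \<partial>Pi\<^sub>M {1..n} (\<lambda>_. cube))" (is ?thesis1)
    "(\<lambda>u. (W2 (empirical_measure n (\<lambda>i. quant \<alpha> (u i))) (laguerre_measure \<alpha>))\<^sup>2) \<in> borel_measurable (Pi\<^sub>M {1..n} (\<lambda>_. cube))" (is ?thesis2)
proof -
  let ?I = "{1..n}" and ?q = "compose {1..n} (quant \<alpha>)"
  let ?F = "\<lambda>x. (W2 (empirical_measure n x) (laguerre_measure \<alpha>))\<^sup>2"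
  have F: "?F \<in> borel_measurable (Pi\<^sub>M ?I (\<lambda>_. orthant_borel))"
    by (rule measurable_W2_sq_empirical[OF n sets_laguerre prob_space_laguerre[OF \<alpha>]])
  have q: "?q \<in> measurable (Pi\<^sub>M ?I (\<lambda>_. cube)) (Pi\<^sub>M ?I (\<lambda>_. orthant_borel))"
    unfolding compose_def
    by (intro measurable_restrict measurable_compose[OF measurable_component_singleton[where M = "\<lambda>_. cube"] quant_measurable[OF \<alpha>]])
  have Fq: "?F (?q u) = ?F (\<lambda>i. quant \<alpha> (u i))" for u
  proof -
    have "empirical_measure n (?q u) = empirical_measure n (\<lambda>i. quant \<alpha> (u i))"
      by (rule empirical_measure_cong) (simp only: compose_def restrict_apply' if_True)
    then show ?thesis by simp
  qed
  have "(\<lambda>u. ?F (?q u)) \<in> borel_measurable (Pi\<^sub>M ?I (\<lambda>_. cube))" by (rule measurable_compose[OF q F])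
  then show ?thesis2 unfolding Fq .
  let ?\<mu> = "laguerre_measure \<alpha>"
  have qm: "quant \<alpha> \<in> measurable cube ?\<mu>"
    using quant_measurable[OF \<alpha>] measurable_cong_sets[OF refl sets_laguerre[of \<alpha>]] by blast
  have dq: "distr cube ?\<mu> (quant \<alpha>) = ?\<mu>"
    using distr_cong[OF refl sets_laguerre[of \<alpha>], of cube "quant \<alpha>" "quant \<alpha>"] distr_quant[OF \<alpha>] by simp
  have s: "sets (Pi\<^sub>M ?I (\<lambda>_. ?\<mu>)) = sets (Pi\<^sub>M ?I (\<lambda>_. orthant_borel))"
    by (rule sets_PiM_cong[OF refl sets_laguerre])
  have q': "?q \<in> measurable (Pi\<^sub>M ?I (\<lambda>_. cube)) (Pi\<^sub>M ?I (\<lambda>_. ?\<mu>))"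
    using q measurable_cong_sets[OF refl s] by blast
  have F': "?F \<in> borel_measurable (Pi\<^sub>M ?I (\<lambda>_. ?\<mu>))"
    using F measurable_cong_sets[OF s refl] by blast
  have "distr (Pi\<^sub>M ?I (\<lambda>_. cube)) (Pi\<^sub>M ?I (\<lambda>_. ?\<mu>)) ?q = Pi\<^sub>M ?I (\<lambda>_. distr cube ?\<mu> (quant \<alpha>))"
    by (rule distr_PiM_finite_prob_space') (use prob_space_laguerre[OF \<alpha>] qm in \<open>simp_all\<close>)
  then have D: "distr (Pi\<^sub>M ?I (\<lambda>_. cube)) (Pi\<^sub>M ?I (\<lambda>_. ?\<mu>)) ?q = Pi\<^sub>M ?I (\<lambda>_. ?\<mu>)" by (simp only: dq)
  have "(\<integral>\<^sup>+x. ?F x \<partial>distr (Pi\<^sub>M ?I (\<lambda>_. cube)) (Pi\<^sub>M ?I (\<lambda>_. ?\<mu>)) ?q) = (\<integral>\<^sup>+u. ?F (?q u) \<partial>Pi\<^sub>M ?I (\<lambda>_. cube))"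
    by (rule nn_integral_distr[OF q']) (unfold D, rule F')
  then show ?thesis1 unfolding expected_W2_sq_def D Fq .
qed

text \<open>The clipped sample is inserted between the sample and its target. The first difference
  does not involve the target, the second stays bounded at the unbounded ends of the sample.\<close>

lemma pathwise_bound:
  fixes \<alpha> :: "real ^ 'N" and xs :: "('N \<times> (nat \<Rightarrow> real) \<times> nat) list"
  assumes \<alpha>: "\<And>j. - 1 / 2 \<le> \<alpha> $ j" and C: "0 < C"
    "\<And>u v. (\<forall>j. 0 < u j \<and> u j < 1 \<and> 0 < v j \<and> v j < 1) \<Longrightarrow>
      (rho_vec (quant \<alpha> u) (quant \<alpha> v))\<^sup>2 \<le> C * (\<Sum>j\<in>UNIV. (ref_quant (u j) - ref_quant (v j))\<^sup>2)"
    and n: "1 \<le> n" and ls: "labels {1..n} xs ls" and xs: "strict_specs xs"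
    and u: "\<And>i j. i \<in> {1..n} \<Longrightarrow> 0 < u i j \<and> u i j < 1"
  defines "w \<equiv> \<lambda>i j. sample_pt xs ls j i (u i j)"
  shows "(W2 (empirical_measure n (\<lambda>i. quant \<alpha> (w i))) (laguerre_measure \<alpha>))\<^sup>2 \<le>
    ennreal (2 * C / real n) * (\<Sum>j\<in>UNIV. (\<Sum>i\<in>{1..n}. ennreal ((ref_quant (w i j) - ref_quant (clip B P (w i j)))\<^sup>2)) +
      (\<Sum>i\<in>{1..n}. \<integral>\<^sup>+v. ennreal ((ref_quant (clip B P (w i j)) - ref_quant (target_pt xs ls {1..n} j i (v j)))\<^sup>2) \<partial>cube))"
proof -
  let ?I = "{1..n}"
  let ?a = "\<lambda>i j. (ref_quant (w i j) - ref_quant (clip B P (w i j)))\<^sup>2"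
  let ?b = "\<lambda>i v j. (ref_quant (clip B P (w i j)) - ref_quant (target_pt xs ls ?I j i (v j)))\<^sup>2"
  have w: "0 < w i j \<and> w i j < 1" if "i \<in> ?I" for i j
    unfolding w_def using u[OF that, of j] by (intro sample_pt_in_open[OF xs ls that]) auto
  have mb: "(\<lambda>v. ennreal (?b i v j)) \<in> borel_measurable cube" for i j
  proof -
    have [measurable]: "(\<lambda>v. target_pt xs ls ?I j i (v j)) \<in> borel_measurable cube"
      by (rule measurable_compose[OF cube_component target_pt_measurable])
    show ?thesis by measurable
  qed
  interpret Cu: prob_space "cube :: ('N \<Rightarrow> real) measure" by simp
  have "(\<integral>\<^sup>+v. ennreal ((rho_vec (quant \<alpha> (w i)) (quant \<alpha> (\<lambda>j. target_pt xs ls ?I j i (v j))))\<^sup>2) \<partial>cube) \<le>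
    ennreal (2 * C) * (\<Sum>j\<in>UNIV. ennreal (?a i j) + (\<integral>\<^sup>+v. ennreal (?b i v j) \<partial>cube))" (is "?L \<le> ?R") if i: "i \<in> ?I" for i
  proof -
    have "?L \<le> (\<integral>\<^sup>+v. ennreal (2 * C) * (\<Sum>j\<in>UNIV. ennreal (?a i j) + ennreal (?b i v j)) \<partial>cube)"
    proof (rule nn_integral_mono_AE, use AE_cube in eventually_elim)
      case (elim v)
      have 1: "(rho_vec (quant \<alpha> (w i)) (quant \<alpha> (\<lambda>j. target_pt xs ls ?I j i (v j))))\<^sup>2 \<le>
        C * (\<Sum>j\<in>UNIV. (ref_quant (w i j) - ref_quant (target_pt xs ls ?I j i (v j)))\<^sup>2)"
      proof (intro C(2) allI)
        fix j
        have "0 < target_pt xs ls ?I j i (v j) \<and> target_pt xs ls ?I j i (v j) < 1"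
          using elim by (intro target_pt_in_01[OF finite_atLeastAtMost ls subset_refl i]) blast+
        with w[OF i, of j] show "0 < w i j \<and> w i j < 1 \<and> 0 < target_pt xs ls ?I j i (v j) \<and> target_pt xs ls ?I j i (v j) < 1" by blast
      qed
      have "(\<Sum>j\<in>UNIV. (ref_quant (w i j) - ref_quant (target_pt xs ls ?I j i (v j)))\<^sup>2) \<le> (\<Sum>j\<in>UNIV. 2 * (?a i j + ?b i v j))"
      proof (rule sum_mono)
        fix j
        show "(ref_quant (w i j) - ref_quant (target_pt xs ls ?I j i (v j)))\<^sup>2 \<le> 2 * (?a i j + ?b i v j)"
          using diff_sq_le[of "ref_quant (w i j) - ref_quant (clip B P (w i j))" "ref_quant (target_pt xs ls ?I j i (v j)) - ref_quant (clip B P (w i j))"]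
          by (simp add: power2_commute)
      qed
      also have "\<dots> = 2 * (\<Sum>j\<in>UNIV. ?a i j + ?b i v j)" by (rule sum_distrib_left[symmetric])
      finally have "C * (\<Sum>j\<in>UNIV. (ref_quant (w i j) - ref_quant (target_pt xs ls ?I j i (v j)))\<^sup>2) \<le> C * (2 * (\<Sum>j\<in>UNIV. ?a i j + ?b i v j))"
        using C(1) by (intro mult_left_mono) simp_all
      from order_trans[OF 1 this] have "(rho_vec (quant \<alpha> (w i)) (quant \<alpha> (\<lambda>j. target_pt xs ls ?I j i (v j))))\<^sup>2 \<le>
          2 * C * (\<Sum>j\<in>UNIV. ?a i j + ?b i v j)" by (simp only: ac_simps)
      moreover have "ennreal (2 * C * (\<Sum>j\<in>UNIV. ?a i j + ?b i v j)) =
          ennreal (2 * C) * (\<Sum>j\<in>UNIV. ennreal (?a i j) + ennreal (?b i v j))"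
      proof -
        have "ennreal (2 * C * (\<Sum>j\<in>UNIV. ?a i j + ?b i v j)) = ennreal (2 * C) * ennreal (\<Sum>j\<in>UNIV. ?a i j + ?b i v j)"
          using C(1) by (intro ennreal_mult') simp
        also have "ennreal (\<Sum>j\<in>UNIV. ?a i j + ?b i v j) = (\<Sum>j\<in>UNIV. ennreal (?a i j + ?b i v j))"
          by (rule sum_ennreal[symmetric]) (intro add_nonneg_nonneg zero_le_power2)
        also have "\<dots> = (\<Sum>j\<in>UNIV. ennreal (?a i j) + ennreal (?b i v j))"
          by (intro sum.cong refl ennreal_plus zero_le_power2)
        finally show ?thesis .
      qed
      ultimately show ?case by (rule ord_le_eq_trans[OF ennreal_leI])
    qed
    also have "\<dots> = ?R"
      using mb by (simp add: nn_integral_cmult nn_integral_sum nn_integral_add Cu.emeasure_space_1[simplified])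
    finally show ?thesis .
  qed
  then have "ennreal (1 / real n) * (\<Sum>i\<in>?I. \<integral>\<^sup>+v. ennreal ((rho_vec (quant \<alpha> (w i)) (quant \<alpha> (\<lambda>j. target_pt xs ls ?I j i (v j))))\<^sup>2) \<partial>cube) \<le>
    ennreal (1 / real n) * (\<Sum>i\<in>?I. ennreal (2 * C) * (\<Sum>j\<in>UNIV. ennreal (?a i j) + (\<integral>\<^sup>+v. ennreal (?b i v j) \<partial>cube)))"
    by (intro mult_left_mono sum_mono) auto
  also have "\<dots> = (ennreal (1 / real n) * ennreal (2 * C)) * (\<Sum>j\<in>UNIV. \<Sum>i\<in>?I. ennreal (?a i j) + (\<integral>\<^sup>+v. ennreal (?b i v j) \<partial>cube))"
    by (subst sum.swap) (simp only: sum_distrib_left mult.assoc)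
  also have "ennreal (1 / real n) * ennreal (2 * C) = ennreal (2 * C / real n)"
    using C(1) by (simp flip: ennreal_mult)
  finally have "ennreal (1 / real n) * (\<Sum>i\<in>?I. \<integral>\<^sup>+v. ennreal ((rho_vec (quant \<alpha> (w i)) (quant \<alpha> (\<lambda>j. target_pt xs ls ?I j i (v j))))\<^sup>2) \<partial>cube)
    \<le> ennreal (2 * C / real n) * (\<Sum>j\<in>UNIV. (\<Sum>i\<in>?I. ennreal (?a i j)) + (\<Sum>i\<in>?I. \<integral>\<^sup>+v. ennreal (?b i v j) \<partial>cube))"
    by (simp only: sum.distrib)
  then show ?thesis
    by (rule order_trans[OF coupling_cost_bound[OF \<alpha> n ls quant_pos[OF \<alpha>]]])
qed

lemma target_cost_measurable:
  fixes xs :: "('n::finite \<times> (nat \<Rightarrow> real) \<times> nat) list"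
  shows "(\<lambda>u. \<Sum>i\<in>I. \<integral>\<^sup>+v. ennreal ((ref_quant (clip B P (sample_pt xs ls j i (u i j))) - ref_quant (target_pt xs ls I j i (v j)))\<^sup>2) \<partial>cube)
    \<in> borel_measurable (Pi\<^sub>M I (\<lambda>_. cube))"
proof (intro borel_measurable_sum)
  fix i assume i: "i \<in> I"
  interpret Cu: prob_space "cube :: ('n \<Rightarrow> real) measure" by simp
  have [measurable]: "(\<lambda>v. target_pt xs ls I j i (v j)) \<in> borel_measurable cube"
    by (rule measurable_compose[OF cube_component target_pt_measurable])
  have [measurable]: "(\<lambda>u. u i j) \<in> borel_measurable (Pi\<^sub>M I (\<lambda>_. cube))"
    by (rule measurable_compose[OF measurable_component_singleton[OF i, where M = "\<lambda>_. cube"] cube_component])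
  show "(\<lambda>u. \<integral>\<^sup>+v. ennreal ((ref_quant (clip B P (sample_pt xs ls j i (u i j))) - ref_quant (target_pt xs ls I j i (v j)))\<^sup>2) \<partial>cube)
    \<in> borel_measurable (Pi\<^sub>M I (\<lambda>_. cube))"
    by measurable
qed

text \<open>\<open>coordinate_bound\<close> is uniform in the residual positions, so it can be
  integrated once the finite sum over labels is exchanged with the integral.\<close>

lemma expected_main_part:
  fixes j :: "'n::finite" and K :: nat
  assumes I: "finite I" and B: "tame c B P" and ax: "distinct ax" "set ax = (UNIV :: 'n set)"
  defines "xs \<equiv> coarse_ops B P ax @ fine_ops K ax"
  shows "nexpect I xs (\<lambda>ls. \<integral>\<^sup>+u. (\<Sum>i\<in>I. \<integral>\<^sup>+v. ennreal ((ref_quant (clip B P (sample_pt xs ls j i (u i j))) - ref_quant (target_pt xs ls I j i (v j)))\<^sup>2) \<partial>cube) \<partial>Pi\<^sub>M I (\<lambda>_. cube)) \<le>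
    ennreal (real (card I) * (\<Sum>k<P. (B (Suc k) - B k) * (2 * lipsq B P k / 4 ^ K + 8 * tail_cost c P k)) +
      real P ^ (CARD('n) - 1) * (2 ^ CARD('n) * (\<Sum>k<K. (2 ^ CARD('n) / 4) ^ k) * (\<Sum>k<P. lipsq B P k) +
        768 * c\<^sup>2 * (\<Sum>k<P. count_cost B P k)))" (is "nexpect I xs (\<lambda>ls. \<integral>\<^sup>+u. ?D ls u \<partial>?M) \<le> ennreal ?Y")
proof -
  interpret M: prob_space ?M by (rule prob_space_PiM) simp
  have "nexpect I xs (\<lambda>ls. \<integral>\<^sup>+u. ?D ls u \<partial>?M) = (\<integral>\<^sup>+u. nexpect I xs (\<lambda>ls. ?D ls u) \<partial>?M)"
    using nexpect_nn_integral[of ?D ?M I xs, OF target_cost_measurable] by blast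
  also have "\<dots> \<le> (\<integral>\<^sup>+u. ennreal ?Y \<partial>?M)"
  proof (rule nn_integral_mono_AE, use AE_cubes[OF I] in eventually_elim)
    case (elim u)
    then have "0 \<le> u i j \<and> u i j \<le> 1" if "i \<in> I" for i using that by (meson less_imp_le)
    then show ?case unfolding xs_def by (rule coordinate_bound[OF I B ax])
  qed
  also have "\<dots> = ennreal ?Y" by (simp add: M.emeasure_space_1)
  finally show ?thesis .
qed

text \<open>No target occurs, so the expansion into labels can be undone; each sample coordinate is
  uniform again and \<open>tail_integral\<close> applies.\<close>

lemma expected_tail_part:
  fixes j :: "'n::finite"
  assumes I: "finite I" and B: "tame c B P" and xs: "specs xs"
  shows "nexpect I xs (\<lambda>ls. \<integral>\<^sup>+u. (\<Sum>i\<in>I. ennreal ((ref_quant (sample_pt xs ls j i (u i j)) - ref_quant (clip B P (sample_pt xs ls j i (u i j))))\<^sup>2)) \<partial>Pi\<^sub>M I (\<lambda>_. cube)) \<le>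
    ennreal (real (card I) * (\<Sum>k<P. (B (Suc k) - B k) * (4 * tail_cost c P k)))"
proof -
  let ?f = "\<lambda>x. ennreal ((ref_quant x - ref_quant (clip B P x))\<^sup>2)"
  let ?A = "\<lambda>w :: nat \<Rightarrow> 'n \<Rightarrow> real. \<Sum>i\<in>I. ?f (w i j)"
  have f: "?f \<in> borel_measurable borel" by measurable
  have c: "(\<lambda>u. u i) \<in> measurable (Pi\<^sub>M I (\<lambda>_. cube)) (cube :: ('n \<Rightarrow> real) measure)" if "i \<in> I" for i
    using measurable_component_singleton[OF that, where M = "\<lambda>_. cube"] .
  have m: "(\<lambda>u. ?f (u i j)) \<in> borel_measurable (Pi\<^sub>M I (\<lambda>_. cube))" if "i \<in> I" for i
    using measurable_compose[OF measurable_compose[OF c[OF that] cube_component] f] .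
  have A: "?A \<in> borel_measurable (Pi\<^sub>M I (\<lambda>_. cube))" by (intro borel_measurable_sum m)
  have "(\<integral>\<^sup>+u. ?A u \<partial>Pi\<^sub>M I (\<lambda>_. cube)) = nexpect I xs (\<lambda>ls. \<integral>\<^sup>+u. ?A (\<lambda>i. if i \<in> I then (\<lambda>j. sample_pt xs ls j i (u i j)) else u i) \<partial>Pi\<^sub>M I (\<lambda>_. cube))"
    by (rule nn_integral_cubes_nexpect[OF I xs A])
  also have "\<dots> = nexpect I xs (\<lambda>ls. \<integral>\<^sup>+u. (\<Sum>i\<in>I. ?f (sample_pt xs ls j i (u i j))) \<partial>Pi\<^sub>M I (\<lambda>_. cube))"
    by (simp cong: sum.cong)
  finally have "nexpect I xs (\<lambda>ls. \<integral>\<^sup>+u. (\<Sum>i\<in>I. ?f (sample_pt xs ls j i (u i j))) \<partial>Pi\<^sub>M I (\<lambda>_. cube)) = (\<integral>\<^sup>+u. ?A u \<partial>Pi\<^sub>M I (\<lambda>_. cube))" ..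
  also have "\<dots> = (\<Sum>i\<in>I. \<integral>\<^sup>+u. ?f (u i j) \<partial>Pi\<^sub>M I (\<lambda>_. cube))" by (rule nn_integral_sum[OF m])
  also have "\<dots> = (\<Sum>i\<in>I. \<integral>\<^sup>+t. ?f t \<partial>unif)"
  proof (rule sum.cong)
    fix i assume i: "i \<in> I"
    have "distr (Pi\<^sub>M I (\<lambda>_. cube :: ('n \<Rightarrow> real) measure)) cube (\<lambda>u. u i) = cube"
      by (rule distr_PiM_component[where M = "\<lambda>_. cube", OF _ i]) simp
    then have "(\<integral>\<^sup>+v. ?f (v j) \<partial>cube) = (\<integral>\<^sup>+v. ?f (v j) \<partial>distr (Pi\<^sub>M I (\<lambda>_. cube)) cube (\<lambda>u. u i))" by simp
    also have "\<dots> = (\<integral>\<^sup>+u. ?f (u i j) \<partial>Pi\<^sub>M I (\<lambda>_. cube))"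
      by (rule nn_integral_distr[OF c[OF i]]) (simp add: measurable_compose[OF cube_component f])
    finally show "(\<integral>\<^sup>+u. ?f (u i j) \<partial>Pi\<^sub>M I (\<lambda>_. cube)) = (\<integral>\<^sup>+t. ?f t \<partial>unif)"
      using nn_integral_cube_component[OF f, of j] by simp
  qed simp
  also have "\<dots> \<le> (\<Sum>i\<in>I. ennreal (\<Sum>k<P. (B (Suc k) - B k) * (4 * tail_cost c P k)))"
    by (intro sum_mono tail_integral[OF B])
  also have "\<dots> = ennreal (real (card I) * (\<Sum>k<P. (B (Suc k) - B k) * (4 * tail_cost c P k)))"
    by (simp add: ennreal_mult' ennreal_of_nat_eq_real_of_nat)
  finally show ?thesis .
qed

text \<open>The first sum holds the resolution of the final cells and the mass beyond the outermost
  cuts. The second summand is the cost paid per group, first by the digits and then by the coarse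
  cuts, with up to \<open>P ^ (d - 1)\<close> groups from the other axes.\<close>

definition cost_bound :: "nat \<Rightarrow> nat \<Rightarrow> real \<Rightarrow> (nat \<Rightarrow> real) \<Rightarrow> nat \<Rightarrow> nat \<Rightarrow> real" where
  "cost_bound d n c B P K = (\<Sum>k<P. (B (Suc k) - B k) * (lipsq B P k / 4 ^ K + tail_cost c P k)) +
     real P ^ (d - 1) * ((\<Sum>k<K. (2 ^ d / 4) ^ k) * (\<Sum>k<P. lipsq B P k) + c\<^sup>2 * (\<Sum>k<P. count_cost B P k)) / real n"

text \<open>The coefficients are 2 for the resolution, 4 + 8 for the tails, \<open>2 ^ d\<close> for
  the digits and 768 for the coarse cuts, and 780 = 768 + 12.\<close>

lemma cost_bound_combine:
  assumes B: "tame c B P" and n: "1 \<le> n"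
  shows "(real n * (\<Sum>k<P. (B (Suc k) - B k) * (4 * tail_cost c P k)) +
    (real n * (\<Sum>k<P. (B (Suc k) - B k) * (2 * lipsq B P k / 4 ^ K + 8 * tail_cost c P k)) +
      real P ^ (d - 1) * (2 ^ d * (\<Sum>k<K. (2 ^ d / 4) ^ k) * (\<Sum>k<P. lipsq B P k) +
        768 * c\<^sup>2 * (\<Sum>k<P. count_cost B P k)))) / real n \<le> (2 ^ d + 780) * cost_bound d n c B P K"
proof -
  have d: "0 \<le> B (Suc k) - B k" if "k < P" for k using tame_cuts[OF B] that by (simp add: cuts_def)
  let ?T = "\<Sum>k<P. (B (Suc k) - B k) * tail_cost c P k" and ?L = "\<Sum>k<P. (B (Suc k) - B k) * (lipsq B P k / 4 ^ K)"
  define X where "X = real P ^ (d - 1) * ((\<Sum>k<K. (2 ^ d / 4) ^ k) * (\<Sum>k<P. lipsq B P k))"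
  define Y where "Y = real P ^ (d - 1) * (c\<^sup>2 * (\<Sum>k<P. count_cost B P k))"
  have T: "0 \<le> ?T" "0 \<le> ?L" using d tail_cost_nonneg lipsq_nonneg by (auto intro!: sum_nonneg)
  have X: "0 \<le> X" unfolding X_def by (intro mult_nonneg_nonneg sum_nonneg lipsq_nonneg) auto
  have Y: "0 \<le> Y" unfolding Y_def using count_cost_nonneg[OF tame_cuts[OF B]] by (intro mult_nonneg_nonneg sum_nonneg) auto
  have S: "cost_bound d n c B P K = ?L + ?T + (X + Y) / real n"
    unfolding cost_bound_def X_def Y_def by (simp add: distrib_left sum.distrib)
  have e1: "(\<Sum>k<P. (B (Suc k) - B k) * (4 * tail_cost c P k)) = 4 * ?T"
    unfolding sum_distrib_left by (rule sum.cong) simp_all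
  have e2: "(\<Sum>k<P. (B (Suc k) - B k) * (2 * lipsq B P k / 4 ^ K + 8 * tail_cost c P k)) = 2 * ?L + 8 * ?T"
    unfolding sum_distrib_left sum.distrib[symmetric] by (rule sum.cong) (simp_all add: distrib_left)
  have e3: "real P ^ (d - 1) * (2 ^ d * (\<Sum>k<K. (2 ^ d / 4) ^ k) * (\<Sum>k<P. lipsq B P k) + 768 * c\<^sup>2 * (\<Sum>k<P. count_cost B P k)) = 2 ^ d * X + 768 * Y"
    unfolding X_def Y_def by (simp only: distrib_left ac_simps)
  have aux: "(r * (4 * t) + (r * (2 * l + 8 * t) + (e * x + 768 * y))) / r \<le> (e + 780) * (l + t + (x + y) / r)"
    if "0 \<le> t" "0 \<le> l" "0 \<le> x" "0 \<le> y" "1 \<le> e" "0 < r" for r t l e x y :: real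
  proof -
    have "12 * t + 2 * l + e * p + 768 * q \<le> (e + 780) * (l + t + (p + q))" if "0 \<le> p" "0 \<le> q" for p q
    proof -
      have "0 \<le> e * t" "0 \<le> e * l" "0 \<le> e * q" using that \<open>0 \<le> t\<close> \<open>0 \<le> l\<close> \<open>1 \<le> e\<close> by auto
      then show ?thesis
        using that \<open>0 \<le> t\<close> \<open>0 \<le> l\<close> by (simp add: distrib_left distrib_right)
    qed
    from this[of "x / r" "y / r"] have "12 * t + 2 * l + e * (x / r) + 768 * (y / r) \<le> (e + 780) * (l + t + (x / r + y / r))"
      using divide_nonneg_pos[OF that(3,6)] divide_nonneg_pos[OF that(4,6)] by blast
    moreover have "(r * (4 * t) + (r * (2 * l + 8 * t) + (e * x + 768 * y))) / r = 12 * t + 2 * l + e * (x / r) + 768 * (y / r)"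
      using that(6) by (simp add: field_simps)
    ultimately show ?thesis by (simp add: add_divide_distrib)
  qed
  show ?thesis unfolding S e1 e2 e3 by (rule aux[OF T X Y]) (use n in auto)
qed

lemma expected_bound:
  fixes \<alpha> :: "real ^ 'N"
  assumes \<alpha>: "\<And>j. - 1 / 2 \<le> \<alpha> $ j"
  shows "\<exists>C>0. \<forall>n c B P K. 1 \<le> n \<longrightarrow> tame c B P \<longrightarrow>
    expected_W2_sq (Pi\<^sub>M {1..n} (\<lambda>_. laguerre_measure \<alpha>)) (\<lambda>j x. x j) n \<alpha> \<le> ennreal (C * cost_bound CARD('N) n c B P K)"
proof -
  obtain C where C: "0 < C" "\<And>u v. (\<forall>j. 0 < u j \<and> u j < 1 \<and> 0 < v j \<and> v j < 1) \<Longrightarrow>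
      (rho_vec (quant \<alpha> u) (quant \<alpha> v))\<^sup>2 \<le> C * (\<Sum>j\<in>UNIV. (ref_quant (u j) - ref_quant (v j))\<^sup>2)"
    using quant_lipschitz[OF \<alpha>] by blast
  obtain ax :: "'N list" where ax: "set ax = UNIV" "distinct ax"
    using finite_distinct_list[of "UNIV :: 'N set"] by auto
  define D where "D = 2 * C * real CARD('N) * (2 ^ CARD('N) + 780)"
  have "expected_W2_sq (Pi\<^sub>M {1..n} (\<lambda>_. laguerre_measure \<alpha>)) (\<lambda>j x. x j) n \<alpha> \<le> ennreal (D * cost_bound CARD('N) n c B P K)"
    if n: "1 \<le> n" and B: "tame c B P" for n c B P K
  proof -
    let ?I = "{1..n}" and ?F = "\<lambda>u. (W2 (empirical_measure n (\<lambda>i. quant \<alpha> (u i))) (laguerre_measure \<alpha>))\<^sup>2"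
    define M :: "(nat \<Rightarrow> 'N \<Rightarrow> real) measure" where "M = Pi\<^sub>M ?I (\<lambda>_. cube)"
    define xs where "xs = coarse_ops B P ax @ fine_ops K ax"
    have st: "strict_specs xs" unfolding xs_def by (rule strict_specs_ops[OF B])
    then have sp: "specs xs" by (rule strict_specs_specs)
    let ?w = "\<lambda>ls u i j. sample_pt xs ls j i (u i j)"
    let ?A = "\<lambda>ls j u. \<Sum>i\<in>?I. ennreal ((ref_quant (?w ls u i j) - ref_quant (clip B P (?w ls u i j)))\<^sup>2)"
    let ?D = "\<lambda>ls j u. \<Sum>i\<in>?I. \<integral>\<^sup>+v. ennreal ((ref_quant (clip B P (?w ls u i j)) - ref_quant (target_pt xs ls ?I j i (v j)))\<^sup>2) \<partial>cube"
    let ?a = "real n * (\<Sum>k<P. (B (Suc k) - B k) * (4 * tail_cost c P k))"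
    let ?d = "real n * (\<Sum>k<P. (B (Suc k) - B k) * (2 * lipsq B P k / 4 ^ K + 8 * tail_cost c P k)) +
      real P ^ (CARD('N) - 1) * (2 ^ CARD('N) * (\<Sum>k<K. (2 ^ CARD('N) / 4) ^ k) * (\<Sum>k<P. lipsq B P k) +
        768 * c\<^sup>2 * (\<Sum>k<P. count_cost B P k))"
    have A: "?A ls j \<in> borel_measurable M" for ls j
    proof (intro borel_measurable_sum)
      fix i assume i: "i \<in> ?I"
      have [measurable]: "(\<lambda>u. u i j) \<in> borel_measurable M"
        unfolding M_def by (rule measurable_compose[OF measurable_component_singleton[OF i, where M = "\<lambda>_. cube"] cube_component])
      show "(\<lambda>u. ennreal ((ref_quant (?w ls u i j) - ref_quant (clip B P (?w ls u i j)))\<^sup>2)) \<in> borel_measurable M"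
        by measurable
    qed
    have D: "?D ls j \<in> borel_measurable M" for ls j unfolding M_def by (rule target_cost_measurable)
    have "expected_W2_sq (Pi\<^sub>M ?I (\<lambda>_. laguerre_measure \<alpha>)) (\<lambda>j x. x j) n \<alpha> = (\<integral>\<^sup>+u. ?F u \<partial>M)"
      unfolding M_def by (rule expected_W2_sq_cube[OF \<alpha> n])
    also have "\<dots> = nexpect ?I xs (\<lambda>ls. \<integral>\<^sup>+u. ?F (\<lambda>i. if i \<in> ?I then (\<lambda>j. sample_pt xs ls j i (u i j)) else u i) \<partial>M)"
      unfolding M_def by (rule nn_integral_cubes_nexpect[OF finite_atLeastAtMost sp expected_W2_sq_cube(2)[OF \<alpha> n]])
    also have "\<dots> \<le> nexpect ?I xs (\<lambda>ls. ennreal (2 * C / real n) * (\<Sum>j\<in>UNIV. (\<integral>\<^sup>+u. ?A ls j u \<partial>M) + (\<integral>\<^sup>+u. ?D ls j u \<partial>M)))"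
    proof (rule nexpect_mono)
      fix ls assume ls: "labels ?I xs ls"
      have e: "?F (\<lambda>i. if i \<in> ?I then (\<lambda>j. sample_pt xs ls j i (u i j)) else u i) = ?F (?w ls u)" for u
      proof -
        have "empirical_measure n (\<lambda>i. quant \<alpha> (if i \<in> ?I then (\<lambda>j. sample_pt xs ls j i (u i j)) else u i)) =
          empirical_measure n (\<lambda>i. quant \<alpha> (?w ls u i))"
          by (rule empirical_measure_cong) (simp only: if_True)
        then show ?thesis by simp
      qed
      have "(\<integral>\<^sup>+u. ?F (?w ls u) \<partial>M) \<le> (\<integral>\<^sup>+u. ennreal (2 * C / real n) * (\<Sum>j\<in>UNIV. ?A ls j u + ?D ls j u) \<partial>M)"
      proof (rule nn_integral_mono_AE, unfold M_def, use AE_cubes[OF finite_atLeastAtMost] in eventually_elim)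
        case (elim u)
        show ?case
          by (rule pathwise_bound[OF \<alpha> C n ls st]) (use elim in blast)+
      qed
      also have "\<dots> = ennreal (2 * C / real n) * (\<Sum>j\<in>UNIV. (\<integral>\<^sup>+u. ?A ls j u \<partial>M) + (\<integral>\<^sup>+u. ?D ls j u \<partial>M))"
        by (subst nn_integral_cmult, (intro borel_measurable_sum borel_measurable_add A D)[1],
            subst nn_integral_sum, (intro borel_measurable_add A D)[1], subst nn_integral_add[OF A D], rule refl)
      finally show "(\<integral>\<^sup>+u. ?F (\<lambda>i. if i \<in> ?I then (\<lambda>j. sample_pt xs ls j i (u i j)) else u i) \<partial>M) \<le>
        ennreal (2 * C / real n) * (\<Sum>j\<in>UNIV. (\<integral>\<^sup>+u. ?A ls j u \<partial>M) + (\<integral>\<^sup>+u. ?D ls j u \<partial>M))" unfolding e .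
    qed
    also have "\<dots> = ennreal (2 * C / real n) * (\<Sum>j\<in>UNIV. nexpect ?I xs (\<lambda>ls. \<integral>\<^sup>+u. ?A ls j u \<partial>M) + nexpect ?I xs (\<lambda>ls. \<integral>\<^sup>+u. ?D ls j u \<partial>M))"
      unfolding nexpect_cmult nexpect_sum[of ?I xs _ "UNIV :: 'N set"] nexpect_add ..
    also have "\<dots> \<le> ennreal (2 * C / real n) * (\<Sum>j\<in>(UNIV :: 'N set). ennreal ?a + ennreal ?d)"
    proof (intro mult_left_mono sum_mono add_mono)
      fix j :: 'N
      show "nexpect ?I xs (\<lambda>ls. \<integral>\<^sup>+u. ?A ls j u \<partial>M) \<le> ennreal ?a"
        using expected_tail_part[OF finite_atLeastAtMost B sp, of 1 n j] unfolding M_def card_atLeastAtMost by simp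
      show "nexpect ?I xs (\<lambda>ls. \<integral>\<^sup>+u. ?D ls j u \<partial>M) \<le> ennreal ?d"
        using expected_main_part[OF finite_atLeastAtMost B ax(2,1), of 1 n K j] unfolding M_def xs_def card_atLeastAtMost by simp
    qed simp_all
    also have "\<dots> = ennreal (2 * C * real CARD('N) * ((?a + ?d) / real n))"
    proof -
      have dd: "0 \<le> B (Suc k) - B k" if "k < P" for k using tame_cuts[OF B] that by (simp add: cuts_def)
      have a0: "0 \<le> ?a"
        by (intro mult_nonneg_nonneg sum_nonneg) (use dd tail_cost_nonneg in auto)
      have d0: "0 \<le> ?d"
        using dd tail_cost_nonneg lipsq_nonneg count_cost_nonneg[OF tame_cuts[OF B]]
        by (intro add_nonneg_nonneg mult_nonneg_nonneg sum_nonneg) auto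
      have "(\<Sum>j\<in>(UNIV :: 'N set). ennreal ?a + ennreal ?d) = ennreal (real CARD('N) * (?a + ?d))"
        unfolding ennreal_plus[OF a0 d0, symmetric] sum_constant by (simp only: ennreal_of_nat_eq_real_of_nat ennreal_mult'[OF of_nat_0_le_iff])
      then show ?thesis
        using C(1) by (simp add: ennreal_mult'[symmetric] mult.assoc)
    qed
    also have "\<dots> \<le> ennreal (2 * C * real CARD('N) * ((2 ^ CARD('N) + 780) * cost_bound CARD('N) n c B P K))"
      using C(1) by (intro ennreal_leI mult_left_mono cost_bound_combine[OF B n]) auto
    finally show ?thesis by (simp only: D_def mult.assoc)
  qed
  moreover have "0 < D" using C(1) by (simp add: D_def add_nonneg_pos)
  ultimately show ?thesis by blast
qed

section \<open>Ladders of cells\<close>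

text \<open>
  The cut points have tail masses \<open>exp (- f i) / 2\<close>. Dimension 1 uses \<open>f i = i\<close>; in higher dimensions
  \<open>f i = i\<^sup>2 / m\<close> gives all cells a \<open>lipsq\<close> of order \<open>1 / m\<close>.
\<close>

definition ladder :: "(nat \<Rightarrow> real) \<Rightarrow> nat \<Rightarrow> nat \<Rightarrow> real" where
  "ladder f m k = (if k = 0 then 0 else if k \<le> m + 1 then exp (- f (m + 1 - k)) / 2
    else if k \<le> 2 * m + 1 then 1 - exp (- f (k - m - 1)) / 2 else 1)"

lemma ladder_reflect:
  assumes "f 0 = 0" "k \<le> 2 * m + 2"
  shows "ladder f m (2 * m + 2 - k) = 1 - ladder f m k"
proof -
  consider "k = 0" | "1 \<le> k" "k \<le> m" | "k = m + 1" | "m + 2 \<le> k" "k \<le> 2 * m + 1" | "k = 2 * m + 2"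
    using assms(2) by linarith
  then show ?thesis
  proof cases
    case 2
    then have "2 * m + 2 - k - m - 1 = m + 1 - k" "\<not> 2 * m + 2 - k \<le> m + 1" "2 * m + 2 - k \<le> 2 * m + 1" "k \<noteq> 0" "2 * m + 2 - k \<noteq> 0" by auto
    with 2 show ?thesis by (simp add: ladder_def)
  next
    case 3
    then show ?thesis using assms(1) by (simp add: ladder_def)
  next
    case 4
    then have "m + 1 - (2 * m + 2 - k) = k - m - 1" "2 * m + 2 - k \<le> m + 1" "\<not> k \<le> m + 1" "k \<noteq> 0" "2 * m + 2 - k \<noteq> 0" by auto
    with 4 show ?thesis by (simp add: ladder_def)
  qed (simp_all add: ladder_def)
qed

lemma ladder_low: "1 \<le> k \<Longrightarrow> k \<le> m + 1 \<Longrightarrow> ladder f m k = exp (- f (m + 1 - k)) / 2"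
  by (simp add: ladder_def)

text \<open>The bound 3 covers both choices of f, with steps 1 and \<open>(2 * i + 1) / m\<close>.
  It makes neighbouring tail masses comparable with constant \<open>exp 3\<close>.\<close>

locale steps =
  fixes f :: "nat \<Rightarrow> real" and m :: nat
  assumes f0: "f 0 = 0" and m: "1 \<le> m"
    and inc: "\<And>i. i < m \<Longrightarrow> f i < f (Suc i)" and step: "\<And>i. i < m \<Longrightarrow> f (Suc i) - f i \<le> 3"
begin

abbreviation "B \<equiv> ladder f m"
abbreviation "P \<equiv> 2 * m + 2"

lemma f_nonneg: "i \<le> m \<Longrightarrow> 0 \<le> f i"
proof (induction i)
  case (Suc i)
  then show ?case using inc[of i] by simp
qed (simp add: f0)

lemma reflect: "k \<le> P \<Longrightarrow> B (P - k) = 1 - B k"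
  by (rule ladder_reflect[of f, OF f0])

text \<open>Levels are counted from the centre: cell k of the left half lies between the levels
  \<open>Suc i\<close> and i with i = m - k, and cell 0 is the end cell beyond level m. The right
  half follows by \<open>reflect\<close>.\<close>

lemma low_cases:
  assumes "k \<le> m"
  obtains (zero) "k = 0" "B k = 0" "B (Suc k) = exp (- f m) / 2"
    | (pos) i where "1 \<le> k" "i < m" "k + i = m" "B k = exp (- f (Suc i)) / 2" "B (Suc k) = exp (- f i) / 2"
proof (cases "k = 0")
  case True
  then show ?thesis using zero by (simp add: ladder_def)
next
  case False
  have "m + 1 - k = Suc (m - k)" "m + 1 - Suc k = m - k" using assms by auto
  then show ?thesis using False assms pos[of "m - k"] by (simp add: ladder_low)
qed

lemma exp_step:
  assumes "i < m"
  shows "exp (- f i) \<le> exp 3 * exp (- f (Suc i))" "exp (- f i) - exp (- f (Suc i)) \<le> exp 3 * exp (- f (Suc i)) * (f (Suc i) - f i)"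
    "exp (- f i) - exp (- f (Suc i)) \<le> exp (- f i) * (f (Suc i) - f i)"
proof -
  let ?t = "f (Suc i) - f i"
  have e: "exp (- f i) = exp ?t * exp (- f (Suc i))" by (simp flip: exp_add)
  have t: "exp ?t \<le> exp 3" "0 < ?t" using step[OF assms] inc[OF assms] by simp_all
  show "exp (- f i) \<le> exp 3 * exp (- f (Suc i))" unfolding e using t by simp
  have r: "exp (- f (Suc i)) = exp (- ?t) * exp (- f i)" by (simp flip: exp_add)
  have "1 - ?t \<le> exp (- ?t)" using exp_ge_add_one_self[of "- ?t"] by (simp add: algebra_simps)
  then have "(1 - ?t) * exp (- f i) \<le> exp (- ?t) * exp (- f i)" by (intro mult_right_mono) auto
  then show *: "exp (- f i) - exp (- f (Suc i)) \<le> exp (- f i) * ?t" unfolding r by (simp add: algebra_simps)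
  also have "\<dots> \<le> exp 3 * exp (- f (Suc i)) * ?t"
    using t by (intro mult_right_mono) (simp_all add: e)
  finally show "exp (- f i) - exp (- f (Suc i)) \<le> exp 3 * exp (- f (Suc i)) * ?t" .
qed

lemma low_strict:
  assumes "k \<le> m"
  shows "0 \<le> B k \<and> B k < B (Suc k) \<and> B (Suc k) \<le> 1 / 2"
  using assms
proof (cases rule: low_cases)
  case zero
  show ?thesis using f_nonneg[of m] unfolding zero(2,3) by simp
next
  case (pos i)
  show ?thesis using inc[of i] f_nonneg[of i] pos(2) unfolding pos(4,5) by simp
qed

lemma strict: "k < P \<Longrightarrow> B k < B (Suc k)"
proof (cases "k \<le> m")
  case False
  assume k: "k < P"
  then have "B (P - Suc k) < B (Suc (P - Suc k))" using False low_strict[of "P - Suc k"] by simp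
  moreover have "Suc (P - Suc k) = P - k" using k by simp
  ultimately show ?thesis using reflect[of k] reflect[of "Suc k"] k by simp
qed (use low_strict in simp)

lemma exp3: "2 \<le> exp (3 :: real)"
  using exp_ge_add_one_self[of 3] by simp

lemma ratio:
  assumes "0 < k" "k < P"
  shows "B (Suc k) \<le> exp 3 * B k"
proof (cases "k \<le> m")
  case True
  then show ?thesis
  proof (cases rule: low_cases)
    case (pos i)
    show ?thesis using exp_step(1)[OF pos(2)] unfolding pos(4,5) by simp
  qed (use assms in simp)
next
  case False
  have "B (P - k) \<le> 1 / 2"
  proof -
    have "Suc (P - k - 1) = P - k" "P - k - 1 \<le> m" using False assms by auto
    then show ?thesis using low_strict[of "P - k - 1"] by simp
  qed
  then have "1 / 2 \<le> B k" using reflect[of k] assms by simp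
  moreover have "B (Suc k) \<le> 1"
    using low_strict[of "P - Suc k"] reflect[of "Suc k"] False assms by simp
  ultimately show ?thesis using mult_mono[OF exp3, of "1/2" "B k"] by simp
qed

lemma tame_ladder: "tame (exp 3) B P"
  unfolding tame_def
proof (intro conjI allI impI)
  show "B 0 = 0" "B P = 1" by (simp_all add: ladder_def)
  show "B k < B (Suc k)" if "k < P" for k using strict that .
  show "B (Suc k) \<le> exp 3 * B k" if "0 < k \<and> k < P" for k using ratio that by blast
  show "1 - B k \<le> exp 3 * (1 - B (Suc k))" if k: "Suc k < P" for k
  proof -
    have "B (Suc (P - Suc k)) \<le> exp 3 * B (P - Suc k)" using k by (intro ratio) auto
    moreover have "Suc (P - Suc k) = P - k" using k by simp
    ultimately show ?thesis using reflect[of k] reflect[of "Suc k"] k by simp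
  qed
qed simp_all

lemma tail_root_exp: "0 \<le> y \<Longrightarrow> 1 + y \<le> (tail_root (exp (- y) / 2))\<^sup>2"
proof -
  assume y: "0 \<le> y"
  have "0 \<le> ln (2 :: real)" by simp
  moreover have "1 - ln (exp (- y) / 2) = 1 + y + ln 2" by (simp add: ln_div)
  ultimately show ?thesis using y unfolding tail_root_def by (simp only: real_sqrt_pow2)
qed

text \<open>Relative to the near tail the length of a cell is at most of the order of the step of f,
  and \<open>tail_root\<close> squared is at least \<open>1 + f i\<close>. The summand for the far
  tail, whose mass is at least 1/2, obeys the same bound.\<close>

lemma lipsq_low:
  assumes "k \<le> m"
  shows "lipsq B P k \<le> (if k = 0 then 0 else (exp 3 + 2)\<^sup>2 * ((f (Suc (m - k)) - f (m - k))\<^sup>2 / (1 + f (m - k))))"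
  using assms
proof (cases rule: low_cases)
  case zero
  then show ?thesis by (simp add: lipsq_def)
next
  case (pos i)
  let ?t = "f (Suc i) - f i" and ?q = "exp (- f (Suc i)) / 2" and ?r = "exp (- f i) / 2"
  have i: "m - k = i" using pos by simp
  have fi: "0 \<le> f i" using f_nonneg[of i] pos by simp
  have t: "0 < ?t" using inc[of i] pos by simp
  have r: "?r \<le> 1 / 2" "0 < ?r" "0 < ?q" using fi by (auto intro: order_trans[of _ 1])
  have q: "?q < ?r" using t by simp
  have g: "1 \<le> tail_root ?r" "1 \<le> tail_root (1 - ?q)" by (rule tail_root_ge_1; use r q in linarith)+
  \<comment> \<open>The far summand is divided by the far \<open>tail_root\<close>, which is merely
    at least 1. The small tail mass \<open>?r\<close> compensates for the missing factor
    \<open>tail_root ?r\<close>.\<close>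
  have rg: "?r * tail_root ?r \<le> 1"
  proof -
    have "ln (1 / ?r) \<le> 1 / ?r - 1" using r by (intro ln_le_minus_one) simp
    then have lnr: "1 - ln ?r \<le> 1 / ?r" using r by (simp add: ln_div)
    have "tail_root ?r \<le> 1 / ?r" unfolding tail_root_def
    proof (rule real_le_lsqrt)
      have "1 \<le> 1 / ?r" using r by (subst le_divide_eq_1) linarith
      then have "1 / ?r \<le> (1 / ?r)\<^sup>2" by (intro self_le_power) simp_all
      then show "1 - ln ?r \<le> (1 / ?r)\<^sup>2" using lnr by linarith
    qed (use r in simp)
    then show ?thesis using r by (simp add: field_simps)
  qed
  have a: "(?r - ?q) / ((1 - ?r) * tail_root (1 - ?q)) \<le> 2 * ?t / tail_root ?r"
  proof -
    have "?r - ?q \<le> ?r * ?t" using exp_step(3)[of i] pos by simp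
    moreover have "(?r * tail_root ?r) * ?t \<le> 1 * ?t" using rg t by (intro mult_right_mono) auto
    ultimately have "?r - ?q \<le> ?t / tail_root ?r" 
    proof -
      assume h: "?r - ?q \<le> ?r * ?t" "?r * tail_root ?r * ?t \<le> 1 * ?t"
      have "(?r - ?q) * tail_root ?r \<le> (?r * ?t) * tail_root ?r" using h(1) g by (intro mult_right_mono) auto
      also have "\<dots> = ?r * tail_root ?r * ?t" by (simp only: ac_simps)
      also note h(2)
      finally have "(?r - ?q) * tail_root ?r \<le> ?t" unfolding mult_1 .
      then show ?thesis using g by (subst pos_le_divide_eq) auto
    qed
    moreover have "1 / 2 * 1 \<le> (1 - ?r) * tail_root (1 - ?q)" by (intro mult_mono; use r g in linarith)
    ultimately have "(?r - ?q) / ((1 - ?r) * tail_root (1 - ?q)) \<le> (?t / tail_root ?r) / (1 / 2)"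
      using q t g by (intro frac_le) auto
    moreover have "x / y / (1 / 2) = 2 * x / y" for x y :: real by simp
    ultimately show ?thesis by (simp only:)
  qed
  have b: "(?r - ?q) / (?q * tail_root ?r) \<le> exp 3 * ?t / tail_root ?r"
  proof -
    have "?r - ?q \<le> exp 3 * ?t * ?q" using exp_step(2)[of i] pos by (simp add: field_simps)
    then have "(?r - ?q) / (?q * tail_root ?r) \<le> (exp 3 * ?t * ?q) / (?q * tail_root ?r)"
      using r g by (intro divide_right_mono) auto
    then show ?thesis by simp
  qed
  have ab: "0 \<le> (?r - ?q) / ((1 - ?r) * tail_root (1 - ?q)) + (?r - ?q) / (?q * tail_root ?r)"
    by (intro add_nonneg_nonneg divide_nonneg_nonneg mult_nonneg_nonneg; use r g q in linarith)
  have "lipsq B P k = ((?r - ?q) / ((1 - ?r) * tail_root (1 - ?q)) + (?r - ?q) / (?q * tail_root ?r))\<^sup>2"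
    unfolding lipsq_def pos(4,5) using pos(1-3) by (simp add: Suc_le_eq)
  also have "\<dots> \<le> ((exp 3 + 2) * (?t / tail_root ?r))\<^sup>2"
  proof (rule power_mono[OF _ ab])
    have "2 * x / y + z * x / y = (z + 2) * (x / y)" for x y z :: real by (simp add: distrib_right add_divide_distrib)
    then show "(?r - ?q) / ((1 - ?r) * tail_root (1 - ?q)) + (?r - ?q) / (?q * tail_root ?r) \<le> (exp 3 + 2) * (?t / tail_root ?r)"
      using add_mono[OF a b] by (simp only:)
  qed
  also have "\<dots> = (exp 3 + 2)\<^sup>2 * (?t\<^sup>2 / (tail_root ?r)\<^sup>2)" by (simp add: power_mult_distrib power_divide)
  also have "\<dots> \<le> (exp 3 + 2)\<^sup>2 * (?t\<^sup>2 / (1 + f i))"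
    using tail_root_exp[OF fi] fi by (intro mult_left_mono divide_left_mono mult_pos_pos) (auto simp: add_pos_nonneg)
  finally show ?thesis using pos i by simp
qed

text \<open>The near tail gives at most two terms over \<open>tail_root\<close> squared. The far
  tail has the masses \<open>B k\<close> and \<open>B (Suc k)\<close> in the numerator, together at
  most \<open>exp (- f (m - k))\<close>, so it costs no more.\<close>

lemma count_cost_low:
  assumes "k \<le> m"
  shows "count_cost B P k \<le> 3 / (1 + f (m - k))"
proof -
  let ?i = "m - k"
  have fi: "0 \<le> f ?i" by (rule f_nonneg) simp
  have r: "B (Suc k) = exp (- f ?i) / 2" using assms by (simp add: ladder_low)
  have qr: "0 \<le> B k" "B k < B (Suc k)" "B (Suc k) \<le> 1 / 2" using low_strict[OF assms] by auto
  have "1 \<le> tail_root (1 - B k)" using qr by (intro tail_root_ge_1) auto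
  then have "(B k + (if Suc k < P then B (Suc k) else 0)) / (tail_root (1 - B k))\<^sup>2 \<le> exp (- f ?i) / 1"
    using qr r by (intro frac_le) (auto intro: one_le_power)
  also have "\<dots> \<le> 1 / (1 + f ?i)"
    using exp_ge_add_one_self[of "f ?i"] fi by (simp add: exp_minus field_simps)
  finally have a: "(B k + (if Suc k < P then B (Suc k) else 0)) / (tail_root (1 - B k))\<^sup>2 \<le> 1 / (1 + f ?i)" .
  have "(1 - B (Suc k) + (if 0 < k then 1 - B k else 0)) / (tail_root (B (Suc k)))\<^sup>2 \<le> 2 / (1 + f ?i)"
    using qr tail_root_exp[OF fi] fi unfolding r[symmetric] by (intro frac_le) auto
  then show ?thesis unfolding count_cost_def using a by (simp add: add_divide_distrib[symmetric]) 
qed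

lemma lipsq_reflect: "k < P \<Longrightarrow> lipsq B P (P - Suc k) = lipsq B P k"
proof -
  assume k: "k < P"
  have s: "Suc (P - Suc k) = P - k" using k by simp
  have "B (P - Suc k) = 1 - B (Suc k)" "B (P - k) = 1 - B k" using k by (intro reflect; simp)+
  moreover have "P - Suc k = 0 \<longleftrightarrow> Suc k = P" "Suc (P - Suc k) = P \<longleftrightarrow> k = 0" using k by auto
  ultimately show ?thesis unfolding lipsq_def s by (simp add: add.commute)
qed

lemma count_cost_reflect: "k < P \<Longrightarrow> count_cost B P (P - Suc k) = count_cost B P k"
proof -
  assume k: "k < P"
  have s: "Suc (P - Suc k) = P - k" using k by simp
  have "B (P - Suc k) = 1 - B (Suc k)" "B (P - k) = 1 - B k" using k by (intro reflect; simp)+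
  moreover have "P - k < P \<longleftrightarrow> 0 < k" "0 < P - Suc k \<longleftrightarrow> Suc k < P" using k by auto
  ultimately show ?thesis unfolding count_cost_def s by (cases "k = 0") simp_all
qed

lemma sum_reflect:
  fixes g :: "nat \<Rightarrow> real"
  assumes "\<And>k. k < P \<Longrightarrow> g (P - Suc k) = g k"
  shows "(\<Sum>k<P. g k) = 2 * (\<Sum>i\<le>m. g (m - i))"
proof -
  have split: "(\<Sum>k<a + b. g k) = (\<Sum>k<a. g k) + (\<Sum>k<b. g (k + a))" for a b
    by (induction b) (simp_all add: ac_simps)
  have "(\<Sum>k<P. g k) = (\<Sum>k<m + 1. g k) + (\<Sum>k<m + 1. g (k + (m + 1)))"
  proof -
    have "P = (m + 1) + (m + 1)" by simp
    then show ?thesis using split[of "m + 1" "m + 1"] by (simp only:)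
  qed
  also have "(\<Sum>k<m + 1. g (k + (m + 1))) = (\<Sum>k<m + 1. g (m - k))"
  proof (rule sum.cong)
    fix k assume "k \<in> {..<m + 1}"
    then have "m - k < P" "P - Suc (m - k) = k + (m + 1)" by auto
    then show "g (k + (m + 1)) = g (m - k)" using assms[of "m - k"] by simp
  qed simp
  also have "(\<Sum>k<m + 1. g k) = (\<Sum>k<m + 1. g (m - k))"
    using sum.nat_diff_reindex[of g "m + 1"] by simp
  finally show ?thesis by (simp add: lessThan_Suc_atMost)
qed

lemma weight_sum: "(\<Sum>k<P. B (Suc k) - B k) = 1"
proof -
  have "(\<Sum>k<P. B (Suc k) - B k) = B P - B 0" by (rule sum_lessThan_telescope)
  then show ?thesis using tame_ladder unfolding tame_def by linarith
qed

lemma lipsq_le: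
  assumes L: "\<And>i. i < m \<Longrightarrow> (f (Suc i) - f i)\<^sup>2 / (1 + f i) \<le> L" and k: "k < P"
  shows "lipsq B P k \<le> (exp 3 + 2)\<^sup>2 * L"
proof -
  have L0: "0 \<le> L"
    by (rule order_trans[OF _ L[of 0]]) (use m f0 in auto)
  have low: "lipsq B P k \<le> (exp 3 + 2)\<^sup>2 * L" if "k \<le> m" for k
  proof (cases "k = 0")
    case True
    have "0 \<le> (exp 3 + 2)\<^sup>2 * L" using L0 by (intro mult_nonneg_nonneg) auto
    then show ?thesis using lipsq_low[OF that] unfolding if_P[OF True] by (rule order_trans[rotated])
  next
    case False
    then have "(exp 3 + 2)\<^sup>2 * ((f (Suc (m - k)) - f (m - k))\<^sup>2 / (1 + f (m - k))) \<le> (exp 3 + 2)\<^sup>2 * L"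
      using that by (intro mult_left_mono L) auto
    then show ?thesis using lipsq_low[OF that] False by simp
  qed
  show ?thesis
  proof (cases "k \<le> m")
    case False
    then show ?thesis using low[of "P - Suc k"] lipsq_reflect[OF k] by simp
  qed (rule low)
qed

lemma lipsq_sum: "(\<Sum>k<P. lipsq B P k) \<le> 2 * ((exp 3 + 2)\<^sup>2 * (\<Sum>i<m. (f (Suc i) - f i)\<^sup>2 / (1 + f i)))"
proof -
  let ?h = "\<lambda>i. (exp 3 + 2)\<^sup>2 * ((f (Suc i) - f i)\<^sup>2 / (1 + f i))"
  have "(\<Sum>k<P. lipsq B P k) = 2 * (\<Sum>i\<le>m. lipsq B P (m - i))" by (rule sum_reflect[where g = "lipsq B P", OF lipsq_reflect])
  also have "(\<Sum>i\<le>m. lipsq B P (m - i)) \<le> (\<Sum>i\<le>m. if i = m then 0 else ?h i)"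
  proof (rule sum_mono)
    fix i assume "i \<in> {..m}"
    then show "lipsq B P (m - i) \<le> (if i = m then 0 else ?h i)"
      using lipsq_low[of "m - i"] by (auto split: if_splits)
  qed
  also have "\<dots> = (\<Sum>i<m. ?h i)" by (simp flip: lessThan_Suc_atMost)
  finally show ?thesis by (simp add: sum_distrib_left)
qed

lemma count_cost_sum: "(\<Sum>k<P. count_cost B P k) \<le> 6 * (\<Sum>i\<le>m. 1 / (1 + f i))"
proof -
  have "(\<Sum>k<P. count_cost B P k) = 2 * (\<Sum>i\<le>m. count_cost B P (m - i))" by (rule sum_reflect[where g = "count_cost B P", OF count_cost_reflect])
  also have "(\<Sum>i\<le>m. count_cost B P (m - i)) \<le> (\<Sum>i\<le>m. 3 * (1 / (1 + f i)))"
  proof (rule sum_mono)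
    fix i assume "i \<in> {..m}"
    then show "count_cost B P (m - i) \<le> 3 * (1 / (1 + f i))"
      using count_cost_low[of "m - i"] by simp
  qed
  also have "(\<Sum>i\<le>m. 3 * (1 / (1 + f i))) = 3 * (\<Sum>i\<le>m. 1 / (1 + f i))" by (rule sum_distrib_left[symmetric])
  finally show ?thesis by (simp only: mult.assoc[symmetric]) simp
qed

lemma tail_sum: "(\<Sum>k<P. (B (Suc k) - B k) * tail_cost (exp 3) P k) = (2 * (exp 3)\<^sup>2 + 32) * exp (- f m)"
proof -
  have "(\<Sum>k<P. (B (Suc k) - B k) * tail_cost (exp 3) P k) =
    (\<Sum>k\<in>{0, P - 1}. (B (Suc k) - B k) * (2 * (exp 3)\<^sup>2 + 32))"
    by (rule sum.mono_neutral_cong_right) (auto simp: tail_cost_def)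
  also have "\<dots> = (B 1 - B 0 + (B P - B (P - 1))) * (2 * (exp 3)\<^sup>2 + 32)"
    by (simp add: distrib_right)
  also have "B 1 - B 0 + (B P - B (P - 1)) = exp (- f m)"
    using reflect[of 1] by (simp add: ladder_def)
  finally show ?thesis by simp
qed

text \<open>With E for \<open>(exp 3 + 2)\<^sup>2\<close>, the common factor \<open>6 * E\<close>
  dominates E from the resolution, \<open>2 * E\<close> from the digits,
  \<open>6 * (exp 3)\<^sup>2\<close> from the counts and \<open>2 * (exp 3)\<^sup>2 + 32\<close>
  from the tails.\<close>

lemma cost_bound_ladder:
  assumes L: "\<And>i. i < m \<Longrightarrow> (f (Suc i) - f i)\<^sup>2 / (1 + f i) \<le> L"
  shows "cost_bound d n (exp 3) B P K \<le> 6 * (exp 3 + 2)\<^sup>2 * (L / 4 ^ K + exp (- f m) +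
    real P ^ (d - 1) * ((\<Sum>k<K. (2 ^ d / 4) ^ k) * (\<Sum>i<m. (f (Suc i) - f i)\<^sup>2 / (1 + f i)) + (\<Sum>i\<le>m. 1 / (1 + f i))) / real n)"
proof -
  let ?A = "(exp 3 + 2)\<^sup>2 :: real" and ?S = "\<Sum>k<K. (2 ^ d / 4 :: real) ^ k"
  let ?U = "\<Sum>i<m. (f (Suc i) - f i)\<^sup>2 / (1 + f i)" and ?V = "\<Sum>i\<le>m. 1 / (1 + f i)"
  have L0: "0 \<le> L"
    by (rule order_trans[OF _ L[of 0]]) (use m f0 in auto)
  have dB: "0 \<le> B (Suc k) - B k" if "k < P" for k using strict[OF that] by simp
  have S: "0 \<le> ?S" by (intro sum_nonneg) simp
  have V: "0 \<le> ?V" using f_nonneg by (intro sum_nonneg) (simp add: add_nonneg_nonneg)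
  have U: "0 \<le> ?U" using f_nonneg by (intro sum_nonneg) (simp add: add_nonneg_nonneg)
  have "(\<Sum>k<P. (B (Suc k) - B k) * (lipsq B P k / 4 ^ K)) \<le> (\<Sum>k<P. (B (Suc k) - B k) * (?A * L / 4 ^ K))"
    using dB by (intro sum_mono mult_left_mono divide_right_mono lipsq_le L) auto
  also have "\<dots> = ?A * L / 4 ^ K" unfolding sum_distrib_right[symmetric] weight_sum by simp
  also have "\<dots> \<le> 6 * ?A * (L / 4 ^ K)" using L0 by (simp add: divide_right_mono mult_right_mono)
  finally have 1: "(\<Sum>k<P. (B (Suc k) - B k) * (lipsq B P k / 4 ^ K)) \<le> 6 * ?A * (L / 4 ^ K)" .
  have sq: "(exp 3)\<^sup>2 \<le> ?A" by (intro power_mono) auto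
  have A16: "16 \<le> ?A" using power_mono[of 4 "exp 3 + 2 :: real" 2] exp3 by simp
  have 2: "(\<Sum>k<P. (B (Suc k) - B k) * tail_cost (exp 3) P k) \<le> 6 * ?A * exp (- f m)"
  proof -
    have "2 * (exp 3)\<^sup>2 + 32 \<le> 6 * ?A" using sq A16 by linarith
    then show ?thesis unfolding tail_sum by (rule mult_right_mono) simp
  qed
  have "?S * (\<Sum>k<P. lipsq B P k) + (exp 3)\<^sup>2 * (\<Sum>k<P. count_cost B P k) \<le> ?S * (2 * (?A * ?U)) + ?A * (6 * ?V)"
  proof (intro add_mono mult_mono S sq count_cost_sum)
    show "(\<Sum>k<P. lipsq B P k) \<le> 2 * (?A * ?U)" by (rule lipsq_sum)
    show "0 \<le> (\<Sum>k<P. lipsq B P k)" by (intro sum_nonneg lipsq_nonneg)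
    show "0 \<le> (\<Sum>k<P. count_cost B P k)" by (intro sum_nonneg count_cost_nonneg[OF tame_cuts[OF tame_ladder]]) simp
  qed simp_all
  also have "\<dots> \<le> 6 * ?A * (?S * ?U + ?V)"
  proof -
    have "0 \<le> ?A * (?S * ?U)" using S U by (intro mult_nonneg_nonneg) auto
    then show ?thesis by (simp add: algebra_simps)
  qed
  finally have "real P ^ (d - 1) * (?S * (\<Sum>k<P. lipsq B P k) + (exp 3)\<^sup>2 * (\<Sum>k<P. count_cost B P k)) / real n \<le>
     real P ^ (d - 1) * (6 * ?A * (?S * ?U + ?V)) / real n"
    by (intro divide_right_mono mult_left_mono) auto
  also have "\<dots> = 6 * ?A * (real P ^ (d - 1) * (?S * ?U + ?V) / real n)" by (simp only: ac_simps times_divide_eq_right)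
  finally have 3: "real P ^ (d - 1) * (?S * (\<Sum>k<P. lipsq B P k) + (exp 3)\<^sup>2 * (\<Sum>k<P. count_cost B P k)) / real n \<le>
     6 * ?A * (real P ^ (d - 1) * (?S * ?U + ?V) / real n)" .
  show ?thesis
    unfolding cost_bound_def distrib_left[of "B (Suc _) - B _"] sum.distrib
    using add_mono[OF add_mono[OF 1 2] 3] by (simp only: distrib_left)
qed

end

section \<open>Rates\<close>

lemma harmonic_le: "(\<Sum>i\<le>m. 1 / (1 + real i)) \<le> 1 + ln (real m + 1)"
proof (induction m)
  case (Suc m)
  have "ln ((real m + 1) / (real m + 2)) \<le> (real m + 1) / (real m + 2) - 1" by (intro ln_le_minus_one) auto
  also have "(real m + 1) / (real m + 2) - 1 = - (1 / (real m + 2))" by (simp add: field_simps)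
  finally have "1 / (real m + 2) \<le> ln (real m + 2) - ln (real m + 1)" by (simp add: ln_div)
  with Suc show ?case by (simp add: add.commute add.left_commute)
qed simp

lemma sum_power_le:
  fixes r :: real
  shows "2 \<le> r \<Longrightarrow> (\<Sum>k<K. r ^ k) \<le> r ^ K"
proof (induction K)
  case (Suc K)
  then have "(\<Sum>k<Suc K. r ^ k) \<le> 2 * r ^ K" by simp
  also have "\<dots> \<le> r * r ^ K" using Suc by (intro mult_right_mono) auto
  finally show ?case by simp
qed simp

lemma log_ceiling:
  assumes "1 \<le> ln (real n)"
  defines "m \<equiv> nat \<lceil>ln (real n)\<rceil>"
  shows "1 \<le> m" "ln (real n) \<le> real m" "real m \<le> ln (real n) + 1" "exp (- real m) \<le> 1 / real n" "1 \<le> n"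
proof -
  have n: "1 \<le> n" using assms(1) by (cases "n = 0") auto
  then show "1 \<le> n" .
  have m: "real m = of_int \<lceil>ln (real n)\<rceil>" unfolding m_def using assms(1) by simp
  show lm: "ln (real n) \<le> real m" "real m \<le> ln (real n) + 1" unfolding m by linarith+
  show "1 \<le> m" using lm(1) assms(1) by linarith
  have "exp (- real m) \<le> exp (- ln (real n))" using lm by simp
  also have "\<dots> = 1 / real n" using n by (simp add: exp_minus inverse_eq_divide)
  finally show "exp (- real m) \<le> 1 / real n" .
qed

text \<open>With one axis the digits cost a geometric series of ratio 1/2, bounded in K, and K = n
  already makes the resolution smaller than \<open>1 / n\<close>. Unit steps give the same harmonic
  terms for digits and counts. The factor 11 is 2 * 3 + 3 from these, plus 1 each for resolution and
  tails.\<close>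

lemma cost_bound_dim1:
  "\<exists>D>0. eventually (\<lambda>n. \<exists>c B P K. tame c B P \<and> cost_bound 1 n c B P K \<le> D * (ln (ln (real n)) / real n)) sequentially"
proof -
  define A :: real where "A = 6 * (exp 3 + 2)\<^sup>2"
  have A: "0 < A" unfolding A_def by (intro mult_pos_pos zero_less_power add_pos_pos) auto
  have "eventually (\<lambda>n::nat. ln (ln (real n) + 2) \<le> 2 * ln (ln (real n))) sequentially"
       "eventually (\<lambda>n::nat. 1 \<le> ln (ln (real n))) sequentially"
       "eventually (\<lambda>n::nat. 1 \<le> ln (real n)) sequentially" by real_asymp+
  then have "eventually (\<lambda>n. \<exists>c B P K. tame c B P \<and> cost_bound 1 n c B P K \<le> (A * 11) * (ln (ln (real n)) / real n)) sequentially"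
  proof eventually_elim
    case (elim n)
    define m where "m = nat \<lceil>ln (real n)\<rceil>"
    note m = log_ceiling[OF elim(3), folded m_def]
    interpret L: steps real m by unfold_locales (use m in auto)
    let ?l = "ln (ln (real n))"
    let ?H = "\<Sum>i\<le>m. 1 / (1 + real i)" and ?H' = "\<Sum>i<m. (real (Suc i) - real i)\<^sup>2 / (1 + real i)"
    let ?S = "\<Sum>k<n. (2 ^ 1 / 4 :: real) ^ k"
    have "ln (real m + 1) \<le> ln (ln (real n) + 2)" using m by (subst ln_le_cancel_iff) auto
    then have H: "?H \<le> 3 * ?l" using harmonic_le[of m] elim by linarith
    have H': "0 \<le> ?H'" "?H' \<le> ?H"
    proof -
      have e: "?H' = (\<Sum>i<m. 1 / (1 + real i))" by simp
      show "0 \<le> ?H'" unfolding e by (intro sum_nonneg) simp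
      show "?H' \<le> ?H" unfolding e by (intro sum_mono2) auto
    qed
    have S: "?S \<le> 2"
    proof -
      have "?S = 2 - 2 * (1 / 2) ^ n" by (induction n) simp_all
      then show ?thesis by simp
    qed
    have "?S * ?H' \<le> 2 * (3 * ?l)" using S H H' elim by (intro mult_mono) auto
    then have "(?S * ?H' + ?H) / real n \<le> (9 * ?l) / real n" using H by (intro divide_right_mono) auto
    moreover have "1 / 4 ^ n \<le> ?l / real n"
    proof -
      have "real n \<le> 4 ^ n"
        using of_nat_mono[OF less_imp_le[OF less_exp[of n]], where 'a = real] power_mono[of "2::real" 4 n] by simp
      then show ?thesis using elim m by (intro frac_le) auto
    qed
    moreover have "exp (- real m) \<le> ?l / real n"
      using m(4) elim by (meson divide_right_mono of_nat_0_le_iff order_trans)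
    ultimately have "1 / 4 ^ n + exp (- real m) + real (2 * m + 2) ^ (1 - 1) * (?S * ?H' + ?H) / real n \<le> 11 * (?l / real n)"
      by (simp add: add_divide_distrib)
    then have "A * (1 / 4 ^ n + exp (- real m) + real (2 * m + 2) ^ (1 - 1) * (?S * ?H' + ?H) / real n) \<le> A * (11 * (?l / real n))"
      using A by (intro mult_left_mono) auto
    moreover have "cost_bound 1 n (exp 3) (ladder real m) (2 * m + 2) n \<le> A * (1 / 4 ^ n + exp (- real m) + real (2 * m + 2) ^ (1 - 1) * (?S * ?H' + ?H) / real n)"
      unfolding A_def by (rule L.cost_bound_ladder) auto
    ultimately have "cost_bound 1 n (exp 3) (ladder real m) (2 * m + 2) n \<le> (A * 11) * (?l / real n)"
      by (simp only: mult.assoc)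
    then show ?case using L.tame_ladder by blast
  qed
  moreover have "0 < A * 11" using A by simp
  ultimately show ?thesis by blast
qed

text \<open>At level m the quadratic ladder still reaches tail mass \<open>exp (- m)\<close>, while
  \<open>(2 * i + 1)\<^sup>2 / m\<^sup>2\<close> over \<open>1 + i\<^sup>2 / m\<close> is at most
  \<open>8 / m\<close>. Summed over the m steps this stays bounded by 8, so the digits pay no
  further power of m.\<close>

lemma cost_bound_quadratic:
  assumes n: "1 \<le> ln (real n)"
  defines "m \<equiv> nat \<lceil>ln (real n)\<rceil>"
  shows "\<exists>c B P. tame c B P \<and> cost_bound d n c B P K \<le> 48 * (exp 3 + 2)\<^sup>2 *
    (1 / (real m * 4 ^ K) + 1 / real n + (4 * real m) ^ (d - 1) * ((\<Sum>k<K. (2 ^ d / 4) ^ k) + real m) / real n)"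
proof -
  note m = log_ceiling[OF n, folded m_def]
  let ?f = "\<lambda>i. (real i)\<^sup>2 / real m"
  let ?S = "\<Sum>k<K. (2 ^ d / 4 :: real) ^ k"
  have S: "0 \<le> ?S" by (intro sum_nonneg) simp
  have d: "?f (Suc i) - ?f i = (2 * real i + 1) / real m" for i
    by (simp add: diff_divide_distrib[symmetric] power2_eq_square algebra_simps)
  interpret L: steps ?f m
  proof
    fix i assume i: "i < m"
    have "0 < (2 * real i + 1) / real m" using m by (intro divide_pos_pos) auto
    then show "?f i < ?f (Suc i)" using d[of i] by linarith
    have "2 * real i + 1 \<le> 3 * real m" using i by linarith
    then show "?f (Suc i) - ?f i \<le> 3" unfolding d using m by (subst pos_divide_le_eq) auto
  qed (use m in auto)
  have L: "(?f (Suc i) - ?f i)\<^sup>2 / (1 + ?f i) \<le> 8 / real m" for i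
  proof -
    have "(2 * real i + 1)\<^sup>2 \<le> 8 * (real m + (real i)\<^sup>2)"
    proof -
      have "0 \<le> (2 * real i - 1)\<^sup>2" by simp
      then show ?thesis using m(1) by (simp add: power2_eq_square algebra_simps)
    qed
    moreover have "0 < real m + (real i)\<^sup>2" using m(1) by (intro add_pos_nonneg) auto
    ultimately have "(2 * real i + 1)\<^sup>2 / (real m + (real i)\<^sup>2) \<le> 8" by (subst pos_divide_le_eq) auto
    then have "(2 * real i + 1)\<^sup>2 / (real m + (real i)\<^sup>2) / real m \<le> 8 / real m" by (intro divide_right_mono) auto
    moreover have "((2 * real i + 1) / real m)\<^sup>2 / (1 + ?f i) = (2 * real i + 1)\<^sup>2 / (real m + (real i)\<^sup>2) / real m"
    proof -
      have "1 + ?f i = (real m + (real i)\<^sup>2) / real m" using m(1) by (simp add: add_divide_distrib)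
      then show ?thesis by (simp add: power_divide power2_eq_square)
    qed
    ultimately show ?thesis unfolding d by simp
  qed
  let ?U = "\<Sum>i<m. (?f (Suc i) - ?f i)\<^sup>2 / (1 + ?f i)" and ?V = "\<Sum>i\<le>m. 1 / (1 + ?f i)"
  have U: "?U \<le> 8"
  proof -
    have "?U \<le> (\<Sum>i<m. 8 / real m)" by (intro sum_mono L)
    then show ?thesis using m(1) by simp
  qed
  have V: "?V \<le> real m + 1"
  proof -
    have "?V \<le> (\<Sum>i\<le>m. 1)" by (intro sum_mono) (auto simp: field_simps add_pos_nonneg)
    then show ?thesis by simp
  qed
  have UV: "?S * ?U + ?V \<le> 8 * (?S + real m)"
    using mult_left_mono[OF U S] V m(1) by (simp add: distrib_left)
  have "real (2 * m + 2) ^ (d - 1) * (?S * ?U + ?V) / real n \<le> real (2 * m + 2) ^ (d - 1) * (8 * (?S + real m)) / real n"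
    by (intro divide_right_mono mult_left_mono UV) auto
  also have "\<dots> \<le> (4 * real m) ^ (d - 1) * (8 * (?S + real m)) / real n"
    using m(1) S by (intro divide_right_mono mult_right_mono power_mono) auto
  also have "\<dots> = 8 * ((4 * real m) ^ (d - 1) * (?S + real m) / real n)" by (simp only: ac_simps times_divide_eq_right)
  finally have h3: "real (2 * m + 2) ^ (d - 1) * (?S * ?U + ?V) / real n \<le> 8 * ((4 * real m) ^ (d - 1) * (?S + real m) / real n)" .
  have h1: "8 / real m / 4 ^ K \<le> 8 * (1 / (real m * 4 ^ K))" by simp
  have "?f m = real m" by (simp add: power2_eq_square)
  moreover have "exp (- real m) \<le> 8 * (1 / real n)"
    by (rule order_trans[OF m(4)]) (simp add: divide_right_mono)
  ultimately have h2: "exp (- ?f m) \<le> 8 * (1 / real n)" by (simp only:)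
  have "8 / real m / 4 ^ K + exp (- ?f m) + real (2 * m + 2) ^ (d - 1) * (?S * ?U + ?V) / real n \<le>
    8 * (1 / (real m * 4 ^ K)) + 8 * (1 / real n) + 8 * ((4 * real m) ^ (d - 1) * (?S + real m) / real n)" (is "?l \<le> ?r")
    by (rule add_mono[OF add_mono[OF h1 h2] h3])
  then have "6 * (exp 3 + 2)\<^sup>2 * ?l \<le> 6 * (exp 3 + 2)\<^sup>2 * ?r"
    by (intro mult_left_mono) auto
  moreover have "cost_bound d n (exp 3) (ladder ?f m) (2 * m + 2) K \<le> 6 * (exp 3 + 2)\<^sup>2 * ?l"
    by (rule L.cost_bound_ladder) (rule L)
  ultimately have "cost_bound d n (exp 3) (ladder ?f m) (2 * m + 2) K \<le> 6 * (exp 3 + 2)\<^sup>2 * ?r" by (rule order_trans[rotated])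
  also have "\<dots> = 48 * (exp 3 + 2)\<^sup>2 *
    (1 / (real m * 4 ^ K) + 1 / real n + (4 * real m) ^ (d - 1) * (?S + real m) / real n)"
    by (simp add: algebra_simps)
  finally show ?thesis using L.tame_ladder by blast
qed

text \<open>The ratio \<open>2\<^sup>2 / 4\<close> is 1, so every round costs the same, and K = m
  rounds suffice because \<open>4 ^ m\<close> is at least n. One logarithm comes from the rounds,
  the other from the coarse cells of the second axis.\<close>

lemma cost_bound_dim2:
  "\<exists>D>0. eventually (\<lambda>n. \<exists>c B P K. tame c B P \<and> cost_bound 2 n c B P K \<le> D * ((ln (real n))\<^sup>2 / real n)) sequentially"
proof -
  define A :: real where "A = 48 * (exp 3 + 2)\<^sup>2"
  have A: "0 < A" unfolding A_def by (intro mult_pos_pos zero_less_power add_pos_pos) auto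
  have "eventually (\<lambda>n::nat. 1 \<le> ln (real n)) sequentially" by real_asymp
  then have "eventually (\<lambda>n. \<exists>c B P K. tame c B P \<and> cost_bound 2 n c B P K \<le> (A * 40) * ((ln (real n))\<^sup>2 / real n)) sequentially"
  proof eventually_elim
    case (elim n)
    define m where "m = nat \<lceil>ln (real n)\<rceil>"
    note m = log_ceiling[OF elim, folded m_def]
    obtain c B P where B: "tame c B P" "cost_bound 2 n c B P m \<le> A *
      (1 / (real m * 4 ^ m) + 1 / real n + (4 * real m) ^ (2 - 1) * ((\<Sum>k<m. (2 ^ 2 / 4) ^ k) + real m) / real n)"
      using cost_bound_quadratic[OF elim, of 2 m, folded m_def A_def] by blast
    have m1: "1 \<le> real m" using m(1) by simp
    have "1 / (real m * 4 ^ m) \<le> 1 / real n"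
    proof -
      have "exp 1 ^ m \<le> (4 :: real) ^ m" using exp_le by (intro power_mono) auto
      then have "exp (real m) \<le> 4 ^ m" by (simp flip: exp_of_nat_mult)
      moreover have "real n \<le> exp (real m)"
        using m(4,5) by (simp add: exp_minus field_simps)
      moreover have "1 * 4 ^ m \<le> real m * 4 ^ m" using m1 by (intro mult_right_mono) auto
      ultimately have "real n \<le> real m * 4 ^ m" by linarith
      then show ?thesis using m(5) by (intro divide_left_mono) auto
    qed
    moreover have "(4 * real m) ^ (2 - 1) * ((\<Sum>k<m. (2 ^ 2 / 4) ^ k) + real m) / real n = 8 * (real m)\<^sup>2 / real n"
      by (simp add: power2_eq_square)
    moreover have "1 / real n \<le> (real m)\<^sup>2 / real n" using m1 by (intro divide_right_mono) (auto intro: one_le_power)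
    moreover have "(real m)\<^sup>2 / real n \<le> 4 * ((ln (real n))\<^sup>2 / real n)"
    proof -
      have "(real m)\<^sup>2 \<le> (2 * ln (real n))\<^sup>2" using m(3) elim by (intro power_mono) auto
      then have "(real m)\<^sup>2 / real n \<le> (2 * ln (real n))\<^sup>2 / real n" by (intro divide_right_mono) auto
      then show ?thesis by (simp add: power_mult_distrib)
    qed
    ultimately have "1 / (real m * 4 ^ m) + 1 / real n + (4 * real m) ^ (2 - 1) * ((\<Sum>k<m. (2 ^ 2 / 4) ^ k) + real m) / real n
        \<le> 40 * ((ln (real n))\<^sup>2 / real n)" by linarith
    then have "A * (1 / (real m * 4 ^ m) + 1 / real n + (4 * real m) ^ (2 - 1) * ((\<Sum>k<m. (2 ^ 2 / 4) ^ k) + real m) / real n)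
        \<le> A * (40 * ((ln (real n))\<^sup>2 / real n))" using A by (intro mult_left_mono) auto
    from order_trans[OF B(2) this] have "cost_bound 2 n c B P m \<le> (A * 40) * ((ln (real n))\<^sup>2 / real n)"
      by (simp only: mult.assoc)
    with B(1) show ?case by blast
  qed
  moreover have "0 < A * 40" using A by simp
  ultimately show ?thesis by blast
qed

lemma dyadic_scale:
  fixes x :: real
  assumes "1 \<le> x"
  obtains K :: nat where "2 ^ K \<le> x" "x \<le> 2 * 2 ^ K"
proof
  define K where "K = nat \<lfloor>log 2 x\<rfloor>"
  have "real K = of_int \<lfloor>log 2 x\<rfloor>" unfolding K_def using assms by simp
  then have K: "real K \<le> log 2 x" "log 2 x \<le> real K + 1" by linarith+
  have "2 powr real K \<le> 2 powr log 2 x" using K by (intro powr_mono) auto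
  then show "2 ^ K \<le> x" using assms by (simp add: powr_realpow)
  have "2 powr log 2 x \<le> 2 powr (real K + 1)" using K by (intro powr_mono) auto
  then show "x \<le> 2 * 2 ^ K" using assms by (simp add: powr_realpow powr_add)
qed

text \<open>Here y stands for \<open>n powr (1 / d)\<close>. With \<open>2 ^ K\<close> close to
  \<open>y / m\<close>, the resolution \<open>1 / (m * 4 ^ K)\<close> and the digit cost
  \<open>m ^ (d - 1) * (y / m) ^ (d - 2) / y ^ d\<close> are both of order
  \<open>m / y\<^sup>2\<close>. The hypothesis on \<open>m ^ (d - 1)\<close> keeps the cost of the
  coarse cuts below the same order.\<close>

lemma cost_bound_scale:
  fixes m y :: real
  assumes d: "3 \<le> d" and m: "1 \<le> m" "m \<le> y" "m ^ (d - 1) \<le> y ^ (d - 2)" and K: "2 ^ K \<le> y / m" "y / m \<le> 2 * 2 ^ K"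
  shows "1 / (m * 4 ^ K) + 1 / y ^ d + (4 * m) ^ (d - 1) * ((\<Sum>k<K. (2 ^ d / 4) ^ k) + m) / y ^ d \<le>
    (5 + 2 * 4 ^ (d - 1)) * (m / y\<^sup>2)"
proof -
  have y: "1 \<le> y" using m by linarith
  obtain e where e: "d = e + 2" "1 \<le> e" using d that[of "d - 2"] by simp
  have r: "(2 ^ d / 4 :: real) = 2 ^ e" by (simp add: e power_add)
  have "1 / (m * 4 ^ K) \<le> 4 * (m / y\<^sup>2)"
  proof -
    have "(y / m)\<^sup>2 \<le> (2 * 2 ^ K)\<^sup>2" using K(2) y m by (intro power_mono) auto
    also have "\<dots> = 4 * 4 ^ K" unfolding power2_eq_square mult.assoc mult.left_commute[of "2 ^ K"] by (simp flip: power_mult_distrib)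
    finally have "y\<^sup>2 \<le> 4 * 4 ^ K * m\<^sup>2" using m by (simp add: power_divide pos_divide_le_eq)
    then have "y\<^sup>2 * 1 \<le> (4 * m) * (m * 4 ^ K)" by (simp add: power2_eq_square ac_simps)
    then show ?thesis using m y by (simp add: divide_simps mult.commute)
  qed
  moreover have "1 / y ^ d \<le> m / y\<^sup>2"
    using m y d by (intro frac_le power_increasing) auto
  moreover have "(4 * m) ^ (d - 1) * ((\<Sum>k<K. (2 ^ d / 4) ^ k) + m) / y ^ d \<le> 2 * 4 ^ (d - 1) * (m / y\<^sup>2)"
  proof -
    have "(\<Sum>k<K. (2 ^ d / 4 :: real) ^ k) \<le> (2 ^ e) ^ K"
      unfolding r using e(2) self_le_power[of "2::real" e] by (intro sum_power_le) auto
    also have "\<dots> = (2 ^ K) ^ e" by (simp add: power_mult[symmetric] mult.commute)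
    also have "\<dots> \<le> (y / m) ^ e" using K(1) by (intro power_mono) auto
    finally have S: "m ^ (d - 1) * (\<Sum>k<K. (2 ^ d / 4 :: real) ^ k) \<le> m ^ (d - 1) * (y / m) ^ e"
      using m by (intro mult_left_mono) auto
    also have "\<dots> = m * y ^ e" using m by (simp add: e power_divide)
    finally have S: "m ^ (d - 1) * (\<Sum>k<K. (2 ^ d / 4 :: real) ^ k) \<le> m * y ^ e" .
    have "m ^ (d - 1) * m \<le> y ^ e * m" using m by (intro mult_right_mono) (auto simp: e)
    with S have "m ^ (d - 1) * ((\<Sum>k<K. (2 ^ d / 4) ^ k) + m) \<le> 2 * (m * y ^ e)"
      by (simp add: distrib_left mult.commute)
    then have "m ^ (d - 1) * ((\<Sum>k<K. (2 ^ d / 4) ^ k) + m) / y ^ d \<le> 2 * (m * y ^ e) / y ^ d"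
      using y by (intro divide_right_mono) auto
    also have "\<dots> = 2 * (m / y\<^sup>2)" using y by (simp add: e power_add power2_eq_square)
    finally have "4 ^ (d - 1) * (m ^ (d - 1) * ((\<Sum>k<K. (2 ^ d / 4) ^ k) + m) / y ^ d) \<le> 4 ^ (d - 1) * (2 * (m / y\<^sup>2))"
      by (intro mult_left_mono) auto
    then show ?thesis by (simp only: power_mult_distrib ac_simps times_divide_eq_right times_divide_eq_left)
  qed
  ultimately show ?thesis by (simp only: distrib_right)
qed

lemma cost_bound_dim3:
  assumes d: "3 \<le> d"
  shows "\<exists>D>0. eventually (\<lambda>n. \<exists>c B P K. tame c B P \<and> cost_bound d n c B P K \<le> D * (ln (real n) / real n powr (2 / real d))) sequentially"
proof -
  define A :: real where "A = 48 * (exp 3 + 2)\<^sup>2"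
  define D where "D = A * (5 + 2 * 4 ^ (d - 1)) * 2"
  have A: "0 < A" unfolding A_def by (intro mult_pos_pos zero_less_power add_pos_pos) auto
  then have D: "0 < D" unfolding D_def by (intro mult_pos_pos add_pos_nonneg) auto
  have b: "0 < 1 / real d" "0 < real (d - 2) / real d" using d by auto
  have pw: "eventually (\<lambda>n::nat. (2 * ln (real n)) ^ p \<le> real n powr b) sequentially" if "0 < b" for b :: real and p :: nat
    using that by real_asymp
  have "eventually (\<lambda>n::nat. 1 \<le> ln (real n)) sequentially" by real_asymp
  then have "eventually (\<lambda>n. \<exists>c B P K. tame c B P \<and> cost_bound d n c B P K \<le> D * (ln (real n) / real n powr (2 / real d))) sequentially"
    using pw[OF b(1), of 1] pw[OF b(2), of "d - 1"]
  proof eventually_elim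
    case (elim n)
    define m where "m = nat \<lceil>ln (real n)\<rceil>"
    define y where "y = real n powr (1 / real d)"
    note m = log_ceiling[OF elim(1), folded m_def]
    have m1: "1 \<le> real m" "real m \<le> 2 * ln (real n)" using m(1,3) elim(1) by auto
    have n: "0 < real n" using m(5) by simp
    have yp: "y ^ k = real n powr (real k / real d)" for k
      unfolding y_def using n by (simp add: powr_realpow[symmetric] powr_powr)
    have yd: "y ^ d = real n" using d n by (simp add: yp)
    have my: "real m \<le> y" using m1 elim(2) by (simp add: y_def)
    have "real m ^ (d - 1) \<le> (2 * ln (real n)) ^ (d - 1)" using m1 by (intro power_mono) auto
    also have "\<dots> \<le> y ^ (d - 2)" using elim(3) by (simp add: yp)
    finally have mp: "real m ^ (d - 1) \<le> y ^ (d - 2)" .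
    have "1 \<le> y / real m" using my m1 by (simp add: le_divide_eq)
    then obtain K where K: "2 ^ K \<le> y / real m" "y / real m \<le> 2 * 2 ^ K" by (rule dyadic_scale)
    obtain c B P where B: "tame c B P" "cost_bound d n c B P K \<le> A *
      (1 / (real m * 4 ^ K) + 1 / real n + (4 * real m) ^ (d - 1) * ((\<Sum>k<K. (2 ^ d / 4) ^ k) + real m) / real n)"
      using cost_bound_quadratic[OF elim(1), of d K, folded m_def A_def] by blast
    note B(2)
    also have "A * (1 / (real m * 4 ^ K) + 1 / real n + (4 * real m) ^ (d - 1) * ((\<Sum>k<K. (2 ^ d / 4) ^ k) + real m) / real n)
        \<le> A * ((5 + 2 * 4 ^ (d - 1)) * (real m / y\<^sup>2))"
      using cost_bound_scale[OF d m1(1) my mp K] A by (intro mult_left_mono) (simp_all add: yd)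
    also have "\<dots> \<le> A * ((5 + 2 * 4 ^ (d - 1)) * (2 * ln (real n) / y\<^sup>2))"
      using A m1(2) by (intro mult_left_mono divide_right_mono) auto
    also have "\<dots> = D * (ln (real n) / real n powr (2 / real d))"
      unfolding D_def by (simp add: yp)
    finally show ?case using B(1) by blast
  qed
  then show ?thesis using D by blast
qed

lemma expected_rate:
  fixes \<alpha> :: "real ^ 'N"
  assumes \<alpha>: "\<And>j. - 1 / 2 \<le> \<alpha> $ j"
    and d: "CARD('N) = d" and sb: "\<exists>D>0. eventually (\<lambda>n. \<exists>c B P K. tame c B P \<and> cost_bound d n c B P K \<le> D * \<phi> n) sequentially"
    and \<phi>: "eventually (\<lambda>n. \<phi> n \<le> rate \<alpha> n) sequentially"
  shows "\<exists>c>0. \<exists>n0. \<forall>n\<ge>n0. expected_W2_sq (Pi\<^sub>M {1..n} (\<lambda>_. laguerre_measure \<alpha>)) (\<lambda>j x. x j) n \<alpha> \<le> ennreal (c * rate \<alpha> n)"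
proof -
  obtain C where C: "0 < C" "\<And>n c B P K. 1 \<le> n \<Longrightarrow> tame c B P \<Longrightarrow>
    expected_W2_sq (Pi\<^sub>M {1..n} (\<lambda>_. laguerre_measure \<alpha>)) (\<lambda>j x. x j) n \<alpha> \<le> ennreal (C * cost_bound CARD('N) n c B P K)"
    using expected_bound[OF \<alpha>] by blast
  obtain D where D: "0 < D" and ev: "eventually (\<lambda>n. \<exists>c B P K. tame c B P \<and> cost_bound CARD('N) n c B P K \<le> D * \<phi> n) sequentially"
    using sb unfolding d by blast
  have "eventually (\<lambda>n. expected_W2_sq (Pi\<^sub>M {1..n} (\<lambda>_. laguerre_measure \<alpha>)) (\<lambda>j x. x j) n \<alpha> \<le> ennreal ((C * D) * rate \<alpha> n)) sequentially"
    using ev \<phi> eventually_ge_at_top[of 1]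
  proof eventually_elim
    case (elim n)
    then obtain c B P K where B: "tame c B P" "cost_bound CARD('N) n c B P K \<le> D * \<phi> n" by blast
    have "D * \<phi> n \<le> D * rate \<alpha> n" using elim(2) D by (intro mult_left_mono) auto
    with B(2) have "C * cost_bound CARD('N) n c B P K \<le> C * (D * rate \<alpha> n)" using C(1) by (intro mult_left_mono) auto
    then have "ennreal (C * cost_bound CARD('N) n c B P K) \<le> ennreal ((C * D) * rate \<alpha> n)" by (simp only: mult.assoc ennreal_leI)
    with C(2)[OF elim(3) B(1)] show ?case by (rule order_trans)
  qed
  moreover have "0 < C * D" using C(1) D by simp
  ultimately show ?thesis unfolding eventually_sequentially by blast
qed

text \<open>The parameters sum to at least - d / 2, so the exponent \<open>1 / (a + d)\<close> is at
  most \<open>2 / d\<close>. The extreme sums -1/2 in dimension 1 and -1 in dimension 2 hit the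
  matching branch of \<open>rate\<close> exactly, and larger sums give slower rates. From dimension
  3 on the first branch always applies.\<close>

lemma rate_lower:
  fixes \<alpha> :: "real ^ 'N"
  assumes \<alpha>: "\<And>j. - 1 / 2 \<le> \<alpha> $ j"
  shows "CARD('N) = 1 \<Longrightarrow> eventually (\<lambda>n. ln (ln (real n)) / real n \<le> rate \<alpha> n) sequentially"
    and "CARD('N) = 2 \<Longrightarrow> eventually (\<lambda>n. (ln (real n))\<^sup>2 / real n \<le> rate \<alpha> n) sequentially"
    and "3 \<le> CARD('N) \<Longrightarrow> eventually (\<lambda>n. ln (real n) / real n powr (2 / real CARD('N)) \<le> rate \<alpha> n) sequentially"
proof -
  define a where "a = (\<Sum>i\<in>UNIV. \<alpha> $ i)"
  define d where "d = CARD('N)"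
  have "(\<Sum>i\<in>(UNIV :: 'N set). - 1 / 2) \<le> a" unfolding a_def by (intro sum_mono \<alpha>)
  then have a: "- real d / 2 \<le> a" by (simp add: d_def)
  note rate = rate_def[of \<alpha>, folded a_def d_def, unfolded Let_def]
  show "eventually (\<lambda>n. ln (ln (real n)) / real n \<le> rate \<alpha> n) sequentially" if "CARD('N) = 1"
  proof -
    have d1: "d = 1" using that by (simp add: d_def)
    consider "0 < a" | "a = 0" | "- 1 / 2 < a" "a < 0" | "a = - 1 / 2" using a d1 by fastforce
    then show ?thesis
    proof cases
      case 1
      then have "0 < 1 / (a + 1)" "1 / (a + 1) < 1" by auto
      then have "eventually (\<lambda>n::nat. ln (ln (real n)) / real n \<le> ln (real n) / real n powr (1 / (a + 1))) sequentially" by real_asymp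
      then show ?thesis using 1 by (simp add: rate d1)
    next
      case 2
      have "eventually (\<lambda>n::nat. ln (ln (real n)) / real n \<le> (ln (real n))\<^sup>2 / real n) sequentially" by real_asymp
      then show ?thesis using 2 by (simp add: rate d1)
    next
      case 3
      then have "0 < 2 * (a + 1) - 1" by auto
      then have "eventually (\<lambda>n::nat. ln (ln (real n)) / real n \<le> ln (real n) powr (2 * (a + 1) - 1) / real n) sequentially" by real_asymp
      then show ?thesis using 3 by (simp add: rate d1)
    qed (simp add: rate d1)
  qed
  show "eventually (\<lambda>n. (ln (real n))\<^sup>2 / real n \<le> rate \<alpha> n) sequentially" if "CARD('N) = 2"
  proof -
    have d2: "d = 2" using that by (simp add: d_def)
    consider "- 1 < a" | "a = - 1" using a d2 by fastforce
    then show ?thesis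
    proof cases
      case 1
      then have "0 < 1 / (a + 2)" "1 / (a + 2) < 1" by auto
      then have "eventually (\<lambda>n::nat. (ln (real n))\<^sup>2 / real n \<le> ln (real n) / real n powr (1 / (a + 2))) sequentially" by real_asymp
      then show ?thesis using 1 by (simp add: rate d2)
    qed (simp add: rate d2)
  qed
  show "eventually (\<lambda>n. ln (real n) / real n powr (2 / real CARD('N)) \<le> rate \<alpha> n) sequentially" if "3 \<le> CARD('N)"
  proof -
    have d3: "3 \<le> real d" using that by (simp add: d_def)
    have "1 - real d < a" using a d3 by linarith
    moreover have "1 / (a + real d) \<le> 2 / real d"
      using a d3 by (simp add: divide_simps)
    then have "ln (real n) / real n powr (2 / real d) \<le> ln (real n) / real n powr (1 / (a + real d))" if "1 \<le> n" for n
      using that by (intro divide_left_mono powr_mono) auto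
    then have "eventually (\<lambda>n. ln (real n) / real n powr (2 / real d) \<le> ln (real n) / real n powr (1 / (a + real d))) sequentially"
      using eventually_ge_at_top[of "1::nat"] by (rule eventually_mono[rotated])
    ultimately show ?thesis by (simp add: rate d_def[symmetric])
  qed
qed

(* HOL cannot quantify over the type 'w of the sample space below the existential quantifier
   for c and n0. The bound is therefore stated for the coordinate variables on the n-fold product
   space, where c and n0 cannot depend on 'w, and the second part transfers it, with the same
   c and n0, to every independent sample on every probability space. *)
theorem theorem2p1:
  fixes \<alpha> :: "real ^ 'N"
  assumes "\<And>i. \<alpha> $ i \<ge> - 1 / 2"
  shows "(\<exists>c>0. \<exists>n0. \<forall>n\<ge>n0.
            expected_W2_sq (Pi\<^sub>M {1..n} (\<lambda>_. laguerre_measure \<alpha>)) (\<lambda>j x. x j) n \<alpha>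
              \<le> ennreal (c * rate \<alpha> n)) \<and>
         (\<forall>n\<ge>1. \<forall>(M :: 'w measure) X. iid_sample M X n (laguerre_measure \<alpha>) \<longrightarrow>
            expected_W2_sq M X n \<alpha> =
              expected_W2_sq (Pi\<^sub>M {1..n} (\<lambda>_. laguerre_measure \<alpha>)) (\<lambda>j x. x j) n \<alpha>)"
proof (intro conjI allI impI)
  have "0 < CARD('N)" by simp
  then consider "CARD('N) = 1" | "CARD('N) = 2" | "3 \<le> CARD('N)" by linarith
  then show "\<exists>c>0. \<exists>n0. \<forall>n\<ge>n0. expected_W2_sq (Pi\<^sub>M {1..n} (\<lambda>_. laguerre_measure \<alpha>)) (\<lambda>j x. x j) n \<alpha> \<le> ennreal (c * rate \<alpha> n)"
  proof cases
    case 1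
    show ?thesis by (rule expected_rate[OF assms 1 cost_bound_dim1 rate_lower(1)[OF assms 1]])
  next
    case 2
    show ?thesis by (rule expected_rate[OF assms 2 cost_bound_dim2 rate_lower(2)[OF assms 2]])
  next
    case 3
    show ?thesis by (rule expected_rate[OF assms refl cost_bound_dim3[OF 3] rate_lower(3)[OF assms 3]])
  qed
next
  fix n :: nat and M :: "'w measure" and X
  assume "1 \<le> n" "iid_sample M X n (laguerre_measure \<alpha>)"
  then show "expected_W2_sq M X n \<alpha> = expected_W2_sq (Pi\<^sub>M {1..n} (\<lambda>_. laguerre_measure \<alpha>)) (\<lambda>j x. x j) n \<alpha>"
    by (intro expected_W2_sq_iid prob_space_laguerre[OF assms])
qed

end
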